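(* Let $q\in(0,1)$. Every representation of $\mathcal{O}(\mathbb{C}_q^2)$ of the standard form described in the context is unitarily equivalent to a direct sum of representations of the following type. Let $\mu$ and $\nu$ be $q$-invariant Borel measures on $[0,\infty)$ such that $\mu(\{0\})=\nu(\{0\})=0$. Denote by $\delta_0$ the Dirac measure centred at $0$, and define a Borel measure $\sigma$ on $[0,\infty)$ by setting $\sigma(\{q^{-n}\}):=1$ for all $n\in\mathbb{N}$ and $\sigma\big([0,\infty)\setminus\{q^{-n}:n\in\mathbb{N}\}\big):=0$. For $\epsilon\in\{0,1\}$, consider the Hilbert space $$\mathcal{H}:=\mathcal{L}_2\big([0,\infty)\times[0,\infty),\ \sigma\otimes\mu+\nu\otimes\delta_0+\epsilon\,\delta_0\otimes\delta_0\big),$$ whose elements are written as functions of $(s,t)\in[0,\infty)\times[0,\infty)$, and set $$\mathrm{dom}(z_1):=\{h\in\mathcal{H}: s\,t\,h\in\mathcal{H}\ \text{and}\ s\,\chi_{\{0\}}(t)\,h\in\mathcal{H}\},\qquad \mathrm{dom}(z_2):=\{g\in\mathcal{H}: t\,g\in\mathcal{H}\}.$$ For $h\in\mathrm{dom}(z_1)$ and $g\in\mathrm{dom}(z_2)$, the actions of the generators of $\mathcal{O}(\mathbb{C}_q^2)$ are given by $$z_1h(s,t)=\sqrt{(qs)^2-1}\;t\,h(qs,t)+q\,\chi_{\{0\}}(t)\,s\,h(qs,t),\qquad z_2g(s,t)=q\,t\,g(s,qt),$$ $$z_1^*h(s,t)=\sqrt{s^2-1}\;t\,h(q^{-1}s,t)+\chi_{\{0\}}(t)\,s\,h(q^{-1}s,t),\qquad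 z_2^*g(s,t)=t\,g(s,q^{-1}t).$$
   Context: Throughout $q\in(0,1)$ and $\mathbb{N}=\{1,2,\dots\}$. $\mathcal{O}(\mathbb{C}_q^2)$ is the unital $*$-algebra over $\mathbb{C}$ generated by $z_1,z_2$ with relations $$z_2z_1=qz_1z_2,\quad z_1^*z_2^*=qz_2^*z_1^*,\quad z_2z_1^*=qz_1^*z_2,\quad z_1z_2^*=qz_2^*z_1,$$ $$z_2z_2^*=q^2z_2^*z_2,\quad z_1z_1^*=q^2z_1^*z_1-(1-q^2)z_2^*z_2.$$ The same letters denote the generators and the (closed, densely defined) Hilbert space operators representing them. Representations of standard form. Let $\mathcal{N}$, $\mathcal{H}_0$, $\mathcal{H}_{00}$ be Hilbert spaces (possibly zero), and let $A$ and $B$ be self-adjoint operators on $\mathcal{H}_0$ and $\mathcal{H}_{00}$, respectively, with spectra contained in $[q,1]$ and such that $q$ is not an eigenvalue of $A$ or of $B$. The representation space is $$\mathcal{N}\oplus\Big(\bigoplus_{k\in\mathbb{Z}}\mathcal{H}_0\Big)\oplus\Big(\bigoplus_{n\in\mathbb{Z}}\bigoplus_{m\in\mathbb{N}}\mathcal{H}_{00}\Big),$$ and $z_1,z_2$ act by: $z_1=z_2=0$ on $\mathcal{N}$; $z_1h_k=q^kA\,h_{k-1}$ and $z_2=0$ on $\bigoplus_{k\in\mathbb{Z}}\mathcal{H}_0$; $z_1h_{n,m}=\sqrt{q^{-2m}-1}\,q^nB\,h_{n,m+1}$ and $z_2h_{n,m}=q^nB\,h_{n-1,m}$ on $\bigoplus_{n\in\mathbb{Z}}\bigoplus_{m\in\mathbb{N}}\mathcal{H}_{00}$.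 Here $h_k$ (resp. $h_{n,m}$) denotes the vector whose $k$-th (resp. $(n,m)$-th) component is $h\in\mathcal{H}_0$ (resp. $h\in\mathcal{H}_{00}$) and whose other components are zero, and $T h_k:=(Th)_k$, $Th_{n,m}:=(Th)_{n,m}$ for an operator $T$ on the component space. The closed operators $z_1,z_2$ are the closures of the operators given by these formulas on vectors with finitely many non-zero components. A Borel measure $\mu$ on $[0,\infty)$ is called $q$-invariant if $\mu(qS)=\mu(S)$ for all Borel subsets $S\subset[0,\infty)$ (the zero measure is allowed). $\chi_{\{0\}}$ is the indicator function of $\{0\}$, i.e. $\chi_{\{0\}}(t)=1$ if $t=0$ and $0$ otherwise. In the formulas of the claim, terms of the form $\sqrt{\cdot}\;t\,h$ are zero where $t=0$, and $\sqrt{(qs)^2-1}\,t\,h(qs,t)$ is zero where $qs=1$ (regardless of the value of $h$ there, which lies in a null set for $t>0$). *)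

theory Defs
  imports "HOL-Probability.Probability"
begin

text \<open>The inner product is linear in its first argument. The zero space is included.\<close>

class complex_hilbert = real_inner + complete_space +
  fixes cscale :: "complex \<Rightarrow> 'a \<Rightarrow> 'a" (infixr "*\<^sub>C" 75)
    and cinner :: "'a \<Rightarrow> 'a \<Rightarrow> complex"
  assumes cscale_add_right: "c *\<^sub>C (x + y) = c *\<^sub>C x + c *\<^sub>C y"
    and cscale_add_left: "(c + d) *\<^sub>C x = c *\<^sub>C x + d *\<^sub>C x"
    and cscale_cscale: "c *\<^sub>C (d *\<^sub>C x) = (c * d) *\<^sub>C x"
    and cscale_of_real: "complex_of_real r *\<^sub>C x = r *\<^sub>R x"
    and cinner_add_left: "cinner (x + y) z = cinner x z + cinner y z"
    and cinner_cscale_left: "cinner (c *\<^sub>C x) y = c * cinner x y"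
    and cinner_commute: "cinner x y = cnj (cinner y x)"
    and inner_eq_Re_cinner: "inner x y = Re (cinner x y)"

text \<open>
  Direct sums and \<open>L\<^sub>2\<close>-spaces depend on parameters, so they are not types. They are given by
  a carrier set together with the operations on it.
\<close>

record 'v hspace =
  hcarrier :: "'v set"
  hadd :: "'v \<Rightarrow> 'v \<Rightarrow> 'v"
  hscale :: "complex \<Rightarrow> 'v \<Rightarrow> 'v"
  hinner :: "'v \<Rightarrow> 'v \<Rightarrow> complex"

definition type_space :: "('a::complex_hilbert) hspace" where
  "type_space = \<lparr>hcarrier = UNIV, hadd = (+), hscale = (*\<^sub>C), hinner = cinner\<rparr>"

definition hdist :: "'v hspace \<Rightarrow> 'v \<Rightarrow> 'v \<Rightarrow> real" where
  "hdist H x y = (let d = hadd H x (hscale H (-1) y) in sqrt (Re (hinner H d d)))"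

definition pair_space :: "'v hspace \<Rightarrow> 'w hspace \<Rightarrow> ('v \<times> 'w) hspace" where
  "pair_space H K = \<lparr>
     hcarrier = hcarrier H \<times> hcarrier K,
     hadd = (\<lambda>(x, y) (x', y'). (hadd H x x', hadd K y y')),
     hscale = (\<lambda>c (x, y). (hscale H c x, hscale K c y)),
     hinner = (\<lambda>(x, y) (x', y'). hinner H x x' + hinner K y y')\<rparr>"

definition sum_space :: "'i set \<Rightarrow> ('i \<Rightarrow> 'v hspace) \<Rightarrow> ('i \<Rightarrow> 'v) hspace" where
  "sum_space I H = \<lparr>
     hcarrier = {x \<in> (\<Pi>\<^sub>E i\<in>I. hcarrier (H i)). (\<lambda>i. Re (hinner (H i) (x i) (x i))) summable_on I},
     hadd = (\<lambda>x y. \<lambda>i\<in>I. hadd (H i) (x i) (y i)),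
     hscale = (\<lambda>c x. \<lambda>i\<in>I. hscale (H i) c (x i)),
     hinner = (\<lambda>x y. \<Sum>\<^sub>\<infinity>i\<in>I. hinner (H i) (x i) (y i))\<rparr>"

text \<open>An operator is represented by its graph; its domain is \<^const>\<open>Domain\<close>.\<close>

definition op_closure :: "'v hspace \<Rightarrow> ('v \<times> 'v) set \<Rightarrow> ('v \<times> 'v) set" where
  "op_closure H T = {(x, y) \<in> hcarrier H \<times> hcarrier H.
     \<forall>e>0. \<exists>(u, v)\<in>T. hdist H x u < e \<and> hdist H y v < e}"

definition adjoint_op :: "'v hspace \<Rightarrow> ('v \<times> 'v) set \<Rightarrow> ('v \<times> 'v) set" where
  "adjoint_op H T = {(x, y) \<in> hcarrier H \<times> hcarrier H.
     \<forall>(u, v)\<in>T. hinner H v x = hinner H u y}"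

definition self_adjoint_op :: "('a::complex_hilbert \<times> 'a) set \<Rightarrow> bool" where
  "self_adjoint_op T \<longleftrightarrow> closure (Domain T) = UNIV \<and> adjoint_op type_space T = T"

definition op_spectrum :: "('a::complex_hilbert \<times> 'a) set \<Rightarrow> complex set" where
  "op_spectrum T = {c. \<not> (\<exists>R. bounded_linear R \<and>
     (\<lambda>(x, y). (x, y - c *\<^sub>C x)) ` T = range (\<lambda>y. (R y, y)))}"

definition op_eigenvalue :: "('a::complex_hilbert \<times> 'a) set \<Rightarrow> complex \<Rightarrow> bool" where
  "op_eigenvalue T c \<longleftrightarrow> (\<exists>x. x \<noteq> 0 \<and> (x, c *\<^sub>C x) \<in> T)"

text \<open>
  A representation on a Hilbert space is determined by the operators of the generators
  \<open>z\<^sub>1\<close> and \<open>z\<^sub>2\<close>; \<open>z\<^sub>1\<^sup>*\<close> and \<open>z\<^sub>2\<^sup>*\<close> act by the adjoint operators.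
\<close>

record 'v rep =
  rspace :: "'v hspace"
  rz1 :: "('v \<times> 'v) set"
  rz2 :: "('v \<times> 'v) set"

definition unitary_op :: "'v hspace \<Rightarrow> 'w hspace \<Rightarrow> ('v \<Rightarrow> 'w) \<Rightarrow> bool" where
  "unitary_op H K U \<longleftrightarrow> bij_betw U (hcarrier H) (hcarrier K) \<and>
     (\<forall>x\<in>hcarrier H. \<forall>y\<in>hcarrier H. U (hadd H x y) = hadd K (U x) (U y)) \<and>
     (\<forall>c. \<forall>x\<in>hcarrier H. U (hscale H c x) = hscale K c (U x)) \<and>
     (\<forall>x\<in>hcarrier H. \<forall>y\<in>hcarrier H. hinner K (U x) (U y) = hinner H x y)"

definition unitarily_equivalent :: "'v rep \<Rightarrow> 'w rep \<Rightarrow> bool" where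
  "unitarily_equivalent P Q \<longleftrightarrow> (\<exists>U. unitary_op (rspace P) (rspace Q) U \<and>
     map_prod U U ` rz1 P = rz1 Q \<and> map_prod U U ` rz2 P = rz2 Q)"

text \<open>Intertwining \<open>z\<^sub>1\<close> and \<open>z\<^sub>2\<close> is enough, because adjoints are then intertwined as well.\<close>

lemma unitary_op_adjoint:
  assumes U: "unitary_op H K U" and T: "T \<subseteq> hcarrier H \<times> hcarrier H"
  shows "adjoint_op K (map_prod U U ` T) = map_prod U U ` adjoint_op H T"
proof -
  have im: "U ` hcarrier H = hcarrier K"
    and ip: "\<And>x y. x \<in> hcarrier H \<Longrightarrow> y \<in> hcarrier H \<Longrightarrow> hinner K (U x) (U y) = hinner H x y"
    using U by (auto simp: unitary_op_def bij_betw_def)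
  have iff: "(U x, U y) \<in> adjoint_op K (map_prod U U ` T) \<longleftrightarrow> (x, y) \<in> adjoint_op H T"
    if "x \<in> hcarrier H" "y \<in> hcarrier H" for x y
  proof -
    have "(\<forall>(u, v)\<in>map_prod U U ` T. hinner K v (U x) = hinner K u (U y)) \<longleftrightarrow>
          (\<forall>(u, v)\<in>T. hinner K (U v) (U x) = hinner K (U u) (U y))"
      by auto
    also have "\<dots> \<longleftrightarrow> (\<forall>(u, v)\<in>T. hinner H v x = hinner H u y)"
      using that T ip by (intro ball_cong) auto
    finally show ?thesis
      using that im by (auto simp: adjoint_op_def)
  qed
  show ?thesis
  proof (intro set_eqI iffI)
    fix p assume p: "p \<in> adjoint_op K (map_prod U U ` T)"
    obtain x' y' where [simp]: "p = (x', y')" by (cases p)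
    have "x' \<in> hcarrier K" "y' \<in> hcarrier K"
      using p by (auto simp: adjoint_op_def)
    then obtain x y where xy: "x \<in> hcarrier H" "y \<in> hcarrier H" and [simp]: "x' = U x" "y' = U y"
      unfolding im[symmetric] by blast
    show "p \<in> map_prod U U ` adjoint_op H T"
      using p iff[OF xy] by force
  next
    fix p assume "p \<in> map_prod U U ` adjoint_op H T"
    then obtain x y where "p = (U x, U y)" "(x, y) \<in> adjoint_op H T"
      by auto
    moreover from this have "x \<in> hcarrier H" "y \<in> hcarrier H"
      by (auto simp: adjoint_op_def)
    ultimately show "p \<in> adjoint_op K (map_prod U U ` T)"
      using iff by auto
  qed
qed

definition sum_op :: "'i set \<Rightarrow> ('i \<Rightarrow> 'v hspace) \<Rightarrow> ('i \<Rightarrow> ('v \<times> 'v) set)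
    \<Rightarrow> (('i \<Rightarrow> 'v) \<times> ('i \<Rightarrow> 'v)) set" where
  "sum_op I H T = {(x, y) \<in> hcarrier (sum_space I H) \<times> hcarrier (sum_space I H).
     \<forall>i\<in>I. (x i, y i) \<in> T i}"

definition sum_rep :: "'i set \<Rightarrow> ('i \<Rightarrow> 'v rep) \<Rightarrow> ('i \<Rightarrow> 'v) rep" where
  "sum_rep I P = \<lparr>
     rspace = sum_space I (\<lambda>i. rspace (P i)),
     rz1 = sum_op I (\<lambda>i. rspace (P i)) (\<lambda>i. rz1 (P i)),
     rz2 = sum_op I (\<lambda>i. rspace (P i)) (\<lambda>i. rz2 (P i))\<rparr>"

abbreviation std_index :: "(int \<times> nat) set" where
  "std_index \<equiv> UNIV \<times> {1..}"

definition std_space :: "'n::complex_hilbert itself \<Rightarrow>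
    ('n \<times> (int \<Rightarrow> 'a::complex_hilbert) \<times> (int \<times> nat \<Rightarrow> 'b::complex_hilbert)) hspace" where
  "std_space _ = pair_space type_space
     (pair_space (sum_space UNIV (\<lambda>_. type_space)) (sum_space std_index (\<lambda>_. type_space)))"

definition finite_vectors :: "'n::complex_hilbert itself \<Rightarrow>
    ('n \<times> (int \<Rightarrow> 'a::complex_hilbert) \<times> (int \<times> nat \<Rightarrow> 'b::complex_hilbert)) set" where
  "finite_vectors N = {(a, x, u) \<in> hcarrier (std_space N).
     finite {k. x k \<noteq> 0} \<and> finite {p \<in> std_index. u p \<noteq> 0}}"

text \<open>
  The operators on finite vectors, read componentwise: with \<open>w\<^sub>k = A x\<^sub>k\<close> and
  \<open>r\<^sub>n\<^sub>,\<^sub>m = B u\<^sub>n\<^sub>,\<^sub>m\<close>, the rule \<open>h\<^sub>k \<mapsto> q\<^sup>k A h\<^sub>k\<^sub>-\<^sub>1\<close> sends \<open>x\<close> to the vector whose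
  component of index \<open>k - 1\<close> is \<open>q\<^sup>k w\<^sub>k\<close>, and likewise for the rules on the third summand.
\<close>

definition std_z1_fin where
  "std_z1_fin q N A B = {((a, x, u), (b, y, v)) \<in> finite_vectors N \<times> finite_vectors N.
     b = 0 \<and>
     (\<exists>w. \<forall>k. (x k, w k) \<in> A \<and> y (k - 1) = complex_of_real (q powi k) *\<^sub>C w k) \<and>
     (\<exists>r. \<forall>n. v (n, 1) = 0 \<and> (\<forall>m\<ge>1. (u (n, m), r (n, m)) \<in> B \<and>
        v (n, m + 1) =
          complex_of_real (sqrt (q powi (- 2 * int m) - 1) * q powi n) *\<^sub>C r (n, m)))}"

definition std_z2_fin where
  "std_z2_fin q N B = {((a, x, u), (b, y, v)) \<in> finite_vectors N \<times> finite_vectors N.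
     b = 0 \<and> (\<forall>k. y k = 0) \<and>
     (\<exists>r. \<forall>n. \<forall>m\<ge>1. (u (n, m), r (n, m)) \<in> B \<and>
        v (n - 1, m) = complex_of_real (q powi n) *\<^sub>C r (n, m))}"

definition std_rep :: "real \<Rightarrow> 'n::complex_hilbert itself
    \<Rightarrow> ('a::complex_hilbert \<times> 'a) set \<Rightarrow> ('b::complex_hilbert \<times> 'b) set
    \<Rightarrow> ('n \<times> (int \<Rightarrow> 'a) \<times> (int \<times> nat \<Rightarrow> 'b)) rep" where
  "std_rep q N A B = \<lparr>
     rspace = std_space N,
     rz1 = op_closure (std_space N) (std_z1_fin q N A B),
     rz2 = op_closure (std_space N) (std_z2_fin q N B)\<rparr>"

abbreviation nonneg_borel :: "real measure" where
  "nonneg_borel \<equiv> restrict_space borel {0..}"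

definition q_invariant :: "real \<Rightarrow> real measure \<Rightarrow> bool" where
  "q_invariant q \<mu> \<longleftrightarrow> sets \<mu> = sets nonneg_borel \<and>
     (\<forall>S\<in>sets nonneg_borel. emeasure \<mu> ((\<lambda>x. q * x) ` S) = emeasure \<mu> S)"

definition sigma_q :: "real \<Rightarrow> real measure" where
  "sigma_q q = distr (count_space {1::nat..}) nonneg_borel (\<lambda>n. q powi (- int n))"

lemma emeasure_sigma_q:
  assumes "0 < q" "S \<in> sets nonneg_borel"
  shows "emeasure (sigma_q q) S = emeasure (count_space {1..}) {n \<in> {1..}. q powi (- int n) \<in> S}"
  unfolding sigma_q_def using assms
  by (subst emeasure_distr)
     (auto simp: measurable_restrict_space2_iff intro!: arg_cong2[where f=emeasure])

lemma
  assumes "0 < q" "q < 1"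
  shows emeasure_sigma_q_point: "n \<ge> 1 \<Longrightarrow> emeasure (sigma_q q) {q powi (- int n)} = 1"
    and emeasure_sigma_q_rest: "emeasure (sigma_q q) ({0..} - {q powi (- int n) |n. n \<ge> 1}) = 0"
proof -
  have inj: "q powi (- int n) = q powi (- int m) \<longleftrightarrow> n = m" for n m
    using assms by (auto simp: power_int_minus power_inject_exp' intro: power_inject_exp)
  show "emeasure (sigma_q q) {q powi (- int n)} = 1" if "n \<ge> 1"
  proof -
    have "{m \<in> {1..}. q powi (- int m) \<in> {q powi (- int n)}} = {n}"
      using that inj by auto
    then show ?thesis
      using assms that by (subst emeasure_sigma_q) (auto simp: sets_restrict_space_iff)
  qed
  have "countable {q powi (- int n) |n. n \<ge> 1}"
    by (rule countable_subset[of _ "range (\<lambda>n. q powi (- int n))"]) auto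
  then have "{0..} - {q powi (- int n) |n. n \<ge> 1} \<in> sets nonneg_borel"
    by (auto simp: sets_restrict_space_iff intro!: sets.Diff sets.countable)
  moreover have "{m \<in> {1..}. q powi (- int m) \<in> {0..} - {q powi (- int n) |n. n \<ge> 1}} = {}"
    by auto
  ultimately show "emeasure (sigma_q q) ({0..} - {q powi (- int n) |n. n \<ge> 1}) = 0"
    using assms by (simp only: emeasure_sigma_q) simp
qed

definition add_measure :: "'a measure \<Rightarrow> 'a measure \<Rightarrow> 'a measure" where
  "add_measure M N = measure_of (space M) (sets M) (\<lambda>S. emeasure M S + emeasure N S)"

lemma emeasure_add_measure:
  assumes "sets N = sets M" "S \<in> sets M"
  shows "emeasure (add_measure M N) S = emeasure M S + emeasure N S"
  unfolding add_measure_def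
proof (rule emeasure_measure_of_sigma)
  show "sigma_algebra (space M) (sets M)" ..
  show "positive (sets M) (\<lambda>S. emeasure M S + emeasure N S)"
    by (simp add: positive_def)
  show "countably_additive (sets M) (\<lambda>S. emeasure M S + emeasure N S)"
    using assms(1) by (auto simp: countably_additive_def suminf_emeasure suminf_add[symmetric])
qed (use assms in auto)

definition model_measure :: "real \<Rightarrow> real measure \<Rightarrow> real measure \<Rightarrow> nat \<Rightarrow> (real \<times> real) measure" where
  "model_measure q \<mu> \<nu> \<epsilon> =
     add_measure
       (add_measure (sigma_q q \<Otimes>\<^sub>M \<mu>) (\<nu> \<Otimes>\<^sub>M return nonneg_borel 0))
       (scale_measure (of_nat \<epsilon>) (return nonneg_borel 0 \<Otimes>\<^sub>M return nonneg_borel 0))"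

definition l2_fun :: "'x measure \<Rightarrow> ('x \<Rightarrow> complex) set" where
  "l2_fun M = {f \<in> borel_measurable M. integrable M (\<lambda>x. (cmod (f x))\<^sup>2)}"

definition ae_class :: "'x measure \<Rightarrow> ('x \<Rightarrow> complex) \<Rightarrow> ('x \<Rightarrow> complex) set" where
  "ae_class M f = {g \<in> borel_measurable M. AE x in M. g x = f x}"

definition ae_rep :: "('x \<Rightarrow> complex) set \<Rightarrow> 'x \<Rightarrow> complex" where
  "ae_rep X = (SOME f. f \<in> X)"

definition l2_space :: "'x measure \<Rightarrow> ('x \<Rightarrow> complex) set hspace" where
  "l2_space M = \<lparr>
     hcarrier = ae_class M ` l2_fun M,
     hadd = (\<lambda>X Y. ae_class M (\<lambda>x. ae_rep X x + ae_rep Y x)),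
     hscale = (\<lambda>c X. ae_class M (\<lambda>x. c * ae_rep X x)),
     hinner = (\<lambda>X Y. \<integral>x. ae_rep X x * cnj (ae_rep Y x) \<partial>M)\<rparr>"

definition chi0 :: "real \<Rightarrow> real" where
  "chi0 = indicator {0}"

definition dom_z1 :: "(real \<times> real) measure \<Rightarrow> (real \<times> real \<Rightarrow> complex) set" where
  "dom_z1 M = {h \<in> l2_fun M.
     (\<lambda>(s, t). complex_of_real (s * t) * h (s, t)) \<in> l2_fun M \<and>
     (\<lambda>(s, t). complex_of_real (s * chi0 t) * h (s, t)) \<in> l2_fun M}"

definition dom_z2 :: "(real \<times> real) measure \<Rightarrow> (real \<times> real \<Rightarrow> complex) set" where
  "dom_z2 M = {g \<in> l2_fun M. (\<lambda>(s, t). complex_of_real t * g (s, t)) \<in> l2_fun M}"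

text \<open>
  The library's square root of a negative number is negative rather than undefined. In the
  formulas below a negative radicand occurs only where \<open>t = 0\<close> or on a null set of
  \<^const>\<open>model_measure\<close>.
\<close>

definition z1_fun :: "real \<Rightarrow> (real \<times> real \<Rightarrow> complex) \<Rightarrow> real \<times> real \<Rightarrow> complex" where
  "z1_fun q h = (\<lambda>(s, t). complex_of_real (sqrt ((q * s)\<^sup>2 - 1) * t) * h (q * s, t)
     + complex_of_real (q * chi0 t * s) * h (q * s, t))"

definition z2_fun :: "real \<Rightarrow> (real \<times> real \<Rightarrow> complex) \<Rightarrow> real \<times> real \<Rightarrow> complex" where
  "z2_fun q g = (\<lambda>(s, t). complex_of_real (q * t) * g (s, q * t))"

definition z1_adj_fun :: "real \<Rightarrow> (real \<times> real \<Rightarrow> complex) \<Rightarrow> real \<times> real \<Rightarrow> complex" where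
  "z1_adj_fun q h = (\<lambda>(s, t). complex_of_real (sqrt (s\<^sup>2 - 1) * t) * h (inverse q * s, t)
     + complex_of_real (chi0 t * s) * h (inverse q * s, t))"

definition z2_adj_fun :: "real \<Rightarrow> (real \<times> real \<Rightarrow> complex) \<Rightarrow> real \<times> real \<Rightarrow> complex" where
  "z2_adj_fun q g = (\<lambda>(s, t). complex_of_real t * g (s, inverse q * t))"

definition fun_graph :: "'x measure \<Rightarrow> ('x \<Rightarrow> complex) set \<Rightarrow> (('x \<Rightarrow> complex) \<Rightarrow> 'x \<Rightarrow> complex)
    \<Rightarrow> (('x \<Rightarrow> complex) set \<times> ('x \<Rightarrow> complex) set) set" where
  "fun_graph M D F = (\<lambda>h. (ae_class M h, ae_class M (F h))) ` D"

definition model_rep :: "real \<Rightarrow> real measure \<Rightarrow> real measure \<Rightarrow> nat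
    \<Rightarrow> (real \<times> real \<Rightarrow> complex) set rep" where
  "model_rep q \<mu> \<nu> \<epsilon> = (let M = model_measure q \<mu> \<nu> \<epsilon> in \<lparr>
     rspace = l2_space M,
     rz1 = fun_graph M (dom_z1 M) (z1_fun q),
     rz2 = fun_graph M (dom_z2 M) (z2_fun q)\<rparr>)"

text \<open>
  The formulas for \<open>z\<^sub>1\<^sup>*\<close> and \<open>z\<^sub>2\<^sup>*\<close> describe the adjoints of the operators above on the
  domains of \<open>z\<^sub>1\<close> and \<open>z\<^sub>2\<close>. The domain of \<open>z\<^sub>1\<^sup>*\<close> is larger than that of \<open>z\<^sub>1\<close> in
  general, hence inclusions.
\<close>

definition model_adjoints :: "real \<Rightarrow> real measure \<Rightarrow> real measure \<Rightarrow> nat \<Rightarrow> bool" where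
  "model_adjoints q \<mu> \<nu> \<epsilon> \<longleftrightarrow> (let M = model_measure q \<mu> \<nu> \<epsilon>; P = model_rep q \<mu> \<nu> \<epsilon> in
     fun_graph M (dom_z1 M) (z1_adj_fun q) \<subseteq> adjoint_op (rspace P) (rz1 P) \<and>
     fun_graph M (dom_z2 M) (z2_adj_fun q) \<subseteq> adjoint_op (rspace P) (rz2 P))"

end

theory Submission
  imports Defs
begin

text \<open>
  A self-adjoint operator \<open>A\<close> with spectrum in \<open>[q, 1]\<close> is bounded, and its space is an orthogonal sum
  of cyclic subspaces \<open>L\<^sub>2([q, 1], \<nu>)\<close> on which \<open>A\<close> is multiplication by \<open>t\<close>. Since \<open>q\<close> is not an
  eigenvalue, \<open>\<nu>\<close> lives on \<open>(q, 1]\<close>, a fundamental domain for multiplication by \<open>q\<close> on \<open>(0, \<infinity>)\<close>.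
  Hence \<open>\<nu>\<close> has a unique \<open>q\<close>-invariant extension, and \<open>\<Oplus>\<^bsub>k\<in>\<int>\<^esub> L\<^sub>2((q, 1], \<nu>)\<close> becomes \<open>L\<^sub>2\<close> of that
  extension, the \<open>k\<close>-th summand sitting on \<open>q\<^sup>k (q, 1]\<close>. Under this identification the weighted shifts
  of the standard form turn into the dilations of the model. Each cyclic subspace for \<open>A\<close>
  contributes a summand carried by \<open>t = 0\<close>, each one for \<open>B\<close> a summand carried by
  \<open>{q\<^sup>-\<^sup>m | m \<ge> 1} \<times> (0, \<infinity>)\<close>, and each vector of an orthonormal basis of \<open>\<N>\<close> a point mass at the origin.
\<close>

section \<open>Complex Hilbert spaces\<close>

text \<open>Two points are delicate. First, the hypotheses speak only of graphs and bounded
  resolvents, so boundedness is itself derived: a gap in the spectrum around \<open>l\<close> bounds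
  \<open>A - l\<close> from below, taking \<open>l\<close> far out on either side confines the
  quadratic form, and the form controls the norm. Spectral measures then come from moments, because
  the forms of \<open>T^i (1 - T)^j\<close> are nonnegative, which is Hausdorff's condition. Second,
  the operators must agree together with their domains. The closure from finitely supported vectors
  is the maximal weighted shift, whereas \<open>dom_z1\<close> is given by the multiplier
  \<open>s * t\<close> in place of the weight \<open>sqrt (s^2 - 1) * t\<close>. On the support
  \<open>s\<close> is at least \<open>1 / q\<close>, so the two are comparable with constant
  \<open>1 / sqrt (1 - q^2)\<close>; the remaining parameter \<open>t\<close> in
  \<open>(q, 1]\<close> changes norms by bounded factors only. Each summand of the result switches
  on just one of the three terms of the model measure, and vectors of the three component spaces
  serve as indices, whence the index type \<open>'n + 'a + 'b\<close>.\<close>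

instance complex_hilbert \<subseteq> banach ..

lemma norm_add_sq_le: "(norm (a + b))\<^sup>2 \<le> 2 * (norm a)\<^sup>2 + 2 * (norm (b :: 'v::real_normed_vector))\<^sup>2"
proof -
  have "(norm (a + b))\<^sup>2 \<le> (norm a + norm b)\<^sup>2"
    by (intro power_mono norm_triangle_ineq) auto
  also have "\<dots> \<le> 2 * (norm a)\<^sup>2 + 2 * (norm b)\<^sup>2"
    using sum_squares_bound[of "norm a" "norm b"] by (simp add: power2_sum)
  finally show ?thesis .
qed

lemma cscale_scaleR: "c *\<^sub>C (r *\<^sub>R x) = r *\<^sub>R (c *\<^sub>C x)"
  by (metis cscale_cscale cscale_of_real mult.commute)

lemma cscale_zero_right [simp]: "c *\<^sub>C 0 = (0::'a::complex_hilbert)"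
  using cscale_add_right[of c 0 "0::'a"] by simp

lemma cscale_zero_left [simp]: "0 *\<^sub>C x = (0::'a::complex_hilbert)"
  using cscale_of_real[of 0 x] by simp

lemma cscale_one [simp]: "1 *\<^sub>C x = (x::'a::complex_hilbert)"
  using cscale_of_real[of 1 x] by simp

lemma cscale_minus_one: "(-1) *\<^sub>C x = - (x::'a::complex_hilbert)"
  using cscale_of_real[of "-1" x] by simp

lemma cscale_minus_right: "c *\<^sub>C (- x) = - (c *\<^sub>C (x::'a::complex_hilbert))"
  by (metis cscale_add_right cscale_zero_right add.right_inverse minus_unique)

lemma cscale_diff_right: "c *\<^sub>C (x - y) = c *\<^sub>C x - c *\<^sub>C (y::'a::complex_hilbert)"
  by (metis cscale_add_right cscale_minus_right diff_conv_add_uminus)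

lemma cinner_zero_left [simp]: "cinner 0 (x::'a::complex_hilbert) = 0"
  using cinner_cscale_left[of 0 0 x] by simp

lemma cinner_zero_right [simp]: "cinner (x::'a::complex_hilbert) 0 = 0"
  using cinner_commute[of x 0] by simp

lemma cinner_add_right: "cinner (x::'a::complex_hilbert) (y + z) = cinner x y + cinner x z"
  by (metis cinner_add_left cinner_commute complex_cnj_add)

lemma cinner_cscale_right: "cinner (x::'a::complex_hilbert) (c *\<^sub>C y) = cnj c * cinner x y"
  by (metis cinner_commute cinner_cscale_left complex_cnj_mult)

lemma cinner_minus_left [simp]: "cinner (- x) (y::'a::complex_hilbert) = - cinner x y"
  using cinner_cscale_left[of "-1" x y] by (simp add: cscale_minus_one)

lemma cinner_minus_right [simp]: "cinner (x::'a::complex_hilbert) (- y) = - cinner x y"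
  using cinner_cscale_right[of x "-1" y] by (simp add: cscale_minus_one)

lemma cinner_diff_left: "cinner (x - y) (z::'a::complex_hilbert) = cinner x z - cinner y z"
  using cinner_add_left[of x "- y" z] by simp

lemma cinner_diff_right: "cinner (z::'a::complex_hilbert) (x - y) = cinner z x - cinner z y"
  using cinner_add_right[of z x "- y"] by simp

lemma cinner_scaleR_left: "cinner (r *\<^sub>R x) (y::'a::complex_hilbert) = r *\<^sub>R cinner x y"
  by (metis cinner_cscale_left cscale_of_real scaleR_conv_of_real)

lemma cinner_scaleR_right: "cinner x (r *\<^sub>R (y::'a::complex_hilbert)) = r *\<^sub>R cinner x y"
  by (metis cinner_cscale_right complex_cnj_complex_of_real cscale_of_real scaleR_conv_of_real)

lemma cinner_sum_left: "cinner (\<Sum>i\<in>I. f i) (y::'a::complex_hilbert) = (\<Sum>i\<in>I. cinner (f i) y)"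
  by (induction I rule: infinite_finite_induct) (auto simp: cinner_add_left)

lemma cinner_self: "cinner (x::'a::complex_hilbert) x = complex_of_real ((norm x)\<^sup>2)"
proof (rule complex_eqI)
  show "Re (cinner x x) = Re (complex_of_real ((norm x)\<^sup>2))"
    by (simp add: inner_eq_Re_cinner[symmetric] power2_norm_eq_inner)
  show "Im (cinner x x) = Im (complex_of_real ((norm x)\<^sup>2))"
    using arg_cong[OF cinner_commute[of x x], of Im] by simp
qed

lemma norm_cscale [simp]: "norm (c *\<^sub>C (x::'a::complex_hilbert)) = cmod c * norm x"
proof -
  have "complex_of_real ((norm (c *\<^sub>C x))\<^sup>2) = c * cnj c * complex_of_real ((norm x)\<^sup>2)"
    by (simp only: cinner_self[symmetric] cinner_cscale_left cinner_cscale_right) simp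
  also have "\<dots> = complex_of_real ((cmod c * norm x)\<^sup>2)"
    by (simp add: complex_norm_square[symmetric] power_mult_distrib)
  finally have "(norm (c *\<^sub>C x))\<^sup>2 = (cmod c * norm x)\<^sup>2"
    by (simp only: of_real_eq_iff)
  then show ?thesis
    by (simp add: power2_eq_iff_nonneg)
qed

text \<open>Multiplying \<open>x\<close> by the conjugate of \<open>cinner x y\<close> makes the
  pairing with \<open>y\<close> real and nonnegative, which reduces the complex inequality to real
  Cauchy-Schwarz.\<close>

lemma norm_cinner_le: "cmod (cinner x (y::'a::complex_hilbert)) \<le> norm x * norm y"
proof (cases "cinner x y = 0")
  case False
  define c where "c = cnj (cinner x y)"
  have "cinner (c *\<^sub>C x) y = complex_of_real ((cmod (cinner x y))\<^sup>2)"
    by (simp only: cinner_cscale_left c_def complex_norm_square mult.commute)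
  then have "(cmod (cinner x y))\<^sup>2 = inner (c *\<^sub>C x) y"
    by (simp add: inner_eq_Re_cinner)
  also have "\<dots> \<le> cmod (cinner x y) * norm x * norm y"
    using norm_cauchy_schwarz[of "c *\<^sub>C x" y] by (simp add: c_def)
  finally show ?thesis
    using False by (simp add: power2_eq_square mult.assoc)
qed simp

lemma bounded_linear_cinner_left: "bounded_linear (\<lambda>x. cinner x (y::'a::complex_hilbert))"
  by (rule bounded_linear_intro[where K="norm y"])
     (auto simp: cinner_add_left cinner_scaleR_left norm_cinner_le)

lemma bounded_linear_cscale: "bounded_linear (\<lambda>x. c *\<^sub>C (x::'a::complex_hilbert))"
  by (rule bounded_linear_intro[where K="cmod c"])
     (auto simp: cscale_add_right cscale_scaleR)

lemma tendsto_cinner: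
  fixes f g :: "_ \<Rightarrow> 'a::complex_hilbert"
  assumes "(f \<longlongrightarrow> a) F" "(g \<longlongrightarrow> b) F"
  shows "((\<lambda>x. cinner (f x) (g x)) \<longlongrightarrow> cinner a b) F"
proof -
  have "bounded_bilinear (cinner :: 'a \<Rightarrow> _)"
    by (rule bounded_bilinear.intro)
       (auto simp: cinner_add_left cinner_add_right cinner_scaleR_left cinner_scaleR_right
          intro!: exI[of _ 1] norm_cinner_le)
  from bounded_bilinear.tendsto[OF this assms] show ?thesis .
qed

section \<open>Density, nearest points and orthogonal series\<close>

lemma cinner_eq_zero_dense:
  fixes x :: "'a::complex_hilbert"
  assumes "closure D = UNIV" "\<And>u. u \<in> D \<Longrightarrow> cinner u x = 0"
  shows "x = 0"
proof -
  obtain u where u: "\<And>n. u n \<in> D" "u \<longlonglongrightarrow> x"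
    using assms(1) closure_sequential[of x D] by auto
  have "(\<lambda>n. cinner (u n) x) \<longlonglongrightarrow> cinner x x"
    by (intro tendsto_cinner u) simp
  then have "cinner x x = 0"
    using assms(2) u(1) by (simp add: LIMSEQ_const_iff)
  then show ?thesis by (simp add: cinner_self)
qed

text \<open>Nearest points exist by the parallelogram law: a minimizing sequence is Cauchy.\<close>

lemma orthogonal_projection_exists:
  fixes Z :: "'a::complex_hilbert set"
  assumes "closed Z" "0 \<in> Z" and add: "\<And>x y. x \<in> Z \<Longrightarrow> y \<in> Z \<Longrightarrow> x + y \<in> Z"
    and sc: "\<And>c x. x \<in> Z \<Longrightarrow> c *\<^sub>C x \<in> Z"
  shows "\<exists>y\<in>Z. \<forall>z\<in>Z. cinner (h - y) z = 0"
proof -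
  define d where "d = (INF y\<in>Z. (norm (h - y))\<^sup>2)"
  have bdd: "bdd_below ((\<lambda>y. (norm (h - y))\<^sup>2) ` Z)"
    by (rule bdd_belowI[of _ 0]) auto
  have d_le: "d \<le> (norm (h - y))\<^sup>2" if "y \<in> Z" for y
    unfolding d_def using bdd that by (rule cINF_lower)
  have scR: "r *\<^sub>R x \<in> Z" if "x \<in> Z" for r x
    using sc[OF that, of "complex_of_real r"] by (simp add: cscale_of_real)
  have "\<exists>y\<in>Z. (norm (h - y))\<^sup>2 < d + 1 / real (Suc n)" for n
  proof -
    have "\<exists>x\<in>(\<lambda>y. (norm (h - y))\<^sup>2) ` Z. x < d + 1 / real (Suc n)"
      using assms(2) unfolding d_def by (intro cInf_lessD) auto
    then show ?thesis by auto
  qed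
  then obtain y where y: "\<And>n. y n \<in> Z" "\<And>n. (norm (h - y n))\<^sup>2 < d + 1 / real (Suc n)"
    by metis
  \<comment> \<open>The midpoint of two points of \<open>Z\<close> stays in \<open>Z\<close>, so its
    squared distance to \<open>h\<close> is at least \<open>d\<close>; this controls the negative
    term.\<close>
  have par: "(norm (a - b))\<^sup>2 = 2 * (norm (h - a))\<^sup>2 + 2 * (norm (h - b))\<^sup>2
      - 4 * (norm (h - (1/2) *\<^sub>R (a + b)))\<^sup>2" for a b
    unfolding power2_norm_eq_inner
    by (simp add: inner_diff_left inner_diff_right inner_add_left inner_add_right
        inner_commute algebra_simps)
  have close: "(norm (y m - y n))\<^sup>2 < 4 / real (Suc N)" if "m \<ge> N" "n \<ge> N" for m n N
  proof -
    have "1 / real (Suc m) \<le> 1 / real (Suc N)" "1 / real (Suc n) \<le> 1 / real (Suc N)"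
      using that by (auto simp: field_simps)
    moreover have "d \<le> (norm (h - (1/2) *\<^sub>R (y m + y n)))\<^sup>2"
      by (intro d_le scR add y)
    ultimately show ?thesis
      unfolding par[of "y m"] using y(2)[of m] y(2)[of n] by argo
  qed
  have "Cauchy y"
  proof (rule metric_CauchyI)
    fix e :: real assume "e > 0"
    then obtain N where "4 / e\<^sup>2 < real N"
      using reals_Archimedean2 by blast
    then have "4 < real N * e\<^sup>2"
      using \<open>e > 0\<close> by (simp add: field_simps)
    then have "4 / real (Suc N) < e\<^sup>2"
      using \<open>e > 0\<close> by (simp add: field_simps add_strict_increasing)
    then have "norm (y m - y n) < e" if "m \<ge> N" "n \<ge> N" for m n
      using close[OF that] \<open>e > 0\<close> by (intro power2_less_imp_less[of _ e]) auto
    then show "\<exists>N. \<forall>m\<ge>N. \<forall>n\<ge>N. dist (y m) (y n) < e"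
      by (auto simp: dist_norm)
  qed
  then obtain y0 where lim: "y \<longlonglongrightarrow> y0"
    using Cauchy_convergent_iff convergent_def by blast
  have y0: "y0 \<in> Z"
    using closed_sequentially[OF assms(1)] y(1) lim by blast
  have "(\<lambda>n. d + 1 / real (Suc n)) \<longlonglongrightarrow> d + 0"
    using LIMSEQ_inverse_real_of_nat by (intro tendsto_add) (auto simp: inverse_eq_divide)
  moreover have "(\<lambda>n. (norm (h - y n))\<^sup>2) \<longlonglongrightarrow> (norm (h - y0))\<^sup>2"
    by (intro tendsto_intros lim)
  ultimately have le: "(norm (h - y0))\<^sup>2 \<le> d"
    using LIMSEQ_le[of "\<lambda>n. (norm (h - y n))\<^sup>2" _ "\<lambda>n. d + 1 / real (Suc n)" "d + 0"]
      less_imp_le[OF y(2)] by simp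
  have "cinner (h - y0) z = 0" if z: "z \<in> Z" for z
  proof (rule ccontr)
    assume nz: "cinner (h - y0) z \<noteq> 0"
    then have zn: "norm z \<noteq> 0" by auto
    \<comment> \<open>\<open>c *\<^sub>C z\<close> is the component of \<open>h - y0\<close> along
      \<open>z\<close>; adding it to \<open>y0\<close> would push the squared distance below the
      infimum \<open>d\<close>.\<close>
    define c where "c = cinner (h - y0) z / complex_of_real ((norm z)\<^sup>2)"
    have "h - (y0 + c *\<^sub>C z) = (h - y0) - c *\<^sub>C z" by simp
    then have "cinner (h - (y0 + c *\<^sub>C z)) (h - (y0 + c *\<^sub>C z))
      = cinner (h - y0) (h - y0) - cnj c * cinner (h - y0) z - c * cnj (cinner (h - y0) z)
        + c * cnj c * cinner z z"
      using cinner_commute[of z "h - y0"]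
      by (simp only: cinner_diff_left[of "h - y0"] cinner_diff_right[of _ "h - y0"]
          cinner_cscale_left cinner_cscale_right) (simp add: algebra_simps)
    also have "\<dots> = cinner (h - y0) (h - y0) - c * cnj c * cinner z z"
    proof -
      define w where "w = complex_of_real ((norm z)\<^sup>2)"
      have "w \<noteq> 0" "cnj w = w" using zn by (auto simp: w_def)
      then show ?thesis
        unfolding c_def w_def[symmetric] cinner_self[of z] by (simp add: field_simps)
    qed
    finally have "complex_of_real ((norm (h - (y0 + c *\<^sub>C z)))\<^sup>2)
        = complex_of_real ((norm (h - y0))\<^sup>2 - (cmod c * norm z)\<^sup>2)"
      by (simp add: cinner_self complex_norm_square[symmetric] power_mult_distrib)
    then have "(norm (h - (y0 + c *\<^sub>C z)))\<^sup>2 = (norm (h - y0))\<^sup>2 - (cmod c * norm z)\<^sup>2"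
      by (simp only: of_real_eq_iff)
    moreover have "d \<le> (norm (h - (y0 + c *\<^sub>C z)))\<^sup>2"
      by (intro d_le add sc y0 z)
    moreover have "(cmod c * norm z)\<^sup>2 > 0"
      using nz zn by (simp add: c_def)
    ultimately show False using le by linarith
  qed
  then show ?thesis using y0 by blast
qed

lemma norm_sum_orthogonal:
  fixes y :: "'i \<Rightarrow> 'a::complex_hilbert"
  assumes "finite F" "\<And>i j. i \<in> F \<Longrightarrow> j \<in> F \<Longrightarrow> i \<noteq> j \<Longrightarrow> cinner (y i) (y j) = 0"
  shows "(norm (\<Sum>i\<in>F. y i))\<^sup>2 = (\<Sum>i\<in>F. (norm (y i))\<^sup>2)"
  using assms
proof (induction F rule: finite_induct)
  case (insert k F)
  have "cinner (y k) (\<Sum>i\<in>F. y i) = cnj (\<Sum>i\<in>F. cinner (y i) (y k))"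
    by (metis cinner_commute cinner_sum_left)
  also have "\<dots> = 0"
    using insert by (subst sum.neutral) auto
  finally have "inner (y k) (\<Sum>i\<in>F. y i) = 0"
    by (simp add: inner_eq_Re_cinner)
  moreover have "(norm (\<Sum>i\<in>F. y i))\<^sup>2 = (\<Sum>i\<in>F. (norm (y i))\<^sup>2)"
    using insert by auto
  ultimately show ?case
    using insert by (simp add: power2_norm_eq_inner inner_add_left inner_add_right inner_commute)
qed simp

text \<open>By Pythagoras the squared norm of a difference of nested partial sums is a difference of
  partial sums of the numerical series. The net of partial sums is therefore Cauchy, and the space
  is complete.\<close>

lemma summable_on_orthogonal:
  fixes y :: "'i \<Rightarrow> 'a::complex_hilbert"
  assumes orth: "\<And>i j. i \<in> I \<Longrightarrow> j \<in> I \<Longrightarrow> i \<noteq> j \<Longrightarrow> cinner (y i) (y j) = 0"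
    and sm: "(\<lambda>i. (norm (y i))\<^sup>2) summable_on I"
  shows "y summable_on I"
proof -
  let ?s = "sum (\<lambda>i. (norm (y i))\<^sup>2)"
  have "cauchy_filter (filtermap (sum y) (finite_subsets_at_top I))"
  proof (unfold cauchy_filter_metric_filtermap, intro allI impI)
    fix e :: real assume e: "e > 0"
    obtain S where S: "((\<lambda>i. (norm (y i))\<^sup>2) has_sum S) I"
      using sm by (auto simp: summable_on_def)
    then have "eventually (\<lambda>F. dist (?s F) S < e\<^sup>2 / 16) (finite_subsets_at_top I)"
      using e by (auto simp: has_sum_def dest!: tendstoD[where e="e\<^sup>2 / 16"])
    then obtain F0 where F0: "finite F0" "F0 \<subseteq> I"
      "\<And>F. finite F \<Longrightarrow> F0 \<subseteq> F \<Longrightarrow> F \<subseteq> I \<Longrightarrow> dist (?s F) S < e\<^sup>2 / 16"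
      by (auto simp: eventually_finite_subsets_at_top)
    have near: "dist (sum y F) (sum y F0) < e / 2" if F: "finite F" "F0 \<subseteq> F" "F \<subseteq> I" for F
    proof -
      have "sum y F - sum y F0 = sum y (F - F0)"
        using F by (simp add: sum_diff)
      then have "(norm (sum y F - sum y F0))\<^sup>2 = ?s (F - F0)"
        using norm_sum_orthogonal[of "F - F0" y] orth F by (metis DiffD1 finite_Diff subsetD)
      also have "\<dots> = ?s F - ?s F0"
        using F by (simp add: sum_diff)
      also have "\<dots> < (e / 2)\<^sup>2"
      proof -
        have "a - b < k / 4" if "dist a S < k / 16" "dist b S < k / 16" for a b k
          using that unfolding dist_real_def by linarith
        from this[OF F0(3)[OF F] F0(3)[OF F0(1) order_refl F0(2)]] show ?thesis
          by (simp add: power_divide)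
      qed
      finally show ?thesis
        using e unfolding dist_norm by (intro power2_less_imp_less[of _ "e / 2"]) auto
    qed
    show "\<exists>P. eventually P (finite_subsets_at_top I) \<and> (\<forall>F G. P F \<and> P G \<longrightarrow> dist (sum y F) (sum y G) < e)"
    proof (intro exI conjI allI impI)
      show "eventually (\<lambda>F. finite F \<and> F0 \<subseteq> F \<and> F \<subseteq> I) (finite_subsets_at_top I)"
        using F0 by (auto simp: eventually_finite_subsets_at_top)
      fix F G assume "(finite F \<and> F0 \<subseteq> F \<and> F \<subseteq> I) \<and> (finite G \<and> F0 \<subseteq> G \<and> G \<subseteq> I)"
      then show "dist (sum y F) (sum y G) < e"
        using near[of F] near[of G] dist_triangle2[of "sum y F" "sum y G" "sum y F0"] by auto
    qed
  qed
  then obtain l where "filtermap (sum y) (finite_subsets_at_top I) \<le> nhds l"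
    using cauchy_filter_complete_converges[of "filtermap (sum y) (finite_subsets_at_top I)" UNIV]
      complete_UNIV by (auto simp: filtermap_bot_iff)
  then show ?thesis
    by (auto simp: summable_on_def has_sum_def filterlim_def)
qed

section \<open>Self-adjoint operators with bounded spectrum\<close>

context
  fixes A :: "('a::complex_hilbert \<times> 'a) set"
  assumes sa: "self_adjoint_op A"
begin

text \<open>Since \<open>A\<close> is its own adjoint, membership in the graph is tested by symmetry
  alone; linearity and closedness of the graph are then read off from this test.\<close>

lemma self_adjoint_mem_iff: "(x, y) \<in> A \<longleftrightarrow> (\<forall>(u, v)\<in>A. cinner v x = cinner u y)"
proof -
  have "(x, y) \<in> adjoint_op type_space A \<longleftrightarrow> (\<forall>(u, v)\<in>A. cinner v x = cinner u y)"
    by (simp add: adjoint_op_def type_space_def)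
  then show ?thesis
    using sa by (simp add: self_adjoint_op_def)
qed

lemma self_adjoint_sym: "(x, y) \<in> A \<Longrightarrow> (u, v) \<in> A \<Longrightarrow> cinner v x = cinner u y"
  using self_adjoint_mem_iff by auto

text \<open>Two images of \<open>x\<close> have the same inner products with the dense domain, so
  they agree.\<close>

lemma self_adjoint_unique:
  assumes "(x, y) \<in> A" "(x, z) \<in> A"
  shows "y = z"
proof -
  have "y - z = 0"
  proof (rule cinner_eq_zero_dense)
    show "closure (Domain A) = UNIV"
      using sa by (simp add: self_adjoint_op_def)
    show "cinner u (y - z) = 0" if "u \<in> Domain A" for u
      using that assms self_adjoint_sym by (auto simp: cinner_diff_right) (metis)
  qed
  then show ?thesis by simp
qed

lemma self_adjoint_add: "(x, y) \<in> A \<Longrightarrow> (x', y') \<in> A \<Longrightarrow> (x + x', y + y') \<in> A"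
  unfolding self_adjoint_mem_iff[of "x + x'"]
  using self_adjoint_sym by (auto simp: cinner_add_right)

lemma self_adjoint_scale: "(x, y) \<in> A \<Longrightarrow> (c *\<^sub>C x, c *\<^sub>C y) \<in> A"
  unfolding self_adjoint_mem_iff[of "c *\<^sub>C x"]
  using self_adjoint_sym by (auto simp: cinner_cscale_right)

lemma self_adjoint_scaleR: "(x, y) \<in> A \<Longrightarrow> (r *\<^sub>R x, r *\<^sub>R y) \<in> A"
  using self_adjoint_scale[of x y "complex_of_real r"] by (simp add: cscale_of_real)

lemma self_adjoint_minus: "(x, y) \<in> A \<Longrightarrow> (- x, - y) \<in> A"
  using self_adjoint_scaleR[of x y "-1"] by simp

lemma self_adjoint_closed:
  assumes "\<And>n. (x n, y n) \<in> A" "x \<longlonglongrightarrow> a" "y \<longlonglongrightarrow> b"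
  shows "(a, b) \<in> A"
  unfolding self_adjoint_mem_iff[of a b]
proof safe
  fix u v assume uv: "(u, v) \<in> A"
  have "(\<lambda>n. cinner v (x n)) \<longlonglongrightarrow> cinner v a" "(\<lambda>n. cinner u (y n)) \<longlonglongrightarrow> cinner u b"
    by (intro tendsto_cinner tendsto_const assms)+
  moreover have "cinner v (x n) = cinner u (y n)" for n
    using self_adjoint_sym[OF assms(1) uv] .
  ultimately show "cinner v a = cinner u b"
    using LIMSEQ_unique by auto
qed

text \<open>The equality of graphs in the definition of the spectrum has two halves:
  \<open>R\<close> maps into the domain as a right inverse of \<open>A - l\<close>, and it is a left
  inverse on the graph.\<close>

lemma resolvent_exists:
  assumes "complex_of_real l \<notin> op_spectrum A"
  obtains R where "bounded_linear R" "\<And>z. (R z, z + l *\<^sub>R R z) \<in> A"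
    "\<And>x y. (x, y) \<in> A \<Longrightarrow> R (y - l *\<^sub>R x) = x"
proof -
  from assms obtain R where R: "bounded_linear R"
    and eq: "(\<lambda>(x, y). (x, y - l *\<^sub>R x)) ` A = range (\<lambda>y. (R y, y))"
    by (auto simp: op_spectrum_def cscale_of_real)
  have 1: "(R z, z + l *\<^sub>R R z) \<in> A" for z
  proof -
    have "(R z, z) \<in> (\<lambda>(x, y). (x, y - l *\<^sub>R x)) ` A"
      unfolding eq by auto
    then obtain x y where "(x, y) \<in> A" "R z = x" "z = y - l *\<^sub>R x" by auto
    then show ?thesis by simp
  qed
  have 2: "R (y - l *\<^sub>R x) = x" if "(x, y) \<in> A" for x y
  proof -
    have "(x, y - l *\<^sub>R x) \<in> (\<lambda>(x, y). (x, y - l *\<^sub>R x)) ` A"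
      using that by force
    then show ?thesis unfolding eq by auto
  qed
  show ?thesis by (rule that[OF R 1 2])
qed

text \<open>
  With \<open>R\<close> the resolvent at \<open>l\<close> and \<open>m = \<parallel>R\<parallel>\<close>, one of \<open>l \<plusminus> 1/m\<close> lies in the spectrum, since
  \<open>1 - R\<^sup>2/m\<^sup>2\<close> is not bounded below.
\<close>

lemma spectrum_gap_norm_ge:
  assumes gap: "\<And>r. \<bar>r - l\<bar> < d \<Longrightarrow> complex_of_real r \<notin> op_spectrum A"
    and d: "d > 0" and xy: "(x, y) \<in> A"
  shows "d * norm x \<le> norm (y - l *\<^sub>R x)"
proof -
  obtain R where R: "bounded_linear R" and RA: "\<And>z. (R z, z + l *\<^sub>R R z) \<in> A"
    and RI: "\<And>x y. (x, y) \<in> A \<Longrightarrow> R (y - l *\<^sub>R x) = x"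
    using resolvent_exists[OF gap[of l]] d by auto
  interpret R: bounded_linear R by fact
  define m where "m = onorm R"
  have Rm: "norm (R z) \<le> m * norm z" for z
    unfolding m_def by (rule onorm[OF R])
  have "m * d \<le> 1"
  proof (rule ccontr)
    assume "\<not> m * d \<le> 1"
    then have mpos: "m > 0"
      using d mult_nonpos_nonneg[of m d] by linarith
    then have md: "1 / m < d"
      using \<open>\<not> m * d \<le> 1\<close> by (simp add: field_simps)
    \<comment> \<open>Both \<open>l + c\<close> and \<open>l - c\<close> lie in the gap, so their
      resolvents \<open>P\<close> and \<open>N\<close> exist. The contradiction will be that the
      norm of \<open>R\<close> is strictly below \<open>m\<close>.\<close>
    define c where "c = 1 / m"
    have c: "c > 0" "c < d" "c * m = 1"
      using mpos md by (auto simp: c_def)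
    obtain P where P: "bounded_linear P"
      and PI: "\<And>x y. (x, y) \<in> A \<Longrightarrow> P (y - (l + c) *\<^sub>R x) = x"
      by (rule resolvent_exists[OF gap[of "l + c"]]) (use c in auto)
    obtain N where N: "bounded_linear N"
      and NI: "\<And>x y. (x, y) \<in> A \<Longrightarrow> N (y - (l - c) *\<^sub>R x) = x"
      by (rule resolvent_exists[OF gap[of "l - c"]]) (use c in auto)
    define K where "K = onorm (\<lambda>z. N (P z))"
    have NP: "norm (N (P z)) \<le> K * norm z" for z
      unfolding K_def using bounded_linear_compose[OF N P] by (rule onorm)
    have K: "K \<ge> 0"
      unfolding K_def using bounded_linear_compose[OF N P] by (rule onorm_pos_le)
    have symR: "inner (R z) w = inner z (R w)" for z w
    proof -
      have "cinner (w + l *\<^sub>R R w) (R z) = cinner (R w) (z + l *\<^sub>R R z)"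
        by (rule self_adjoint_sym[OF RA RA])
      then have "cinner w (R z) = cinner (R w) z"
        by (simp add: cinner_add_left cinner_add_right cinner_scaleR_left cinner_scaleR_right)
      then show ?thesis
        by (simp add: inner_eq_Re_cinner[symmetric] inner_commute)
          (metis inner_commute inner_eq_Re_cinner)
    qed
    \<comment> \<open>In operator terms \<open>N P (1 - c^2 R^2) = R^2\<close>, because
      \<open>1 - c^2 R^2\<close> is \<open>(A - (l + c)) (A - (l - c)) R^2\<close>. Consequently
      \<open>1 - c^2 R^2\<close> is bounded below.\<close>
    have inv: "N (P (z - c\<^sup>2 *\<^sub>R R (R z))) = R (R z)" for z
    proof -
      define w g where "w = R (R z)" and "g = R z + c *\<^sub>R w"
      have "(w, R z + l *\<^sub>R w) \<in> A" "(R z, z + l *\<^sub>R R z) \<in> A"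
        unfolding w_def by (rule RA)+
      then have "(g, z + l *\<^sub>R R z + c *\<^sub>R (R z + l *\<^sub>R w)) \<in> A"
        unfolding g_def by (intro self_adjoint_add self_adjoint_scaleR)
      from PI[OF this] have "P (z - c\<^sup>2 *\<^sub>R w) = g"
        by (simp add: g_def algebra_simps power2_eq_square)
      moreover have "N g = w"
        using NI[OF \<open>(w, R z + l *\<^sub>R w) \<in> A\<close>] by (simp add: g_def algebra_simps)
      ultimately show ?thesis by (simp add: w_def)
    qed
    \<comment> \<open>\<open>D\<close> is the constant in
      \<open>norm z \<le> D * norm (z - c\<^sup>2 *\<^sub>R R (R z))\<close>. Comparison with the
      upper bound \<open>e2\<close> for the same norm leaves the factor \<open>1 - 1 / D^2\<close>,
      which is less than \<open>1\<close>.\<close>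
    define D where "D = 1 + c\<^sup>2 * K"
    have D1: "D \<ge> 1" using K by (simp add: D_def)
    have bound: "(norm (R z))\<^sup>2 \<le> (m\<^sup>2 * (1 - 1 / D\<^sup>2)) * (norm z)\<^sup>2" for z
    proof -
      define e where "e = norm (z - c\<^sup>2 *\<^sub>R R (R z))"
      have "e\<^sup>2 = (norm z)\<^sup>2 - 2 * c\<^sup>2 * (norm (R z))\<^sup>2 + c\<^sup>2 * c\<^sup>2 * (norm (R (R z)))\<^sup>2"
        unfolding e_def power2_norm_eq_inner symR[of z "R z"] inner_diff_left inner_diff_right
        using symR[of z "R z"] inner_commute[of "R (R z)" z] by (simp add: algebra_simps)
      also have "c\<^sup>2 * c\<^sup>2 * (norm (R (R z)))\<^sup>2 \<le> c\<^sup>2 * c\<^sup>2 * (m * norm (R z))\<^sup>2"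
        by (intro mult_left_mono power_mono Rm) auto
      also have "c\<^sup>2 * c\<^sup>2 * (m * norm (R z))\<^sup>2 = c\<^sup>2 * (norm (R z))\<^sup>2 * (c * m)\<^sup>2"
        by (simp add: power2_eq_square)
      finally have e2: "e\<^sup>2 \<le> (norm z)\<^sup>2 - c\<^sup>2 * (norm (R z))\<^sup>2"
        using c by simp
      have "norm z \<le> e + norm (c\<^sup>2 *\<^sub>R R (R z))"
        unfolding e_def using norm_triangle_ineq[of "z - c\<^sup>2 *\<^sub>R R (R z)" "c\<^sup>2 *\<^sub>R R (R z)"] by simp
      also have "norm (c\<^sup>2 *\<^sub>R R (R z)) \<le> c\<^sup>2 * (K * e)"
        using NP[of "z - c\<^sup>2 *\<^sub>R R (R z)"] by (simp add: inv e_def mult_left_mono)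
      finally have "norm z \<le> D * e"
        by (simp add: D_def algebra_simps)
      then have "(norm z)\<^sup>2 \<le> D\<^sup>2 * e\<^sup>2"
        by (metis norm_ge_zero power_mono power_mult_distrib)
      then have "(norm z)\<^sup>2 / D\<^sup>2 \<le> e\<^sup>2"
        using D1 by (simp add: field_simps)
      with e2 have "c\<^sup>2 * (norm (R z))\<^sup>2 \<le> (1 - 1 / D\<^sup>2) * (norm z)\<^sup>2"
        by (simp add: algebra_simps)
      then have "m\<^sup>2 * (c\<^sup>2 * (norm (R z))\<^sup>2) \<le> m\<^sup>2 * ((1 - 1 / D\<^sup>2) * (norm z)\<^sup>2)"
        by (intro mult_left_mono) auto
      moreover have "m\<^sup>2 * (c\<^sup>2 * (norm (R z))\<^sup>2) = (c * m)\<^sup>2 * (norm (R z))\<^sup>2"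
        by (simp add: power2_eq_square)
      ultimately show ?thesis using c by (simp add: mult.assoc)
    qed
    define b where "b = m * sqrt (1 - 1 / D\<^sup>2)"
    have D2: "1 / D\<^sup>2 \<le> 1" "1 / D\<^sup>2 > 0"
      using D1 by (auto simp: field_simps)
    have b2: "b\<^sup>2 = m\<^sup>2 * (1 - 1 / D\<^sup>2)" "b \<ge> 0"
      using D2 mpos by (auto simp: b_def power_mult_distrib)
    have "norm (R z) \<le> b * norm z" for z
    proof (rule power2_le_imp_le)
      show "(norm (R z))\<^sup>2 \<le> (b * norm z)\<^sup>2"
        using bound[of z] by (simp add: power_mult_distrib b2)
    qed (use b2 in auto)
    then have "m \<le> b"
      unfolding m_def by (intro onorm_bound b2)
    moreover have "b < m"
      using D2 mpos by (simp add: b_def real_sqrt_lt_1_iff)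
    ultimately show False by simp
  qed
  have "d * norm x = d * norm (R (y - l *\<^sub>R x))"
    using RI[OF xy] by simp
  also have "\<dots> \<le> d * (m * norm (y - l *\<^sub>R x))"
    using d by (intro mult_left_mono Rm) auto
  also have "\<dots> = (m * d) * norm (y - l *\<^sub>R x)"
    by simp
  also have "\<dots> \<le> 1 * norm (y - l *\<^sub>R x)"
    using \<open>m * d \<le> 1\<close> by (intro mult_right_mono) auto
  finally show ?thesis by simp
qed

section \<open>Bounds on the quadratic form, and boundedness\<close>

context
  fixes a b :: real
  assumes spec: "op_spectrum A \<subseteq> complex_of_real ` {a..b}"
begin

text \<open>The point \<open>- n\<close> has distance at least \<open>a + n\<close> from the
  spectrum, so the gap estimate applies there. After squaring, the \<open>n^2\<close> terms cancel
  and what remains is linear in \<open>n\<close>; a large \<open>n\<close> then forces the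
  bound.\<close>

lemma self_adjoint_form_ge:
  assumes xy: "(x, y) \<in> A"
  shows "a * (norm x)\<^sup>2 \<le> inner y x"
proof (rule ccontr)
  assume "\<not> ?thesis"
  then have pos: "a * (norm x)\<^sup>2 - inner y x > 0" by simp
  have key: "2 * n * (a * (norm x)\<^sup>2 - inner y x) \<le> (norm y)\<^sup>2" if n: "n > 0" "a + n > 0" for n
  proof -
    have "(a + n) * norm x \<le> norm (y - (- n) *\<^sub>R x)"
    proof (rule spectrum_gap_norm_ge[OF _ n(2) xy])
      fix r :: real assume "\<bar>r - - n\<bar> < a + n"
      then have "r < a" by linarith
      then show "complex_of_real r \<notin> op_spectrum A"
        using spec by fastforce
    qed
    then have "((a + n) * norm x)\<^sup>2 \<le> (norm (y + n *\<^sub>R x))\<^sup>2"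
      using n by (intro power_mono) auto
    also have "\<dots> = (norm y)\<^sup>2 + 2 * n * inner y x + n\<^sup>2 * (norm x)\<^sup>2"
      unfolding power2_norm_eq_inner
      by (simp add: inner_add_left inner_add_right inner_commute power2_eq_square)
    finally have "a\<^sup>2 * (norm x)\<^sup>2 + 2 * n * a * (norm x)\<^sup>2 \<le> (norm y)\<^sup>2 + 2 * n * inner y x"
      by (simp add: power2_eq_square algebra_simps)
    moreover have "a\<^sup>2 * (norm x)\<^sup>2 \<ge> 0" by simp
    ultimately have "2 * n * a * (norm x)\<^sup>2 \<le> (norm y)\<^sup>2 + 2 * n * inner y x" by linarith
    then show ?thesis by (simp add: algebra_simps)
  qed
  \<comment> \<open>The first entry keeps \<open>n\<close> and \<open>a + n\<close> positive; the
    second makes \<open>n\<close> large enough to contradict \<open>key\<close>.\<close>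
  define n where "n = max (\<bar>a\<bar> + 1) ((norm y)\<^sup>2 / (a * (norm x)\<^sup>2 - inner y x) + 1)"
  have n: "n > 0" "a + n > 0" by (auto simp: n_def)
  have "(norm y)\<^sup>2 / (a * (norm x)\<^sup>2 - inner y x) < n"
    by (simp add: n_def max_def)
  then have "(norm y)\<^sup>2 / (a * (norm x)\<^sup>2 - inner y x) < 2 * n"
    using n by linarith
  then have "(norm y)\<^sup>2 < 2 * n * (a * (norm x)\<^sup>2 - inner y x)"
    using pos by (simp add: pos_divide_less_eq)
  with key[OF n] show False by simp
qed

text \<open>The same argument from the other side of the spectrum, with base point \<open>n\<close>
  at distance at least \<open>n - b\<close>.\<close>

lemma self_adjoint_form_le:
  assumes xy: "(x, y) \<in> A"
  shows "inner y x \<le> b * (norm x)\<^sup>2"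
proof (rule ccontr)
  assume "\<not> ?thesis"
  then have pos: "inner y x - b * (norm x)\<^sup>2 > 0" by simp
  have key: "2 * n * (inner y x - b * (norm x)\<^sup>2) \<le> (norm y)\<^sup>2" if n: "n > 0" "n - b > 0" for n
  proof -
    have "(n - b) * norm x \<le> norm (y - n *\<^sub>R x)"
    proof (rule spectrum_gap_norm_ge[OF _ n(2) xy])
      fix r :: real assume "\<bar>r - n\<bar> < n - b"
      then have "r > b" by linarith
      then show "complex_of_real r \<notin> op_spectrum A"
        using spec by fastforce
    qed
    then have "((n - b) * norm x)\<^sup>2 \<le> (norm (y - n *\<^sub>R x))\<^sup>2"
      using n by (intro power_mono) auto
    also have "\<dots> = (norm y)\<^sup>2 - 2 * n * inner y x + n\<^sup>2 * (norm x)\<^sup>2"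
      unfolding power2_norm_eq_inner
      by (simp add: inner_diff_left inner_diff_right inner_commute power2_eq_square)
    finally have "b\<^sup>2 * (norm x)\<^sup>2 - 2 * n * b * (norm x)\<^sup>2 \<le> (norm y)\<^sup>2 - 2 * n * inner y x"
      by (simp add: power2_eq_square algebra_simps)
    moreover have "b\<^sup>2 * (norm x)\<^sup>2 \<ge> 0" by simp
    ultimately have "- (2 * n * b * (norm x)\<^sup>2) \<le> (norm y)\<^sup>2 - 2 * n * inner y x" by linarith
    then show ?thesis by (simp add: algebra_simps)
  qed
  define n where "n = max (\<bar>b\<bar> + 1) ((norm y)\<^sup>2 / (inner y x - b * (norm x)\<^sup>2) + 1)"
  have n: "n > 0" "n - b > 0" by (auto simp: n_def)
  have "(norm y)\<^sup>2 / (inner y x - b * (norm x)\<^sup>2) < n"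
    by (simp add: n_def max_def)
  then have "(norm y)\<^sup>2 / (inner y x - b * (norm x)\<^sup>2) < 2 * n"
    using n by linarith
  then have "(norm y)\<^sup>2 < 2 * n * (inner y x - b * (norm x)\<^sup>2)"
    using pos by (simp add: pos_divide_less_eq)
  with key[OF n] show False by simp
qed

text \<open>Polarization: as the form is nonnegative and at most \<open>b\<close> times the squared
  norm, \<open>4 * inner y u\<close> is at most the form at \<open>x + u\<close>. This bounds
  \<open>inner y u\<close> for \<open>u\<close> in the domain, by density for all \<open>u\<close>,
  and a suitable multiple of \<open>y\<close> turns it into a norm bound.\<close>

lemma self_adjoint_norm_le:
  assumes xy: "(x, y) \<in> A" and "0 \<le> a" "0 \<le> b"
  shows "norm y \<le> b * norm x"
proof -
  have le: "inner y u \<le> b * ((norm x)\<^sup>2 + (norm u)\<^sup>2) / 2" if u: "u \<in> Domain A" for u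
  proof -
    obtain v where uv: "(u, v) \<in> A" using u by auto
    have sym: "inner y u = inner v x"
      using arg_cong[OF self_adjoint_sym[OF xy uv], of Re]
      by (simp only: inner_eq_Re_cinner[symmetric] inner_commute)
    have "inner (y + v) (x + u) \<le> b * (norm (x + u))\<^sup>2"
      using self_adjoint_form_le[OF self_adjoint_add[OF xy uv]] .
    moreover have "0 \<le> inner (y - v) (x - u)"
    proof -
      have "(x - u, y - v) \<in> A"
        using self_adjoint_add[OF xy self_adjoint_minus[OF uv]] by simp
      from self_adjoint_form_ge[OF this] show ?thesis
        using assms(2) by (meson mult_nonneg_nonneg order_trans zero_le_power2)
    qed
    moreover have "inner (y + v) (x + u) - inner (y - v) (x - u) = 4 * inner y u"
      using sym by (simp add: inner_diff_left inner_diff_right inner_add_left inner_add_right)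
    moreover have "b * (norm (x + u))\<^sup>2 \<le> b * (2 * ((norm x)\<^sup>2 + (norm u)\<^sup>2))"
    proof (intro mult_left_mono assms)
      have "(norm (x + u))\<^sup>2 + (norm (x - u))\<^sup>2 = 2 * ((norm x)\<^sup>2 + (norm u)\<^sup>2)"
        unfolding power2_norm_eq_inner
        by (simp add: inner_diff_left inner_diff_right inner_add_left inner_add_right)
      then show "(norm (x + u))\<^sup>2 \<le> 2 * ((norm x)\<^sup>2 + (norm u)\<^sup>2)"
        using zero_le_power2[of "norm (x - u)"] by linarith
    qed
    ultimately show ?thesis by argo
  qed
  have le': "inner y u \<le> b * ((norm x)\<^sup>2 + (norm u)\<^sup>2) / 2" for u
  proof -
    obtain f where f: "\<And>n. f n \<in> Domain A" "f \<longlonglongrightarrow> u"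
      using sa closure_sequential[of u "Domain A"] by (auto simp: self_adjoint_op_def)
    have "(\<lambda>n. inner y (f n)) \<longlonglongrightarrow> inner y u"
      "(\<lambda>n. b * ((norm x)\<^sup>2 + (norm (f n))\<^sup>2) / 2) \<longlonglongrightarrow> b * ((norm x)\<^sup>2 + (norm u)\<^sup>2) / 2"
      by (intro tendsto_intros f; simp)+
    then show ?thesis
      using le[OF f(1)] by (intro LIMSEQ_le) auto
  qed
  show ?thesis
  proof (cases "x = 0 \<or> y = 0")
    case True
    then show ?thesis
      using assms self_adjoint_unique[of 0 y 0] xy self_adjoint_scaleR[of x y 0] by auto
  next
    case False
    \<comment> \<open>Rescaling \<open>y\<close> to the length of \<open>x\<close> balances the two
      squares on the right of \<open>le'\<close>.\<close>
    define u where "u = (norm x / norm y) *\<^sub>R y"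
    have "norm u = norm x" using False by (simp add: u_def)
    moreover have "inner y u = norm x * norm y"
      using False by (simp add: u_def power2_norm_eq_inner[symmetric] power2_eq_square)
    ultimately have "norm x * norm y \<le> norm x * (b * norm x)"
      using le'[of u] by (simp add: power2_eq_square mult.left_commute)
    then show ?thesis using False by simp
  qed
qed

text \<open>The norm bound sends Cauchy sequences of the domain to Cauchy sequences of images. Since
  the graph is closed and the domain dense, the domain is the whole space.\<close>

theorem self_adjoint_bounded_spectrum:
  assumes "0 \<le> a" "0 \<le> b"
  obtains T where "A = range (\<lambda>x. (x, T x))" "bounded_linear T"
    "\<And>c x. T (c *\<^sub>C x) = c *\<^sub>C T x" "\<And>x y. cinner (T x) y = cinner x (T y)"
    "\<And>x. a * (norm x)\<^sup>2 \<le> Re (cinner (T x) x)" "\<And>x. Re (cinner (T x) x) \<le> b * (norm x)\<^sup>2"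
proof -
  have "\<exists>y. (x, y) \<in> A" for x
  proof -
    obtain f where f: "\<And>n. f n \<in> Domain A" "f \<longlonglongrightarrow> x"
      using sa closure_sequential[of x "Domain A"] by (auto simp: self_adjoint_op_def)
    then obtain g where g: "\<And>n. (f n, g n) \<in> A" by (meson DomainE)
    have le: "norm (g m - g n) \<le> b * norm (f m - f n)" for m n
      using self_adjoint_norm_le[OF self_adjoint_add[OF g[of m] self_adjoint_minus[OF g[of n]]] assms]
      by simp
    have "Cauchy g"
    proof (rule metric_CauchyI)
      fix e :: real assume e: "e > 0"
      have "Cauchy f" using f(2) LIMSEQ_imp_Cauchy by blast
      \<comment> \<open>The divisor is \<open>b + 1\<close> because \<open>b\<close> may be
        \<open>0\<close>.\<close>
      then obtain M where M: "\<And>m n. m \<ge> M \<Longrightarrow> n \<ge> M \<Longrightarrow> dist (f m) (f n) < e / (b + 1)"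
        using metric_CauchyD[of f "e / (b + 1)"] e assms by auto
      have "dist (g m) (g n) < e" if "m \<ge> M" "n \<ge> M" for m n
      proof -
        have "norm (g m - g n) \<le> (b + 1) * norm (f m - f n)"
          using le[of m n] by (simp add: algebra_simps add_increasing)
        also have "\<dots> < (b + 1) * (e / (b + 1))"
          using M[OF that] assms by (intro mult_strict_left_mono) (auto simp: dist_norm)
        finally show ?thesis using assms by (simp add: dist_norm)
      qed
      then show "\<exists>M. \<forall>m\<ge>M. \<forall>n\<ge>M. dist (g m) (g n) < e" by auto
    qed
    then obtain y where "g \<longlonglongrightarrow> y"
      using Cauchy_convergent_iff convergent_def by blast
    from self_adjoint_closed[OF g f(2) this] show ?thesis ..
  qed
  then obtain T where T: "\<And>x. (x, T x) \<in> A" by metis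
  have eq: "T x = y" if "(x, y) \<in> A" for x y
    using self_adjoint_unique[OF T that] .
  show ?thesis
  proof (rule that)
    show "A = range (\<lambda>x. (x, T x))" using T eq by fastforce
    show "bounded_linear T"
      by (rule bounded_linear_intro[where K=b])
        (auto intro!: eq self_adjoint_add self_adjoint_scaleR T simp: mult.commute[of _ b]
          self_adjoint_norm_le[OF T assms])
    show "T (c *\<^sub>C x) = c *\<^sub>C T x" for c x
      by (intro eq self_adjoint_scale T)
    show "cinner (T x) y = cinner x (T y)" for x y
      using self_adjoint_sym[OF T T] .
    show "a * (norm x)\<^sup>2 \<le> Re (cinner (T x) x)" for x
      using self_adjoint_form_ge[OF T] by (simp add: inner_eq_Re_cinner)
    show "Re (cinner (T x) x) \<le> b * (norm x)\<^sup>2" for x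
      using self_adjoint_form_le[OF T] by (simp add: inner_eq_Re_cinner)
  qed
qed

end

end

section \<open>The Hausdorff moment problem\<close>

text \<open>Both binomials are falling factorials over the same denominator. For
  \<open>j < k\<close> the factor at \<open>i = j\<close> vanishes, in accordance with
  \<open>j choose k = 0\<close>.\<close>

lemma choose_ratio_eq_prod:
  assumes "k \<le> n"
  shows "real (j choose k) / real (n choose k) = (\<Prod>i<k. (real j - real i) / (real n - real i))"
proof -
  have *: "real (m choose k) = (\<Prod>i<k. real m - real i) / (\<Prod>i<k. real (k - i))" for m
    unfolding binomial_gbinomial gbinomial_altdef_of_nat
    by (simp add: prod_dividef atLeast0LessThan)
  have "(\<Prod>i<k. real (k - i)) \<noteq> 0"
    by simp
  then show ?thesis
    by (simp add: * prod_dividef)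
qed

text \<open>The assumption \<open>2 * k < n\<close> keeps every factor at absolute value at most
  \<open>1\<close>, including the negative ones with \<open>j < i\<close>. Hence the products differ
  by at most the sum of the differences of their factors, each at most
  \<open>k / (n - k)\<close>.\<close>

lemma choose_ratio_approx:
  assumes "2 * k < n" "j \<le> n"
  shows "\<bar>(real j / real n) ^ k - real (j choose k) / real (n choose k)\<bar> \<le> real k * (real k / (real n - real k))"
proof -
  have "\<bar>(\<Prod>i<k. real j / real n) - (\<Prod>i<k. (real j - real i) / (real n - real i))\<bar>
      \<le> (\<Sum>i<k. \<bar>real j / real n - (real j - real i) / (real n - real i)\<bar>)"
    unfolding real_norm_def[symmetric]
  proof (rule norm_prod_diff)
    fix i assume "i \<in> {..<k}"
    then have i: "i < k" by simp
    show "norm (real j / real n) \<le> 1"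
      using assms by (simp add: divide_simps)
    have "real n - real i > 0" "\<bar>real j - real i\<bar> \<le> real n - real i"
      using i assms by linarith+
    then show "norm ((real j - real i) / (real n - real i)) \<le> 1"
      by (simp add: divide_simps)
  qed
  also have "\<dots> \<le> (\<Sum>i<k. real k / (real n - real k))"
  proof (rule sum_mono)
    fix i assume "i \<in> {..<k}"
    then have i: "i < k" by simp
    have n: "real n > 0" "real n - real i > 0" "real n - real k > 0"
      using i assms by linarith+
    have "\<bar>real j / real n - (real j - real i) / (real n - real i)\<bar>
        = \<bar>real i * ((real n - real j) / real n) / (real n - real i)\<bar>"
      using n by (intro arg_cong[where f=abs]) (simp add: field_simps)
    also have "\<dots> = real i * ((real n - real j) / real n) / (real n - real i)"
      using n assms by (intro abs_of_nonneg) auto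
    also have "\<dots> \<le> real k * 1 / (real n - real k)"
      using n assms i by (intro frac_le mult_mono) (auto simp: field_simps)
    finally show "\<bar>real j / real n - (real j - real i) / (real n - real i)\<bar> \<le> real k / (real n - real k)"
      by simp
  qed
  also have "\<dots> = real k * (real k / (real n - real k))"
    by simp
  finally show ?thesis
    using assms by (simp add: choose_ratio_eq_prod)
qed

text \<open>This is the \<open>k\<close>-th factorial moment of the binomial distribution as a ring
  identity: choosing \<open>j\<close> elements and \<open>k\<close> among them amounts to choosing
  the \<open>k\<close> first, and the binomial theorem sums the rest to \<open>1\<close>. The ring
  is general because the identity is applied to complex polynomials.\<close>

lemma bernstein_choose_sum:
  fixes x y :: "'r::comm_ring_1"
  assumes "k \<le> n" "x + y = 1"
  shows "(\<Sum>j\<le>n. of_nat ((n choose j) * (j choose k)) * (x ^ j * y ^ (n - j))) = of_nat (n choose k) * x ^ k"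
proof -
  have "(\<Sum>j\<le>n. of_nat ((n choose j) * (j choose k)) * (x ^ j * y ^ (n - j)))
      = (\<Sum>j\<in>{k..n}. of_nat ((n choose j) * (j choose k)) * (x ^ j * y ^ (n - j)))"
    by (rule sum.mono_neutral_right) (auto simp: not_le binomial_eq_0)
  also have "\<dots> = (\<Sum>j\<in>{k..n}. of_nat ((n choose k) * ((n - k) choose (j - k))) * (x ^ j * y ^ (n - j)))"
    by (intro sum.cong refl) (simp only: choose_mult atLeastAtMost_iff)
  also have "\<dots> = (\<Sum>i\<le>n - k. of_nat ((n choose k) * ((n - k) choose i)) * (x ^ (i + k) * y ^ (n - (i + k))))"
    by (rule sum.reindex_bij_witness[of _ "\<lambda>i. i + k" "\<lambda>j. j - k"]) (use assms in auto)
  also have "\<dots> = of_nat (n choose k) * x ^ k * (\<Sum>i\<le>n - k. of_nat ((n - k) choose i) * x ^ i * y ^ (n - k - i))"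
    by (simp add: sum_distrib_left power_add mult_ac add.commute)
  also have "(\<Sum>i\<le>n - k. of_nat ((n - k) choose i) * x ^ i * y ^ (n - k - i)) = 1"
    using binomial_ring[of x y "n - k"] assms by simp
  finally show ?thesis by simp
qed

text \<open>
  The measures putting the Bernstein weights \<open>(n choose j) L (X\<^sup>j (1 - X)\<^sup>n\<^sup>-\<^sup>j)\<close> on \<open>j/n\<close> are
  tight, and their moments converge to those prescribed by \<open>L\<close>.
\<close>

theorem hausdorff_moment:
  fixes L :: "complex poly \<Rightarrow> complex"
  assumes add: "\<And>p r. L (p + r) = L p + L r" and scale: "\<And>c p. L (smult c p) = c * L p"
    and one: "L 1 = 1"
    and pos: "\<And>i j. \<exists>w\<ge>0. L ([:0, 1:] ^ i * [:1, -1:] ^ j) = complex_of_real w"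
  obtains M where "real_distribution M" "AE t in M. 0 \<le> t \<and> t \<le> 1"
    "\<And>p. L p = (\<integral>t. poly p (complex_of_real t) \<partial>M)"
proof -
  obtain w where w: "\<And>i j. w i j \<ge> 0" "\<And>i j. L ([:0, 1:] ^ i * [:1, -1:] ^ j) = complex_of_real (w i j)"
    using pos by metis
  have L_sum: "L (\<Sum>i\<in>I. c i * smult (d i) (f i)) = (\<Sum>i\<in>I. L (c i * smult (d i) (f i)))" for c :: "'i \<Rightarrow> complex poly" and d f I
  proof (induction I rule: infinite_finite_induct)
    case (infinite A) then show ?case using scale[of 0 0] by simp
  next
    case empty then show ?case using scale[of 0 0] by simp
  qed (simp add: add)
  have L_lin: "L (\<Sum>i\<in>I. smult (d i) (f i)) = (\<Sum>i\<in>I. d i * L (f i))" for d :: "nat \<Rightarrow> complex" and f I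
    using L_sum[of "\<lambda>_. 1" d f I] by (simp add: scale)
  \<comment> \<open>Applying \<open>L\<close> to the ring identity at \<open>x = X\<close> and
    \<open>y = 1 - X\<close> transfers the factorial moments to the numbers
    \<open>w\<close>.\<close>
  have L_bern: "(\<Sum>j\<le>n. real ((n choose j) * (j choose k)) * w j (n - j)) = real (n choose k) * w k 0"
    if "k \<le> n" for n k
  proof -
    have "(\<Sum>j\<le>n. smult (of_nat ((n choose j) * (j choose k))) ([:0, 1:] ^ j * [:1, -1:] ^ (n - j)))
      = smult (of_nat (n choose k)) ([:0, 1:: complex:] ^ k * [:1, -1:] ^ 0)"
    proof -
      have "[:0, 1:] + [:1, -1:] = (1 :: complex poly)" by (simp add: one_pCons)
      from bernstein_choose_sum[OF that this] show ?thesis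
        by (simp add: of_nat_poly del: of_nat_mult)
    qed
    from arg_cong[OF this, of L]
    have "complex_of_real (\<Sum>j\<le>n. real ((n choose j) * (j choose k)) * w j (n - j))
        = complex_of_real (real (n choose k) * w k 0)"
      by (simp only: L_lin scale w) simp
    then show ?thesis by (simp only: of_real_eq_iff)
  qed
  have w00: "w 0 0 = 1" using w(2)[of 0 0] one by simp
  define W where "W n j = real (n choose j) * w j (n - j)" for n j
  have W: "W n j \<ge> 0" for n j using w(1) by (simp add: W_def)
  have W1: "(\<Sum>j\<le>n. W n j) = 1" for n
    using L_bern[of 0 n] by (simp add: W_def w00)
  \<comment> \<open>With binomial ratios in place of powers the moments of the weights are exact for
    all \<open>n \<ge> k\<close>; replacing the ratios by powers of \<open>j / n\<close> costs an
    error that tends to \<open>0\<close>.\<close>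
  have Wk: "(\<Sum>j\<le>n. W n j * (real (j choose k) / real (n choose k))) = w k 0" if "k \<le> n" for n k
  proof -
    have "(\<Sum>j\<le>n. W n j * (real (j choose k) / real (n choose k)))
        = (\<Sum>j\<le>n. real ((n choose j) * (j choose k)) * w j (n - j)) / real (n choose k)"
      by (simp add: W_def sum_divide_distrib mult_ac)
    also have "\<dots> = w k 0"
      using that by (simp only: L_bern) simp
    finally show ?thesis .
  qed
  define \<mu> where "\<mu> n = distr (point_measure {..n} (W n)) borel (\<lambda>j. real j / real n)" for n
  have ps: "prob_space (point_measure {..n} (W n))" for n
    by (rule prob_space_point_measure) (use W W1 in \<open>auto simp: sum_ennreal\<close>)
  have meas: "(\<lambda>j. real j / real n) \<in> measurable (point_measure {..n} (W n)) borel" for n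
    by (simp add: measurable_def space_point_measure sets_point_measure)
  have rd: "real_distribution (\<mu> n)" for n
    unfolding \<mu>_def using prob_space.real_distribution_distr[OF ps meas] .
  have int: "integral\<^sup>L (\<mu> n) f = (\<Sum>j\<le>n. W n j * f (real j / real n))"
    if "f \<in> borel_measurable borel" for n and f :: "real \<Rightarrow> real"
    unfolding \<mu>_def using that meas
    by (simp add: integral_distr lebesgue_integral_point_measure_finite W)
  have unit: "0 \<le> real j / real n \<and> real j / real n \<le> 1" if "j \<le> n" for j n
    using that by (auto simp: divide_simps)
  have "tight \<mu>"
    unfolding tight_def
  proof (intro conjI allI impI rd)
    fix e :: real assume e: "e > 0"
    have "measure (\<mu> n) {-1<..1} = integral\<^sup>L (\<mu> n) (indicator {-1<..1})" for n
      using rd[of n] by (simp add: real_distribution_def real_distribution_axioms_def sets_eq_imp_space_eq)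
    also have "\<dots> n = (\<Sum>j\<le>n. W n j * 1)" for n
      by (subst int, simp, intro sum.cong refl arg_cong2[where f="(*)"])
        (use unit in \<open>auto simp: indicator_def intro: less_le_trans[of _ 0]\<close>)
    finally show "\<exists>a b. a < b \<and> (\<forall>n. 1 - e < measure (\<mu> n) {a<..b})"
      using e W1 by (intro exI[of _ "-1"] exI[of _ 1]) simp
  qed
  from tight_imp_convergent_subsubsequence[OF this strict_mono_id]
  obtain r M where r: "strict_mono r" and M: "real_distribution M" and wc: "weak_conv_m (\<mu> \<circ> r) M"
    by auto
  interpret M: real_distribution M by fact
  have conv: "(\<lambda>n. integral\<^sup>L (\<mu> (r n)) f) \<longlonglongrightarrow> integral\<^sup>L M f"
    if "continuous_on UNIV f" "\<And>x. norm (f x) \<le> B" for f :: "real \<Rightarrow> real" and B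
    using weak_conv_imp_integral_bdd_continuous_conv[OF _ M wc, of f B] rd that
    by (auto simp: continuous_on_eq_continuous_at)
  \<comment> \<open>Weak convergence only tests bounded continuous functions, so
    \<open>t ^ k\<close> is clamped to \<open>[0, 1]\<close>, where all the approximating measures
    live.\<close>
  define c where "c t = max 0 (min 1 t)" for t :: real
  have c_cont: "continuous_on UNIV c"
    unfolding c_def by (intro continuous_intros)
  have c01: "0 \<le> c t" "c t \<le> 1" for t by (auto simp: c_def)
  have c_id: "c t = t" if "0 \<le> t \<and> t \<le> 1" for t using that by (auto simp: c_def)
  have c_meas [measurable]: "c \<in> borel_measurable borel"
    using c_cont by (rule borel_measurable_continuous_onI)
  have AE: "AE t in M. 0 \<le> t \<and> t \<le> 1"
  proof -
    \<comment> \<open>\<open>g\<close> is bounded and continuous and vanishes exactly on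
      \<open>[0, 1]\<close>. Its integral is \<open>0\<close> for every approximating measure, hence
      also for the limit.\<close>
    define g where "g t = min 1 \<bar>t - c t\<bar>" for t
    have "continuous_on UNIV g"
      unfolding g_def by (intro continuous_intros c_cont)
    then have g_meas [measurable]: "g \<in> borel_measurable borel" by (rule borel_measurable_continuous_onI)
    have "(\<lambda>n. integral\<^sup>L (\<mu> (r n)) g) \<longlonglongrightarrow> integral\<^sup>L M g"
      by (rule conv[of _ 1]) (fact, auto simp: g_def)
    moreover have "integral\<^sup>L (\<mu> n) g = 0" for n
      using c_id[OF unit] by (subst int) (auto simp: g_def intro!: sum.neutral)
    ultimately have "integral\<^sup>L M g = 0"
      by (simp add: LIMSEQ_const_iff)
    moreover have "integrable M g"
      by (rule M.integrable_const_bound[of _ 1]) (auto simp: g_def)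
    ultimately have "AE t in M. g t = 0"
      by (subst (asm) integral_nonneg_eq_0_iff_AE) (auto simp: g_def)
    then show ?thesis
      by eventually_elim (auto simp: g_def c_def min_def max_def split: if_splits)
  qed
  have moment: "integral\<^sup>L M (\<lambda>t. c t ^ k) = w k 0" for k
  proof (rule LIMSEQ_unique)
    show "(\<lambda>n. integral\<^sup>L (\<mu> (r n)) (\<lambda>t. c t ^ k)) \<longlonglongrightarrow> integral\<^sup>L M (\<lambda>t. c t ^ k)"
      by (rule conv[of _ 1]) (auto intro!: continuous_intros c_cont power_le_one simp: c01 power_abs abs_of_nonneg)
    have "(\<lambda>n. integral\<^sup>L (\<mu> n) (\<lambda>t. c t ^ k)) \<longlonglongrightarrow> w k 0"
    proof (rule LIM_zero_cancel, rule Lim_null_comparison)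
      let ?e = "\<lambda>n. real k * (real k / (real n - real k))"
      have "\<bar>integral\<^sup>L (\<mu> n) (\<lambda>t. c t ^ k) - w k 0\<bar> \<le> ?e n" if n: "2 * k < n" for n
      proof -
        have "integral\<^sup>L (\<mu> n) (\<lambda>t. c t ^ k) - w k 0
          = (\<Sum>j\<le>n. W n j * ((real j / real n) ^ k - real (j choose k) / real (n choose k)))"
          using n c_id[OF unit] Wk[of k n] by (subst int) (auto simp: right_diff_distrib sum_subtractf)
        also have "\<bar>\<dots>\<bar> \<le> (\<Sum>j\<le>n. W n j * ?e n)"
        proof (intro order_trans[OF sum_abs] sum_mono)
          fix j assume "j \<in> {..n}"
          then show "\<bar>W n j * ((real j / real n) ^ k - real (j choose k) / real (n choose k))\<bar> \<le> W n j * ?e n"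
            unfolding abs_mult abs_of_nonneg[OF W]
            by (intro mult_left_mono choose_ratio_approx n W) auto
        qed
        also have "\<dots> = ?e n"
          by (simp only: sum_distrib_right[symmetric] W1 mult_1)
        finally show ?thesis .
      qed
      then show "eventually (\<lambda>n. norm (integral\<^sup>L (\<mu> n) (\<lambda>t. c t ^ k) - w k 0) \<le> ?e n) sequentially"
        by (intro eventually_sequentiallyI[of "2 * k + 1"]) auto
      show "?e \<longlonglongrightarrow> 0"
        by real_asymp
    qed
    from LIMSEQ_subseq_LIMSEQ[OF this r]
    show "(\<lambda>n. integral\<^sup>L (\<mu> (r n)) (\<lambda>t. c t ^ k)) \<longlonglongrightarrow> w k 0" by (simp add: o_def)
  qed
  have "L p = (\<integral>t. poly p (complex_of_real t) \<partial>M)" for p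
  proof -
    have "L p = L (\<Sum>i\<le>degree p. smult (coeff p i) ([:0, 1:] ^ i * [:1, -1:] ^ 0))"
      using poly_as_sum_of_monoms[of p] by (simp add: monom_altdef)
    also have "\<dots> = (\<Sum>i\<le>degree p. coeff p i * complex_of_real (integral\<^sup>L M (\<lambda>t. c t ^ i)))"
      by (simp only: L_lin w moment)
    also have "\<dots> = (\<Sum>i\<le>degree p. \<integral>t. coeff p i * complex_of_real (c t ^ i) \<partial>M)"
      by (simp del: of_real_power)
    also have "\<dots> = (\<integral>t. (\<Sum>i\<le>degree p. coeff p i * complex_of_real (c t ^ i)) \<partial>M)"
      by (intro Bochner_Integration.integral_sum[symmetric] integrable_mult_right integrable_of_real
          M.integrable_const_bound[of _ 1]) (auto simp: c01 power_le_one power_abs)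
    also have "\<dots> = (\<integral>t. poly p (complex_of_real t) \<partial>M)"
    proof (rule integral_cong_AE)
      show "AE t in M. (\<Sum>i\<le>degree p. coeff p i * complex_of_real (c t ^ i)) = poly p (complex_of_real t)"
        using AE by eventually_elim (simp add: c_id poly_altdef)
      show "(\<lambda>t. poly p (complex_of_real t)) \<in> borel_measurable M"
        unfolding poly_altdef by measurable
    qed measurable
    finally show ?thesis .
  qed
  then show ?thesis using that M AE by blast
qed

section \<open>Square-integrable functions\<close>

abbreviation sqnorm :: "'x measure \<Rightarrow> ('x \<Rightarrow> complex) \<Rightarrow> real" where
  "sqnorm M f \<equiv> (\<integral>x. (cmod (f x))\<^sup>2 \<partial>M)"

lemma l2_funD [dest]: 
  "f \<in> l2_fun M \<Longrightarrow> f \<in> borel_measurable M" "f \<in> l2_fun M \<Longrightarrow> integrable M (\<lambda>x. (cmod (f x))\<^sup>2)"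
  by (auto simp: l2_fun_def)

lemma l2_fun_bound:
  assumes "f \<in> borel_measurable M" "integrable M g" "AE x in M. (cmod (f x))\<^sup>2 \<le> g x"
  shows "f \<in> l2_fun M"
  unfolding l2_fun_def
proof safe
  show "integrable M (\<lambda>x. (cmod (f x))\<^sup>2)"
    using assms by (intro Bochner_Integration.integrable_bound[OF assms(2)]) auto
qed fact

lemma l2_fun_add:
  assumes "f \<in> l2_fun M" "g \<in> l2_fun M"
  shows "(\<lambda>x. f x + g x) \<in> l2_fun M"
proof (rule l2_fun_bound)
  show "integrable M (\<lambda>x. 2 * (cmod (f x))\<^sup>2 + 2 * (cmod (g x))\<^sup>2)"
    using assms by (auto simp: l2_fun_def)
  have [measurable]: "f \<in> borel_measurable M" "g \<in> borel_measurable M"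
    using assms by auto
  show "(\<lambda>x. f x + g x) \<in> borel_measurable M" by measurable
qed (simp add: norm_add_sq_le)

lemma l2_fun_scale: "f \<in> l2_fun M \<Longrightarrow> (\<lambda>x. c * f x) \<in> l2_fun M"
  by (auto simp: l2_fun_def norm_mult power_mult_distrib)

lemma l2_fun_diff:
  assumes "f \<in> l2_fun M" "g \<in> l2_fun M"
  shows "(\<lambda>x. f x - g x) \<in> l2_fun M"
  using l2_fun_add[OF assms(1) l2_fun_scale[OF assms(2), of "-1"]] by simp

lemma sqnorm_add_le:
  assumes "f \<in> l2_fun M" "g \<in> l2_fun M"
  shows "sqnorm M (\<lambda>x. f x + g x) \<le> 2 * sqnorm M f + 2 * sqnorm M g"
proof -
  have "sqnorm M (\<lambda>x. f x + g x) \<le> (\<integral>x. 2 * (cmod (f x))\<^sup>2 + 2 * (cmod (g x))\<^sup>2 \<partial>M)"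
    using assms l2_fun_add[OF assms] by (intro integral_mono) (auto simp: l2_fun_def norm_add_sq_le)
  also have "\<dots> = 2 * sqnorm M f + 2 * sqnorm M g"
    using assms by (subst Bochner_Integration.integral_add) (auto simp: l2_fun_def)
  finally show ?thesis .
qed

lemma sqnorm_scale: "sqnorm M (\<lambda>x. c * f x) = (cmod c)\<^sup>2 * sqnorm M f"
  by (simp add: norm_mult power_mult_distrib)

lemma sqnorm_diff_le:
  assumes "f \<in> l2_fun M" "g \<in> l2_fun M" "h \<in> l2_fun M"
  shows "sqnorm M (\<lambda>x. f x - h x) \<le> 2 * sqnorm M (\<lambda>x. f x - g x) + 2 * sqnorm M (\<lambda>x. g x - h x)"
  using sqnorm_add_le[OF l2_fun_diff[OF assms(1,2)] l2_fun_diff[OF assms(2,3)]] by simp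

lemma borel_measurable_cnj [measurable]: "cnj \<in> borel_measurable borel"
  by (intro borel_measurable_continuous_onI continuous_intros)

lemma l2_fun_mult_integrable:
  assumes "f \<in> l2_fun M" "g \<in> l2_fun M"
  shows "integrable M (\<lambda>x. f x * cnj (g x))"
proof (rule Bochner_Integration.integrable_bound)
  show "integrable M (\<lambda>x. (cmod (f x))\<^sup>2 + (cmod (g x))\<^sup>2)"
    using assms by (auto simp: l2_fun_def)
  have [measurable]: "f \<in> borel_measurable M" "g \<in> borel_measurable M"
    using assms by auto
  show "(\<lambda>x. f x * cnj (g x)) \<in> borel_measurable M" by measurable
  have "a * b \<le> a\<^sup>2 + b\<^sup>2" if "a \<ge> 0" "b \<ge> 0" for a b :: real
    using sum_squares_bound[of a b] mult_nonneg_nonneg[OF that] by linarith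
  then show "AE x in M. norm (f x * cnj (g x)) \<le> norm ((cmod (f x))\<^sup>2 + (cmod (g x))\<^sup>2)"
    by (intro AE_I2) (simp add: norm_mult)
qed

lemma sqnorm_eq_0_iff:
  assumes "f \<in> l2_fun M"
  shows "sqnorm M f = 0 \<longleftrightarrow> (AE x in M. f x = 0)"
  using integral_nonneg_eq_0_iff_AE[of M "\<lambda>x. (cmod (f x))\<^sup>2"] assms by (auto simp: l2_fun_def)

lemma nn_integral_sqnorm:
  "f \<in> l2_fun M \<Longrightarrow> (\<integral>\<^sup>+x. ennreal ((cmod (f x))\<^sup>2) \<partial>M) = ennreal (sqnorm M f)"
  by (rule nn_integral_eq_integral) (auto simp: l2_fun_def)

lemma l2_fun_iff_nn_integral:
  "f \<in> l2_fun M \<longleftrightarrow> f \<in> borel_measurable M \<and> (\<integral>\<^sup>+x. ennreal ((cmod (f x))\<^sup>2) \<partial>M) < \<infinity>"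
proof -
  have "integrable M (\<lambda>x. (cmod (f x))\<^sup>2) \<longleftrightarrow> (\<integral>\<^sup>+x. ennreal ((cmod (f x))\<^sup>2) \<partial>M) < \<infinity>"
    if [measurable]: "f \<in> borel_measurable M"
    by (subst integrable_iff_bounded) auto
  then show ?thesis by (auto simp: l2_fun_def)
qed

text \<open>
  Along a rapidly convergent subsequence with increments \<open>g\<^sub>k\<close>, the pointwise bound
  \<open>\<bar>g\<^sub>k\<bar> \<le> 2\<^sup>k \<bar>g\<^sub>k\<bar>\<^sup>2 + 2\<^sup>-\<^sup>k\<close> gives almost everywhere convergence.
\<close>

theorem l2_fun_complete:
  fixes f :: "nat \<Rightarrow> 'x \<Rightarrow> complex"
  assumes l2: "\<And>n. f n \<in> l2_fun M"
    and cauchy: "\<And>e. e > 0 \<Longrightarrow> \<exists>N. \<forall>m\<ge>N. \<forall>n\<ge>N. sqnorm M (\<lambda>x. f m x - f n x) < e"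
  shows "\<exists>g\<in>l2_fun M. (\<lambda>n. sqnorm M (\<lambda>x. g x - f n x)) \<longlonglongrightarrow> 0"
proof -
  have [measurable]: "f n \<in> borel_measurable M" for n
    using l2 by auto
  \<comment> \<open>Increments of squared norm below \<open>(1/4)^k\<close> stay summable after
    multiplication by the weight \<open>2^k\<close>.\<close>
  have "\<exists>N. \<forall>k. (\<forall>m\<ge>N k. \<forall>n\<ge>N k. sqnorm M (\<lambda>x. f m x - f n x) < (1/4) ^ k)"
    using cauchy[of "(1/4)^_"] by (intro choice) auto
  then obtain N where N: "\<And>k m n. m \<ge> N k \<Longrightarrow> n \<ge> N k \<Longrightarrow> sqnorm M (\<lambda>x. f m x - f n x) < (1/4) ^ k"
    by blast
  \<comment> \<open>Adding \<open>k\<close> and all earlier thresholds makes \<open>r k\<close>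
    exceed \<open>N k\<close> and \<open>k\<close>, and \<open>r (Suc k)\<close> exceed
    \<open>N k\<close>.\<close>
  define r where "r k = k + (\<Sum>i\<le>k. N i)" for k
  have r_ge: "r k \<ge> N k" "r (Suc k) \<ge> N k" "r k \<ge> k" for k
  proof -
    have "N k \<le> (\<Sum>i\<le>k. N i)" by (rule member_le_sum) auto
    then show "r k \<ge> N k" "r (Suc k) \<ge> N k" "r k \<ge> k" by (auto simp: r_def)
  qed
  define d where "d k x = f (r (Suc k)) x - f (r k) x" for k x
  have d_l2: "d k \<in> l2_fun M" for k
    unfolding d_def by (intro l2_fun_diff l2)
  have [measurable]: "d k \<in> borel_measurable M" for k
    using d_l2 by auto
  have d_le: "sqnorm M (d k) \<le> (1/4)^k" for k
    unfolding d_def using N[OF r_ge(2) r_ge(1)] by (rule less_imp_le)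
  have "(\<integral>\<^sup>+x. (\<Sum>k. ennreal (2^k * (cmod (d k x))\<^sup>2)) \<partial>M) = (\<Sum>k. \<integral>\<^sup>+x. ennreal (2^k * (cmod (d k x))\<^sup>2) \<partial>M)"
    by (rule nn_integral_suminf) measurable
  also have "\<dots> \<le> (\<Sum>k. ennreal ((1/2)^k))"
  proof (intro suminf_le allI summableI)
    fix k
    have "(\<integral>\<^sup>+x. ennreal (2^k * (cmod (d k x))\<^sup>2) \<partial>M) = ennreal (2^k) * ennreal (sqnorm M (d k))"
      by (simp add: ennreal_mult' nn_integral_cmult nn_integral_sqnorm[OF d_l2, symmetric])
    also have "\<dots> = ennreal (2^k * sqnorm M (d k))"
      by (simp add: ennreal_mult')
    also have "\<dots> \<le> ennreal (2^k * (1/4)^k)"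
      by (intro ennreal_leI mult_left_mono d_le) auto
    also have "2^k * (1/4)^k = ((1/2)^k :: real)"
      by (simp add: power_mult_distrib[symmetric])
    finally show "(\<integral>\<^sup>+x. ennreal (2^k * (cmod (d k x))\<^sup>2) \<partial>M) \<le> ennreal ((1/2)^k)" .
  qed
  also have "\<dots> < \<infinity>"
    by (subst suminf_ennreal2) (auto simp: summable_geometric)
  finally have "AE x in M. (\<Sum>k. ennreal (2^k * (cmod (d k x))\<^sup>2)) \<noteq> \<infinity>"
    by (intro nn_integral_PInf_AE) auto
  then have conv: "AE x in M. convergent (\<lambda>k. f (r k) x)"
  proof eventually_elim
    case (elim x)
    then have "summable (\<lambda>k. 2^k * (cmod (d k x))\<^sup>2)"
      by (intro summable_suminf_not_top) auto
    then have "summable (\<lambda>k. 2^k * (cmod (d k x))\<^sup>2 + (1/2)^k)"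
      by (intro summable_add summable_geometric) auto
    then have "summable (\<lambda>k. d k x)"
    proof (rule summable_comparison_test'[where N=0])
      fix k
      have "2 * (2^k * cmod (d k x)) \<le> (2^k * cmod (d k x))\<^sup>2 + 1"
        using sum_squares_bound[of "2^k * cmod (d k x)" 1] by simp
      moreover have "0 \<le> 2^k * cmod (d k x)" by simp
      ultimately have "2^k * cmod (d k x) \<le> (2^k * cmod (d k x))\<^sup>2 + 1" by linarith
      then have "2^k * cmod (d k x) \<le> 2^k * (2^k * (cmod (d k x))\<^sup>2) + 1"
        by (simp add: power2_eq_square mult_ac)
      then have "2^k * cmod (d k x) \<le> 2^k * (2^k * (cmod (d k x))\<^sup>2 + (1/2)^k)"
        by (simp add: distrib_left power_mult_distrib[symmetric])
      then show "norm (d k x) \<le> 2^k * (cmod (d k x))\<^sup>2 + (1/2)^k"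
        by simp
    qed
    then have "convergent (\<lambda>n. f (r 0) x + (\<Sum>k<n. d k x))"
      by (intro convergent_add convergent_const) (simp add: summable_iff_convergent)
    moreover have "f (r 0) x + (\<Sum>k<n. d k x) = f (r n) x" for n
      using sum_lessThan_telescope[of "\<lambda>k. f (r k) x" n] by (simp add: d_def)
    ultimately show ?case by simp
  qed
  define g where "g x = lim (\<lambda>k. f (r k) x)" for x
  have [measurable]: "g \<in> borel_measurable M"
    unfolding g_def by measurable
  have lim: "AE x in M. (\<lambda>k. f (r k) x) \<longlonglongrightarrow> g x"
    using conv by eventually_elim (simp add: g_def convergent_LIMSEQ_iff)
  \<comment> \<open>Fatou's lemma along the subsequence turns almost everywhere convergence into a
    norm estimate for every late \<open>n\<close>, so the whole sequence converges and not just the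
    subsequence.\<close>
  have fatou: "(\<integral>\<^sup>+x. ennreal ((cmod (g x - f n x))\<^sup>2) \<partial>M) \<le> ennreal ((1/4)^K)" if n: "n \<ge> N K" for n K
  proof -
    have "(\<integral>\<^sup>+x. ennreal ((cmod (g x - f n x))\<^sup>2) \<partial>M)
      = (\<integral>\<^sup>+x. liminf (\<lambda>k. ennreal ((cmod (f (r k) x - f n x))\<^sup>2)) \<partial>M)"
      using lim
    proof (intro nn_integral_cong_AE, eventually_elim)
      case (elim x)
      then have "(\<lambda>k. ennreal ((cmod (f (r k) x - f n x))\<^sup>2)) \<longlonglongrightarrow> ennreal ((cmod (g x - f n x))\<^sup>2)"
        by (intro tendsto_intros)
      from lim_imp_Liminf[OF _ this] show ?case by simp
    qed
    also have "\<dots> \<le> liminf (\<lambda>k. \<integral>\<^sup>+x. ennreal ((cmod (f (r k) x - f n x))\<^sup>2) \<partial>M)"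
      by (rule nn_integral_liminf) measurable
    also have "\<dots> \<le> liminf (\<lambda>k. ennreal ((1/4)^K))"
    proof (rule Liminf_mono, rule eventually_sequentiallyI[of "N K"])
      fix k assume "k \<ge> N K"
      then have "r k \<ge> N K" using r_ge(3)[of k] by simp
      then show "(\<integral>\<^sup>+x. ennreal ((cmod (f (r k) x - f n x))\<^sup>2) \<partial>M) \<le> ennreal ((1/4)^K)"
        using N[of K "r k" n] n
        by (subst nn_integral_sqnorm[OF l2_fun_diff[OF l2 l2]]) (auto intro!: ennreal_leI less_imp_le)
    qed
    also have "\<dots> = ennreal ((1/4)^K)"
      by (simp add: Liminf_const)
    finally show ?thesis .
  qed
  have diff_l2: "(\<lambda>x. g x - f (N 0) x) \<in> l2_fun M"
    unfolding l2_fun_iff_nn_integral using fatou[of 0 "N 0"] by (auto simp: le_less_trans)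
  have g_l2: "g \<in> l2_fun M"
    using l2_fun_add[OF diff_l2 l2[of "N 0"]] by simp
  have small: "sqnorm M (\<lambda>x. g x - f n x) \<le> (1/4)^K" if "n \<ge> N K" for n K
    using fatou[OF that] by (subst (asm) nn_integral_sqnorm[OF l2_fun_diff[OF g_l2 l2]]) auto
  have "(\<lambda>n. sqnorm M (\<lambda>x. g x - f n x)) \<longlonglongrightarrow> 0"
  proof (rule LIMSEQ_I)
    fix e :: real assume "e > 0"
    then obtain K where "(1/4::real)^K < e"
      using real_arch_pow_inv[of e "1/4"] by auto
    then show "\<exists>n0. \<forall>n\<ge>n0. norm (sqnorm M (\<lambda>x. g x - f n x) - 0) < e"
      using small[of K] by (intro exI[of _ "N K"]) (auto intro: le_less_trans)
  qed
  then show ?thesis using g_l2 by blast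
qed

lemma sqnorm_dominated_convergence:
  assumes "f \<in> borel_measurable M" "\<And>n. g n \<in> borel_measurable M" "h \<in> borel_measurable M"
    and "integrable M (\<lambda>x. (h x)\<^sup>2)"
    and lim: "AE x in M. (\<lambda>n. g n x) \<longlonglongrightarrow> f x"
    and bd: "AE x in M. cmod (f x) \<le> h x" "\<And>n. AE x in M. cmod (g n x) \<le> h x"
  shows "f \<in> l2_fun M" "\<And>n. g n \<in> l2_fun M" "(\<lambda>n. sqnorm M (\<lambda>x. f x - g n x)) \<longlonglongrightarrow> 0"
proof -
  note [measurable] = assms(1-3)
  show f: "f \<in> l2_fun M"
    by (rule l2_fun_bound[OF assms(1,4)]) (use bd(1) in \<open>eventually_elim, auto intro: power_mono\<close>)
  show g: "g n \<in> l2_fun M" for n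
    by (rule l2_fun_bound[OF assms(2,4)]) (use bd(2)[of n] in \<open>eventually_elim, auto intro: power_mono\<close>)
  have "(\<lambda>n. sqnorm M (\<lambda>x. f x - g n x)) \<longlonglongrightarrow> (\<integral>x. 0 \<partial>M)"
  proof (rule integral_dominated_convergence[where w = "\<lambda>x. 4 * (h x)\<^sup>2"])
    show "AE x in M. (\<lambda>n. (cmod (f x - g n x))\<^sup>2) \<longlonglongrightarrow> 0"
      using lim
    proof eventually_elim
      case (elim x)
      then have "(\<lambda>n. (cmod (f x - g n x))\<^sup>2) \<longlonglongrightarrow> (cmod (f x - f x))\<^sup>2"
        by (intro tendsto_intros)
      then show ?case by simp
    qed
    show "AE x in M. norm ((cmod (f x - g n x))\<^sup>2) \<le> 4 * (h x)\<^sup>2" for n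
      using bd(1) bd(2)[of n]
    proof eventually_elim
      case (elim x)
      have "cmod (f x - g n x) \<le> 2 * h x"
        using norm_triangle_ineq4[of "f x" "g n x"] elim by simp
      from power_mono[OF this, of 2] show ?case by (simp add: power_mult_distrib)
    qed
  qed (use assms(4) in auto)
  then show "(\<lambda>n. sqnorm M (\<lambda>x. f x - g n x)) \<longlonglongrightarrow> 0" by simp
qed

subsection \<open>Density of the polynomials\<close>

abbreviation poly_fun :: "complex poly \<Rightarrow> real \<Rightarrow> complex" where
  "poly_fun p \<equiv> \<lambda>t. poly p (complex_of_real t)"

lemma poly_fun_measurable [measurable]: "poly_fun p \<in> borel_measurable borel"
  by (intro borel_measurable_continuous_onI continuous_intros)

locale unit_interval_measure = real_distribution M for M +
  assumes AE_unit: "AE t in M. 0 \<le> t \<and> t \<le> 1"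
begin

lemma l2_fun_bounded:
  assumes "f \<in> borel_measurable borel" "AE t in M. cmod (f t) \<le> B"
  shows "f \<in> l2_fun M"
proof (rule l2_fun_bound)
  show "f \<in> borel_measurable M" using assms by simp
  show "integrable M (\<lambda>_. B\<^sup>2)" by simp
  show "AE t in M. (cmod (f t))\<^sup>2 \<le> B\<^sup>2"
    using assms(2) by eventually_elim (auto intro: power_mono)
qed

lemma l2_fun_continuous:
  assumes "continuous_on {0..1} f" "f \<in> borel_measurable borel"
  shows "f \<in> l2_fun M"
proof -
  have "bounded (f ` {0..1})"
    by (intro compact_imp_bounded compact_continuous_image assms) auto
  then obtain B where B: "\<And>t. t \<in> {0..1} \<Longrightarrow> cmod (f t) \<le> B"
    unfolding bounded_iff by blast
  have "AE t in M. cmod (f t) \<le> B"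
    using AE_unit by eventually_elim (simp add: B)
  then show ?thesis by (rule l2_fun_bounded[OF assms(2)])
qed

lemma poly_fun_l2 [simp]: "poly_fun p \<in> l2_fun M"
  by (rule l2_fun_continuous) (auto intro!: continuous_intros)

lemma mult_l2_fun:
  assumes "f \<in> l2_fun M"
  shows "(\<lambda>t. complex_of_real t * f t) \<in> l2_fun M"
proof (rule l2_fun_bound)
  have "f \<in> borel_measurable borel"
    using assms by (auto simp: l2_fun_def)
  then show "(\<lambda>t. complex_of_real t * f t) \<in> borel_measurable M" by simp
  show "integrable M (\<lambda>t. (cmod (f t))\<^sup>2)" using assms by auto
  show "AE t in M. (cmod (complex_of_real t * f t))\<^sup>2 \<le> (cmod (f t))\<^sup>2"
    using AE_unit by eventually_elim (auto simp: norm_mult power_mult_distrib power_le_one mult_left_le_one_le)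
qed

text \<open>Membership in the L2 closure of the polynomials. The lemmas about it are the closure
  properties used by the Borel set induction and by the passage to simple functions.\<close>

definition poly_approx :: "(real \<Rightarrow> complex) \<Rightarrow> bool" where
  "poly_approx f \<longleftrightarrow> f \<in> l2_fun M \<and> (\<forall>e>0. \<exists>p. sqnorm M (\<lambda>t. f t - poly_fun p t) < e)"

lemma poly_approx_l2: "poly_approx f \<Longrightarrow> f \<in> l2_fun M"
  by (simp add: poly_approx_def)

lemma poly_approx_ex: "poly_approx f \<Longrightarrow> e > 0 \<Longrightarrow> \<exists>p. sqnorm M (\<lambda>t. f t - poly_fun p t) < e"
  by (simp add: poly_approx_def)

lemma poly_approx_add:
  assumes "poly_approx f" "poly_approx g"
  shows "poly_approx (\<lambda>t. f t + g t)"
  unfolding poly_approx_def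
proof safe
  have f: "f \<in> l2_fun M" and g: "g \<in> l2_fun M" using assms by (auto simp: poly_approx_def)
  then show "(\<lambda>t. f t + g t) \<in> l2_fun M" by (rule l2_fun_add)
  fix e :: real assume "e > 0"
  then have "e / 4 > 0" by simp
  then obtain p r where pr: "sqnorm M (\<lambda>t. f t - poly_fun p t) < e / 4"
    "sqnorm M (\<lambda>t. g t - poly_fun r t) < e / 4"
    using assms[THEN poly_approx_ex] by meson
  have "sqnorm M (\<lambda>t. f t + g t - poly_fun (p + r) t)
      = sqnorm M (\<lambda>t. (f t - poly_fun p t) + (g t - poly_fun r t))"
    by (intro Bochner_Integration.integral_cong) (auto simp: algebra_simps)
  also have "\<dots> \<le> 2 * sqnorm M (\<lambda>t. f t - poly_fun p t) + 2 * sqnorm M (\<lambda>t. g t - poly_fun r t)"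
    by (intro sqnorm_add_le l2_fun_diff f g poly_fun_l2)
  also have "\<dots> < e" using pr by linarith
  finally show "\<exists>p. sqnorm M (\<lambda>t. f t + g t - poly_fun p t) < e" by blast
qed

lemma poly_approx_scale:
  assumes "poly_approx f"
  shows "poly_approx (\<lambda>t. c * f t)"
  unfolding poly_approx_def
proof safe
  show "(\<lambda>t. c * f t) \<in> l2_fun M"
    using assms by (auto simp: poly_approx_def intro: l2_fun_scale)
  fix e :: real assume e: "e > 0"
  define d where "d = e / ((cmod c)\<^sup>2 + 1)"
  have "d > 0" using e by (simp add: d_def add_nonneg_pos)
  then obtain p where p: "sqnorm M (\<lambda>t. f t - poly_fun p t) < d"
    using assms by (auto simp: poly_approx_def)
  have "sqnorm M (\<lambda>t. c * f t - poly_fun (smult c p) t) = (cmod c)\<^sup>2 * sqnorm M (\<lambda>t. f t - poly_fun p t)"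
    by (simp add: sqnorm_scale[symmetric] right_diff_distrib)
  also have "\<dots> \<le> (cmod c)\<^sup>2 * d"
    using p by (intro mult_left_mono) auto
  also have "\<dots> < ((cmod c)\<^sup>2 + 1) * d"
    using \<open>d > 0\<close> by simp
  also have "\<dots> = e"
    by (simp add: d_def add_nonneg_eq_0_iff)
  finally show "\<exists>p. sqnorm M (\<lambda>t. c * f t - poly_fun p t) < e" by blast
qed

lemma poly_approx_poly [simp]: "poly_approx (poly_fun p)"
  unfolding poly_approx_def by (auto intro!: exI[of _ p])

lemma poly_approx_limit:
  assumes f: "f \<in> l2_fun M" and g: "\<And>n. poly_approx (g n)"
    and lim: "(\<lambda>n. sqnorm M (\<lambda>t. f t - g n t)) \<longlonglongrightarrow> 0"
  shows "poly_approx f"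
  unfolding poly_approx_def
proof (safe intro!: f)
  fix e :: real assume e: "e > 0"
  then have "eventually (\<lambda>n. sqnorm M (\<lambda>t. f t - g n t) < e / 4) sequentially"
    using order_tendstoD(2)[OF lim, of "e / 4"] by simp
  then obtain n where n: "sqnorm M (\<lambda>t. f t - g n t) < e / 4"
    by (auto simp: eventually_sequentially)
  obtain p where p: "sqnorm M (\<lambda>t. g n t - poly_fun p t) < e / 4"
    using poly_approx_ex[OF g[of n], of "e / 4"] e by auto
  have "sqnorm M (\<lambda>t. f t - poly_fun p t) \<le> 2 * sqnorm M (\<lambda>t. f t - g n t) + 2 * sqnorm M (\<lambda>t. g n t - poly_fun p t)"
    by (intro sqnorm_diff_le f poly_fun_l2 poly_approx_l2 g)
  with n p show "\<exists>p. sqnorm M (\<lambda>t. f t - poly_fun p t) < e"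
    by (intro exI[of _ p]) linarith
qed

text \<open>Bernstein approximation is uniform on \<open>[0, 1]\<close>, and for a probability
  measure carried by this interval uniform closeness implies L2 closeness.\<close>

lemma poly_approx_continuous:
  assumes f: "continuous_on UNIV (f :: real \<Rightarrow> real)"
  shows "poly_approx (\<lambda>t. complex_of_real (f t))"
  unfolding poly_approx_def
proof safe
  have f01: "continuous_on {0..1} f" using f continuous_on_subset by blast
  have [measurable]: "f \<in> borel_measurable borel" using f by (rule borel_measurable_continuous_onI)
  show l2: "(\<lambda>t. complex_of_real (f t)) \<in> l2_fun M"
    by (rule l2_fun_continuous) (auto intro!: continuous_intros f01)
  fix e :: real assume e: "e > 0"
  \<comment> \<open>The cap at \<open>1\<close> gives \<open>d^2 \<le> d\<close>, and
    \<open>e / 2\<close> makes the result smaller than \<open>e\<close>.\<close>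
  define d where "d = min 1 (e / 2)"
  have d: "d > 0" "d\<^sup>2 < e"
  proof -
    have "d\<^sup>2 \<le> d * 1" unfolding power2_eq_square using e by (intro mult_left_mono) (auto simp: d_def)
    then show "d\<^sup>2 < e" "d > 0" using e by (auto simp: d_def min_def split: if_splits)
  qed
  obtain n where n: "\<And>x. x \<in> {0..1} \<Longrightarrow> \<bar>f x - (\<Sum>k\<le>n. f (real k / real n) * Bernstein n k x)\<bar> < d"
    using Bernstein_Weierstrass[OF f01 d(1)] by blast
  define p where "p = (\<Sum>k\<le>n. smult (complex_of_real (f (real k / real n)) * of_nat (n choose k))
    ([:0, 1:] ^ k * [:1, -1:] ^ (n - k)))"
  have p: "poly_fun p t = complex_of_real (\<Sum>k\<le>n. f (real k / real n) * Bernstein n k t)" for t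
    by (simp add: p_def poly_sum Bernstein_def mult_ac)
  have "sqnorm M (\<lambda>t. complex_of_real (f t) - poly_fun p t) \<le> (\<integral>t. d\<^sup>2 \<partial>M)"
  proof (rule integral_mono_AE)
    show "integrable M (\<lambda>t. (cmod (complex_of_real (f t) - poly_fun p t))\<^sup>2)"
      using l2_fun_diff[OF l2 poly_fun_l2] by auto
    show "AE t in M. (cmod (complex_of_real (f t) - poly_fun p t))\<^sup>2 \<le> d\<^sup>2"
      using AE_unit
    proof eventually_elim
      case (elim t)
      then show ?case
        using n[of t] d unfolding p of_real_diff[symmetric] norm_of_real by (intro power_mono) auto
    qed
  qed simp
  also have "\<dots> < e"
    using d prob_space by simp
  finally show "\<exists>p. sqnorm M (\<lambda>t. complex_of_real (f t) - poly_fun p t) < e"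
    by blast
qed

lemma poly_approx_dominated:
  assumes "f \<in> borel_measurable borel" "\<And>n. poly_approx (g n)" "h \<in> borel_measurable borel"
    and "integrable M (\<lambda>t. (h t)\<^sup>2)"
    and "\<And>t. (\<lambda>n. g n t) \<longlonglongrightarrow> f t" "\<And>n t. cmod (f t) \<le> h t" "\<And>n t. cmod (g n t) \<le> h t"
  shows "poly_approx f"
proof -
  have g: "g n \<in> borel_measurable M" for n using assms(2) by (auto dest: poly_approx_l2)
  have f: "f \<in> borel_measurable M" and h: "h \<in> borel_measurable M" using assms by auto
  have bd: "AE t in M. (\<lambda>n. g n t) \<longlonglongrightarrow> f t" "AE t in M. cmod (f t) \<le> h t"
    "AE t in M. cmod (g n t) \<le> h t" for n
    using assms by auto
  note * = sqnorm_dominated_convergence[OF f g h assms(4) bd]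
  show ?thesis
    by (rule poly_approx_limit[OF *(1) assms(2) *(3)])
qed

text \<open>\<open>d\<close> measures how far \<open>t\<close> is outside the interval, and the
  continuous functions \<open>max 0 (1 - n * d t)\<close> decrease pointwise to the indicator while
  staying below \<open>1\<close>.\<close>

lemma poly_approx_Icc: "poly_approx (indicator {a..b})"
proof -
  define d where "d t = max 0 (max (a - t) (t - b))" for t
  have d: "d t \<ge> 0" "d t = 0 \<longleftrightarrow> t \<in> {a..b}" for t
    by (auto simp: d_def max_def)
  define g where "g n t = complex_of_real (max 0 (1 - real n * d t))" for n t
  have g1: "cmod (g n t) \<le> 1" for n t
    unfolding g_def norm_of_real using d(1)[of t] by (auto simp: max_def)
  have lim: "(\<lambda>n. g n t) \<longlonglongrightarrow> indicator {a..b} t" for t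
  proof (cases "t \<in> {a..b}")
    case True
    then have "d t = 0" using d(2) by blast
    then show ?thesis using True by (simp add: g_def)
  next
    case False
    then have dt: "d t > 0" using d[of t] by force
    then obtain N where N: "1 / d t < real N" using reals_Archimedean2 by blast
    have "g n t = 0" if "n \<ge> N" for n
    proof -
      have "1 / d t < real n" using N that by simp
      then show ?thesis using dt by (simp add: g_def field_simps)
    qed
    then show ?thesis
      using False by (intro tendsto_eventually eventually_sequentiallyI[of N]) auto
  qed
  have "poly_approx (g n)" for n
    unfolding g_def d_def by (intro poly_approx_continuous continuous_intros)
  moreover have "cmod (indicator {a..b} t) \<le> 1" for t by (simp add: indicator_def)
  ultimately show ?thesis
    by (intro poly_approx_dominated[where h = "\<lambda>_. 1", OF _ _ _ _ lim _ g1]) simp_all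
qed

text \<open>Induction over Borel sets from closed intervals: complements use the constant
  \<open>1\<close>, and a disjoint union is the limit of its finite parts, dominated by
  \<open>1\<close>.\<close>

lemma poly_approx_indicator:
  assumes "S \<in> sets borel"
  shows "poly_approx (indicator S)"
  using assms
proof (induction rule: borel_set_induct)
  case empty
  then show ?case using poly_approx_poly[of 0] by (simp add: indicator_def)
next
  case (interval a b)
  show ?case by (rule poly_approx_Icc)
next
  case (compl A)
  have one: "poly_approx (\<lambda>_. 1)"
    using poly_approx_poly[of 1] by simp
  have "poly_approx (\<lambda>t. 1 + (-1) * indicator A t)"
    by (intro poly_approx_add poly_approx_scale one compl)
  moreover have "(\<lambda>t. 1 + (-1) * indicator A t) = (indicator (- A) :: _ \<Rightarrow> complex)"
    by (auto simp: indicator_def)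
  ultimately show ?case by simp
next
  case (union A)
  have part: "poly_approx (indicator (\<Union>i<n. A i))" for n
  proof (induction n)
    case 0
    show ?case using poly_approx_poly[of 0] by (simp add: indicator_def)
  next
    case (Suc n)
    have "A n \<inter> A i = {}" if "i < n" for i
      using disjoint_family_onD[OF union(1), of n i] that by simp
    then have "A n \<inter> (\<Union>i<n. A i) = {}"
      by blast
    then have "indicator (\<Union>i<Suc n. A i) = (\<lambda>t. indicator (\<Union>i<n. A i) t + indicator (A n) t :: complex)"
      by (auto simp: indicator_def lessThan_Suc fun_eq_iff)
    then show ?case using poly_approx_add[OF Suc union(3)[of n]] by simp
  qed
  show ?case
  proof (rule poly_approx_dominated[where h = "\<lambda>_. 1" and g = "\<lambda>n. indicator (\<Union>i<n. A i)"])
    show "(\<lambda>n. indicator (\<Union>i<n. A i) t) \<longlonglongrightarrow> (indicator (\<Union>i. A i) t :: complex)" for t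
      by (rule LIMSEQ_indicator_UN)
    show "poly_approx (indicator (\<Union>i<n. A i))" for n by (rule part)
    show "(indicator (\<Union>i. A i) :: _ \<Rightarrow> complex) \<in> borel_measurable borel"
      using union by (intro borel_measurable_indicator sets.countable_UN) auto
  qed (auto simp: indicator_def)
qed

lemma poly_approx_sum: "(\<And>i. i \<in> I \<Longrightarrow> poly_approx (f i)) \<Longrightarrow> poly_approx (\<lambda>t. \<Sum>i\<in>I. f i t)"
proof (induction I rule: infinite_finite_induct)
  case (insert x F)
  then show ?case using poly_approx_add[of "f x" "\<lambda>t. \<Sum>i\<in>F. f i t"] by simp
qed (use poly_approx_poly[of 0] in auto)

text \<open>Simple functions converging to \<open>f\<close> and dominated by
  \<open>2 * cmod (f t)\<close> are linear combinations of indicators, so dominated convergence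
  concludes.\<close>

theorem poly_dense:
  assumes f: "f \<in> l2_fun M"
  shows "poly_approx f"
proof -
  have [measurable]: "f \<in> borel_measurable borel" using f by (auto simp: l2_fun_def)
  obtain s where s: "\<And>i. simple_function borel (s i)" "\<And>x. (\<lambda>i. s i x) \<longlonglongrightarrow> f x"
    "\<And>i x. dist (s i x) 0 \<le> 2 * dist (f x) 0"
    using borel_measurable_implies_sequence_metric[of f borel 0] by auto
  show ?thesis
  proof (rule poly_approx_dominated[where h = "\<lambda>t. 2 * cmod (f t)" and g = s])
    show "integrable M (\<lambda>t. (2 * cmod (f t))\<^sup>2)"
      using f by (auto simp: power_mult_distrib)
    show "poly_approx (s n)" for n
    proof -
      have "s n = (\<lambda>t. \<Sum>y\<in>range (s n). y * indicator (s n -` {y}) t)"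
      proof
        fix t
        have "(\<Sum>y\<in>range (s n). y * indicator (s n -` {y}) t) = (\<Sum>y\<in>range (s n). if y = s n t then y else 0)"
          by (intro sum.cong refl) (simp add: indicator_def)
        then show "s n t = (\<Sum>y\<in>range (s n). y * indicator (s n -` {y}) t)"
          using simple_functionD(1)[OF s(1)[of n]] by (simp add: sum.delta)
      qed
      moreover have "poly_approx (\<lambda>t. \<Sum>y\<in>range (s n). y * indicator (s n -` {y}) t)"
        using simple_functionD(2)[OF s(1)[of n]] by (intro poly_approx_sum poly_approx_scale poly_approx_indicator) auto
      ultimately show ?thesis by simp
    qed
  qed (use s in \<open>auto\<close>)
qed

end

section \<open>Continuity of the inner product of square-integrable functions\<close>

lemma l2_cauchy_schwarz:
  assumes u: "u \<in> l2_fun M" and v: "v \<in> l2_fun M"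
  shows "cmod (\<integral>x. u x * cnj (v x) \<partial>M) \<le> sqrt (sqnorm M u) * sqrt (sqnorm M v)"
proof -
  have [measurable]: "u \<in> borel_measurable M" "v \<in> borel_measurable M" using u v by auto
  let ?I = "\<integral>x. cmod (u x) * cmod (v x) \<partial>M"
  have int: "integrable M (\<lambda>x. cmod (u x) * cmod (v x))"
    using integrable_norm[OF l2_fun_mult_integrable[OF u v]] by (simp add: norm_mult)
  have "(ennreal ?I)\<^sup>2 = (\<integral>\<^sup>+x. ennreal (cmod (u x)) * ennreal (cmod (v x)) \<partial>M)\<^sup>2"
    using int by (subst nn_integral_eq_integral[symmetric]) (auto simp: ennreal_mult')
  also have "\<dots> \<le> (\<integral>\<^sup>+x. (ennreal (cmod (u x)))\<^sup>2 \<partial>M) * (\<integral>\<^sup>+x. (ennreal (cmod (v x)))\<^sup>2 \<partial>M)"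
    by (rule Cauchy_Schwarz_nn_integral) measurable
  also have "\<dots> = ennreal (sqnorm M u * sqnorm M v)"
    using nn_integral_sqnorm[OF u] nn_integral_sqnorm[OF v] by (simp add: ennreal_power ennreal_mult')
  finally have "?I\<^sup>2 \<le> sqnorm M u * sqnorm M v"
    by (simp add: ennreal_power)
  then have "?I \<le> sqrt (sqnorm M u * sqnorm M v)"
    by (rule real_le_rsqrt)
  moreover have "cmod (\<integral>x. u x * cnj (v x) \<partial>M) \<le> ?I"
    using integral_norm_bound[of M "\<lambda>x. u x * cnj (v x)"] by (simp add: norm_mult)
  ultimately show ?thesis by (simp add: real_sqrt_mult)
qed

lemma l2_inner_tendsto:
  assumes f: "f \<in> l2_fun M" and g: "g \<in> l2_fun M"
    and p: "\<And>n. p n \<in> l2_fun M" and r: "\<And>n. r n \<in> l2_fun M"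
    and fp: "(\<lambda>n. sqnorm M (\<lambda>x. f x - p n x)) \<longlonglongrightarrow> 0"
    and gr: "(\<lambda>n. sqnorm M (\<lambda>x. g x - r n x)) \<longlonglongrightarrow> 0"
  shows "(\<lambda>n. \<integral>x. p n x * cnj (r n x) \<partial>M) \<longlonglongrightarrow> (\<integral>x. f x * cnj (g x) \<partial>M)"
proof (rule LIM_zero_cancel, rule Lim_null_comparison)
  let ?b = "\<lambda>n. sqrt (sqnorm M (\<lambda>x. f x - p n x)) * sqrt (2 * sqnorm M (\<lambda>x. g x - r n x) + 2 * sqnorm M g)
    + sqrt (sqnorm M f) * sqrt (sqnorm M (\<lambda>x. g x - r n x))"
  have "?b \<longlonglongrightarrow> sqrt 0 * sqrt (2 * 0 + 2 * sqnorm M g) + sqrt (sqnorm M f) * sqrt 0"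
    by (intro tendsto_intros fp gr)
  then show "?b \<longlonglongrightarrow> 0" by simp
  have "cmod ((\<integral>x. p n x * cnj (r n x) \<partial>M) - (\<integral>x. f x * cnj (g x) \<partial>M)) \<le> ?b n" for n
  proof -
    have "(\<integral>x. p n x * cnj (r n x) \<partial>M) - (\<integral>x. f x * cnj (g x) \<partial>M)
        = (\<integral>x. p n x * cnj (r n x) - f x * cnj (g x) \<partial>M)"
      by (intro Bochner_Integration.integral_diff[symmetric] l2_fun_mult_integrable f g p r)
    also have "\<dots> = (\<integral>x. - ((f x - p n x) * cnj (r n x)) - f x * cnj (g x - r n x) \<partial>M)"
      by (intro Bochner_Integration.integral_cong) (auto simp: algebra_simps)
    also have "\<dots> = - (\<integral>x. (f x - p n x) * cnj (r n x) \<partial>M) - (\<integral>x. f x * cnj (g x - r n x) \<partial>M)"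
      using l2_fun_mult_integrable[OF l2_fun_diff[OF f p] r] l2_fun_mult_integrable[OF f l2_fun_diff[OF g r]]
      by (subst Bochner_Integration.integral_diff) (simp_all only: integrable_minus integral_minus)
    also have "cmod \<dots> \<le> cmod (\<integral>x. (f x - p n x) * cnj (r n x) \<partial>M) + cmod (\<integral>x. f x * cnj (g x - r n x) \<partial>M)"
      using norm_triangle_ineq4[of "- (\<integral>x. (f x - p n x) * cnj (r n x) \<partial>M)"] by simp
    also have "\<dots> \<le> sqrt (sqnorm M (\<lambda>x. f x - p n x)) * sqrt (sqnorm M (r n))
        + sqrt (sqnorm M f) * sqrt (sqnorm M (\<lambda>x. g x - r n x))"
      by (intro add_mono l2_cauchy_schwarz l2_fun_diff f g p r)
    also have "sqnorm M (r n) \<le> 2 * sqnorm M (\<lambda>x. g x - r n x) + 2 * sqnorm M g"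
      using sqnorm_add_le[OF l2_fun_diff[OF r[of n] g] g] by (simp add: norm_minus_commute)
    finally show ?thesis
      by (simp add: mult_left_mono)
  qed
  then show "eventually (\<lambda>n. norm ((\<integral>x. p n x * cnj (r n x) \<partial>M) - (\<integral>x. f x * cnj (g x) \<partial>M)) \<le> ?b n) sequentially"
    by simp
qed

section \<open>The spectral theorem for a self-adjoint contraction\<close>

locale positive_contraction =
  fixes T :: "'a::complex_hilbert \<Rightarrow> 'a"
  assumes bl: "bounded_linear T" and T_scale: "T (c *\<^sub>C x) = c *\<^sub>C T x"
    and T_sym: "cinner (T x) y = cinner x (T y)"
    and T_pos: "0 \<le> Re (cinner (T x) x)" and T_le: "Re (cinner (T x) x) \<le> (norm x)\<^sup>2"
begin

lemma T_add: "T (x + y) = T x + T y" and T_zero [simp]: "T 0 = 0" and T_diff: "T (x - y) = T x - T y"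
  using bl by (auto simp: bounded_linear.linear linear_add linear_0 linear_diff)

text \<open>Horner's scheme for \<open>p(T) x\<close>. Folding over the coefficients makes the rule
  for \<open>pCons\<close> available, and with it induction on polynomials.\<close>

definition pT :: "complex poly \<Rightarrow> 'a \<Rightarrow> 'a" where
  "pT p x = fold_coeffs (\<lambda>a y. a *\<^sub>C x + T y) p 0"

lemma pT_0 [simp]: "pT 0 x = 0"
  by (simp add: pT_def)

lemma pT_pCons [simp]: "pT (pCons a p) x = a *\<^sub>C x + T (pT p x)"
  by (cases "a = 0 \<and> p = 0") (auto simp: pT_def)

lemma pT_1 [simp]: "pT 1 x = x"
  by (simp add: one_pCons)

lemma pT_add: "pT (p + r) x = pT p x + pT r x"
  by (induction p r rule: poly_induct2) (auto simp: cscale_add_left T_add)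

lemma pT_smult: "pT (smult c p) x = c *\<^sub>C pT p x"
  by (induction p) (auto simp: cscale_add_right cscale_cscale T_scale)

lemma pT_diff: "pT (p - r) x = pT p x - pT r x"
proof -
  have "p - r = p + smult (-1) r" by simp
  then show ?thesis
    by (simp only: pT_add pT_smult cscale_minus_one) simp
qed

lemma pT_mult: "pT (p * r) x = pT p (pT r x)"
  by (induction p) (auto simp: mult_pCons_left pT_add pT_smult)

lemma pT_adj_power:
  assumes "\<And>x y. cinner (pT p x) y = cinner x (pT p y)"
  shows "cinner (pT (p ^ n) x) y = cinner x (pT (p ^ n) y)"
proof (induction n arbitrary: x y)
  case (Suc n)
  have "cinner (pT (p ^ Suc n) x) y = cinner (pT (p ^ n) x) (pT p y)"
    by (simp add: pT_mult assms)
  also have "\<dots> = cinner x (pT (p ^ n * p) y)"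
    by (simp only: Suc pT_mult)
  finally show ?case by (simp add: mult.commute)
qed simp

section \<open>Positivity of the operators \<open>T^i (1 - T)^j\<close> and spectral
  measures\<close>

definition psd :: "complex poly \<Rightarrow> bool" where
  "psd p \<longleftrightarrow> (\<forall>x. cinner (pT p x) x \<in> \<real>\<^sub>\<ge>\<^sub>0)"

abbreviation "pX \<equiv> [:0, 1 :: complex:]"
abbreviation "pY \<equiv> [:1, - 1 :: complex:]"

lemma T_minus: "T (- x) = - T x"
  using bl by (simp add: bounded_linear.linear linear_neg)

lemma pX_adj: "cinner (pT pX x) y = cinner x (pT pX y)"
  by (simp add: T_sym)

lemma pT_pY: "pT pY x = x - T x"
  by (simp add: cscale_minus_one T_minus)

lemma pY_adj: "cinner (pT pY x) y = cinner x (pT pY y)"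
  unfolding pT_pY by (simp add: cinner_diff_left cinner_diff_right T_sym)

lemma nonneg_Reals_cinner_self [simp]: "cinner x x \<in> \<real>\<^sub>\<ge>\<^sub>0"
  by (simp add: cinner_self)

lemma psd_pX: "psd pX"
  unfolding psd_def
proof
  fix x
  have "cinner (T x) x = cnj (cinner (T x) x)"
    using cinner_commute[of "T x" x] by (simp add: T_sym)
  then have "Im (cinner (T x) x) = 0"
    by (metis Reals_cnj_iff complex_is_Real_iff)
  then show "cinner (pT pX x) x \<in> \<real>\<^sub>\<ge>\<^sub>0"
    using T_pos by (simp add: complex_nonneg_Reals_iff)
qed

lemma psd_pY: "psd pY"
  unfolding psd_def
proof
  fix x
  have "Im (cinner (T x) x) = 0"
    using psd_pX by (auto simp: psd_def complex_nonneg_Reals_iff)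
  then show "cinner (pT pY x) x \<in> \<real>\<^sub>\<ge>\<^sub>0"
    unfolding pT_pY using T_le[of x]
    by (simp add: complex_nonneg_Reals_iff cinner_diff_left cinner_self)
qed

lemma psd_conj:
  assumes "psd p" "\<And>x y. cinner (pT r x) y = cinner x (pT r y)"
  shows "psd (r * p * r)"
  using assms by (simp add: psd_def pT_mult)

lemma psd_add: "psd p \<Longrightarrow> psd r \<Longrightarrow> psd (p + r)"
  by (simp add: psd_def pT_add cinner_add_left)

text \<open>A product of commuting positive operators is positive; here no square root is taken, as
  \<open>X + Y = 1\<close> splits \<open>XY\<close> into the conjugates \<open>YXY\<close> and
  \<open>XYX\<close> of positive elements.\<close>

lemma psd_pX_pY: "psd (pX * pY)"
proof -
  have eq: "pX * pY = pY * pX * pY + pX * pY * pX"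
  proof -
    have "pX * pY = pX * pY * (pY + pX)" by (simp add: one_pCons)
    also have "\<dots> = pY * pX * pY + pX * pY * pX" by (simp only: distrib_left mult_ac)
    finally show ?thesis .
  qed
  show ?thesis
    by (subst eq) (intro psd_add psd_conj[OF psd_pX pY_adj] psd_conj[OF psd_pY pX_adj])
qed

text \<open>Half of each exponent is moved into a symmetric factor \<open>R\<close> on both sides.
  Conjugation by \<open>R\<close> preserves positivity, so only the parities matter, that is
  \<open>1\<close>, \<open>X\<close>, \<open>Y\<close> and \<open>XY\<close>.\<close>

lemma psd_bernstein: "psd (pX ^ i * pY ^ j)"
proof -
  define R where "R = pX ^ (i div 2) * pY ^ (j div 2)"
  have R: "cinner (pT R x) y = cinner x (pT R y)" for x y
  proof -
    have "cinner (pT R x) y = cinner x (pT (pY ^ (j div 2) * pX ^ (i div 2)) y)"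
      by (simp only: R_def pT_mult pT_adj_power[OF pX_adj] pT_adj_power[OF pY_adj])
    then show ?thesis by (simp only: R_def mult.commute)
  qed
  have "psd (pX ^ (i mod 2) * pY ^ (j mod 2))"
    using psd_pX psd_pY psd_pX_pY by (cases "even i"; cases "even j") (auto simp: odd_iff_mod_2_eq_one even_iff_mod_2_eq_zero psd_def)
  from psd_conj[OF this R] have "psd (R * (pX ^ (i mod 2) * pY ^ (j mod 2)) * R)" .
  also have "R * (pX ^ (i mod 2) * pY ^ (j mod 2)) * R
      = pX ^ (i div 2 + i div 2 + i mod 2) * pY ^ (j div 2 + j div 2 + j mod 2)"
    unfolding R_def power_add by (simp only: mult_ac)
  also have "i div 2 + i div 2 + i mod 2 = i" by presburger
  also have "j div 2 + j div 2 + j mod 2 = j" by presburger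
  finally show ?thesis .
qed

text \<open>The functional \<open>p \<mapsto> cinner (pT p x) x\<close> satisfies Hausdorff's
  positivity by \<open>psd_bernstein\<close>, and the unit length of \<open>x\<close> normalizes its
  value at \<open>1\<close>.\<close>

lemma ex_spectral_measure:
  assumes "norm x = 1"
  shows "\<exists>M. unit_interval_measure M \<and> (\<forall>p. cinner (pT p x) x = (\<integral>t. poly_fun p t \<partial>M))"
proof -
  obtain M where "real_distribution M" "AE t in M. 0 \<le> t \<and> t \<le> 1"
    "\<And>p. cinner (pT p x) x = (\<integral>t. poly_fun p t \<partial>M)"
  proof (rule hausdorff_moment[of "\<lambda>p. cinner (pT p x) x"])
    show "\<exists>w\<ge>0. cinner (pT (pX ^ i * pY ^ j) x) x = complex_of_real w" for i j
      using psd_bernstein[of i j] unfolding psd_def by (metis nonneg_Reals_cases)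
  qed (auto simp: pT_add pT_smult cinner_add_left cinner_cscale_left cinner_self assms)
  then show ?thesis
    by (auto simp: unit_interval_measure_def unit_interval_measure_axioms_def)
qed

definition sm :: "'a \<Rightarrow> real measure" where
  "sm x = (SOME M. unit_interval_measure M \<and> (\<forall>p. cinner (pT p x) x = (\<integral>t. poly_fun p t \<partial>M)))"

lemma sm:
  assumes "norm x = 1"
  shows "unit_interval_measure (sm x)" "cinner (pT p x) x = (\<integral>t. poly_fun p t \<partial>sm x)"
proof -
  have "unit_interval_measure (sm x) \<and> (\<forall>p. cinner (pT p x) x = (\<integral>t. poly_fun p t \<partial>sm x))"
    unfolding sm_def by (rule someI_ex[OF ex_spectral_measure[OF assms]])
  then show "unit_interval_measure (sm x)" "cinner (pT p x) x = (\<integral>t. poly_fun p t \<partial>sm x)"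
    by blast+
qed

context
  fixes x :: 'a assumes x: "norm x = 1"
begin

interpretation unit_interval_measure "sm x"
  using x by (rule sm)

text \<open>Symmetry moves each power of \<open>T\<close> from the right argument to the left, and
  on functions this corresponds to \<open>t\<close> being real. The map from polynomials to vectors
  is thus an isometry for the L2 norm.\<close>

lemma cinner_pT: "cinner (pT p x) (pT r x) = (\<integral>t. poly_fun p t * cnj (poly_fun r t) \<partial>sm x)"
proof (induction r arbitrary: p)
  case (pCons a r)
  have "cinner (pT p x) (pT (pCons a r) x) = cnj a * cinner (pT p x) x + cinner (pT (pCons 0 p) x) (pT r x)"
    by (simp add: cinner_add_right cinner_cscale_right T_sym)
  also have "\<dots> = (\<integral>t. cnj a * poly_fun p t \<partial>sm x) + (\<integral>t. poly_fun (pCons 0 p) t * cnj (poly_fun r t) \<partial>sm x)"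
    by (simp only: pCons.IH sm(2)[OF x] integral_mult_right_zero)
  also have "\<dots> = (\<integral>t. cnj a * poly_fun p t + poly_fun (pCons 0 p) t * cnj (poly_fun r t) \<partial>sm x)"
    using l2_fun_mult_integrable[OF poly_fun_l2[of p] poly_fun_l2[of 1]]
      l2_fun_mult_integrable[OF poly_fun_l2[of "pCons 0 p"] poly_fun_l2[of r]]
    by (intro Bochner_Integration.integral_add[symmetric]) auto
  also have "\<dots> = (\<integral>t. poly_fun p t * cnj (poly_fun (pCons a r) t) \<partial>sm x)"
    by (intro Bochner_Integration.integral_cong) (auto simp: algebra_simps)
  finally show ?case .
qed simp

lemma norm_pT: "(norm (pT p x))\<^sup>2 = sqnorm (sm x) (poly_fun p)"
proof -
  have "complex_of_real ((norm (pT p x))\<^sup>2) = (\<integral>t. complex_of_real ((cmod (poly_fun p t))\<^sup>2) \<partial>sm x)"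
    unfolding cinner_self[symmetric] cinner_pT complex_norm_square ..
  then show ?thesis by (simp only: integral_complex_of_real of_real_eq_iff)
qed

end

end

section \<open>Square-integrable functional calculus on a cyclic subspace\<close>

context positive_contraction
begin

text \<open>\<open>cyc x f y\<close> expresses \<open>y = f(T) x\<close> for the square-integrable functional calculus of \<open>T\<close>.\<close>

definition cyc :: "'a \<Rightarrow> (real \<Rightarrow> complex) \<Rightarrow> 'a \<Rightarrow> bool" where
  "cyc x f y \<longleftrightarrow> f \<in> l2_fun (sm x) \<and>
     (\<exists>p. (\<lambda>n. sqnorm (sm x) (\<lambda>t. f t - poly_fun (p n) t)) \<longlonglongrightarrow> 0 \<and> (\<lambda>n. pT (p n) x) \<longlonglongrightarrow> y)"

lemma cyc_l2: "cyc x f y \<Longrightarrow> f \<in> l2_fun (sm x)"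
  by (simp add: cyc_def)

lemma cyc_cinner_eq_0:
  assumes "cyc x f y" "cyc x' g z" "\<And>p r. cinner (pT p x) (pT r x') = 0"
  shows "cinner y z = 0"
proof -
  obtain p r where "(\<lambda>n. pT (p n) x) \<longlonglongrightarrow> y" "(\<lambda>n. pT (r n) x') \<longlonglongrightarrow> z"
    using assms by (auto simp: cyc_def)
  from tendsto_cinner[OF this] show ?thesis
    by (simp add: assms(3) LIMSEQ_const_iff)
qed

context
  fixes x :: 'a assumes x: "norm x = 1"
begin

interpretation unit_interval_measure "sm x"
  using x by (rule sm)

lemma cyc_add:
  assumes "cyc x f y" "cyc x g z"
  shows "cyc x (\<lambda>t. f t + g t) (y + z)"
proof -
  have f: "f \<in> l2_fun (sm x)" and g: "g \<in> l2_fun (sm x)" using assms by (auto dest: cyc_l2)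
  obtain p where p: "(\<lambda>n. sqnorm (sm x) (\<lambda>t. f t - poly_fun (p n) t)) \<longlonglongrightarrow> 0" "(\<lambda>n. pT (p n) x) \<longlonglongrightarrow> y"
    using assms by (auto simp: cyc_def)
  obtain r where r: "(\<lambda>n. sqnorm (sm x) (\<lambda>t. g t - poly_fun (r n) t)) \<longlonglongrightarrow> 0" "(\<lambda>n. pT (r n) x) \<longlonglongrightarrow> z"
    using assms by (auto simp: cyc_def)
  show ?thesis
    unfolding cyc_def
  proof (intro conjI exI[of _ "\<lambda>n. p n + r n"])
    show "(\<lambda>t. f t + g t) \<in> l2_fun (sm x)" by (intro l2_fun_add f g)
    show "(\<lambda>n. pT (p n + r n) x) \<longlonglongrightarrow> y + z"
      unfolding pT_add by (intro tendsto_add p r)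
    show "(\<lambda>n. sqnorm (sm x) (\<lambda>t. f t + g t - poly_fun (p n + r n) t)) \<longlonglongrightarrow> 0"
    proof (rule tendsto_sandwich[OF _ _ tendsto_const])
      let ?b = "\<lambda>n. 2 * sqnorm (sm x) (\<lambda>t. f t - poly_fun (p n) t) + 2 * sqnorm (sm x) (\<lambda>t. g t - poly_fun (r n) t)"
      have "?b \<longlonglongrightarrow> 2 * 0 + 2 * 0" by (intro tendsto_intros p r)
      then show "?b \<longlonglongrightarrow> 0" by simp
      have "sqnorm (sm x) (\<lambda>t. f t + g t - poly_fun (p n + r n) t) \<le> ?b n" for n
        using sqnorm_add_le[OF l2_fun_diff[OF f poly_fun_l2[of "p n"]] l2_fun_diff[OF g poly_fun_l2[of "r n"]]]
        by (simp add: algebra_simps)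
      then show "eventually (\<lambda>n. sqnorm (sm x) (\<lambda>t. f t + g t - poly_fun (p n + r n) t) \<le> ?b n) sequentially"
        by simp
    qed simp
  qed
qed

lemma cyc_scale:
  assumes "cyc x f y"
  shows "cyc x (\<lambda>t. c * f t) (c *\<^sub>C y)"
proof -
  obtain p where p: "(\<lambda>n. sqnorm (sm x) (\<lambda>t. f t - poly_fun (p n) t)) \<longlonglongrightarrow> 0" "(\<lambda>n. pT (p n) x) \<longlonglongrightarrow> y"
    using assms by (auto simp: cyc_def)
  show ?thesis
    unfolding cyc_def
  proof (intro conjI exI[of _ "\<lambda>n. smult c (p n)"])
    show "(\<lambda>t. c * f t) \<in> l2_fun (sm x)" using assms by (intro l2_fun_scale) (rule cyc_l2)
    show "(\<lambda>n. pT (smult c (p n)) x) \<longlonglongrightarrow> c *\<^sub>C y"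
      unfolding pT_smult by (rule bounded_linear.tendsto[OF bounded_linear_cscale p(2)])
    have "(\<lambda>n. (cmod c)\<^sup>2 * sqnorm (sm x) (\<lambda>t. f t - poly_fun (p n) t)) \<longlonglongrightarrow> (cmod c)\<^sup>2 * 0"
      by (intro tendsto_intros p)
    then show "(\<lambda>n. sqnorm (sm x) (\<lambda>t. c * f t - poly_fun (smult c (p n)) t)) \<longlonglongrightarrow> 0"
      unfolding sqnorm_scale[symmetric] by (simp add: right_diff_distrib)
  qed
qed

lemma cyc_diff:
  assumes "cyc x f y" "cyc x g z"
  shows "cyc x (\<lambda>t. f t - g t) (y - z)"
  using cyc_add[OF assms(1) cyc_scale[OF assms(2), of "-1"]] by (simp add: cscale_minus_one)

text \<open>Multiplying the approximating polynomials by the variable applies \<open>T\<close>, and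
  the L2 error does not grow because \<open>t\<close> lies in \<open>[0, 1]\<close> almost
  everywhere.\<close>

lemma cyc_mult:
  assumes "cyc x f y"
  shows "cyc x (\<lambda>t. complex_of_real t * f t) (T y)"
proof -
  have f: "f \<in> l2_fun (sm x)" using assms by (rule cyc_l2)
  obtain p where p: "(\<lambda>n. sqnorm (sm x) (\<lambda>t. f t - poly_fun (p n) t)) \<longlonglongrightarrow> 0" "(\<lambda>n. pT (p n) x) \<longlonglongrightarrow> y"
    using assms by (auto simp: cyc_def)
  show ?thesis
    unfolding cyc_def
  proof (intro conjI exI[of _ "\<lambda>n. pCons 0 (p n)"])
    show "(\<lambda>t. complex_of_real t * f t) \<in> l2_fun (sm x)" by (intro mult_l2_fun f)
    show "(\<lambda>n. pT (pCons 0 (p n)) x) \<longlonglongrightarrow> T y"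
      using bounded_linear.tendsto[OF bl p(2)] by simp
    show "(\<lambda>n. sqnorm (sm x) (\<lambda>t. complex_of_real t * f t - poly_fun (pCons 0 (p n)) t)) \<longlonglongrightarrow> 0"
    proof (rule tendsto_sandwich[OF _ _ tendsto_const p(1)])
      have "sqnorm (sm x) (\<lambda>t. complex_of_real t * f t - poly_fun (pCons 0 (p n)) t)
          \<le> sqnorm (sm x) (\<lambda>t. f t - poly_fun (p n) t)" for n
      proof (rule integral_mono_AE)
        have d: "(\<lambda>t. f t - poly_fun (p n) t) \<in> l2_fun (sm x)"
          by (intro l2_fun_diff f poly_fun_l2)
        then show "integrable (sm x) (\<lambda>t. (cmod (f t - poly_fun (p n) t))\<^sup>2)" by auto
        show "integrable (sm x) (\<lambda>t. (cmod (complex_of_real t * f t - poly_fun (pCons 0 (p n)) t))\<^sup>2)"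
          using l2_funD(2)[OF mult_l2_fun[OF d]] by (simp add: right_diff_distrib)
        show "AE t in sm x. (cmod (complex_of_real t * f t - poly_fun (pCons 0 (p n)) t))\<^sup>2 \<le> (cmod (f t - poly_fun (p n) t))\<^sup>2"
          using AE_unit
        proof eventually_elim
          case (elim t)
          have "cmod (complex_of_real t * f t - poly_fun (pCons 0 (p n)) t) = t * cmod (f t - poly_fun (p n) t)"
            using elim by (simp add: right_diff_distrib[symmetric] norm_mult)
          also have "\<dots> \<le> 1 * cmod (f t - poly_fun (p n) t)"
            using elim by (intro mult_right_mono) auto
          finally show ?case by (intro power_mono) auto
        qed
      qed
      then show "eventually (\<lambda>n. sqnorm (sm x) (\<lambda>t. complex_of_real t * f t - poly_fun (pCons 0 (p n)) t)
          \<le> sqnorm (sm x) (\<lambda>t. f t - poly_fun (p n) t)) sequentially" by simp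
    qed simp
  qed
qed

lemma cyc_inner:
  assumes "cyc x f y" "cyc x g z"
  shows "cinner y z = (\<integral>t. f t * cnj (g t) \<partial>sm x)"
proof -
  obtain p where p: "(\<lambda>n. sqnorm (sm x) (\<lambda>t. f t - poly_fun (p n) t)) \<longlonglongrightarrow> 0" "(\<lambda>n. pT (p n) x) \<longlonglongrightarrow> y"
    using assms by (auto simp: cyc_def)
  obtain r where r: "(\<lambda>n. sqnorm (sm x) (\<lambda>t. g t - poly_fun (r n) t)) \<longlonglongrightarrow> 0" "(\<lambda>n. pT (r n) x) \<longlonglongrightarrow> z"
    using assms by (auto simp: cyc_def)
  have "(\<lambda>n. cinner (pT (p n) x) (pT (r n) x)) \<longlonglongrightarrow> cinner y z"
    by (intro tendsto_cinner p r)
  moreover have "(\<lambda>n. cinner (pT (p n) x) (pT (r n) x)) \<longlonglongrightarrow> (\<integral>t. f t * cnj (g t) \<partial>sm x)"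
    unfolding cinner_pT[OF x] using assms
    by (intro l2_inner_tendsto p r poly_fun_l2) (auto dest: cyc_l2)
  ultimately show ?thesis by (rule LIMSEQ_unique)
qed

lemma cyc_norm:
  assumes "cyc x f y"
  shows "(norm y)\<^sup>2 = sqnorm (sm x) f"
proof -
  have "complex_of_real ((norm y)\<^sup>2) = (\<integral>t. complex_of_real ((cmod (f t))\<^sup>2) \<partial>sm x)"
    unfolding cinner_self[symmetric] cyc_inner[OF assms assms] complex_norm_square ..
  then show ?thesis by (simp only: integral_complex_of_real of_real_eq_iff)
qed

lemma cyc_pT: "cyc x (poly_fun p) (pT p x)"
  unfolding cyc_def by (auto intro!: exI[of _ "\<lambda>_. p"])

lemma cyc_zero: "cyc x (\<lambda>_. 0) 0"
  using cyc_pT[of 0] by simp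

lemma cyc_unique:
  assumes "cyc x f y" "cyc x g y"
  shows "AE t in sm x. f t = g t"
proof -
  have "cyc x (\<lambda>t. f t - g t) 0" using cyc_diff[OF assms] by simp
  from cyc_norm[OF this] have "sqnorm (sm x) (\<lambda>t. f t - g t) = 0" by simp
  then show ?thesis
    using sqnorm_eq_0_iff[OF l2_fun_diff[OF cyc_l2[OF assms(1)] cyc_l2[OF assms(2)]]] by simp
qed

text \<open>Polynomials approximate \<open>f\<close> in L2, and the isometry turns this L2 Cauchy
  sequence into a Cauchy sequence of vectors.\<close>

lemma cyc_exists:
  assumes f: "f \<in> l2_fun (sm x)"
  shows "\<exists>y. cyc x f y"
proof -
  have "\<exists>p. sqnorm (sm x) (\<lambda>t. f t - poly_fun p t) < 1 / real (Suc n)" for n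
    using poly_approx_ex[OF poly_dense[OF f]] by simp
  then obtain p where p: "\<And>n. sqnorm (sm x) (\<lambda>t. f t - poly_fun (p n) t) < 1 / real (Suc n)" by metis
  have lim: "(\<lambda>n. sqnorm (sm x) (\<lambda>t. f t - poly_fun (p n) t)) \<longlonglongrightarrow> 0"
  proof (rule tendsto_sandwich[OF _ _ tendsto_const])
    show "(\<lambda>n. 1 / real (Suc n)) \<longlonglongrightarrow> 0"
      using LIMSEQ_inverse_real_of_nat by (simp add: inverse_eq_divide)
    show "eventually (\<lambda>n. sqnorm (sm x) (\<lambda>t. f t - poly_fun (p n) t) \<le> 1 / real (Suc n)) sequentially"
      using p by (simp add: less_imp_le)
  qed simp
  have "Cauchy (\<lambda>n. pT (p n) x)"
  proof (rule metric_CauchyI)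
    fix e :: real assume e: "e > 0"
    have "eventually (\<lambda>n. sqnorm (sm x) (\<lambda>t. f t - poly_fun (p n) t) < e\<^sup>2 / 4) sequentially"
      using order_tendstoD(2)[OF lim, of "e\<^sup>2 / 4"] e by simp
    then obtain N where N: "\<And>n. n \<ge> N \<Longrightarrow> sqnorm (sm x) (\<lambda>t. f t - poly_fun (p n) t) < e\<^sup>2 / 4"
      by (auto simp: eventually_sequentially)
    have "dist (pT (p m) x) (pT (p n) x) < e" if "m \<ge> N" "n \<ge> N" for m n
    proof -
      have "(norm (pT (p m) x - pT (p n) x))\<^sup>2 = sqnorm (sm x) (\<lambda>t. poly_fun (p m) t - poly_fun (p n) t)"
        unfolding pT_diff[symmetric] norm_pT[OF x] by simp
      also have "\<dots> \<le> 2 * sqnorm (sm x) (\<lambda>t. poly_fun (p m) t - f t) + 2 * sqnorm (sm x) (\<lambda>t. f t - poly_fun (p n) t)"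
        by (intro sqnorm_diff_le f poly_fun_l2)
      also have "\<dots> < e\<^sup>2"
        using N[OF that(1)] N[OF that(2)] by (simp add: norm_minus_commute)
      finally show ?thesis
        unfolding dist_norm using e by (intro power2_less_imp_less[of _ e]) auto
    qed
    then show "\<exists>N. \<forall>m\<ge>N. \<forall>n\<ge>N. dist (pT (p m) x) (pT (p n) x) < e" by auto
  qed
  then obtain y where "(\<lambda>n. pT (p n) x) \<longlonglongrightarrow> y"
    using Cauchy_convergent_iff convergent_def by blast
  then show ?thesis using f lim by (auto simp: cyc_def)
qed

text \<open>The isometry used backwards: convergence of the vectors makes the polynomials L2 Cauchy,
  and L2 is complete.\<close>

lemma cyc_limit:
  assumes lim: "(\<lambda>n. pT (p n) x) \<longlonglongrightarrow> y"
  shows "\<exists>f. cyc x f y"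
proof -
  have "\<exists>g\<in>l2_fun (sm x). (\<lambda>n. sqnorm (sm x) (\<lambda>t. g t - poly_fun (p n) t)) \<longlonglongrightarrow> 0"
  proof (rule l2_fun_complete)
    show "poly_fun (p n) \<in> l2_fun (sm x)" for n by simp
    fix e :: real assume e: "e > 0"
    have "Cauchy (\<lambda>n. pT (p n) x)" using lim by (rule LIMSEQ_imp_Cauchy)
    then obtain N where N: "\<And>m n. m \<ge> N \<Longrightarrow> n \<ge> N \<Longrightarrow> dist (pT (p m) x) (pT (p n) x) < sqrt e"
      using metric_CauchyD[of _ "sqrt e"] e by (metis real_sqrt_gt_zero)
    have "sqnorm (sm x) (\<lambda>t. poly_fun (p m) t - poly_fun (p n) t) < e" if "m \<ge> N" "n \<ge> N" for m n
    proof -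
      have "sqnorm (sm x) (\<lambda>t. poly_fun (p m) t - poly_fun (p n) t) = (norm (pT (p m) x - pT (p n) x))\<^sup>2"
        unfolding pT_diff[symmetric] norm_pT[OF x] by simp
      also have "\<dots> < (sqrt e)\<^sup>2"
        using N[OF that] by (intro power_strict_mono) (auto simp: dist_norm)
      finally show ?thesis using e by simp
    qed
    then show "\<exists>N. \<forall>m\<ge>N. \<forall>n\<ge>N. sqnorm (sm x) (\<lambda>t. poly_fun (p m) t - poly_fun (p n) t) < e" by auto
  qed
  then show ?thesis using lim by (auto simp: cyc_def)
qed

text \<open>A limit of such vectors is again a limit of vectors \<open>pT p x\<close>, choosing one
  polynomial within \<open>1 / (n + 1)\<close> of the \<open>n\<close>-th vector.\<close>

lemma closed_cyc: "closed {y. \<exists>f. cyc x f y}"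
  unfolding closed_sequential_limits
proof safe
  fix y z assume y: "\<forall>n. y n \<in> {y. \<exists>f. cyc x f y}" and lim: "y \<longlonglongrightarrow> z"
  have "\<exists>p. dist (pT p x) (y n) < 1 / real (Suc n)" for n
  proof -
    obtain p where "(\<lambda>k. pT (p k) x) \<longlonglongrightarrow> y n" using y by (auto simp: cyc_def)
    from tendstoD[OF this, of "1 / real (Suc n)"] show ?thesis
      by (auto simp: eventually_sequentially)
  qed
  then obtain p where p: "\<And>n. dist (pT (p n) x) (y n) < 1 / real (Suc n)" by metis
  have "(\<lambda>n. dist (pT (p n) x) (y n)) \<longlonglongrightarrow> 0"
  proof (rule tendsto_sandwich[OF _ _ tendsto_const])
    show "(\<lambda>n. 1 / real (Suc n)) \<longlonglongrightarrow> 0"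
      using LIMSEQ_inverse_real_of_nat by (simp add: inverse_eq_divide)
    show "eventually (\<lambda>n. dist (pT (p n) x) (y n) \<le> 1 / real (Suc n)) sequentially"
      using p by (simp add: less_imp_le)
  qed simp
  then have "(\<lambda>n. (pT (p n) x - y n) + y n) \<longlonglongrightarrow> 0 + z"
    using lim by (intro tendsto_add) (auto simp: dist_norm tendsto_norm_zero_iff)
  then show "\<exists>f. cyc x f z" by (intro cyc_limit[of p]) simp
qed

text \<open>\<open>y\<close> is the orthogonal projection of \<open>h\<close> onto the cyclic
  subspace of \<open>x\<close>, and \<open>f\<close> is the function on the spectrum representing
  it.\<close>

definition coef :: "'a \<Rightarrow> (real \<Rightarrow> complex) \<Rightarrow> 'a \<Rightarrow> bool" where
  "coef h f y \<longleftrightarrow> cyc x f y \<and> (\<forall>g z. cyc x g z \<longrightarrow> cinner (h - y) z = 0)"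

lemma coef_exists: "\<exists>f y. coef h f y"
proof -
  have "\<exists>y\<in>{y. \<exists>f. cyc x f y}. \<forall>z\<in>{y. \<exists>f. cyc x f y}. cinner (h - y) z = 0"
    using cyc_zero cyc_add cyc_scale by (intro orthogonal_projection_exists closed_cyc) blast+
  then show ?thesis by (auto simp: coef_def)
qed

lemma coef_add:
  assumes "coef h f y" "coef h' f' y'"
  shows "coef (h + h') (\<lambda>t. f t + f' t) (y + y')"
proof -
  have "cinner (h + h' - (y + y')) z = 0" if "cyc x g z" for g z
  proof -
    have "cinner (h + h' - (y + y')) z = cinner (h - y) z + cinner (h' - y') z"
      by (simp add: cinner_add_left cinner_diff_left)
    then show ?thesis using assms that by (auto simp: coef_def)
  qed
  then show ?thesis using assms cyc_add by (auto simp: coef_def)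
qed

lemma coef_scale:
  assumes "coef h f y"
  shows "coef (c *\<^sub>C h) (\<lambda>t. c * f t) (c *\<^sub>C y)"
  using assms cyc_scale by (auto simp: coef_def cscale_diff_right[symmetric] cinner_cscale_left)

text \<open>The cyclic subspace is invariant under the symmetric operator \<open>T\<close>, so the
  projection onto it commutes with \<open>T\<close>.\<close>

lemma coef_mult:
  assumes "coef h f y"
  shows "coef (T h) (\<lambda>t. complex_of_real t * f t) (T y)"
proof -
  have "cinner (T h - T y) z = 0" if "cyc x g z" for g z
  proof -
    have "cinner (T h - T y) z = cinner (h - y) (T z)"
      by (simp add: T_diff[symmetric] T_sym)
    then show ?thesis using assms cyc_mult[OF that] by (auto simp: coef_def)
  qed
  then show ?thesis using assms cyc_mult by (auto simp: coef_def)
qed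

lemma coef_unique:
  assumes "coef h f y" "coef h g z"
  shows "y = z" "AE t in sm x. f t = g t"
proof -
  have d: "cyc x (\<lambda>t. f t - g t) (y - z)"
    using assms cyc_diff by (auto simp: coef_def)
  have "cinner (h - z) (y - z) - cinner (h - y) (y - z) = 0"
    using assms d by (auto simp: coef_def)
  then have "cinner (y - z) (y - z) = 0"
    by (simp add: cinner_diff_left)
  then show "y = z" by (simp add: cinner_self)
  then show "AE t in sm x. f t = g t"
    using assms cyc_unique by (auto simp: coef_def)
qed

end

end

text \<open>
  A decomposition into cyclic subspaces: \<open>K x h\<close> is the component of \<open>h\<close> in the cyclic
  subspace of \<open>x\<close>, as a function on the spectrum.
\<close>

locale spectral_model =
  fixes q :: real and T :: "'a::complex_hilbert \<Rightarrow> 'a" and I :: "'a set"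
    and \<nu> :: "'a \<Rightarrow> real measure" and K :: "'a \<Rightarrow> 'a \<Rightarrow> real \<Rightarrow> complex"
  assumes distribution: "x \<in> I \<Longrightarrow> real_distribution (\<nu> x)"
    and support: "x \<in> I \<Longrightarrow> AE t in \<nu> x. q < t \<and> t \<le> 1"
    and K_l2: "x \<in> I \<Longrightarrow> K x h \<in> l2_fun (\<nu> x)"
    and K_add: "x \<in> I \<Longrightarrow> AE t in \<nu> x. K x (h + h') t = K x h t + K x h' t"
    and K_scale: "x \<in> I \<Longrightarrow> AE t in \<nu> x. K x (c *\<^sub>C h) t = c * K x h t"
    and K_mult: "x \<in> I \<Longrightarrow> AE t in \<nu> x. K x (T h) t = complex_of_real t * K x h t"
    and K_inner: "((\<lambda>x. \<integral>t. K x h t * cnj (K x h' t) \<partial>\<nu> x) has_sum cinner h h') I"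
    and K_surj: "(\<And>x. x \<in> I \<Longrightarrow> f x \<in> l2_fun (\<nu> x)) \<Longrightarrow> (\<lambda>x. sqnorm (\<nu> x) (f x)) summable_on I \<Longrightarrow>
      \<exists>h. \<forall>x\<in>I. AE t in \<nu> x. K x h t = f x t"

section \<open>Support of the spectral measures and decomposition into cyclic subspaces\<close>

context positive_contraction
begin

text \<open>Let \<open>y\<close> be the vector of the indicator of \<open>t \<le> q\<close>. The
  form of \<open>T - q\<close> at \<open>y\<close> is minus the integral of \<open>q - t\<close>
  over \<open>t \<le> q\<close>, hence at most \<open>0\<close>, while the lower bound of the form
  makes it at least \<open>0\<close>. So \<open>T y = q y\<close>, and \<open>y = 0\<close> since
  \<open>q\<close> is not an eigenvalue.\<close>

lemma sm_support:
  assumes x: "norm x = 1" and ge: "\<And>y. q * (norm y)\<^sup>2 \<le> Re (cinner (T y) y)"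
    and ev: "\<And>y. T y = q *\<^sub>R y \<Longrightarrow> y = 0"
  shows "AE t in sm x. q < t \<and> t \<le> 1"
proof -
  interpret unit_interval_measure "sm x"
    using x by (rule sm)
  define f :: "real \<Rightarrow> complex" where "f = indicator {..q}"
  have f: "f \<in> l2_fun (sm x)"
    by (rule l2_fun_bounded[of _ 1]) (auto simp: f_def indicator_def)
  then obtain y where y: "cyc x f y" using cyc_exists[OF x] by blast
  define g where "g t = complex_of_real t * f t - complex_of_real q * f t" for t
  have g: "cyc x g (T y - q *\<^sub>R y)"
    using cyc_diff[OF x cyc_mult[OF x y] cyc_scale[OF x y, of "complex_of_real q"]]
    unfolding g_def by (simp add: cscale_of_real)
  define u where "u t = (q - t) * indicator {..q} t" for t
  have ge0: "u t \<ge> 0" for t by (auto simp: u_def indicator_def)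
  have gu: "g t = - complex_of_real (u t)" "g t * cnj (f t) = - complex_of_real (u t)" for t
    by (auto simp: g_def f_def u_def indicator_def)
  have u_int: "integrable (sm x) u"
  proof -
    have "integrable (sm x) (\<lambda>t. - (g t * cnj (f t)))"
      using l2_fun_mult_integrable[OF cyc_l2[OF g] f] by (rule integrable_minus)
    then have "integrable (sm x) (\<lambda>t. complex_of_real (u t))" by (simp only: gu(2) minus_minus)
    then show ?thesis by (simp add: complex_of_real_integrable_eq)
  qed
  have "0 \<le> Re (cinner (T y - q *\<^sub>R y) y)"
    using ge[of y] by (simp add: cinner_diff_left cinner_scaleR_left cinner_self)
  also have "cinner (T y - q *\<^sub>R y) y = - complex_of_real (integral\<^sup>L (sm x) u)"
    unfolding cyc_inner[OF x g y] gu(2) by simp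
  finally have "integral\<^sup>L (sm x) u \<le> 0" by simp
  moreover have "0 \<le> integral\<^sup>L (sm x) u"
    by (intro Bochner_Integration.integral_nonneg ge0)
  ultimately have "integral\<^sup>L (sm x) u = 0" by simp
  then have u0: "AE t in sm x. u t = 0"
    using integral_nonneg_eq_0_iff_AE[OF u_int] ge0 by simp
  then have "AE t in sm x. g t = 0" by (simp add: gu)
  then have "sqnorm (sm x) g = 0"
    using sqnorm_eq_0_iff[OF cyc_l2[OF g]] by simp
  then have "T y - q *\<^sub>R y = 0" using cyc_norm[OF x g] by simp
  then have "y = 0" using ev by simp
  then have "AE t in sm x. f t = 0"
    using cyc_norm[OF x y] sqnorm_eq_0_iff[OF f] by simp
  then show ?thesis
    using AE_unit by eventually_elim (auto simp: f_def indicator_def not_le split: if_splits)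
qed

text \<open>Unit vectors with mutually orthogonal cyclic subspaces; testing the polynomials in one
  argument suffices by symmetry of \<open>T\<close>, as \<open>pT_orthogonal\<close> shows.\<close>

definition indep :: "'a set \<Rightarrow> bool" where
  "indep I \<longleftrightarrow> (\<forall>x\<in>I. norm x = 1) \<and> (\<forall>x\<in>I. \<forall>x'\<in>I. x \<noteq> x' \<longrightarrow> (\<forall>p. cinner (pT p x) x' = 0))"

lemma maximal_indep: "\<exists>I. indep I \<and> (\<forall>J. indep J \<and> I \<subseteq> J \<longrightarrow> J = I)"
proof -
  have "\<Union>C \<in> {I. indep I}" if C: "subset.chain {I. indep I} C" for C
  proof -
    have "norm x = 1" if "x \<in> \<Union>C" for x
      using that C by (auto simp: subset_chain_def indep_def)
    moreover have "cinner (pT p x) x' = 0" if "x \<in> \<Union>C" "x' \<in> \<Union>C" "x \<noteq> x'" for x x' p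
    proof -
      obtain J J' where J: "J \<in> C" "x \<in> J" "J' \<in> C" "x' \<in> J'" using \<open>x \<in> \<Union>C\<close> \<open>x' \<in> \<Union>C\<close> by blast
      then have "J \<subseteq> J' \<or> J' \<subseteq> J" "indep J" "indep J'"
        using C by (auto simp: subset_chain_def)
      then show ?thesis using J \<open>x \<noteq> x'\<close> unfolding indep_def by blast
    qed
    ultimately show ?thesis by (simp add: indep_def)
  qed
  from subset_Zorn'[OF this] show ?thesis by auto
qed

lemma pT_orthogonal:
  assumes "\<And>p. cinner (pT p x) x' = 0"
  shows "cinner (pT p x) (pT r x') = 0"
proof (induction r arbitrary: p)
  case (pCons a r)
  have "cinner (pT p x) (pT (pCons a r) x') = cnj a * cinner (pT p x) x' + cinner (pT (pCons 0 p) x) (pT r x')"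
    by (simp add: cinner_add_right cinner_cscale_right T_sym)
  then show ?case by (simp only: pCons.IH assms mult_zero_right add_0_right)
qed simp

lemma has_sum_only:
  fixes f :: "'i \<Rightarrow> complex"
  assumes "(f has_sum s) I" "x \<in> I" "\<And>y. y \<in> I \<Longrightarrow> y \<noteq> x \<Longrightarrow> f y = 0"
  shows "s = f x"
proof -
  have "(f has_sum (\<Sum>y\<in>{x}. f y)) {x}" by (rule has_sum_finite) simp
  moreover have "(f has_sum f x) {x} \<longleftrightarrow> (f has_sum f x) I"
    by (rule has_sum_cong_neutral) (use assms in auto)
  ultimately have "(f has_sum f x) I" by simp
  then show ?thesis using assms(1) has_sum_unique by blast
qed

text \<open>For a maximal independent set, Bessel's inequality makes the projections onto the cyclic
  subspaces summable. A nonzero remainder would be orthogonal to all of these subspaces, and its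
  normalization could be adjoined, against maximality.\<close>

theorem spectral_theorem:
  assumes ge: "\<And>y. q * (norm y)\<^sup>2 \<le> Re (cinner (T y) y)" and ev: "\<And>y. T y = q *\<^sub>R y \<Longrightarrow> y = 0"
  shows "\<exists>I \<nu> K. spectral_model q T I \<nu> K"
proof -
  obtain I where I: "indep I" and maxI: "\<And>J. indep J \<Longrightarrow> I \<subseteq> J \<Longrightarrow> J = I"
    using maximal_indep by metis
  have unit: "norm x = 1" if "x \<in> I" for x using I that by (simp add: indep_def)
  have orth: "cinner y z = 0" if "x \<in> I" "x' \<in> I" "x \<noteq> x'" "cyc x f y" "cyc x' g z" for x x' f g y z
    using I that by (intro cyc_cinner_eq_0[OF that(4,5)] pT_orthogonal) (auto simp: indep_def)
  define K where "K x h = (SOME f. \<exists>y. coef x h f y)" for x h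
  have "\<exists>y. coef x h (K x h) y" if "x \<in> I" for x h
    unfolding K_def using coef_exists[OF unit[OF that]] by (rule someI_ex)
  then obtain Y where Y: "\<And>x h. x \<in> I \<Longrightarrow> coef x h (K x h) (Y x h)" by metis
  have cycY: "cyc x (K x h) (Y x h)" if "x \<in> I" for x h
    using Y[OF that] coef_def[OF unit[OF that]] by blast
  have Y_orth: "cinner (h - Y x h) z = 0" if "x \<in> I" "cyc x g z" for x h g z
    using Y[OF that(1)] coef_def[OF unit[OF that(1)]] that(2) by blast
  \<comment> \<open>In an inner product with \<open>z\<close> from one cyclic subspace, only the
    summand of the same subspace survives.\<close>
  have only: "cinner h z = cinner (y x) z"
    if "(y has_sum h) I" "\<And>x. x \<in> I \<Longrightarrow> \<exists>f. cyc x f (y x)" "x \<in> I" "cyc x g z" for h y x g z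
  proof (rule has_sum_only[where x = x and f = "\<lambda>x. cinner (y x) z"])
    show "((\<lambda>x. cinner (y x) z) has_sum cinner h z) I"
      using has_sum_bounded_linear[OF bounded_linear_cinner_left that(1)] by (simp add: o_def)
    show "cinner (y x') z = 0" if "x' \<in> I" "x' \<noteq> x" for x'
      using orth \<open>x \<in> I\<close> \<open>cyc x g z\<close> that \<open>\<And>x. x \<in> I \<Longrightarrow> \<exists>f. cyc x f (y x)\<close> by metis
  qed fact
  have bessel: "(\<Sum>x\<in>F. (norm (Y x h))\<^sup>2) \<le> (norm h)\<^sup>2" if F: "finite F" "F \<subseteq> I" for F h
  proof -
    define s where "s = (\<Sum>x\<in>F. Y x h)"
    have "cinner (h - s) (Y x h) = 0" if "x \<in> F" for x
    proof -
      have "cinner s (Y x h) = (\<Sum>x'\<in>F. cinner (Y x' h) (Y x h))"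
        by (simp add: s_def cinner_sum_left)
      also have "\<dots> = (\<Sum>x'\<in>F. if x' = x then cinner (Y x h) (Y x h) else 0)"
      proof (intro sum.cong refl)
        fix x' assume "x' \<in> F"
        then show "cinner (Y x' h) (Y x h) = (if x' = x then cinner (Y x h) (Y x h) else 0)"
          using orth[OF _ _ _ cycY cycY, of x' x h h] F that by auto
      qed
      also have "\<dots> = cinner (Y x h) (Y x h)"
        using F that by simp
      finally show ?thesis
        using Y_orth[of x "K x h" "Y x h" h] F that cycY by (auto simp: cinner_diff_left)
    qed
    then have "cinner (Y x h) (h - s) = 0" if "x \<in> F" for x
      using that by (metis cinner_commute complex_cnj_zero)
    then have "cinner s (h - s) = 0"
      by (simp add: s_def cinner_sum_left)
    then have "inner s h = inner s s"
      by (simp add: cinner_diff_right inner_eq_Re_cinner)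
    then have "norm s * norm s \<le> norm s * norm h"
      using norm_cauchy_schwarz[of s h] by (simp add: power2_norm_eq_inner[symmetric] power2_eq_square)
    then have "norm s \<le> norm h"
      by (cases "s = 0") auto
    then have "(norm s)\<^sup>2 \<le> (norm h)\<^sup>2" by (intro power_mono) auto
    moreover have "(norm s)\<^sup>2 = (\<Sum>x\<in>F. (norm (Y x h))\<^sup>2)"
      unfolding s_def using F orth cycY by (intro norm_sum_orthogonal) blast+
    ultimately show ?thesis by simp
  qed
  have Y_sum: "((\<lambda>x. Y x h) has_sum h) I" for h
  proof -
    have "(\<lambda>x. (norm (Y x h))\<^sup>2) summable_on I"
      using bessel by (intro nonneg_bounded_partial_sums_imp_summable_on[where C="(norm h)\<^sup>2"])
        (auto simp: eventually_finite_subsets_at_top)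
    then have "(\<lambda>x. Y x h) summable_on I"
      using orth cycY by (intro summable_on_orthogonal) blast+
    then obtain S where S: "((\<lambda>x. Y x h) has_sum S) I" by (auto simp: summable_on_def)
    have perp: "cinner (h - S) z = 0" if "x \<in> I" "cyc x g z" for x g z
    proof -
      have "cinner S z = cinner (Y x h) z"
        using only[OF S _ that] cycY by blast
      then show ?thesis using Y_orth[OF that] by (simp add: cinner_diff_left)
    qed
    have "h - S = 0"
    proof (rule ccontr)
      assume nz: "h - S \<noteq> 0"
      define u where "u = (1 / norm (h - S)) *\<^sub>R (h - S)"
      have u: "norm u = 1" using nz by (simp add: u_def)
      have ux: "cinner (pT p x) u = 0" if "x \<in> I" for x p
        using perp[OF that cyc_pT[OF unit[OF that]], of p] cinner_commute[of "pT p x" "h - S"]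
        by (simp add: u_def cinner_scaleR_right)
      \<comment> \<open>\<open>indep\<close> asks for orthogonality in both orders; exchanging the
        side on which the polynomial acts gives the second one.\<close>
      have xu: "cinner (pT p u) x = 0" if "x \<in> I" for x p
        using pT_orthogonal[of x u 1 p] ux[OF that] cinner_commute[of "pT p u" x] by simp
      have "indep (insert u I)"
        using I u ux xu unfolding indep_def by blast
      then have "u \<in> I" using maxI[of "insert u I"] by blast
      from perp[OF this cyc_pT[OF u, of 1]] have "cinner (h - S) u = 0" by simp
      then have "cinner (h - S) (h - S) = 0"
        using nz by (simp add: u_def cinner_scaleR_right)
      then show False using nz by (simp add: cinner_self)
    qed
    then show ?thesis using S by simp
  qed
  have "spectral_model q T I sm K"
  proof (rule spectral_model.intro)
    show "real_distribution (sm x)" if "x \<in> I" for x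
      using sm(1)[OF unit[OF that]] by (simp add: unit_interval_measure_def)
    show "AE t in sm x. q < t \<and> t \<le> 1" if "x \<in> I" for x
      using sm_support[OF unit[OF that] ge ev] .
    show "K x h \<in> l2_fun (sm x)" if "x \<in> I" for x h
      using cycY[OF that] by (rule cyc_l2)
    show "AE t in sm x. K x (h + h') t = K x h t + K x h' t" if "x \<in> I" for x h h'
      by (rule coef_unique(2)[OF unit[OF that] Y[OF that] coef_add[OF unit[OF that] Y[OF that] Y[OF that]]])
    show "AE t in sm x. K x (c *\<^sub>C h) t = c * K x h t" if "x \<in> I" for x c h
      by (rule coef_unique(2)[OF unit[OF that] Y[OF that] coef_scale[OF unit[OF that] Y[OF that]]])
    show "AE t in sm x. K x (T h) t = complex_of_real t * K x h t" if "x \<in> I" for x h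
      by (rule coef_unique(2)[OF unit[OF that] Y[OF that] coef_mult[OF unit[OF that] Y[OF that]]])
    show "((\<lambda>x. \<integral>t. K x h t * cnj (K x h' t) \<partial>sm x) has_sum cinner h h') I" for h h'
    proof -
      have "cinner (Y x h) h' = (\<integral>t. K x h t * cnj (K x h' t) \<partial>sm x)" if "x \<in> I" for x
      proof -
        have "cinner (h' - Y x h') (Y x h) = 0"
          using Y_orth[OF that cycY[OF that]] .
        then have "cinner (Y x h) (h' - Y x h') = 0"
          by (metis cinner_commute complex_cnj_zero)
        then have "cinner (Y x h) h' = cinner (Y x h) (Y x h')"
          by (simp add: cinner_diff_right)
        then show ?thesis
          using cyc_inner[OF unit[OF that] cycY[OF that] cycY[OF that]] by simp
      qed
      moreover have "((\<lambda>x. cinner (Y x h) h') has_sum cinner h h') I"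
        using has_sum_bounded_linear[OF bounded_linear_cinner_left Y_sum] by (simp add: o_def)
      ultimately show ?thesis by (simp cong: has_sum_cong)
    qed
    show "\<exists>h. \<forall>x\<in>I. AE t in sm x. K x h t = f x t"
      if f: "\<And>x. x \<in> I \<Longrightarrow> f x \<in> l2_fun (sm x)" and sf: "(\<lambda>x. sqnorm (sm x) (f x)) summable_on I" for f
    proof -
      have "\<forall>x\<in>I. \<exists>z. cyc x (f x) z"
        using cyc_exists[OF unit] f by blast
      then obtain z where z: "\<And>x. x \<in> I \<Longrightarrow> cyc x (f x) (z x)" by metis
      have "(\<lambda>x. (norm (z x))\<^sup>2) summable_on I"
        using sf cyc_norm[OF unit z] by (simp cong: summable_on_cong)
      then have "z summable_on I"
        using orth z by (intro summable_on_orthogonal) blast+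
      then obtain h where h: "(z has_sum h) I" by (auto simp: summable_on_def)
      have "AE t in sm x. K x h t = f x t" if x: "x \<in> I" for x
      proof (rule coef_unique(2)[OF unit[OF x] Y[OF x]])
        show "coef x h (f x) (z x)"
          unfolding coef_def[OF unit[OF x]] using z[OF x] only[OF h _ x] z
          by (auto simp: cinner_diff_left)
      qed
      then show ?thesis by blast
    qed
  qed
  then show ?thesis by blast
qed

end

section \<open>The Hilbert space of classes of square-integrable functions\<close>

lemma ae_class_self: "f \<in> borel_measurable M \<Longrightarrow> f \<in> ae_class M f"
  by (simp add: ae_class_def)

lemma ae_class_eq_iff:
  assumes "f \<in> borel_measurable M" "g \<in> borel_measurable M"
  shows "ae_class M f = ae_class M g \<longleftrightarrow> (AE x in M. f x = g x)"
proof
  assume "ae_class M f = ae_class M g"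
  then show "AE x in M. f x = g x"
    using ae_class_self[OF assms(1)] by (auto simp: ae_class_def)
next
  assume eq: "AE x in M. f x = g x"
  have "(AE x in M. h x = f x) \<longleftrightarrow> (AE x in M. h x = g x)" for h
    using eq by (auto elim!: AE_mp)
  then show "ae_class M f = ae_class M g"
    by (auto simp: ae_class_def)
qed

lemma ae_rep_class:
  assumes "f \<in> borel_measurable M"
  shows "ae_rep (ae_class M f) \<in> borel_measurable M" "AE x in M. ae_rep (ae_class M f) x = f x"
proof -
  have "ae_rep (ae_class M f) \<in> ae_class M f"
    unfolding ae_rep_def using ae_class_self[OF assms] by (rule someI[of "\<lambda>g. g \<in> ae_class M f"])
  then show "ae_rep (ae_class M f) \<in> borel_measurable M" "AE x in M. ae_rep (ae_class M f) x = f x"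
    by (auto simp: ae_class_def)
qed

lemma l2_fun_AE_cong:
  assumes "f \<in> l2_fun M" "g \<in> borel_measurable M" "AE x in M. f x = g x"
  shows "g \<in> l2_fun M"
proof (rule l2_fun_bound[OF assms(2) l2_funD(2)[OF assms(1)]])
  show "AE x in M. (cmod (g x))\<^sup>2 \<le> (cmod (f x))\<^sup>2"
    using assms(3) by eventually_elim simp
qed

lemma l2_space_carrier: "hcarrier (l2_space M) = ae_class M ` l2_fun M"
  by (simp add: l2_space_def)

lemma l2_class_carrier: "f \<in> l2_fun M \<Longrightarrow> ae_class M f \<in> hcarrier (l2_space M)"
  by (simp add: l2_space_carrier)

lemma l2_rep:
  assumes "X \<in> hcarrier (l2_space M)"
  shows "ae_rep X \<in> l2_fun M" "ae_class M (ae_rep X) = X"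
proof -
  obtain f where f: "f \<in> l2_fun M" and X: "X = ae_class M f"
    using assms by (auto simp: l2_space_carrier)
  have fm: "f \<in> borel_measurable M" using f by auto
  show "ae_rep X \<in> l2_fun M"
    unfolding X using ae_rep_class[OF fm] by (intro l2_fun_AE_cong[OF f]) auto
  show "ae_class M (ae_rep X) = X"
    unfolding X using ae_rep_class[OF fm] fm by (subst ae_class_eq_iff) auto
qed

lemma l2_space_eq_iff:
  assumes "X \<in> hcarrier (l2_space M)" "Y \<in> hcarrier (l2_space M)"
  shows "X = Y \<longleftrightarrow> (AE x in M. ae_rep X x = ae_rep Y x)"
  using ae_class_eq_iff[of "ae_rep X" M "ae_rep Y"] l2_rep[OF assms(1)] l2_rep[OF assms(2)]
  by (auto simp: l2_fun_def)

lemma l2_space_rep_add: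
  assumes "X \<in> hcarrier (l2_space M)" "Y \<in> hcarrier (l2_space M)"
  shows "hadd (l2_space M) X Y \<in> hcarrier (l2_space M)"
    "AE x in M. ae_rep (hadd (l2_space M) X Y) x = ae_rep X x + ae_rep Y x"
proof -
  have l2: "(\<lambda>x. ae_rep X x + ae_rep Y x) \<in> l2_fun M"
    by (intro l2_fun_add l2_rep assms)
  then show "hadd (l2_space M) X Y \<in> hcarrier (l2_space M)"
    by (simp add: l2_space_def)
  show "AE x in M. ae_rep (hadd (l2_space M) X Y) x = ae_rep X x + ae_rep Y x"
    using ae_rep_class(2)[OF l2_funD(1)[OF l2]] by (simp add: l2_space_def)
qed

lemma l2_space_rep_scale:
  assumes "X \<in> hcarrier (l2_space M)"
  shows "hscale (l2_space M) c X \<in> hcarrier (l2_space M)"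
    "AE x in M. ae_rep (hscale (l2_space M) c X) x = c * ae_rep X x"
proof -
  have l2: "(\<lambda>x. c * ae_rep X x) \<in> l2_fun M"
    by (intro l2_fun_scale l2_rep assms)
  then show "hscale (l2_space M) c X \<in> hcarrier (l2_space M)"
    by (simp add: l2_space_def)
  show "AE x in M. ae_rep (hscale (l2_space M) c X) x = c * ae_rep X x"
    using ae_rep_class(2)[OF l2_funD(1)[OF l2]] by (simp add: l2_space_def)
qed

lemma l2_space_hinner: "hinner (l2_space M) X Y = (\<integral>x. ae_rep X x * cnj (ae_rep Y x) \<partial>M)"
  by (simp add: l2_space_def)

lemma l2_space_hinner_class:
  assumes "f \<in> l2_fun M" "g \<in> l2_fun M"
  shows "hinner (l2_space M) (ae_class M f) (ae_class M g) = (\<integral>x. f x * cnj (g x) \<partial>M)"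
  unfolding l2_space_hinner
proof (rule integral_cong_AE)
  have f: "f \<in> borel_measurable M" and g: "g \<in> borel_measurable M" using assms by auto
  note [measurable] = f g ae_rep_class(1)[OF f] ae_rep_class(1)[OF g]
  show "(\<lambda>x. ae_rep (ae_class M f) x * cnj (ae_rep (ae_class M g) x)) \<in> borel_measurable M"
    "(\<lambda>x. f x * cnj (g x)) \<in> borel_measurable M" by measurable
  show "AE x in M. ae_rep (ae_class M f) x * cnj (ae_rep (ae_class M g) x) = f x * cnj (g x)"
    using ae_rep_class(2)[OF f] ae_rep_class(2)[OF g] by eventually_elim simp
qed

text \<open>The explicit factors \<open>1\<close> and \<open>-1\<close> make all four terms
  instances of \<open>f + c * g\<close>, so a statement about norms transfers to inner products
  uniformly in \<open>c\<close>.\<close>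

lemma l2_polarization:
  assumes "f \<in> l2_fun M" "g \<in> l2_fun M"
  shows "(\<integral>x. f x * cnj (g x) \<partial>M) =
    (1 * of_real (sqnorm M (\<lambda>x. f x + 1 * g x)) + (-1) * of_real (sqnorm M (\<lambda>x. f x + (-1) * g x))
     + \<i> * of_real (sqnorm M (\<lambda>x. f x + \<i> * g x)) + (-\<i>) * of_real (sqnorm M (\<lambda>x. f x + (-\<i>) * g x))) / 4"
proof -
  let ?s = "\<lambda>c x. complex_of_real ((cmod (f x + c * g x))\<^sup>2)"
  have int: "integrable M (\<lambda>x. d * ?s c x)" for c d
    using l2_funD(2)[OF l2_fun_add[OF assms(1) l2_fun_scale[OF assms(2), of c]]]
    by (intro integrable_mult_right) (simp only: complex_of_real_integrable_eq)
  have "f x * cnj (g x) = (1 * ?s 1 x + (-1) * ?s (-1) x + \<i> * ?s \<i> x + (-\<i>) * ?s (-\<i>) x) / 4" for x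
    by (simp only: complex_norm_square) (simp add: algebra_simps)
  then have "(\<integral>x. f x * cnj (g x) \<partial>M)
      = (\<integral>x. (1 * ?s 1 x + (-1) * ?s (-1) x + \<i> * ?s \<i> x + (-\<i>) * ?s (-\<i>) x) / 4 \<partial>M)"
    by (rule Bochner_Integration.integral_cong[OF refl])
  also have "\<dots> = (1 * (\<integral>x. ?s 1 x \<partial>M) + (-1) * (\<integral>x. ?s (-1) x \<partial>M)
      + \<i> * (\<integral>x. ?s \<i> x \<partial>M) + (-\<i>) * (\<integral>x. ?s (-\<i>) x \<partial>M)) / 4"
    by (simp only: int integral_divide_zero Bochner_Integration.integral_add
        Bochner_Integration.integrable_add integral_mult_right_zero)
  finally show ?thesis
    unfolding integral_complex_of_real .
qed

section \<open>Measures decomposed along a countable family of maps\<close>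

text \<open>Bridge between integrals over a counting measure, where Tonelli arguments live, and
  unordered sums, in which the Hilbert sums are defined. Enumerating the infinite countable
  \<open>J\<close> reduces it to series.\<close>

lemma nn_integral_count_space_has_sum:
  fixes a :: "'j \<Rightarrow> real"
  assumes J: "countable J" and a: "\<And>j. j \<in> J \<Longrightarrow> a j \<ge> 0"
  shows "(a has_sum S) J \<Longrightarrow> (\<integral>\<^sup>+j. ennreal (a j) \<partial>count_space J) = ennreal S"
    "(\<integral>\<^sup>+j. ennreal (a j) \<partial>count_space J) < \<infinity> \<Longrightarrow> a summable_on J"
proof -
  have "((a has_sum S) J \<longrightarrow> (\<integral>\<^sup>+j. ennreal (a j) \<partial>count_space J) = ennreal S) \<and>
    ((\<integral>\<^sup>+j. ennreal (a j) \<partial>count_space J) < \<infinity> \<longrightarrow> a summable_on J)"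
  proof (cases "finite J")
    case True
    then show ?thesis
      using a has_sum_unique[OF has_sum_finite[OF True, of a]]
      by (auto simp: nn_integral_count_space_finite sum_ennreal)
  next
    case False
    then have bij: "bij_betw (from_nat_into J) UNIV J"
      using J by (rule bij_betw_from_nat_into[rotated])
    define b where "b n = a (from_nat_into J n)" for n
    have b: "b n \<ge> 0" for n
      using a from_nat_into[of J n] False by (auto simp: b_def)
    have nn: "(\<integral>\<^sup>+j. ennreal (a j) \<partial>count_space J) = (\<Sum>n. ennreal (b n))"
      using nn_integral_bij_count_space[OF bij, of "\<lambda>j. ennreal (a j)"]
      by (simp add: b_def nn_integral_count_space_nat)
    have hs: "(a has_sum s) J \<longleftrightarrow> (b has_sum s) UNIV" for s
      using has_sum_reindex_bij_betw[OF bij, of a s] by (simp add: b_def[abs_def])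
    show ?thesis
    proof (intro conjI impI)
      assume "(a has_sum S) J"
      then have "b sums S" using hs has_sum_imp_sums by blast
      then show "(\<integral>\<^sup>+j. ennreal (a j) \<partial>count_space J) = ennreal S"
        unfolding nn using b by (intro suminf_ennreal_eq) auto
    next
      assume "(\<integral>\<^sup>+j. ennreal (a j) \<partial>count_space J) < \<infinity>"
      then have "summable b"
        unfolding nn using b by (intro summable_suminf_not_top) auto
      then have "b summable_on UNIV"
        using b by (simp add: summable_on_UNIV_nonneg_real_iff)
      then show "a summable_on J"
        using hs by (auto simp: summable_on_def)
    qed
  qed
  then show "(a has_sum S) J \<Longrightarrow> (\<integral>\<^sup>+j. ennreal (a j) \<partial>count_space J) = ennreal S"
    "(\<integral>\<^sup>+j. ennreal (a j) \<partial>count_space J) < \<infinity> \<Longrightarrow> a summable_on J" by auto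
qed

text \<open>\<open>M\<close> is the image of counting measure times \<open>\<nu>\<close> under
  \<open>\<Phi>\<close>, expressed by nonnegative integrals. Questions about L2 of \<open>M\<close>
  thereby reduce to the sections \<open>t \<mapsto> f (\<Phi> j t)\<close>.\<close>

locale direct_measure =
  fixes M :: "'p measure" and J :: "'j set" and \<nu> :: "'t measure" and \<Phi> :: "'j \<Rightarrow> 't \<Rightarrow> 'p"
  assumes countable_J: "countable J"
    and measurable_\<Phi> [measurable]: "j \<in> J \<Longrightarrow> \<Phi> j \<in> measurable \<nu> M"
    and nn_integral_M: "g \<in> borel_measurable M \<Longrightarrow>
      (\<integral>\<^sup>+p. (g p :: ennreal) \<partial>M) = (\<integral>\<^sup>+j. (\<integral>\<^sup>+t. g (\<Phi> j t) \<partial>\<nu>) \<partial>count_space J)"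
begin

lemma measurable_section: "f \<in> borel_measurable M \<Longrightarrow> j \<in> J \<Longrightarrow> (\<lambda>t. f (\<Phi> j t)) \<in> borel_measurable \<nu>"
  by (rule measurable_compose[OF measurable_\<Phi>])

text \<open>Almost everywhere equality means that the integral of \<open>cmod (f p - g p)\<close>
  vanishes, and this integral splits over \<open>J\<close>.\<close>

lemma AE_eq_iff:
  fixes f g :: "'p \<Rightarrow> complex"
  assumes [measurable]: "f \<in> borel_measurable M" "g \<in> borel_measurable M"
  shows "(AE p in M. f p = g p) \<longleftrightarrow> (\<forall>j\<in>J. AE t in \<nu>. f (\<Phi> j t) = g (\<Phi> j t))"
proof -
  let ?h = "\<lambda>p. ennreal (cmod (f p - g p))"
  have "(AE p in M. f p = g p) \<longleftrightarrow> (\<integral>\<^sup>+p. ?h p \<partial>M) = 0"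
    by (subst nn_integral_0_iff_AE) (auto simp: ennreal_eq_0_iff)
  also have "\<dots> \<longleftrightarrow> (\<forall>j\<in>J. (\<integral>\<^sup>+t. ?h (\<Phi> j t) \<partial>\<nu>) = 0)"
    by (subst nn_integral_M, simp, subst nn_integral_0_iff_AE) (auto simp: AE_count_space)
  also have "\<dots> \<longleftrightarrow> (\<forall>j\<in>J. AE t in \<nu>. f (\<Phi> j t) = g (\<Phi> j t))"
    by (intro ball_cong refl, subst nn_integral_0_iff_AE) (auto simp: ennreal_eq_0_iff intro: measurable_section)
  finally show ?thesis .
qed

lemma l2_fun_iff:
  assumes f: "f \<in> borel_measurable M"
  shows "f \<in> l2_fun M \<longleftrightarrow> (\<forall>j\<in>J. (\<lambda>t. f (\<Phi> j t)) \<in> l2_fun \<nu>) \<and> (\<lambda>j. sqnorm \<nu> (\<lambda>t. f (\<Phi> j t))) summable_on J"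
    (is "_ \<longleftrightarrow> ?R")
proof -
  let ?n = "\<lambda>j. \<integral>\<^sup>+t. ennreal ((cmod (f (\<Phi> j t)))\<^sup>2) \<partial>\<nu>"
  have fj: "(\<lambda>t. f (\<Phi> j t)) \<in> borel_measurable \<nu>" if "j \<in> J" for j
    using measurable_section[OF f that] .
  have nn: "(\<integral>\<^sup>+p. ennreal ((cmod (f p))\<^sup>2) \<partial>M) = (\<integral>\<^sup>+j. ?n j \<partial>count_space J)"
    using f by (intro nn_integral_M) auto
  have eq: "(\<integral>\<^sup>+j. ?n j \<partial>count_space J) = (\<integral>\<^sup>+j. ennreal (sqnorm \<nu> (\<lambda>t. f (\<Phi> j t))) \<partial>count_space J)"
    if "\<forall>j\<in>J. (\<lambda>t. f (\<Phi> j t)) \<in> l2_fun \<nu>"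
    using that by (intro nn_integral_cong) (auto intro: nn_integral_sqnorm)
  show ?thesis
  proof
    assume "f \<in> l2_fun M"
    then have fin: "(\<integral>\<^sup>+j. ?n j \<partial>count_space J) < \<infinity>"
      by (simp add: l2_fun_iff_nn_integral nn)
    then have "AE j in count_space J. ?n j \<noteq> \<infinity>"
      by (intro nn_integral_PInf_AE) auto
    then have l2: "\<forall>j\<in>J. (\<lambda>t. f (\<Phi> j t)) \<in> l2_fun \<nu>"
      using fj by (auto simp: AE_count_space l2_fun_iff_nn_integral top.not_eq_extremum)
    moreover have "(\<lambda>j. sqnorm \<nu> (\<lambda>t. f (\<Phi> j t))) summable_on J"
      using fin unfolding eq[OF l2] by (intro nn_integral_count_space_has_sum(2)[OF countable_J]) auto
    ultimately show ?R by simp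
  next
    assume R: ?R
    then obtain S where "((\<lambda>j. sqnorm \<nu> (\<lambda>t. f (\<Phi> j t))) has_sum S) J" by (auto simp: summable_on_def)
    from nn_integral_count_space_has_sum(1)[OF countable_J _ this]
    have "(\<integral>\<^sup>+j. ?n j \<partial>count_space J) = ennreal S" using eq R by simp
    then show "f \<in> l2_fun M" using f by (simp add: l2_fun_iff_nn_integral nn)
  qed
qed

lemma sqnorm_has_sum:
  assumes f: "f \<in> l2_fun M"
  shows "((\<lambda>j. sqnorm \<nu> (\<lambda>t. f (\<Phi> j t))) has_sum sqnorm M f) J"
proof -
  have R: "\<forall>j\<in>J. (\<lambda>t. f (\<Phi> j t)) \<in> l2_fun \<nu>" "(\<lambda>j. sqnorm \<nu> (\<lambda>t. f (\<Phi> j t))) summable_on J"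
    using f l2_fun_iff[OF l2_funD(1)[OF f]] by auto
  then obtain S where S: "((\<lambda>j. sqnorm \<nu> (\<lambda>t. f (\<Phi> j t))) has_sum S) J" by (auto simp: summable_on_def)
  have "ennreal (sqnorm M f) = (\<integral>\<^sup>+p. ennreal ((cmod (f p))\<^sup>2) \<partial>M)"
    using f by (simp add: nn_integral_sqnorm)
  also have "\<dots> = (\<integral>\<^sup>+j. (\<integral>\<^sup>+t. ennreal ((cmod (f (\<Phi> j t)))\<^sup>2) \<partial>\<nu>) \<partial>count_space J)"
    using f by (intro nn_integral_M) auto
  also have "\<dots> = (\<integral>\<^sup>+j. ennreal (sqnorm \<nu> (\<lambda>t. f (\<Phi> j t))) \<partial>count_space J)"
    using R by (intro nn_integral_cong) (auto intro: nn_integral_sqnorm)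
  also have "\<dots> = ennreal S"
    by (intro nn_integral_count_space_has_sum(1)[OF countable_J] S) auto
  finally have "sqnorm M f = S"
    using has_sum_nonneg[OF S] by (subst (asm) ennreal_inj) auto
  then show ?thesis using S by simp
qed

text \<open>Polarization derives this from \<open>sqnorm_has_sum\<close>, so convergence of the sum
  of inner products needs no separate estimate.\<close>

lemma inner_has_sum:
  assumes f: "f \<in> l2_fun M" and g: "g \<in> l2_fun M"
  shows "((\<lambda>j. \<integral>t. f (\<Phi> j t) * cnj (g (\<Phi> j t)) \<partial>\<nu>) has_sum (\<integral>p. f p * cnj (g p) \<partial>M)) J"
proof -
  let ?s = "\<lambda>c j. complex_of_real (sqnorm \<nu> (\<lambda>t. f (\<Phi> j t) + c * g (\<Phi> j t)))"
  let ?S = "\<lambda>c. complex_of_real (sqnorm M (\<lambda>p. f p + c * g p))"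
  have s: "(?s c has_sum ?S c) J" for c
    using sqnorm_has_sum[OF l2_fun_add[OF f l2_fun_scale[OF g, of c]]] by (rule has_sum_of_real)
  have "((\<lambda>j. (1 * ?s 1 j + (-1) * ?s (-1) j + \<i> * ?s \<i> j + (-\<i>) * ?s (-\<i>) j) / 4) has_sum
     ((1 * ?S 1 + (-1) * ?S (-1) + \<i> * ?S \<i> + (-\<i>) * ?S (-\<i>)) / 4)) J"
    unfolding divide_inverse by (intro has_sum_cmult_left has_sum_add has_sum_cmult_right s)
  moreover have "(\<integral>t. f (\<Phi> j t) * cnj (g (\<Phi> j t)) \<partial>\<nu>)
      = (1 * ?s 1 j + (-1) * ?s (-1) j + \<i> * ?s \<i> j + (-\<i>) * ?s (-\<i>) j) / 4"
    if "j \<in> J" for j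
    using that f g l2_fun_iff[OF l2_funD(1)[OF f]] l2_fun_iff[OF l2_funD(1)[OF g]]
    by (intro l2_polarization) auto
  ultimately show ?thesis
    unfolding l2_polarization[OF f g] by (simp only: cong: has_sum_cong)
qed

end

section \<open>Weighted shifts as multiplication operators\<close>

text \<open>Component \<open>j\<close> of the image has weight \<open>w j\<close> and source
  \<open>p j\<close>; \<open>s\<close> sends a source to its target, and \<open>d\<close> is the
  multiplier of the domain. The two-sided comparison of \<open>w (s i)\<close> with
  \<open>d i\<close> identifies this domain with the maximal one. The bound of \<open>w i\<close> by
  \<open>d i\<close> serves the adjoint, which reads component \<open>s i\<close> with weight
  \<open>w (s i)\<close>.\<close>

locale shift_weights =
  fixes J :: "'j set" and w d :: "'j \<Rightarrow> real" and p s :: "'j \<Rightarrow> 'j" and C :: real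
  assumes s_J: "i \<in> J \<Longrightarrow> s i \<in> J" and p_s: "i \<in> J \<Longrightarrow> p (s i) = i"
    and w_zero: "j \<in> J \<Longrightarrow> j \<notin> s ` J \<Longrightarrow> w j = 0"
    and w_s_le: "i \<in> J \<Longrightarrow> \<bar>w (s i)\<bar> \<le> C * \<bar>d i\<bar>"
    and d_le: "i \<in> J \<Longrightarrow> \<bar>d i\<bar> \<le> C * \<bar>w (s i)\<bar>"
    and w_le: "i \<in> J \<Longrightarrow> \<bar>w i\<bar> \<le> C * \<bar>d i\<bar>"
begin

lemma inj_s: "inj_on s J"
  by (rule inj_on_inverseI[of _ p]) (rule p_s)

lemma p_J: "j \<in> J \<Longrightarrow> w j \<noteq> 0 \<Longrightarrow> p j \<in> J"
  using w_zero p_s by fastforce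

lemma has_sum_shift:
  assumes "\<And>j. j \<in> J \<Longrightarrow> j \<notin> s ` J \<Longrightarrow> f j = 0"
  shows "(f has_sum S) J \<longleftrightarrow> ((\<lambda>i. f (s i)) has_sum S) J"
proof -
  have "(f has_sum S) J \<longleftrightarrow> (f has_sum S) (s ` J)"
    using assms s_J by (intro has_sum_cong_neutral) auto
  also have "\<dots> \<longleftrightarrow> ((\<lambda>i. f (s i)) has_sum S) J"
    using has_sum_reindex[OF inj_s, of f S] by (simp add: o_def)
  finally show ?thesis .
qed

lemma summable_on_shift:
  assumes "\<And>j. j \<in> J \<Longrightarrow> j \<notin> s ` J \<Longrightarrow> f j = 0"
  shows "f summable_on J \<longleftrightarrow> (\<lambda>i. f (s i)) summable_on J"
  using has_sum_shift[OF assms] by (simp add: summable_on_def)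

end

text \<open>\<open>Fs\<close> is the formal adjoint of the weighted shift \<open>F\<close>, and \<open>d\<close> is the multiplier defining the domain of \<open>F\<close>.\<close>

locale shift_operator = direct_measure M J \<nu> \<Phi> + shift_weights J w d p s C
  for M :: "'p measure" and J :: "'j set" and \<nu> :: "real measure" and \<Phi> w d p s C +
  fixes q :: real and D :: "('p \<Rightarrow> complex) set" and F Fs :: "('p \<Rightarrow> complex) \<Rightarrow> 'p \<Rightarrow> complex"
  assumes q_pos: "0 < q" and support: "AE t in \<nu>. q < t \<and> t \<le> 1"
    and F_measurable: "h \<in> borel_measurable M \<Longrightarrow> F h \<in> borel_measurable M"
    and Fs_measurable: "h \<in> borel_measurable M \<Longrightarrow> Fs h \<in> borel_measurable M"
    and F_section: "j \<in> J \<Longrightarrow> AE t in \<nu>. F h (\<Phi> j t) = complex_of_real (w j * t) * h (\<Phi> (p j) t)"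
    and Fs_section: "i \<in> J \<Longrightarrow> AE t in \<nu>. Fs h (\<Phi> i t) = complex_of_real (w (s i) * t) * h (\<Phi> (s i) t)"
    and D_iff: "h \<in> D \<longleftrightarrow> h \<in> l2_fun M \<and> (\<lambda>j. (d j)\<^sup>2 * sqnorm \<nu> (\<lambda>t. h (\<Phi> j t))) summable_on J"
begin

text \<open>On \<open>(q, 1]\<close> multiplication by \<open>t\<close> changes a norm by a factor
  between \<open>q\<close> and \<open>1\<close>, so domains are decided by the weights
  alone.\<close>

lemma multiplication_bounds:
  assumes f: "f \<in> borel_measurable \<nu>" and g: "g \<in> l2_fun \<nu>"
    and eq: "AE t in \<nu>. f t = complex_of_real (c * t) * g t"
  shows "f \<in> l2_fun \<nu>" "sqnorm \<nu> f \<le> c\<^sup>2 * sqnorm \<nu> g" "q\<^sup>2 * (c\<^sup>2 * sqnorm \<nu> g) \<le> sqnorm \<nu> f"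
proof -
  have le: "AE t in \<nu>. (cmod (f t))\<^sup>2 \<le> c\<^sup>2 * (cmod (g t))\<^sup>2"
    using eq support
  proof eventually_elim
    case (elim t)
    have "(cmod (f t))\<^sup>2 = (c\<^sup>2 * (cmod (g t))\<^sup>2) * t\<^sup>2"
      using elim by (simp add: norm_mult power_mult_distrib)
    also have "\<dots> \<le> (c\<^sup>2 * (cmod (g t))\<^sup>2) * 1"
      using elim q_pos by (intro mult_left_mono power_le_one) auto
    finally show ?case by simp
  qed
  have ge: "AE t in \<nu>. q\<^sup>2 * (c\<^sup>2 * (cmod (g t))\<^sup>2) \<le> (cmod (f t))\<^sup>2"
    using eq support
  proof eventually_elim
    case (elim t)
    have "q\<^sup>2 * (c\<^sup>2 * (cmod (g t))\<^sup>2) \<le> t\<^sup>2 * (c\<^sup>2 * (cmod (g t))\<^sup>2)"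
      using elim q_pos by (intro mult_right_mono power_mono) auto
    also have "\<dots> = (cmod (f t))\<^sup>2"
      using elim by (simp add: norm_mult power_mult_distrib)
    finally show ?case .
  qed
  have gi: "integrable \<nu> (\<lambda>t. (cmod (g t))\<^sup>2)" using g by auto
  show fl2: "f \<in> l2_fun \<nu>"
    using gi by (intro l2_fun_bound[OF f _ le]) auto
  have "sqnorm \<nu> f \<le> (\<integral>t. c\<^sup>2 * (cmod (g t))\<^sup>2 \<partial>\<nu>)"
    using fl2 gi le by (intro integral_mono_AE) auto
  then show "sqnorm \<nu> f \<le> c\<^sup>2 * sqnorm \<nu> g" by simp
  have "(\<integral>t. q\<^sup>2 * (c\<^sup>2 * (cmod (g t))\<^sup>2) \<partial>\<nu>) \<le> sqnorm \<nu> f"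
    using fl2 gi ge by (intro integral_mono_AE) auto
  then show "q\<^sup>2 * (c\<^sup>2 * sqnorm \<nu> g) \<le> sqnorm \<nu> f" by simp
qed

lemma F_section_zero: "j \<in> J \<Longrightarrow> j \<notin> s ` J \<Longrightarrow> AE t in \<nu>. F h (\<Phi> j t) = 0"
  using F_section[of j h] w_zero[of j] by simp

lemma F_section_s: "i \<in> J \<Longrightarrow> AE t in \<nu>. F h (\<Phi> (s i) t) = complex_of_real (w (s i) * t) * h (\<Phi> i t)"
  using F_section[OF s_J, of i h] p_s by simp

text \<open>Both conditions are summability of section norms. Up to the factors \<open>C^2\<close>
  and \<open>C^2 / q^2\<close> the sections of \<open>F h\<close> and those of \<open>d\<close>
  times \<open>h\<close> have the same squared norms; components of \<open>F h\<close> without a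
  source are zero.\<close>

lemma F_l2_iff:
  assumes h: "h \<in> l2_fun M"
  shows "F h \<in> l2_fun M \<longleftrightarrow> h \<in> D"
proof -
  have hm: "h \<in> borel_measurable M" using h by auto
  have Fm: "F h \<in> borel_measurable M" using hm by (rule F_measurable)
  have hj: "(\<lambda>t. h (\<Phi> i t)) \<in> l2_fun \<nu>" if "i \<in> J" for i
    using h that l2_fun_iff[OF hm] by auto
  note mb = multiplication_bounds[OF measurable_section[OF Fm s_J] hj F_section_s]
  let ?b = "\<lambda>j. sqnorm \<nu> (\<lambda>t. F h (\<Phi> j t))"
  have sec0: "(\<lambda>t. F h (\<Phi> j t)) \<in> l2_fun \<nu> \<and> ?b j = 0" if "j \<in> J" "j \<notin> s ` J" for j
  proof -
    have "(\<lambda>_. 0) \<in> l2_fun \<nu>" by (simp add: l2_fun_def)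
    then have l2: "(\<lambda>t. F h (\<Phi> j t)) \<in> l2_fun \<nu>"
      using F_section_zero[OF that, of h] measurable_section[OF Fm that(1)]
      by (elim l2_fun_AE_cong) auto
    then show ?thesis using sqnorm_eq_0_iff[OF l2] F_section_zero[OF that, of h] by simp
  qed
  have sec: "(\<lambda>t. F h (\<Phi> j t)) \<in> l2_fun \<nu>" if "j \<in> J" for j
  proof (cases "j \<in> s ` J")
    case True
    then show ?thesis using mb(1) by auto
  qed (use sec0 that in blast)
  have "F h \<in> l2_fun M \<longleftrightarrow> ?b summable_on J"
    using l2_fun_iff[OF Fm] sec by blast
  also have "\<dots> \<longleftrightarrow> (\<lambda>i. ?b (s i)) summable_on J"
    using sec0 by (intro summable_on_shift) blast
  also have "\<dots> \<longleftrightarrow> (\<lambda>i. (d i)\<^sup>2 * sqnorm \<nu> (\<lambda>t. h (\<Phi> i t))) summable_on J"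
  proof
    assume "(\<lambda>i. ?b (s i)) summable_on J"
    then have "(\<lambda>i. (C\<^sup>2 / q\<^sup>2) * ?b (s i)) summable_on J"
      by (rule summable_on_cmult_right)
    then show "(\<lambda>i. (d i)\<^sup>2 * sqnorm \<nu> (\<lambda>t. h (\<Phi> i t))) summable_on J"
    proof (rule summable_on_comparison_test)
      fix i assume i: "i \<in> J"
      have "(d i)\<^sup>2 \<le> C\<^sup>2 * (w (s i))\<^sup>2"
        using power_mono[OF d_le[OF i], of 2] by (simp add: power_mult_distrib)
      then have "(d i)\<^sup>2 * sqnorm \<nu> (\<lambda>t. h (\<Phi> i t)) \<le> (C\<^sup>2 * (w (s i))\<^sup>2) * sqnorm \<nu> (\<lambda>t. h (\<Phi> i t))"
        by (intro mult_right_mono) auto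
      also have "\<dots> = (C\<^sup>2 / q\<^sup>2) * (q\<^sup>2 * ((w (s i))\<^sup>2 * sqnorm \<nu> (\<lambda>t. h (\<Phi> i t))))"
        using q_pos by simp
      also have "\<dots> \<le> (C\<^sup>2 / q\<^sup>2) * ?b (s i)"
        using mb(3)[OF i i i] by (intro mult_left_mono) auto
      finally show "(d i)\<^sup>2 * sqnorm \<nu> (\<lambda>t. h (\<Phi> i t)) \<le> (C\<^sup>2 / q\<^sup>2) * ?b (s i)" .
    qed auto
  next
    assume "(\<lambda>i. (d i)\<^sup>2 * sqnorm \<nu> (\<lambda>t. h (\<Phi> i t))) summable_on J"
    then have "(\<lambda>i. C\<^sup>2 * ((d i)\<^sup>2 * sqnorm \<nu> (\<lambda>t. h (\<Phi> i t)))) summable_on J"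
      by (rule summable_on_cmult_right)
    then show "(\<lambda>i. ?b (s i)) summable_on J"
    proof (rule summable_on_comparison_test)
      fix i assume i: "i \<in> J"
      have "(w (s i))\<^sup>2 \<le> C\<^sup>2 * (d i)\<^sup>2"
        using power_mono[OF w_s_le[OF i], of 2] by (simp add: power_mult_distrib)
      then have "(w (s i))\<^sup>2 * sqnorm \<nu> (\<lambda>t. h (\<Phi> i t)) \<le> (C\<^sup>2 * (d i)\<^sup>2) * sqnorm \<nu> (\<lambda>t. h (\<Phi> i t))"
        by (intro mult_right_mono) auto
      with mb(2)[OF i i i] show "?b (s i) \<le> C\<^sup>2 * ((d i)\<^sup>2 * sqnorm \<nu> (\<lambda>t. h (\<Phi> i t)))"
        by (simp add: mult.assoc)
    qed auto
  qed
  finally show ?thesis using D_iff[of h] h by simp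
qed

text \<open>Section \<open>i\<close> of \<open>Fs h\<close> is bounded by \<open>d (s i)\<close>
  times section \<open>s i\<close> of \<open>h\<close>, and injectivity of \<open>s\<close> turns
  the sum over \<open>i\<close> into part of the sum defining \<open>D\<close>.\<close>

lemma Fs_l2:
  assumes h: "h \<in> D"
  shows "Fs h \<in> l2_fun M"
proof -
  have hl2: "h \<in> l2_fun M" using h D_iff by blast
  then have hm: "h \<in> borel_measurable M" by auto
  have Fm: "Fs h \<in> borel_measurable M" using hm by (rule Fs_measurable)
  have hj: "(\<lambda>t. h (\<Phi> i t)) \<in> l2_fun \<nu>" if "i \<in> J" for i
    using hl2 that l2_fun_iff[OF hm] by auto
  note mb = multiplication_bounds[OF measurable_section[OF Fm] hj[OF s_J] Fs_section]
  let ?a = "\<lambda>j. C\<^sup>2 * ((d j)\<^sup>2 * sqnorm \<nu> (\<lambda>t. h (\<Phi> j t)))"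
  have "?a summable_on J"
    using h D_iff by (intro summable_on_cmult_right) blast
  then have "?a summable_on s ` J"
    by (rule summable_on_subset_banach) (use s_J in auto)
  then have "(\<lambda>i. ?a (s i)) summable_on J"
    using summable_on_reindex[OF inj_s, of ?a] by (simp add: o_def)
  then have "(\<lambda>i. sqnorm \<nu> (\<lambda>t. Fs h (\<Phi> i t))) summable_on J"
  proof (rule summable_on_comparison_test)
    fix i assume i: "i \<in> J"
    have "(w (s i))\<^sup>2 \<le> C\<^sup>2 * (d (s i))\<^sup>2"
      using power_mono[OF w_le[OF s_J[OF i]], of 2] by (simp add: power_mult_distrib)
    then have "(w (s i))\<^sup>2 * sqnorm \<nu> (\<lambda>t. h (\<Phi> (s i) t)) \<le> (C\<^sup>2 * (d (s i))\<^sup>2) * sqnorm \<nu> (\<lambda>t. h (\<Phi> (s i) t))"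
      by (intro mult_right_mono) auto
    with mb(2)[OF i i i] show "sqnorm \<nu> (\<lambda>t. Fs h (\<Phi> i t)) \<le> ?a (s i)"
      by (simp add: mult.assoc)
  qed auto
  then show ?thesis
    using l2_fun_iff[OF Fm] mb(1) by blast
qed

text \<open>The graph becomes a sectionwise relation on all of L2. No domain condition appears,
  because by \<open>F_l2_iff\<close> a square-integrable image already forces membership in
  \<open>D\<close>.\<close>

theorem fun_graph_eq:
  "fun_graph M D F = {(X, Y). X \<in> hcarrier (l2_space M) \<and> Y \<in> hcarrier (l2_space M) \<and>
     (\<forall>j\<in>J. AE t in \<nu>. ae_rep Y (\<Phi> j t) = complex_of_real (w j * t) * ae_rep X (\<Phi> (p j) t))}"
    (is "_ = ?G")
proof (intro set_eqI iffI)
  fix z assume "z \<in> fun_graph M D F"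
  then obtain h where h: "h \<in> D" and z: "z = (ae_class M h, ae_class M (F h))"
    by (auto simp: fun_graph_def)
  have hl2: "h \<in> l2_fun M" using h D_iff by blast
  have Fl2: "F h \<in> l2_fun M" using F_l2_iff[OF hl2] h by blast
  have rep: "AE t in \<nu>. ae_rep (ae_class M f) (\<Phi> j t) = f (\<Phi> j t)" if "f \<in> l2_fun M" "j \<in> J" for f j
  proof -
    have "f \<in> borel_measurable M" using that by auto
    note this ae_rep_class[OF this]
    then show ?thesis using AE_eq_iff[of "ae_rep (ae_class M f)" f] that(2) by blast
  qed
  have "AE t in \<nu>. ae_rep (ae_class M (F h)) (\<Phi> j t) = complex_of_real (w j * t) * ae_rep (ae_class M h) (\<Phi> (p j) t)"
    if j: "j \<in> J" for j
  \<comment> \<open>When the weight is zero, \<open>p j\<close> may lie outside \<open>J\<close>,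
    where nothing is known about sections; the product vanishes anyway.\<close>
  proof (cases "w j = 0")
    case True
    show ?thesis using rep[OF Fl2 j] F_section[OF j, of h] by eventually_elim (simp add: True)
  next
    case False
    show ?thesis
      using rep[OF Fl2 j] F_section[OF j, of h] rep[OF hl2 p_J[OF j False]] by eventually_elim simp
  qed
  then show "z \<in> ?G"
    unfolding z using l2_class_carrier[OF hl2] l2_class_carrier[OF Fl2] by blast
next
  fix z assume "z \<in> ?G"
  then obtain X Y where z: "z = (X, Y)" and X: "X \<in> hcarrier (l2_space M)" and Y: "Y \<in> hcarrier (l2_space M)"
    and eq: "\<And>j. j \<in> J \<Longrightarrow> AE t in \<nu>. ae_rep Y (\<Phi> j t) = complex_of_real (w j * t) * ae_rep X (\<Phi> (p j) t)"
    by blast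
  define h where "h = ae_rep X"
  have hl2: "h \<in> l2_fun M" and Yl2: "ae_rep Y \<in> l2_fun M"
    using l2_rep(1)[OF X] l2_rep(1)[OF Y] by (auto simp: h_def)
  have hm: "h \<in> borel_measurable M" and Ym: "ae_rep Y \<in> borel_measurable M" using hl2 Yl2 by auto
  have Fm: "F h \<in> borel_measurable M" using hm by (rule F_measurable)
  have "AE t in \<nu>. ae_rep Y (\<Phi> j t) = F h (\<Phi> j t)" if "j \<in> J" for j
    using eq[OF that] F_section[OF that, of h] by eventually_elim (simp add: h_def)
  then have AE: "AE x in M. ae_rep Y x = F h x"
    using AE_eq_iff[OF Ym Fm] by blast
  then have "F h \<in> l2_fun M"
    using l2_fun_AE_cong[OF Yl2 Fm] by blast
  then have "h \<in> D" using F_l2_iff[OF hl2] by blast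
  moreover have "ae_class M h = X" using l2_rep(2)[OF X] by (simp add: h_def)
  moreover have "ae_class M (F h) = Y"
    using AE ae_class_eq_iff[OF Ym Fm] l2_rep(2)[OF Y] by simp
  ultimately show "z \<in> fun_graph M D F" by (auto simp: z fun_graph_def)
qed

text \<open>Both inner products are sums over sections. Those of \<open>F u\<close> vanish off the
  image of \<open>s\<close>, and reindexing by \<open>s\<close> matches the rest with the sections
  of \<open>Fs h\<close> term by term.\<close>

theorem fun_graph_adjoint: "fun_graph M D Fs \<subseteq> adjoint_op (l2_space M) (fun_graph M D F)"
proof
  fix z assume "z \<in> fun_graph M D Fs"
  then obtain h where h: "h \<in> D" and z: "z = (ae_class M h, ae_class M (Fs h))"
    by (auto simp: fun_graph_def)
  have hl2: "h \<in> l2_fun M" using h D_iff by blast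
  have Fsl2: "Fs h \<in> l2_fun M" using Fs_l2[OF h] .
  have "hinner (l2_space M) (ae_class M (F u)) (ae_class M h) = hinner (l2_space M) (ae_class M u) (ae_class M (Fs h))"
    if u: "u \<in> D" for u
  proof -
    have ul2: "u \<in> l2_fun M" using u D_iff by blast
    have Fl2: "F u \<in> l2_fun M" using F_l2_iff[OF ul2] u by blast
    let ?\<alpha> = "\<lambda>j. \<integral>t. F u (\<Phi> j t) * cnj (h (\<Phi> j t)) \<partial>\<nu>"
    have meas: "(\<lambda>t. f (\<Phi> j t)) \<in> borel_measurable \<nu>" if "f \<in> l2_fun M" "j \<in> J" for f j
      using measurable_section that by blast
    have "?\<alpha> j = 0" if "j \<in> J" "j \<notin> s ` J" for j
    proof -
      have "?\<alpha> j = (\<integral>t. 0 \<partial>\<nu>)"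
        using F_section_zero[OF that, of u] meas[OF Fl2 that(1)] meas[OF hl2 that(1)]
        by (intro integral_cong_AE) auto
      then show ?thesis by simp
    qed
    then have "((\<lambda>i. ?\<alpha> (s i)) has_sum (\<integral>x. F u x * cnj (h x) \<partial>M)) J"
      using inner_has_sum[OF Fl2 hl2] has_sum_shift[of ?\<alpha>] by blast
    moreover have "?\<alpha> (s i) = (\<integral>t. u (\<Phi> i t) * cnj (Fs h (\<Phi> i t)) \<partial>\<nu>)" if i: "i \<in> J" for i
    proof (rule integral_cong_AE)
      note [measurable] = meas[OF Fl2 s_J[OF i]] meas[OF hl2 s_J[OF i]] meas[OF ul2 i] meas[OF Fsl2 i]
      show "(\<lambda>t. F u (\<Phi> (s i) t) * cnj (h (\<Phi> (s i) t))) \<in> borel_measurable \<nu>"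
        "(\<lambda>t. u (\<Phi> i t) * cnj (Fs h (\<Phi> i t))) \<in> borel_measurable \<nu>" by measurable
      show "AE t in \<nu>. F u (\<Phi> (s i) t) * cnj (h (\<Phi> (s i) t)) = u (\<Phi> i t) * cnj (Fs h (\<Phi> i t))"
        using F_section_s[OF i, of u] Fs_section[OF i, of h] by eventually_elim simp
    qed
    ultimately have "((\<lambda>i. \<integral>t. u (\<Phi> i t) * cnj (Fs h (\<Phi> i t)) \<partial>\<nu>) has_sum (\<integral>x. F u x * cnj (h x) \<partial>M)) J"
      by (simp cong: has_sum_cong)
    then have "(\<integral>x. F u x * cnj (h x) \<partial>M) = (\<integral>x. u x * cnj (Fs h x) \<partial>M)"
      using inner_has_sum[OF ul2 Fsl2] has_sum_unique by blast
    then show ?thesis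
      using l2_space_hinner_class ul2 Fl2 hl2 Fsl2 by metis
  qed
  then show "z \<in> adjoint_op (l2_space M) (fun_graph M D F)"
    unfolding z adjoint_op_def fun_graph_def using l2_class_carrier[OF hl2] l2_class_carrier[OF Fsl2] by auto
qed

end

section \<open>Hilbert sums of copies of one space, and weighted shifts on them\<close>

definition type_sum :: "'j set \<Rightarrow> ('j \<Rightarrow> 'a::complex_hilbert) hspace" where
  "type_sum J = sum_space J (\<lambda>_. type_space)"

definition shift_op :: "'j set \<Rightarrow> ('a::complex_hilbert \<Rightarrow> 'a) \<Rightarrow> ('j \<Rightarrow> real) \<Rightarrow> ('j \<Rightarrow> 'j)
    \<Rightarrow> (('j \<Rightarrow> 'a) \<times> ('j \<Rightarrow> 'a)) set" where
  "shift_op J T w p = {(u, v) \<in> hcarrier (type_sum J) \<times> hcarrier (type_sum J).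
     \<forall>j\<in>J. v j = complex_of_real (w j) *\<^sub>C T (u (p j))}"

lemma type_sum_carrier:
  "u \<in> hcarrier (type_sum J) \<longleftrightarrow> u \<in> extensional J \<and> (\<lambda>j. (norm (u j))\<^sup>2) summable_on J"
  by (auto simp: type_sum_def sum_space_def type_space_def cinner_self PiE_def)

lemma type_sum_simps:
  "hadd (type_sum J) u v = (\<lambda>j\<in>J. u j + v j)" "hscale (type_sum J) c u = (\<lambda>j\<in>J. c *\<^sub>C u j)"
  "hinner (type_sum J) u v = (\<Sum>\<^sub>\<infinity>j\<in>J. cinner (u j) (v j))"
  by (simp_all add: type_sum_def sum_space_def type_space_def)

context spectral_model
begin

lemma K_measurable: "x \<in> I \<Longrightarrow> K x h \<in> borel_measurable (\<nu> x)"
  using K_l2 by auto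

lemma K_norm: "((\<lambda>x. sqnorm (\<nu> x) (K x h)) has_sum (norm h)\<^sup>2) I"
proof -
  have "(\<integral>t. K x h t * cnj (K x h t) \<partial>\<nu> x) = complex_of_real (sqnorm (\<nu> x) (K x h))" for x
    unfolding complex_norm_square[symmetric] integral_complex_of_real ..
  then show ?thesis
    using has_sum_Re[OF K_inner[of h h]] by (simp add: cinner_self)
qed

text \<open>The squared norm of \<open>h - h'\<close> is the sum of the squared L2 norms of its
  components, and all of these vanish.\<close>

lemma K_eqI:
  assumes "\<And>x. x \<in> I \<Longrightarrow> AE t in \<nu> x. K x h t = K x h' t"
  shows "h = h'"
proof -
  have "sqnorm (\<nu> x) (K x (h + (-1) *\<^sub>C h')) = 0" if x: "x \<in> I" for x
  proof -
    have "AE t in \<nu> x. K x (h + (-1) *\<^sub>C h') t = 0"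
      using K_add[OF x, of h "(-1) *\<^sub>C h'"] K_scale[OF x, of "-1" h'] assms[OF x] by eventually_elim simp
    then show ?thesis using sqnorm_eq_0_iff[OF K_l2[OF x]] by blast
  qed
  then have "((\<lambda>x. 0) has_sum (norm (h + (-1) *\<^sub>C h'))\<^sup>2) I"
    using K_norm[of "h + (-1) *\<^sub>C h'"] by (simp cong: has_sum_cong)
  then have "(norm (h + (-1) *\<^sub>C h'))\<^sup>2 = 0"
    using has_sum_0 has_sum_unique by (metis (no_types, lifting))
  then show ?thesis by (simp add: cscale_minus_one)
qed

end

text \<open>
  The unitary sends \<open>u\<close> to the family of classes of functions on the model spaces whose section
  over \<open>j\<close> is \<open>K x (u j)\<close>; \<open>glue\<close> provides functions with prescribed sections.
\<close>

locale spectral_sum = spectral_model q T I \<nu> K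
  for q and T :: "'a::complex_hilbert \<Rightarrow> 'a" and I \<nu> K +
  fixes J :: "'j set" and \<Phi> :: "'j \<Rightarrow> real \<Rightarrow> 'p" and M :: "'a \<Rightarrow> 'p measure"
  assumes direct: "x \<in> I \<Longrightarrow> direct_measure (M x) J (\<nu> x) \<Phi>"
    and glue: "x \<in> I \<Longrightarrow> (\<And>j. j \<in> J \<Longrightarrow> g j \<in> borel_measurable (\<nu> x)) \<Longrightarrow>
      \<exists>G\<in>borel_measurable (M x). \<forall>j\<in>J. AE t in \<nu> x. (G (\<Phi> j t) :: complex) = g j t"
begin

abbreviation "S \<equiv> sum_space I (\<lambda>x. l2_space (M x))"

lemma S_carrier:
  "X \<in> hcarrier S \<longleftrightarrow> X \<in> extensional I \<and> (\<forall>x\<in>I. X x \<in> hcarrier (l2_space (M x)))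
    \<and> (\<lambda>x. sqnorm (M x) (ae_rep (X x))) summable_on I"
proof -
  have "hinner (l2_space (M x)) Y Y = complex_of_real (sqnorm (M x) (ae_rep Y))" for x Y
    unfolding l2_space_hinner complex_norm_square[symmetric] integral_complex_of_real ..
  then show ?thesis by (auto simp: sum_space_def PiE_def)
qed

lemma S_simps:
  "hadd S X Y = (\<lambda>x\<in>I. hadd (l2_space (M x)) (X x) (Y x))"
  "hscale S c X = (\<lambda>x\<in>I. hscale (l2_space (M x)) c (X x))"
  "hinner S X Y = (\<Sum>\<^sub>\<infinity>x\<in>I. \<integral>p. ae_rep (X x) p * cnj (ae_rep (Y x) p) \<partial>M x)"
  by (simp_all add: sum_space_def l2_space_hinner)

text \<open>A relation between vectors and families of classes, as sections are determined only
  almost everywhere. It is shown to be single-valued, injective and onto, and \<open>U\<close> is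
  then chosen from it.\<close>

definition represents :: "('j \<Rightarrow> 'a) \<Rightarrow> ('a \<Rightarrow> ('p \<Rightarrow> complex) set) \<Rightarrow> bool" where
  "represents u X \<longleftrightarrow> X \<in> extensional I \<and> (\<forall>x\<in>I. X x \<in> hcarrier (l2_space (M x)) \<and>
     (\<forall>j\<in>J. AE t in \<nu> x. ae_rep (X x) (\<Phi> j t) = K x (u j) t))"

lemma representsD:
  assumes "represents u X" "x \<in> I"
  shows "X x \<in> hcarrier (l2_space (M x))" "j \<in> J \<Longrightarrow> AE t in \<nu> x. ae_rep (X x) (\<Phi> j t) = K x (u j) t"
  using assms by (auto simp: represents_def)

lemma represents_unique:
  assumes "represents u X" "represents u Y"
  shows "X = Y"
proof (rule extensionalityI[of _ I])
  fix x assume x: "x \<in> I"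
  interpret direct_measure "M x" J "\<nu> x" \<Phi> using x by (rule direct)
  have X: "X x \<in> hcarrier (l2_space (M x))" and Y: "Y x \<in> hcarrier (l2_space (M x))"
    using assms x by (auto dest: representsD)
  have "AE t in \<nu> x. ae_rep (X x) (\<Phi> j t) = ae_rep (Y x) (\<Phi> j t)" if "j \<in> J" for j
    using representsD(2)[OF assms(1) x that] representsD(2)[OF assms(2) x that] by eventually_elim simp
  then show "X x = Y x"
    using AE_eq_iff[OF l2_funD(1)[OF l2_rep(1)[OF X]] l2_funD(1)[OF l2_rep(1)[OF Y]]] l2_space_eq_iff[OF X Y]
    by blast
qed (use assms in \<open>auto simp: represents_def\<close>)

lemma represents_inj:
  assumes u: "u \<in> extensional J" "u' \<in> extensional J" and "represents u X" "represents u' X"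
  shows "u = u'"
proof (rule extensionalityI[OF u])
  fix j assume j: "j \<in> J"
  show "u j = u' j"
  proof (rule K_eqI)
    fix x assume x: "x \<in> I"
    show "AE t in \<nu> x. K x (u j) t = K x (u' j) t"
      using representsD(2)[OF assms(3) x j] representsD(2)[OF assms(4) x j] by eventually_elim simp
  qed
qed

lemma sections_summable:
  assumes "(\<lambda>j. (norm (u j))\<^sup>2) summable_on J"
  shows "(\<lambda>(x, j). sqnorm (\<nu> x) (K x (u j))) summable_on I \<times> J"
proof -
  have "(\<lambda>(j, x). sqnorm (\<nu> x) (K x (u j))) summable_on J \<times> I"
    by (rule summable_on_SigmaI[where g = "\<lambda>j. (norm (u j))\<^sup>2"]) (use K_norm assms in auto)
  then show ?thesis
    by (subst summable_on_swap) (simp add: case_prod_unfold)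
qed

text \<open>For each \<open>x\<close> the functions \<open>K x (u j)\<close> are glued over
  \<open>j\<close>. Their squared norms are summable jointly on \<open>I \<times> J\<close>, so the
  sum over \<open>j\<close> may be taken before the sum over \<open>x\<close>.\<close>

lemma represents_exists:
  assumes u: "u \<in> hcarrier (type_sum J)"
  shows "\<exists>X\<in>hcarrier S. represents u X"
proof -
  have sm: "(\<lambda>(x, j). sqnorm (\<nu> x) (K x (u j))) summable_on I \<times> J"
    using u by (intro sections_summable) (simp add: type_sum_carrier)
  have smx: "(\<lambda>j. sqnorm (\<nu> x) (K x (u j))) summable_on J" if "x \<in> I" for x
    using summable_on_SigmaD1[OF sm that] .
  define P where "P x G \<longleftrightarrow> G \<in> l2_fun (M x) \<and> (\<forall>j\<in>J. AE t in \<nu> x. G (\<Phi> j t) = K x (u j) t) \<and>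
      ((\<lambda>j. sqnorm (\<nu> x) (K x (u j))) has_sum sqnorm (M x) G) J" for x G
  have "\<exists>G. P x G" if x: "x \<in> I" for x
  proof -
    interpret direct_measure "M x" J "\<nu> x" \<Phi> using x by (rule direct)
    obtain G where G: "G \<in> borel_measurable (M x)" "\<forall>j\<in>J. AE t in \<nu> x. G (\<Phi> j t) = K x (u j) t"
      using glue[OF x, of "\<lambda>j. K x (u j)"] K_measurable[OF x] by blast
    have l2: "(\<lambda>t. G (\<Phi> j t)) \<in> l2_fun (\<nu> x)" if "j \<in> J" for j
      using G(2) that by (intro l2_fun_AE_cong[OF K_l2[OF x, of "u j"] measurable_section[OF G(1) that]]) (auto elim: AE_mp)
    have sq: "sqnorm (\<nu> x) (\<lambda>t. G (\<Phi> j t)) = sqnorm (\<nu> x) (K x (u j))" if "j \<in> J" for j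
    proof (rule integral_cong_AE)
      show "AE t in \<nu> x. (cmod (G (\<Phi> j t)))\<^sup>2 = (cmod (K x (u j) t))\<^sup>2"
        using G(2) that by (auto elim: AE_mp)
    qed (use l2[OF that] K_l2[OF x] in \<open>auto simp: l2_fun_def\<close>)
    have Gl2: "G \<in> l2_fun (M x)"
      using l2_fun_iff[OF G(1)] l2 smx[OF x] by (simp add: sq cong: summable_on_cong)
    then have "((\<lambda>j. sqnorm (\<nu> x) (K x (u j))) has_sum sqnorm (M x) G) J"
      using sqnorm_has_sum[OF Gl2] by (simp add: sq cong: has_sum_cong)
    then show ?thesis unfolding P_def using G Gl2 by blast
  qed
  then obtain G where "\<And>x. x \<in> I \<Longrightarrow> P x (G x)" by metis
  then have G: "\<And>x. x \<in> I \<Longrightarrow> G x \<in> l2_fun (M x)"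
    "\<And>x j. x \<in> I \<Longrightarrow> j \<in> J \<Longrightarrow> AE t in \<nu> x. G x (\<Phi> j t) = K x (u j) t"
    "\<And>x. x \<in> I \<Longrightarrow> ((\<lambda>j. sqnorm (\<nu> x) (K x (u j))) has_sum sqnorm (M x) (G x)) J"
    unfolding P_def by blast+
  define X where "X = (\<lambda>x\<in>I. ae_class (M x) (G x))"
  have Xc: "X x \<in> hcarrier (l2_space (M x))" if "x \<in> I" for x
    using that G by (simp add: X_def l2_class_carrier)
  have Xr: "AE p in M x. ae_rep (X x) p = G x p" if "x \<in> I" for x
    using that ae_rep_class(2)[OF l2_funD(1)[OF G(1)[OF that]]] by (simp add: X_def)
  have "sqnorm (M x) (ae_rep (X x)) = sqnorm (M x) (G x)" if "x \<in> I" for x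
  proof (rule integral_cong_AE)
    show "AE p in M x. (cmod (ae_rep (X x) p))\<^sup>2 = (cmod (G x p))\<^sup>2"
      using Xr[OF that] by eventually_elim simp
  qed (use G(1)[OF that] l2_rep(1)[OF Xc[OF that]] in \<open>auto simp: l2_fun_def\<close>)
  moreover have "(\<lambda>x. sqnorm (M x) (G x)) summable_on I"
  proof -
    have "(\<lambda>x. \<Sum>\<^sub>\<infinity>j\<in>J. sqnorm (\<nu> x) (K x (u j))) summable_on I"
      using summable_on_SigmaD[OF sm] smx by simp
    then show ?thesis
      using infsumI[OF G(3)] by (simp cong: summable_on_cong)
  qed
  ultimately have "X \<in> hcarrier S"
    unfolding S_carrier using Xc by (auto simp: X_def cong: summable_on_cong)
  moreover have "represents u X"
    unfolding represents_def
  proof (intro conjI ballI Xc)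
    show "X \<in> extensional I" by (simp add: X_def)
    fix x j assume x: "x \<in> I" and j: "j \<in> J"
    interpret direct_measure "M x" J "\<nu> x" \<Phi> using x by (rule direct)
    have "AE t in \<nu> x. ae_rep (X x) (\<Phi> j t) = G x (\<Phi> j t)"
      using AE_eq_iff[of "ae_rep (X x)" "G x"] Xr[OF x] l2_rep(1)[OF Xc[OF x]] G(1)[OF x] j by auto
    then show "AE t in \<nu> x. ae_rep (X x) (\<Phi> j t) = K x (u j) t"
      using G(2)[OF x j] by eventually_elim simp
  qed
  ultimately show ?thesis by blast
qed

text \<open>For each \<open>j\<close> the sections over all \<open>x\<close> are the components of
  one vector by \<open>K_surj\<close>; joint summability on \<open>I \<times> J\<close> shows both
  that this applies and that the resulting family is square-summable.\<close>

lemma represents_surj: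
  assumes X: "X \<in> hcarrier S"
  shows "\<exists>u\<in>hcarrier (type_sum J). represents u X"
proof -
  let ?f = "\<lambda>x j t. ae_rep (X x) (\<Phi> j t)"
  have Xc: "X x \<in> hcarrier (l2_space (M x))" if "x \<in> I" for x using X that S_carrier by blast
  have l2: "?f x j \<in> l2_fun (\<nu> x)" if "x \<in> I" "j \<in> J" for x j
  proof -
    interpret direct_measure "M x" J "\<nu> x" \<Phi> using that by (intro direct)
    show ?thesis using l2_rep(1)[OF Xc[OF that(1)]] l2_fun_iff[of "ae_rep (X x)"] that by auto
  qed
  have sm: "(\<lambda>(x, j). sqnorm (\<nu> x) (?f x j)) summable_on I \<times> J"
  proof (rule summable_on_SigmaI[where g = "\<lambda>x. sqnorm (M x) (ae_rep (X x))"])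
    show "(\<lambda>x. sqnorm (M x) (ae_rep (X x))) summable_on I" using X S_carrier by blast
    show "((\<lambda>j. case (x, j) of (x, j) \<Rightarrow> sqnorm (\<nu> x) (?f x j)) has_sum sqnorm (M x) (ae_rep (X x))) J"
      if x: "x \<in> I" for x
    proof -
      interpret direct_measure "M x" J "\<nu> x" \<Phi> using x by (rule direct)
      show ?thesis using sqnorm_has_sum[OF l2_rep(1)[OF Xc[OF x]]] by simp
    qed
  qed auto
  then have sm': "(\<lambda>(j, x). sqnorm (\<nu> x) (?f x j)) summable_on J \<times> I"
    by (subst (asm) summable_on_swap) (simp add: case_prod_unfold)
  have smj: "(\<lambda>x. sqnorm (\<nu> x) (?f x j)) summable_on I" if "j \<in> J" for j
    using summable_on_SigmaD1[OF sm' that] .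
  have "\<exists>h. \<forall>x\<in>I. AE t in \<nu> x. K x h t = ?f x j t" if j: "j \<in> J" for j
    by (rule K_surj) (use l2 smj j in auto)
  then obtain h where h: "\<And>j x. j \<in> J \<Longrightarrow> x \<in> I \<Longrightarrow> AE t in \<nu> x. K x (h j) t = ?f x j t" by metis
  define u where "u = (\<lambda>j\<in>J. h j)"
  have sq: "sqnorm (\<nu> x) (K x (h j)) = sqnorm (\<nu> x) (?f x j)" if "x \<in> I" "j \<in> J" for x j
  proof (rule integral_cong_AE)
    show "AE t in \<nu> x. (cmod (K x (h j) t))\<^sup>2 = (cmod (?f x j t))\<^sup>2"
      using h[OF that(2,1)] by eventually_elim simp
  qed (use l2[OF that] K_l2[OF that(1)] in \<open>auto simp: l2_fun_def\<close>)
  have "(\<lambda>j. \<Sum>\<^sub>\<infinity>x\<in>I. sqnorm (\<nu> x) (?f x j)) summable_on J"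
    using summable_on_SigmaD[OF sm'] smj by simp
  moreover have "(\<Sum>\<^sub>\<infinity>x\<in>I. sqnorm (\<nu> x) (?f x j)) = (norm (u j))\<^sup>2" if j: "j \<in> J" for j
    using infsumI[OF K_norm[of "h j"]] j by (simp add: u_def sq cong: infsum_cong)
  ultimately have "u \<in> hcarrier (type_sum J)"
    by (simp add: type_sum_carrier u_def cong: summable_on_cong)
  moreover have "represents u X"
    unfolding represents_def
  proof (intro conjI ballI Xc)
    show "X \<in> extensional I" using X S_carrier by blast
    fix x j assume "x \<in> I" and "j \<in> J"
    with h[OF this(2,1)] show "AE t in \<nu> x. ae_rep (X x) (\<Phi> j t) = K x (u j) t"
      by (auto simp: u_def elim: AE_mp)
  qed
  ultimately show ?thesis by blast
qed

lemma represents_add: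
  assumes "represents u X" "represents v Y"
  shows "represents (\<lambda>j\<in>J. u j + v j) (hadd S X Y)"
  unfolding represents_def
proof (intro conjI ballI)
  show "hadd S X Y \<in> extensional I" by (simp add: S_simps)
  fix x assume x: "x \<in> I"
  interpret direct_measure "M x" J "\<nu> x" \<Phi> using x by (rule direct)
  have X: "X x \<in> hcarrier (l2_space (M x))" and Y: "Y x \<in> hcarrier (l2_space (M x))"
    using assms x by (auto dest: representsD)
  note add = l2_space_rep_add[OF X Y]
  show c: "hadd S X Y x \<in> hcarrier (l2_space (M x))" using add x by (simp add: S_simps)
  fix j assume j: "j \<in> J"
  have [measurable]: "ae_rep (X x) \<in> borel_measurable (M x)" "ae_rep (Y x) \<in> borel_measurable (M x)"
    "ae_rep (hadd S X Y x) \<in> borel_measurable (M x)"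
    using l2_rep(1)[OF X] l2_rep(1)[OF Y] l2_rep(1)[OF c] by auto
  have "AE p in M x. ae_rep (hadd S X Y x) p = ae_rep (X x) p + ae_rep (Y x) p"
    using add(2) x by (simp add: S_simps)
  then have "AE t in \<nu> x. ae_rep (hadd S X Y x) (\<Phi> j t) = ae_rep (X x) (\<Phi> j t) + ae_rep (Y x) (\<Phi> j t)"
    by (subst (asm) AE_eq_iff) (use j in auto)
  then show "AE t in \<nu> x. ae_rep (hadd S X Y x) (\<Phi> j t) = K x ((\<lambda>j\<in>J. u j + v j) j) t"
    using representsD(2)[OF assms(1) x j] representsD(2)[OF assms(2) x j] K_add[OF x, of "u j" "v j"]
    by eventually_elim (simp add: j)
qed

lemma represents_scale:
  assumes "represents u X"
  shows "represents (\<lambda>j\<in>J. c *\<^sub>C u j) (hscale S c X)"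
  unfolding represents_def
proof (intro conjI ballI)
  show "hscale S c X \<in> extensional I" by (simp add: S_simps)
  fix x assume x: "x \<in> I"
  interpret direct_measure "M x" J "\<nu> x" \<Phi> using x by (rule direct)
  have X: "X x \<in> hcarrier (l2_space (M x))"
    using assms x by (auto dest: representsD)
  note scale = l2_space_rep_scale[OF X, of c]
  show cc: "hscale S c X x \<in> hcarrier (l2_space (M x))" using scale x by (simp add: S_simps)
  fix j assume j: "j \<in> J"
  have [measurable]: "ae_rep (X x) \<in> borel_measurable (M x)" "ae_rep (hscale S c X x) \<in> borel_measurable (M x)"
    using l2_rep(1)[OF X] l2_rep(1)[OF cc] by auto
  have "AE p in M x. ae_rep (hscale S c X x) p = c * ae_rep (X x) p"
    using scale(2) x by (simp add: S_simps)
  then have "AE t in \<nu> x. ae_rep (hscale S c X x) (\<Phi> j t) = c * ae_rep (X x) (\<Phi> j t)"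
    by (subst (asm) AE_eq_iff) (use j in auto)
  then show "AE t in \<nu> x. ae_rep (hscale S c X x) (\<Phi> j t) = K x ((\<lambda>j\<in>J. c *\<^sub>C u j) j) t"
    using representsD(2)[OF assms(1) x j] K_scale[OF x, of c "u j"]
    by eventually_elim (simp add: j)
qed

text \<open>Both sides are the same double sum taken in different orders. Cauchy-Schwarz bounds its
  terms by sums of squared norms, so it converges absolutely on \<open>I \<times> J\<close> and the
  order may be exchanged.\<close>

lemma represents_inner:
  assumes "represents u X" "represents v Y"
    and "u \<in> hcarrier (type_sum J)" "v \<in> hcarrier (type_sum J)"
  shows "hinner S X Y = hinner (type_sum J) u v"
proof -
  let ?c = "\<lambda>x j. \<integral>t. K x (u j) t * cnj (K x (v j) t) \<partial>\<nu> x"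
  have "(\<lambda>z. (case z of (x, j) \<Rightarrow> sqnorm (\<nu> x) (K x (u j))) + (case z of (x, j) \<Rightarrow> sqnorm (\<nu> x) (K x (v j))))
      summable_on I \<times> J"
    using assms by (intro summable_on_add sections_summable) (auto simp: type_sum_carrier)
  then have "(\<lambda>z. norm (case z of (x, j) \<Rightarrow> ?c x j)) summable_on I \<times> J"
  proof (rule summable_on_comparison_test)
    fix z assume "z \<in> I \<times> J"
    then obtain x j where z: "z = (x, j)" "x \<in> I" "j \<in> J" by blast
    let ?a = "sqnorm (\<nu> x) (K x (u j))" and ?b = "sqnorm (\<nu> x) (K x (v j))"
    have "norm (?c x j) \<le> sqrt ?a * sqrt ?b"
      using K_l2[OF z(2)] by (intro l2_cauchy_schwarz)
    also have "\<dots> \<le> (sqrt ?a)\<^sup>2 + (sqrt ?b)\<^sup>2"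
    proof -
      have "0 \<le> sqrt ?a * sqrt ?b" by simp
      then show ?thesis using sum_squares_bound[of "sqrt ?a" "sqrt ?b"] by linarith
    qed
    also have "\<dots> = ?a + ?b" by simp
    finally show "norm (case z of (x, j) \<Rightarrow> ?c x j)
        \<le> (case z of (x, j) \<Rightarrow> sqnorm (\<nu> x) (K x (u j))) + (case z of (x, j) \<Rightarrow> sqnorm (\<nu> x) (K x (v j)))"
      by (simp add: z)
  qed auto
  then have sm: "(\<lambda>(x, j). ?c x j) summable_on I \<times> J"
    by (rule abs_summable_summable)
  have "hinner S X Y = (\<Sum>\<^sub>\<infinity>x\<in>I. \<Sum>\<^sub>\<infinity>j\<in>J. ?c x j)"
    unfolding S_simps
  proof (rule infsum_cong)
    fix x assume x: "x \<in> I"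
    interpret direct_measure "M x" J "\<nu> x" \<Phi> using x by (rule direct)
    have X: "ae_rep (X x) \<in> l2_fun (M x)" and Y: "ae_rep (Y x) \<in> l2_fun (M x)"
      using assms x by (auto dest: representsD intro: l2_rep)
    have "(\<integral>t. ae_rep (X x) (\<Phi> j t) * cnj (ae_rep (Y x) (\<Phi> j t)) \<partial>\<nu> x) = ?c x j" if j: "j \<in> J" for j
    proof (rule integral_cong_AE)
      note [measurable] = measurable_section[OF l2_funD(1)[OF X] j] measurable_section[OF l2_funD(1)[OF Y] j]
        K_measurable[OF x]
      show "(\<lambda>t. ae_rep (X x) (\<Phi> j t) * cnj (ae_rep (Y x) (\<Phi> j t))) \<in> borel_measurable (\<nu> x)"
        "(\<lambda>t. K x (u j) t * cnj (K x (v j) t)) \<in> borel_measurable (\<nu> x)" by measurable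
      show "AE t in \<nu> x. ae_rep (X x) (\<Phi> j t) * cnj (ae_rep (Y x) (\<Phi> j t)) = K x (u j) t * cnj (K x (v j) t)"
        using representsD(2)[OF assms(1) x j] representsD(2)[OF assms(2) x j] by eventually_elim simp
    qed
    then have "((\<lambda>j. ?c x j) has_sum (\<integral>p. ae_rep (X x) p * cnj (ae_rep (Y x) p) \<partial>M x)) J"
      using inner_has_sum[OF X Y] by (simp cong: has_sum_cong)
    then show "(\<integral>p. ae_rep (X x) p * cnj (ae_rep (Y x) p) \<partial>M x) = (\<Sum>\<^sub>\<infinity>j\<in>J. ?c x j)"
      by (rule infsumI[symmetric])
  qed
  also have "\<dots> = (\<Sum>\<^sub>\<infinity>j\<in>J. \<Sum>\<^sub>\<infinity>x\<in>I. ?c x j)"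
    by (rule infsum_swap_banach[OF sm])
  also have "\<dots> = hinner (type_sum J) u v"
    unfolding type_sum_simps by (intro infsum_cong infsumI K_inner)
  finally show ?thesis .
qed

definition U :: "('j \<Rightarrow> 'a) \<Rightarrow> 'a \<Rightarrow> ('p \<Rightarrow> complex) set" where
  "U u = (SOME X. X \<in> hcarrier S \<and> represents u X)"

lemma U: assumes "u \<in> hcarrier (type_sum J)" shows "U u \<in> hcarrier S" "represents u (U u)"
  using someI_ex[of "\<lambda>X. X \<in> hcarrier S \<and> represents u X"] represents_exists[OF assms]
  by (auto simp: U_def)

lemma type_sum_closed:
  assumes "u \<in> hcarrier (type_sum J)" "v \<in> hcarrier (type_sum J)"
  shows "(\<lambda>j\<in>J. u j + v j) \<in> hcarrier (type_sum J)" "(\<lambda>j\<in>J. c *\<^sub>C u j) \<in> hcarrier (type_sum J)"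
proof -
  have u: "(\<lambda>j. (norm (u j))\<^sup>2) summable_on J" and v: "(\<lambda>j. (norm (v j))\<^sup>2) summable_on J"
    using assms by (auto simp: type_sum_carrier)
  have "(\<lambda>j. 2 * (norm (u j))\<^sup>2 + 2 * (norm (v j))\<^sup>2) summable_on J"
    by (intro summable_on_add summable_on_cmult_right u v)
  then have "(\<lambda>j. (norm (u j + v j))\<^sup>2) summable_on J"
    by (rule summable_on_comparison_test) (auto simp: norm_add_sq_le)
  then show "(\<lambda>j\<in>J. u j + v j) \<in> hcarrier (type_sum J)"
    by (simp add: type_sum_carrier cong: summable_on_cong)
  show "(\<lambda>j\<in>J. c *\<^sub>C u j) \<in> hcarrier (type_sum J)"
    using summable_on_cmult_right[OF u, of "(cmod c)\<^sup>2"]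
    by (simp add: type_sum_carrier power_mult_distrib cong: summable_on_cong)
qed

theorem U_unitary: "unitary_op (type_sum J) S U"
  unfolding unitary_op_def
proof (intro conjI ballI allI)
  show "bij_betw U (hcarrier (type_sum J)) (hcarrier S)"
    unfolding bij_betw_def
  proof (intro conjI inj_onI set_eqI iffI)
    fix u v assume uv: "u \<in> hcarrier (type_sum J)" "v \<in> hcarrier (type_sum J)" and eq: "U u = U v"
    then have "represents u (U u)" "represents v (U u)" using U(2) by force+
    then show "u = v" using uv by (intro represents_inj) (auto simp: type_sum_carrier)
  next
    fix X assume "X \<in> U ` hcarrier (type_sum J)"
    then show "X \<in> hcarrier S" using U by auto
  next
    fix X assume X: "X \<in> hcarrier S"
    obtain u where u: "u \<in> hcarrier (type_sum J)" "represents u X" using represents_surj[OF X] by blast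
    then have "U u = X" using represents_unique U(2) by blast
    then show "X \<in> U ` hcarrier (type_sum J)" using u by blast
  qed
next
  fix u v :: "'j \<Rightarrow> 'a" assume uv: "u \<in> hcarrier (type_sum J)" "v \<in> hcarrier (type_sum J)"
  show "U (hadd (type_sum J) u v) = hadd S (U u) (U v)"
    unfolding type_sum_simps
    using represents_unique U(2)[OF type_sum_closed(1)[OF uv]] represents_add[OF U(2)[OF uv(1)] U(2)[OF uv(2)]] by blast
  show "hinner S (U u) (U v) = hinner (type_sum J) u v"
    using represents_inner U uv by blast
next
  fix c and u :: "'j \<Rightarrow> 'a" assume u: "u \<in> hcarrier (type_sum J)"
  show "U (hscale (type_sum J) c u) = hscale S c (U u)"
    unfolding type_sum_simps
    using represents_unique U(2)[OF type_sum_closed(2)[OF u u]] represents_scale[OF U(2)[OF u]] by blast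
qed

text \<open>\<open>K\<close> turns \<open>T\<close> into multiplication by \<open>t\<close>, so the
  relation between components becomes the relation between sections; \<open>K_eqI\<close> leads back
  from sections to vectors.\<close>

theorem U_shift_op:
  assumes p: "\<And>j. j \<in> J \<Longrightarrow> w j \<noteq> 0 \<Longrightarrow> p j \<in> J"
    and Z: "\<And>x. x \<in> I \<Longrightarrow> Z x = {(X, Y). X \<in> hcarrier (l2_space (M x)) \<and> Y \<in> hcarrier (l2_space (M x)) \<and>
     (\<forall>j\<in>J. AE t in \<nu> x. ae_rep Y (\<Phi> j t) = complex_of_real (w j * t) * ae_rep X (\<Phi> (p j) t))}"
  shows "map_prod U U ` shift_op J T w p = sum_op I (\<lambda>x. l2_space (M x)) Z"
proof -
  have iff: "(U u, U v) \<in> sum_op I (\<lambda>x. l2_space (M x)) Z \<longleftrightarrow> (u, v) \<in> shift_op J T w p"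
    if u: "u \<in> hcarrier (type_sum J)" and v: "v \<in> hcarrier (type_sum J)" for u v
  proof -
    have "(U u, U v) \<in> sum_op I (\<lambda>x. l2_space (M x)) Z \<longleftrightarrow>
      (\<forall>x\<in>I. \<forall>j\<in>J. AE t in \<nu> x. ae_rep (U v x) (\<Phi> j t) = complex_of_real (w j * t) * ae_rep (U u x) (\<Phi> (p j) t))"
      using U[OF u] U[OF v] by (auto simp: sum_op_def Z represents_def)
    also have "\<dots> \<longleftrightarrow> (\<forall>x\<in>I. \<forall>j\<in>J. AE t in \<nu> x. K x (v j) t = K x (complex_of_real (w j) *\<^sub>C T (u (p j))) t)"
    proof (intro ball_cong refl)
      fix x j assume x: "x \<in> I" and j: "j \<in> J"
      have Kw: "AE t in \<nu> x. K x (complex_of_real (w j) *\<^sub>C T (u (p j))) t = complex_of_real (w j * t) * K x (u (p j)) t"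
        using K_scale[OF x, of "complex_of_real (w j)" "T (u (p j))"] K_mult[OF x, of "u (p j)"]
        by eventually_elim simp
      have "AE t in \<nu> x. complex_of_real (w j * t) * ae_rep (U u x) (\<Phi> (p j) t) = complex_of_real (w j * t) * K x (u (p j)) t"
      proof (cases "w j = 0")
        case False
        from representsD(2)[OF U(2)[OF u] x p[OF j False]] show ?thesis by eventually_elim simp
      qed simp
      with Kw representsD(2)[OF U(2)[OF v] x j]
      have AE: "AE t in \<nu> x. ae_rep (U v x) (\<Phi> j t) = K x (v j) t \<and>
        complex_of_real (w j * t) * ae_rep (U u x) (\<Phi> (p j) t) = K x (complex_of_real (w j) *\<^sub>C T (u (p j))) t"
        by eventually_elim simp
      show "(AE t in \<nu> x. ae_rep (U v x) (\<Phi> j t) = complex_of_real (w j * t) * ae_rep (U u x) (\<Phi> (p j) t)) \<longleftrightarrow>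
        (AE t in \<nu> x. K x (v j) t = K x (complex_of_real (w j) *\<^sub>C T (u (p j))) t)"
      proof
        assume "AE t in \<nu> x. ae_rep (U v x) (\<Phi> j t) = complex_of_real (w j * t) * ae_rep (U u x) (\<Phi> (p j) t)"
        with AE show "AE t in \<nu> x. K x (v j) t = K x (complex_of_real (w j) *\<^sub>C T (u (p j))) t"
          by eventually_elim metis
      next
        assume "AE t in \<nu> x. K x (v j) t = K x (complex_of_real (w j) *\<^sub>C T (u (p j))) t"
        with AE show "AE t in \<nu> x. ae_rep (U v x) (\<Phi> j t) = complex_of_real (w j * t) * ae_rep (U u x) (\<Phi> (p j) t)"
          by eventually_elim metis
      qed
    qed
    also have "\<dots> \<longleftrightarrow> (\<forall>j\<in>J. v j = complex_of_real (w j) *\<^sub>C T (u (p j)))"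
    proof
      assume eq: "\<forall>x\<in>I. \<forall>j\<in>J. AE t in \<nu> x. K x (v j) t = K x (complex_of_real (w j) *\<^sub>C T (u (p j))) t"
      show "\<forall>j\<in>J. v j = complex_of_real (w j) *\<^sub>C T (u (p j))"
      proof
        fix j assume "j \<in> J"
        then show "v j = complex_of_real (w j) *\<^sub>C T (u (p j))"
          using eq by (intro K_eqI) blast
      qed
    qed simp
    also have "\<dots> \<longleftrightarrow> (u, v) \<in> shift_op J T w p"
      using u v by (simp add: shift_op_def)
    finally show ?thesis .
  qed
  have im: "U ` hcarrier (type_sum J) = hcarrier S"
    using U_unitary by (simp add: unitary_op_def bij_betw_def)
  show ?thesis
  proof (intro set_eqI iffI)
    fix z assume "z \<in> map_prod U U ` shift_op J T w p"
    then obtain u v where "(u, v) \<in> shift_op J T w p" "z = (U u, U v)" by auto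
    then show "z \<in> sum_op I (\<lambda>x. l2_space (M x)) Z"
      using iff[of u v] by (auto simp: shift_op_def)
  next
    fix z assume z: "z \<in> sum_op I (\<lambda>x. l2_space (M x)) Z"
    obtain X Y where XY: "z = (X, Y)" by (cases z)
    then have "X \<in> hcarrier S" "Y \<in> hcarrier S" using z by (auto simp: sum_op_def)
    then obtain u v where uv: "u \<in> hcarrier (type_sum J)" "v \<in> hcarrier (type_sum J)" "X = U u" "Y = U v"
      unfolding im[symmetric] by blast
    then have "(u, v) \<in> shift_op J T w p" using z iff XY by blast
    then show "z \<in> map_prod U U ` shift_op J T w p" using uv XY by force
  qed
qed

end

section \<open>Closures and direct sums\<close>

definition pair_op :: "('v \<times> 'v) set \<Rightarrow> ('w \<times> 'w) set \<Rightarrow> (('v \<times> 'w) \<times> ('v \<times> 'w)) set" where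
  "pair_op T T' = {((a, b), (a', b')). (a, a') \<in> T \<and> (b, b') \<in> T'}"

definition pair_rep :: "'v rep \<Rightarrow> 'w rep \<Rightarrow> ('v \<times> 'w) rep" where
  "pair_rep P P' = \<lparr>rspace = pair_space (rspace P) (rspace P'),
     rz1 = pair_op (rz1 P) (rz1 P'), rz2 = pair_op (rz2 P) (rz2 P')\<rparr>"

text \<open>The square root of a negative number is negative, so squared distances add in a pair
  space only if the radicands are nonnegative. Asking this for all values, not just in the carrier,
  frees the lemmas below from carrier conditions.\<close>

definition nonneg_dist :: "'v hspace \<Rightarrow> bool" where
  "nonneg_dist H \<longleftrightarrow> (\<forall>x y. let d = hadd H x (hscale H (-1) y) in 0 \<le> Re (hinner H d d))"

lemma hdist_pair:
  assumes "nonneg_dist H" "nonneg_dist K"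
  shows "hdist (pair_space H K) (a, b) (a', b') = sqrt ((hdist H a a')\<^sup>2 + (hdist K b b')\<^sup>2)"
  using assms by (simp add: hdist_def pair_space_def nonneg_dist_def Let_def)

lemma nonneg_dist_pair:
  assumes "nonneg_dist H" "nonneg_dist K"
  shows "nonneg_dist (pair_space H K)"
  using assms by (simp add: pair_space_def nonneg_dist_def Let_def split: prod.splits)

lemma hdist_nonneg: "nonneg_dist H \<Longrightarrow> 0 \<le> hdist H x y"
  by (simp add: hdist_def nonneg_dist_def Let_def)

text \<open>Approximants in the two summands are chosen independently, each within
  \<open>e / 2\<close>, so closure commutes with pairing.\<close>

lemma op_closure_pair:
  assumes H: "nonneg_dist H" and K: "nonneg_dist K"
  shows "op_closure (pair_space H K) (pair_op T T') = pair_op (op_closure H T) (op_closure K T')"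
proof (intro set_eqI iffI)
  fix z assume z: "z \<in> op_closure (pair_space H K) (pair_op T T')"
  obtain a b a' b' where [simp]: "z = ((a, b), (a', b'))" by (metis surj_pair)
  have c: "a \<in> hcarrier H" "a' \<in> hcarrier H" "b \<in> hcarrier K" "b' \<in> hcarrier K"
    using z by (auto simp: op_closure_def pair_space_def)
  have "\<exists>(u, v)\<in>T. hdist H a u < e \<and> hdist H a' v < e" "\<exists>(u, v)\<in>T'. hdist K b u < e \<and> hdist K b' v < e"
    if "e > 0" for e
  proof -
    have "\<exists>x\<in>pair_op T T'. hdist (pair_space H K) (a, b) (fst x) < e \<and> hdist (pair_space H K) (a', b') (snd x) < e"
      using z that by (simp add: op_closure_def case_prod_unfold)
    then obtain w w' where w: "(w, w') \<in> pair_op T T'" "hdist (pair_space H K) (a, b) w < e"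
      "hdist (pair_space H K) (a', b') w' < e"
      by (metis prod.collapse)
    obtain u r u' r' where [simp]: "w = (u, r)" "w' = (u', r')" by (metis surj_pair)
    have "hdist H a u < e" "hdist H a' u' < e" "hdist K b r < e" "hdist K b' r' < e"
      using w(2,3) by (auto simp: hdist_pair[OF H K] intro: le_less_trans[rotated] real_sqrt_sum_squares_ge1 real_sqrt_sum_squares_ge2)
    then show "\<exists>(u, v)\<in>T. hdist H a u < e \<and> hdist H a' v < e" "\<exists>(u, v)\<in>T'. hdist K b u < e \<and> hdist K b' v < e"
      using w(1) by (auto simp: pair_op_def)
  qed
  then show "z \<in> pair_op (op_closure H T) (op_closure K T')"
    using c by (auto simp: pair_op_def op_closure_def)
next
  fix z assume z: "z \<in> pair_op (op_closure H T) (op_closure K T')"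
  obtain a b a' b' where [simp]: "z = ((a, b), (a', b'))" by (metis surj_pair)
  have c: "(a, a') \<in> op_closure H T" "(b, b') \<in> op_closure K T'"
    using z by (auto simp: pair_op_def)
  have "\<exists>(w, w')\<in>pair_op T T'. hdist (pair_space H K) (a, b) w < e \<and> hdist (pair_space H K) (a', b') w' < e"
    if e: "e > 0" for e
  proof -
    obtain u u' where u: "(u, u') \<in> T" "hdist H a u < e / 2" "hdist H a' u' < e / 2"
      using c(1) e half_gt_zero[OF e] unfolding op_closure_def by blast
    obtain r r' where r: "(r, r') \<in> T'" "hdist K b r < e / 2" "hdist K b' r' < e / 2"
      using c(2) e half_gt_zero[OF e] unfolding op_closure_def by blast
    have "sqrt (x\<^sup>2 + y\<^sup>2) < e" if "x < e / 2" "y < e / 2" "0 \<le> x" "0 \<le> y" for x y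
      using sqrt_sum_squares_le_sum[of x y] that by linarith
    then have "hdist (pair_space H K) (a, b) (u, r) < e" "hdist (pair_space H K) (a', b') (u', r') < e"
      unfolding hdist_pair[OF H K] using u r hdist_nonneg[OF H] hdist_nonneg[OF K] by blast+
    moreover have "((u, r), (u', r')) \<in> pair_op T T'" using u r by (simp add: pair_op_def)
    ultimately show ?thesis by blast
  qed
  then show "z \<in> op_closure (pair_space H K) (pair_op T T')"
    using c by (auto simp: op_closure_def pair_space_def)
qed

section \<open>Closure of a weighted shift from finitely supported vectors\<close>

lemma nonneg_dist_type_space: "nonneg_dist type_space"
  by (simp add: nonneg_dist_def type_space_def cinner_self)

lemma hdist_type_space: "hdist type_space x y = norm (x - y)"
  by (simp add: hdist_def type_space_def cinner_self cscale_minus_one)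

lemma infsum_complex_of_real: "(\<Sum>\<^sub>\<infinity>j\<in>J. complex_of_real (f j)) = complex_of_real (\<Sum>\<^sub>\<infinity>j\<in>J. f j)"
proof (cases "f summable_on J")
  case True
  then show ?thesis by (intro infsumI has_sum_of_real) (rule has_sum_infsum)
next
  case False
  then have "\<not> (\<lambda>j. complex_of_real (f j)) summable_on J"
    using has_sum_Re by (fastforce simp: summable_on_def)
  with False show ?thesis by (simp add: infsum_not_exists)
qed

lemma type_sum_sq:
  "Re (hinner (type_sum J) (hadd (type_sum J) u (hscale (type_sum J) (-1) v)) (hadd (type_sum J) u (hscale (type_sum J) (-1) v)))
    = (\<Sum>\<^sub>\<infinity>j\<in>J. (norm (u j - v j))\<^sup>2)"
proof -
  let ?d = "\<lambda>j\<in>J. u j + (\<lambda>j\<in>J. (-1) *\<^sub>C v j) j"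
  have "(\<Sum>\<^sub>\<infinity>j\<in>J. cinner (?d j) (?d j)) = (\<Sum>\<^sub>\<infinity>j\<in>J. complex_of_real ((norm (u j - v j))\<^sup>2))"
    by (intro infsum_cong) (simp only: restrict_apply if_True cinner_self cscale_minus_one diff_conv_add_uminus)
  then show ?thesis
    unfolding type_sum_simps by (simp only: infsum_complex_of_real Re_complex_of_real)
qed

lemma hdist_type_sum: "hdist (type_sum J) u v = sqrt (\<Sum>\<^sub>\<infinity>j\<in>J. (norm (u j - v j))\<^sup>2)"
  unfolding hdist_def Let_def type_sum_sq ..

lemma nonneg_dist_type_sum: "nonneg_dist (type_sum J)"
  unfolding nonneg_dist_def Let_def type_sum_sq by (auto intro: infsum_nonneg)

lemma type_sum_diff_summable:
  assumes "u \<in> hcarrier (type_sum J)" "v \<in> hcarrier (type_sum J)"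
  shows "(\<lambda>j. (norm (u j - v j))\<^sup>2) summable_on J"
proof -
  have "(\<lambda>j. 2 * (norm (u j))\<^sup>2 + 2 * (norm (v j))\<^sup>2) summable_on J"
    using assms by (intro summable_on_add summable_on_cmult_right) (auto simp: type_sum_carrier)
  then show ?thesis
    by (rule summable_on_comparison_test) (simp_all add: order_trans[OF norm_add_sq_le[of "u _" "- v _", simplified]])
qed

lemma norm_le_hdist_type_sum:
  assumes "u \<in> hcarrier (type_sum J)" "v \<in> hcarrier (type_sum J)" "j \<in> J"
  shows "norm (u j - v j) \<le> hdist (type_sum J) u v"
proof -
  have "(\<Sum>i\<in>{j}. (norm (u i - v i))\<^sup>2) \<le> (\<Sum>\<^sub>\<infinity>i\<in>J. (norm (u i - v i))\<^sup>2)"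
    using assms by (intro finite_sum_le_infsum type_sum_diff_summable) auto
  then show ?thesis
    unfolding hdist_type_sum by (intro real_le_rsqrt) simp
qed

definition cut_off :: "'j set \<Rightarrow> 'j set \<Rightarrow> ('j \<Rightarrow> 'a::complex_hilbert) \<Rightarrow> 'j \<Rightarrow> 'a" where
  "cut_off J F u = (\<lambda>j\<in>J. if j \<in> F then u j else 0)"

lemma cut_off_carrier:
  assumes "u \<in> hcarrier (type_sum J)"
  shows "cut_off J F u \<in> hcarrier (type_sum J)"
proof -
  have "(\<lambda>j. (norm (u j))\<^sup>2) summable_on J" using assms by (simp add: type_sum_carrier)
  then have "(\<lambda>j. (norm (cut_off J F u j))\<^sup>2) summable_on J"
    by (rule summable_on_comparison_test) (auto simp: cut_off_def)
  then show ?thesis by (simp add: type_sum_carrier cut_off_def)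
qed

text \<open>The bound is kept for all larger finite sets, since the truncations of a vector and of
  its image must be enlarged to fit each other.\<close>

lemma cut_off_approx:
  assumes u: "u \<in> hcarrier (type_sum J)" and e: "e > 0"
  obtains F where "finite F" "F \<subseteq> J" "\<And>G. finite G \<Longrightarrow> F \<subseteq> G \<Longrightarrow> G \<subseteq> J \<Longrightarrow> hdist (type_sum J) u (cut_off J G u) < e"
proof -
  let ?f = "\<lambda>j. (norm (u j))\<^sup>2"
  have sm: "?f summable_on J" using u by (simp add: type_sum_carrier)
  then have "(sum ?f \<longlongrightarrow> infsum ?f J) (finite_subsets_at_top J)"
    using has_sum_infsum has_sum_def by blast
  then have "eventually (\<lambda>F. dist (sum ?f F) (infsum ?f J) < e\<^sup>2) (finite_subsets_at_top J)"
    using e by (intro tendstoD) auto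
  then obtain F where F: "finite F" "F \<subseteq> J"
    "\<And>G. finite G \<Longrightarrow> F \<subseteq> G \<Longrightarrow> G \<subseteq> J \<Longrightarrow> dist (sum ?f G) (infsum ?f J) < e\<^sup>2"
    by (auto simp: eventually_finite_subsets_at_top)
  have "hdist (type_sum J) u (cut_off J G u) < e" if G: "finite G" "F \<subseteq> G" "G \<subseteq> J" for G
  proof -
    have "(\<Sum>\<^sub>\<infinity>j\<in>J. (norm (u j - cut_off J G u j))\<^sup>2) = (\<Sum>\<^sub>\<infinity>j\<in>J - G. ?f j)"
      by (rule infsum_cong_neutral) (use G in \<open>auto simp: cut_off_def\<close>)
    also have "\<dots> = infsum ?f J - sum ?f G"
      using G sm by (subst infsum_Diff) (auto intro: summable_on_subset_banach)
    also have "\<dots> < e\<^sup>2"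
      using F(3)[OF G] by (simp add: dist_real_def)
    finally show ?thesis
      unfolding hdist_type_sum using e by (intro real_less_lsqrt) auto
  qed
  with F show ?thesis using that by blast
qed

definition finite_shift where
  "finite_shift J T w p = {(u, v) \<in> shift_op J T w p. finite {j \<in> J. u j \<noteq> 0} \<and> finite {j \<in> J. v j \<noteq> 0}}"

text \<open>The relation is componentwise and \<open>T\<close> is continuous, so it survives limits.
  Conversely, truncating \<open>u\<close> and \<open>v\<close> to matching finite index sets keeps
  the relation. The closure is thus the maximal shift.\<close>

theorem op_closure_finite_shift:
  assumes T: "bounded_linear T" and inj: "inj_on p {j \<in> J. w j \<noteq> 0}"
    and p: "\<And>j. j \<in> J \<Longrightarrow> w j \<noteq> 0 \<Longrightarrow> p j \<in> J"
  shows "op_closure (type_sum J) (finite_shift J T w p) = shift_op J T w p"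
proof (intro set_eqI iffI)
  fix z assume z: "z \<in> op_closure (type_sum J) (finite_shift J T w p)"
  obtain u v where [simp]: "z = (u, v)" by (cases z)
  have uv: "u \<in> hcarrier (type_sum J)" "v \<in> hcarrier (type_sum J)"
    using z by (auto simp: op_closure_def)
  have "v j = complex_of_real (w j) *\<^sub>C T (u (p j))" if j: "j \<in> J" for j
  proof (rule ccontr)
    assume "v j \<noteq> complex_of_real (w j) *\<^sub>C T (u (p j))"
    define \<delta> where "\<delta> = norm (v j - complex_of_real (w j) *\<^sub>C T (u (p j)))"
    have \<delta>: "\<delta> > 0" using \<open>v j \<noteq> _\<close> by (simp add: \<delta>_def)
    obtain C where C: "C > 0" "\<And>x. norm (T x) \<le> norm x * C"
      using bounded_linear.pos_bounded[OF T] by blast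
    \<comment> \<open>The two approximation errors add up to
      \<open>(1 + \<bar>w j\<bar> * C) * e\<close>, which this choice makes equal to
      \<open>\<delta> / 2\<close>.\<close>
    define e where "e = \<delta> / (2 * (1 + \<bar>w j\<bar> * C))"
    have pos: "1 + \<bar>w j\<bar> * C > 0" using C by (simp add: add_pos_nonneg)
    then have e: "e > 0" using \<delta> by (simp add: e_def)
    obtain a b where ab: "(a, b) \<in> finite_shift J T w p" "hdist (type_sum J) u a < e" "hdist (type_sum J) v b < e"
      using z e by (auto simp: op_closure_def)
    then have abc: "a \<in> hcarrier (type_sum J)" "b \<in> hcarrier (type_sum J)"
      and bj: "b j = complex_of_real (w j) *\<^sub>C T (a (p j))"
      using j by (auto simp: finite_shift_def shift_op_def)
    have eq: "v j - complex_of_real (w j) *\<^sub>C T (u (p j)) = (v j - b j) - complex_of_real (w j) *\<^sub>C T (u (p j) - a (p j))"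
      using T by (simp add: bj bounded_linear.linear linear_diff cscale_diff_right)
    have "\<delta> \<le> norm (v j - b j) + \<bar>w j\<bar> * norm (T (u (p j) - a (p j)))"
      unfolding \<delta>_def eq by (rule order_trans[OF norm_triangle_ineq4]) simp
    also have "norm (v j - b j) \<le> e"
      using norm_le_hdist_type_sum[OF uv(2) abc(2) j] ab(3) by simp
    also have "\<bar>w j\<bar> * norm (T (u (p j) - a (p j))) \<le> \<bar>w j\<bar> * C * e"
    proof (cases "w j = 0")
      case False
      have "norm (u (p j) - a (p j)) \<le> e"
        using norm_le_hdist_type_sum[OF uv(1) abc(1) p[OF j False]] ab(2) by simp
      then have "norm (T (u (p j) - a (p j))) \<le> C * e"
        using C(2)[of "u (p j) - a (p j)"] C(1) by (smt (verit) mult.commute mult_left_mono)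
      then show ?thesis by (simp add: mult_left_mono mult.assoc)
    qed simp
    finally have "\<delta> \<le> (1 + \<bar>w j\<bar> * C) * e" by (simp add: distrib_right)
    also have "\<dots> = \<delta> / 2"
    proof -
      have "P * (\<delta> / (2 * P)) = \<delta> / 2" if "P > 0" for P :: real using that by simp
      from this[OF pos] show ?thesis by (simp only: e_def)
    qed
    finally show False using \<delta> by simp
  qed
  then show "z \<in> shift_op J T w p" using uv by (simp add: shift_op_def)
next
  fix z assume z: "z \<in> shift_op J T w p"
  obtain u v where [simp]: "z = (u, v)" by (cases z)
  have uv: "u \<in> hcarrier (type_sum J)" "v \<in> hcarrier (type_sum J)"
    and rel: "\<And>j. j \<in> J \<Longrightarrow> v j = complex_of_real (w j) *\<^sub>C T (u (p j))"
    using z by (auto simp: shift_op_def)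
  have "\<exists>(a, b)\<in>finite_shift J T w p. hdist (type_sum J) u a < e \<and> hdist (type_sum J) v b < e"
    if e: "e > 0" for e
  proof -
    obtain F where F: "finite F" "F \<subseteq> J"
      "\<And>G. finite G \<Longrightarrow> F \<subseteq> G \<Longrightarrow> G \<subseteq> J \<Longrightarrow> hdist (type_sum J) v (cut_off J G v) < e"
      using cut_off_approx[OF uv(2) e] by blast
    obtain G0 where G0: "finite G0" "G0 \<subseteq> J"
      "\<And>G. finite G \<Longrightarrow> G0 \<subseteq> G \<Longrightarrow> G \<subseteq> J \<Longrightarrow> hdist (type_sum J) u (cut_off J G u) < e"
      using cut_off_approx[OF uv(1) e] by blast
    \<comment> \<open>\<open>G0\<close> is enlarged by the sources of \<open>F\<close>, so that each
      component of \<open>v\<close> kept in \<open>F\<close> with nonzero weight has its source kept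
      in \<open>u\<close>.\<close>
    define G where "G = G0 \<union> p ` {j \<in> F. w j \<noteq> 0}"
    have G: "finite G" "G0 \<subseteq> G" "G \<subseteq> J"
      using F G0 p by (auto simp: G_def)
    \<comment> \<open>Conversely every component of \<open>v\<close> fed by \<open>G\<close> has to
      be kept; injectivity of \<open>p\<close> leaves only finitely many of them.\<close>
    define F' where "F' = F \<union> {j \<in> J. w j \<noteq> 0 \<and> p j \<in> G}"
    have "finite {j \<in> J. w j \<noteq> 0 \<and> p j \<in> G}"
    proof (rule inj_on_finite)
      show "inj_on p {j \<in> J. w j \<noteq> 0 \<and> p j \<in> G}" using inj by (rule inj_on_subset) auto
    qed (use G in auto)
    then have F': "finite F'" "F \<subseteq> F'" "F' \<subseteq> J" using F by (auto simp: F'_def)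
    have "cut_off J F' v j = complex_of_real (w j) *\<^sub>C T (cut_off J G u (p j))" if j: "j \<in> J" for j
    proof (cases "w j = 0")
      case True
      then show ?thesis using rel[OF j] j by (simp add: cut_off_def)
    next
      case False
      have "j \<in> F' \<longleftrightarrow> p j \<in> G" using False j by (auto simp: F'_def G_def)
      moreover have "T 0 = 0" using T by (simp add: bounded_linear.linear linear_0)
      ultimately show ?thesis using rel[OF j] j p[OF j False] by (simp add: cut_off_def)
    qed
    then have "(cut_off J G u, cut_off J F' v) \<in> shift_op J T w p"
      using uv by (simp add: shift_op_def cut_off_carrier)
    moreover have "finite {j \<in> J. cut_off J G u j \<noteq> 0}"
      by (rule finite_subset[OF _ G(1)]) (auto simp: cut_off_def split: if_splits)
    moreover have "finite {j \<in> J. cut_off J F' v j \<noteq> 0}"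
      by (rule finite_subset[OF _ F'(1)]) (auto simp: cut_off_def split: if_splits)
    ultimately have "(cut_off J G u, cut_off J F' v) \<in> finite_shift J T w p"
      by (simp add: finite_shift_def)
    then show ?thesis using F(3)[OF F'] G0(3)[OF G] by blast
  qed
  then show "z \<in> op_closure (type_sum J) (finite_shift J T w p)"
    using uv by (auto simp: op_closure_def)
qed

lemma op_closure_zero: "op_closure type_space {(a, b). b = (0::'a::complex_hilbert)} = {(a, b). b = 0}"
proof (intro set_eqI iffI)
  fix z assume z: "z \<in> op_closure type_space {(a, b). b = (0::'a)}"
  obtain a b where [simp]: "z = (a, b)" by (cases z)
  have "norm b < e" if "e > 0" for e
    using z that by (auto simp: op_closure_def hdist_type_space)
  then have "b = 0" by (metis less_irrefl zero_less_norm_iff)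
  then show "z \<in> {(a, b). b = 0}" by simp
next
  fix z assume "z \<in> {(a :: 'a, b). b = (0::'a)}"
  then show "z \<in> op_closure type_space {(a, b). b = (0::'a)}"
    by (auto simp: op_closure_def hdist_type_space) (auto simp: type_space_def intro: exI[of _ "fst z"])
qed

section \<open>Unitary equivalence of direct sums\<close>

lemma unitarily_equivalent_trans:
  assumes "unitarily_equivalent P Q" "unitarily_equivalent Q R"
  shows "unitarily_equivalent P R"
proof -
  obtain U V where U: "unitary_op (rspace P) (rspace Q) U" "map_prod U U ` rz1 P = rz1 Q" "map_prod U U ` rz2 P = rz2 Q"
    and V: "unitary_op (rspace Q) (rspace R) V" "map_prod V V ` rz1 Q = rz1 R" "map_prod V V ` rz2 Q = rz2 R"
    using assms by (auto simp: unitarily_equivalent_def)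
  have m: "map_prod (V \<circ> U) (V \<circ> U) ` X = map_prod V V ` map_prod U U ` X" for X
    by (simp add: image_image map_prod_compose)
  have c: "U x \<in> hcarrier (rspace Q)" if "x \<in> hcarrier (rspace P)" for x
    using U(1) that by (auto simp: unitary_op_def bij_betw_def)
  have "unitary_op (rspace P) (rspace R) (V \<circ> U)"
    using U(1) V(1) c unfolding unitary_op_def by (auto intro: bij_betw_trans)
  then show ?thesis
    unfolding unitarily_equivalent_def using U V by (intro exI[of _ "V \<circ> U"]) (simp add: m)
qed

text \<open>Cauchy-Schwarz in each summand together with \<open>a * b \<le> a^2 + b^2\<close> gives
  absolute summability.\<close>

lemma l2_sum_inner_summable:
  assumes "X \<in> hcarrier (sum_space I (\<lambda>i. l2_space (M i)))" "Y \<in> hcarrier (sum_space I (\<lambda>i. l2_space (M i)))"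
  shows "(\<lambda>i. hinner (l2_space (M i)) (X i) (Y i)) summable_on I"
proof -
  let ?a = "\<lambda>Z i. sqnorm (M i) (ae_rep (Z i))"
  have eq: "Re (hinner (l2_space (M i)) (Z i) (Z i)) = ?a Z i" for Z i
    unfolding l2_space_hinner complex_norm_square[symmetric] integral_complex_of_real by simp
  have l2: "ae_rep (Z i) \<in> l2_fun (M i)" if "Z \<in> hcarrier (sum_space I (\<lambda>i. l2_space (M i)))" "i \<in> I" for Z i
    using that by (intro l2_rep(1)) (auto simp: sum_space_def)
  have "(\<lambda>i. ?a X i + ?a Y i) summable_on I"
    using assms by (intro summable_on_add) (auto simp: sum_space_def eq)
  then have "(\<lambda>i. norm (hinner (l2_space (M i)) (X i) (Y i))) summable_on I"
  proof (rule summable_on_comparison_test)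
    fix i assume i: "i \<in> I"
    have "norm (hinner (l2_space (M i)) (X i) (Y i)) \<le> sqrt (?a X i) * sqrt (?a Y i)"
      unfolding l2_space_hinner using i assms l2 by (intro l2_cauchy_schwarz) auto
    also have "\<dots> \<le> (sqrt (?a X i))\<^sup>2 + (sqrt (?a Y i))\<^sup>2"
    proof -
      have "0 \<le> sqrt (?a X i) * sqrt (?a Y i)" by simp
      then show ?thesis using sum_squares_bound[of "sqrt (?a X i)" "sqrt (?a Y i)"] by linarith
    qed
    finally show "norm (hinner (l2_space (M i)) (X i) (Y i)) \<le> ?a X i + ?a Y i" by simp
  qed auto
  then show ?thesis by (rule abs_summable_summable)
qed

lemma summable_on_Plus:
  fixes f :: "'i + 'k \<Rightarrow> 'b::banach"
  shows "f summable_on (I <+> I') \<longleftrightarrow> (\<lambda>i. f (Inl i)) summable_on I \<and> (\<lambda>i. f (Inr i)) summable_on I'"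
proof -
  have 1: "f summable_on Inl ` I \<longleftrightarrow> (\<lambda>i. f (Inl i)) summable_on I"
    by (subst summable_on_reindex) (auto simp: o_def)
  have 2: "f summable_on Inr ` I' \<longleftrightarrow> (\<lambda>i. f (Inr i)) summable_on I'"
    by (subst summable_on_reindex) (auto simp: o_def)
  have "f summable_on (I <+> I') \<longleftrightarrow> f summable_on Inl ` I \<and> f summable_on Inr ` I'"
    unfolding Plus_def using summable_on_Un_disjoint[of f "Inl ` I" "Inr ` I'"]
      summable_on_subset_banach[of f "Inl ` I \<union> Inr ` I'"] by blast
  then show ?thesis using 1 2 by simp
qed

lemma infsum_Plus:
  fixes f :: "'i + 'k \<Rightarrow> 'b::banach"
  assumes "(\<lambda>i. f (Inl i)) summable_on I" "(\<lambda>i. f (Inr i)) summable_on I'"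
  shows "infsum f (I <+> I') = infsum (\<lambda>i. f (Inl i)) I + infsum (\<lambda>i. f (Inr i)) I'"
proof -
  have 1: "f summable_on Inl ` I" "infsum f (Inl ` I) = infsum (\<lambda>i. f (Inl i)) I"
    using assms by (simp_all add: summable_on_reindex infsum_reindex o_def)
  have 2: "f summable_on Inr ` I'" "infsum f (Inr ` I') = infsum (\<lambda>i. f (Inr i)) I'"
    using assms by (simp_all add: summable_on_reindex infsum_reindex o_def)
  have "Inl ` I \<inter> Inr ` I' = {}" by auto
  from infsum_Un_disjoint[OF 1(1) 2(1) this] show ?thesis
    unfolding Plus_def by (simp add: 1 2)
qed

lemma ball_Plus: "(\<forall>i\<in>I <+> I'. Q i) \<longleftrightarrow> (\<forall>i\<in>I. Q (Inl i)) \<and> (\<forall>i\<in>I'. Q (Inr i))"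
  by blast

definition sum_join :: "'i set \<Rightarrow> 'k set \<Rightarrow> ('i \<Rightarrow> 'z) \<Rightarrow> ('k \<Rightarrow> 'z) \<Rightarrow> 'i + 'k \<Rightarrow> 'z" where
  "sum_join I I' X Y = (\<lambda>i\<in>I <+> I'. case_sum X Y i)"

lemma sum_join_simps [simp]:
  "i \<in> I \<Longrightarrow> sum_join I I' X Y (Inl i) = X i" "k \<in> I' \<Longrightarrow> sum_join I I' X Y (Inr k) = Y k"
  by (auto simp: sum_join_def)

lemma sum_join_carrier:
  fixes H :: "'i \<Rightarrow> 'z hspace" and H' :: "'k \<Rightarrow> 'z hspace"
  assumes "X \<in> extensional I" "Y \<in> extensional I'"
  shows "sum_join I I' X Y \<in> hcarrier (sum_space (I <+> I') (case_sum H H')) \<longleftrightarrow>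
    X \<in> hcarrier (sum_space I H) \<and> Y \<in> hcarrier (sum_space I' H')"
proof -
  have "(\<lambda>i. Re (hinner (H i) (sum_join I I' X Y (Inl i)) (sum_join I I' X Y (Inl i)))) summable_on I
      \<longleftrightarrow> (\<lambda>i. Re (hinner (H i) (X i) (X i))) summable_on I"
    "(\<lambda>i. Re (hinner (H' i) (sum_join I I' X Y (Inr i)) (sum_join I I' X Y (Inr i)))) summable_on I'
      \<longleftrightarrow> (\<lambda>i. Re (hinner (H' i) (Y i) (Y i))) summable_on I'"
    by (auto intro!: summable_on_cong)
  moreover have "sum_join I I' X Y \<in> (\<Pi>\<^sub>E i\<in>I <+> I'. hcarrier (case_sum H H' i)) \<longleftrightarrow>
     (\<forall>i\<in>I. X i \<in> hcarrier (H i)) \<and> (\<forall>i\<in>I'. Y i \<in> hcarrier (H' i))"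
    by (auto simp: PiE_iff ball_Plus) (auto simp: sum_join_def)
  ultimately show ?thesis
    using assms by (auto simp: sum_space_def summable_on_Plus PiE_iff)
qed

lemma sum_join_split:
  assumes "Z \<in> hcarrier (sum_space (I <+> I') (case_sum H H'))"
  obtains X Y where "X \<in> hcarrier (sum_space I H)" "Y \<in> hcarrier (sum_space I' H')" "Z = sum_join I I' X Y"
proof -
  have ext: "Z \<in> extensional (I <+> I')" using assms by (auto simp: sum_space_def PiE_iff)
  let ?X = "\<lambda>i\<in>I. Z (Inl i)" and ?Y = "\<lambda>i\<in>I'. Z (Inr i)"
  have Z: "Z = sum_join I I' ?X ?Y"
    by (rule extensionalityI[OF ext]) (auto simp: sum_join_def)
  then have "?X \<in> hcarrier (sum_space I H) \<and> ?Y \<in> hcarrier (sum_space I' H')"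
    using assms sum_join_carrier[of ?X I ?Y I' H H'] by simp
  then show ?thesis using that Z by blast
qed

lemma sum_join_op:
  assumes "X \<in> hcarrier (sum_space I H)" "X' \<in> hcarrier (sum_space I H)"
    "Y \<in> hcarrier (sum_space I' H')" "Y' \<in> hcarrier (sum_space I' H')"
  shows "(sum_join I I' X Y, sum_join I I' X' Y') \<in> sum_op (I <+> I') (case_sum H H') (case_sum T T')
    \<longleftrightarrow> (X, X') \<in> sum_op I H T \<and> (Y, Y') \<in> sum_op I' H' T'"
proof -
  have "X \<in> extensional I" "X' \<in> extensional I" "Y \<in> extensional I'" "Y' \<in> extensional I'"
    using assms by (auto simp: sum_space_def PiE_iff)
  note c = sum_join_carrier[OF this(1,3), of H H'] sum_join_carrier[OF this(2,4), of H H']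
  show ?thesis using assms by (simp add: sum_op_def ball_Plus c)
qed

text \<open>The two unitaries are placed side by side on a disjoint union of index sets. The
  hypotheses \<open>inner\<close> let the sum defining the inner product split into its two parts,
  since \<open>infsum\<close> takes the default value \<open>0\<close> on families that are not
  summable.\<close>

theorem unitarily_equivalent_pair:
  fixes P :: "'v rep" and P' :: "'w rep" and R :: "'i \<Rightarrow> 'z rep" and R' :: "'k \<Rightarrow> 'z rep"
  assumes P: "unitarily_equivalent P (sum_rep I R)" and P': "unitarily_equivalent P' (sum_rep I' R')"
    and sub: "rz1 P \<subseteq> hcarrier (rspace P) \<times> hcarrier (rspace P)" "rz2 P \<subseteq> hcarrier (rspace P) \<times> hcarrier (rspace P)"
      "rz1 P' \<subseteq> hcarrier (rspace P') \<times> hcarrier (rspace P')" "rz2 P' \<subseteq> hcarrier (rspace P') \<times> hcarrier (rspace P')"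
    and inner: "\<And>X Y. X \<in> hcarrier (rspace (sum_rep I R)) \<Longrightarrow> Y \<in> hcarrier (rspace (sum_rep I R)) \<Longrightarrow>
        (\<lambda>i. hinner (rspace (R i)) (X i) (Y i)) summable_on I"
      "\<And>X Y. X \<in> hcarrier (rspace (sum_rep I' R')) \<Longrightarrow> Y \<in> hcarrier (rspace (sum_rep I' R')) \<Longrightarrow>
        (\<lambda>i. hinner (rspace (R' i)) (X i) (Y i)) summable_on I'"
  shows "unitarily_equivalent (pair_rep P P') (sum_rep (I <+> I') (case_sum R R'))"
proof -
  let ?H = "\<lambda>i. rspace (R i)" and ?H' = "\<lambda>i. rspace (R' i)"
  let ?S = "sum_space I ?H" and ?S' = "sum_space I' ?H'"
  have cs: "(\<lambda>i. f (case_sum R R' i)) = case_sum (\<lambda>i. f (R i)) (\<lambda>i. f (R' i))" for f :: "'z rep \<Rightarrow> 'b"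
    by (auto split: sum.splits)
  let ?SS = "sum_space (I <+> I') (case_sum ?H ?H')"
  obtain V where V: "unitary_op (rspace P) ?S V" and V1: "map_prod V V ` rz1 P = sum_op I ?H (\<lambda>i. rz1 (R i))"
    and V2: "map_prod V V ` rz2 P = sum_op I ?H (\<lambda>i. rz2 (R i))"
    using P by (auto simp: unitarily_equivalent_def sum_rep_def)
  obtain V' where V': "unitary_op (rspace P') ?S' V'" and V1': "map_prod V' V' ` rz1 P' = sum_op I' ?H' (\<lambda>i. rz1 (R' i))"
    and V2': "map_prod V' V' ` rz2 P' = sum_op I' ?H' (\<lambda>i. rz2 (R' i))"
    using P' by (auto simp: unitarily_equivalent_def sum_rep_def)
  define U where "U = (\<lambda>(a, b). sum_join I I' (V a) (V' b))"
  have Vc: "V a \<in> hcarrier ?S" if "a \<in> hcarrier (rspace P)" for a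
    using V that by (auto simp: unitary_op_def bij_betw_def)
  have Vc': "V' a \<in> hcarrier ?S'" if "a \<in> hcarrier (rspace P')" for a
    using V' that by (auto simp: unitary_op_def bij_betw_def)
  have Vim: "V ` hcarrier (rspace P) = hcarrier ?S" and Vinj: "inj_on V (hcarrier (rspace P))"
    using V by (auto simp: unitary_op_def bij_betw_def)
  have Vim': "V' ` hcarrier (rspace P') = hcarrier ?S'" and Vinj': "inj_on V' (hcarrier (rspace P'))"
    using V' by (auto simp: unitary_op_def bij_betw_def)
  have ext: "X \<in> extensional I" if "X \<in> hcarrier ?S" for X
    using that by (auto simp: sum_space_def PiE_iff)
  have ext': "X \<in> extensional I'" if "X \<in> hcarrier ?S'" for X
    using that by (auto simp: sum_space_def PiE_iff)
  have join_inj: "X = X' \<and> Y = Y'" if "sum_join I I' X Y = sum_join I I' X' Y'"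
    "X \<in> hcarrier ?S" "X' \<in> hcarrier ?S" "Y \<in> hcarrier ?S'" "Y' \<in> hcarrier ?S'" for X X' Y Y'
  proof
    show "X = X'"
    proof (rule extensionalityI[OF ext[OF that(2)] ext[OF that(3)]])
      fix i assume "i \<in> I" then show "X i = X' i" using fun_cong[OF that(1), of "Inl i"] by simp
    qed
    show "Y = Y'"
    proof (rule extensionalityI[OF ext'[OF that(4)] ext'[OF that(5)]])
      fix i assume "i \<in> I'" then show "Y i = Y' i" using fun_cong[OF that(1), of "Inr i"] by simp
    qed
  qed
  have Uc: "U (a, b) \<in> hcarrier ?SS" if "a \<in> hcarrier (rspace P)" "b \<in> hcarrier (rspace P')" for a b
    using sum_join_carrier[OF ext[OF Vc[OF that(1)]] ext'[OF Vc'[OF that(2)]], of ?H ?H'] Vc[OF that(1)] Vc'[OF that(2)]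
    by (simp add: U_def)
  have uni: "unitary_op (pair_space (rspace P) (rspace P')) ?SS U"
    unfolding unitary_op_def
  proof (intro conjI ballI allI)
    show "bij_betw U (hcarrier (pair_space (rspace P) (rspace P'))) (hcarrier ?SS)"
      unfolding bij_betw_def
    proof (intro conjI inj_onI set_eqI iffI)
      fix z z' assume zz: "z \<in> hcarrier (pair_space (rspace P) (rspace P'))" "z' \<in> hcarrier (pair_space (rspace P) (rspace P'))"
        and eq: "U z = U z'"
      obtain a b a' b' where [simp]: "z = (a, b)" "z' = (a', b')" by (metis surj_pair)
      have c: "a \<in> hcarrier (rspace P)" "a' \<in> hcarrier (rspace P)" "b \<in> hcarrier (rspace P')" "b' \<in> hcarrier (rspace P')"
        using zz by (auto simp: pair_space_def)
      have "V a = V a' \<and> V' b = V' b'"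
        using eq c Vc Vc' by (intro join_inj) (auto simp: U_def)
      then show "z = z'" using c Vinj Vinj' by (auto dest: inj_onD)
    next
      fix Z assume "Z \<in> U ` hcarrier (pair_space (rspace P) (rspace P'))"
      then show "Z \<in> hcarrier ?SS" using Uc by (auto simp: pair_space_def)
    next
      fix Z assume "Z \<in> hcarrier ?SS"
      then obtain X Y where XY: "X \<in> hcarrier ?S" "Y \<in> hcarrier ?S'" "Z = sum_join I I' X Y"
        by (rule sum_join_split)
      then obtain a b where "a \<in> hcarrier (rspace P)" "b \<in> hcarrier (rspace P')" "X = V a" "Y = V' b"
        using Vim Vim' by blast
      then show "Z \<in> U ` hcarrier (pair_space (rspace P) (rspace P'))"
        using XY by (auto simp: pair_space_def U_def)
    qed
  next
    fix z z' assume zz: "z \<in> hcarrier (pair_space (rspace P) (rspace P'))" "z' \<in> hcarrier (pair_space (rspace P) (rspace P'))"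
    obtain a b a' b' where [simp]: "z = (a, b)" "z' = (a', b')" by (metis surj_pair)
    have c: "a \<in> hcarrier (rspace P)" "a' \<in> hcarrier (rspace P)" "b \<in> hcarrier (rspace P')" "b' \<in> hcarrier (rspace P')"
      using zz by (auto simp: pair_space_def)
    have "V (hadd (rspace P) a a') = hadd ?S (V a) (V a')" "V' (hadd (rspace P') b b') = hadd ?S' (V' b) (V' b')"
      using V V' c by (auto simp: unitary_op_def)
    then show "U (hadd (pair_space (rspace P) (rspace P')) z z') = hadd ?SS (U z) (U z')"
      by (auto simp: U_def pair_space_def sum_space_def sum_join_def fun_eq_iff Plus_def)
    have "hinner ?SS (U z) (U z') = infsum (\<lambda>i. hinner (?H i) (V a i) (V a' i)) I + infsum (\<lambda>i. hinner (?H' i) (V' b i) (V' b' i)) I'"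
    proof -
      have sm: "(\<lambda>i. hinner (?H i) (V a i) (V a' i)) summable_on I" "(\<lambda>i. hinner (?H' i) (V' b i) (V' b' i)) summable_on I'"
        using inner(1)[of "V a" "V a'"] inner(2)[of "V' b" "V' b'"] c Vc Vc' by (auto simp: sum_rep_def)
      let ?g = "\<lambda>i. hinner (case_sum ?H ?H' i) (case_sum (V a) (V' b) i) (case_sum (V a') (V' b') i)"
      have "hinner ?SS (U z) (U z') = infsum ?g (I <+> I')"
        by (auto simp: sum_space_def U_def sum_join_def intro!: infsum_cong)
      also have "\<dots> = infsum (\<lambda>i. ?g (Inl i)) I + infsum (\<lambda>i. ?g (Inr i)) I'"
        by (rule infsum_Plus) (use sm in simp_all)
      finally show ?thesis by simp
    qed
    also have "\<dots> = hinner ?S (V a) (V a') + hinner ?S' (V' b) (V' b')"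
      by (simp add: sum_space_def)
    also have "\<dots> = hinner (pair_space (rspace P) (rspace P')) z z'"
      using V V' c by (simp add: unitary_op_def pair_space_def)
    finally show "hinner ?SS (U z) (U z') = hinner (pair_space (rspace P) (rspace P')) z z'" .
  next
    fix k z assume zz: "z \<in> hcarrier (pair_space (rspace P) (rspace P'))"
    obtain a b where [simp]: "z = (a, b)" by (metis surj_pair)
    have c: "a \<in> hcarrier (rspace P)" "b \<in> hcarrier (rspace P')"
      using zz by (auto simp: pair_space_def)
    have "V (hscale (rspace P) k a) = hscale ?S k (V a)" "V' (hscale (rspace P') k b) = hscale ?S' k (V' b)"
      using V V' c by (auto simp: unitary_op_def)
    then show "U (hscale (pair_space (rspace P) (rspace P')) k z) = hscale ?SS k (U z)"
      by (auto simp: U_def pair_space_def sum_space_def sum_join_def fun_eq_iff Plus_def)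
  qed
  have op: "map_prod U U ` pair_op T T' = sum_op (I <+> I') (case_sum ?H ?H') (case_sum Q Q')"
    if T: "T \<subseteq> hcarrier (rspace P) \<times> hcarrier (rspace P)" "T' \<subseteq> hcarrier (rspace P') \<times> hcarrier (rspace P')"
      and Q: "map_prod V V ` T = sum_op I ?H Q" "map_prod V' V' ` T' = sum_op I' ?H' Q'" for T T' Q Q'
  proof (intro set_eqI iffI)
    fix z assume "z \<in> map_prod U U ` pair_op T T'"
    then obtain a b a' b' where ab: "(a, a') \<in> T" "(b, b') \<in> T'" and z: "z = (U (a, b), U (a', b'))"
      by (auto simp: pair_op_def)
    have m: "(V a, V a') \<in> sum_op I ?H Q" "(V' b, V' b') \<in> sum_op I' ?H' Q'"
      unfolding Q[symmetric] using ab by (auto intro: map_prod_imageI)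
    have c: "V a \<in> hcarrier ?S" "V a' \<in> hcarrier ?S" "V' b \<in> hcarrier ?S'" "V' b' \<in> hcarrier ?S'"
      using ab T Vc Vc' by blast+
    show "z \<in> sum_op (I <+> I') (case_sum ?H ?H') (case_sum Q Q')"
      using sum_join_op[OF c, of Q Q'] m by (simp add: z U_def)
  next
    fix z assume z: "z \<in> sum_op (I <+> I') (case_sum ?H ?H') (case_sum Q Q')"
    obtain Z Z' where zz: "z = (Z, Z')" by (cases z)
    have "Z \<in> hcarrier ?SS" "Z' \<in> hcarrier ?SS" using z zz by (auto simp: sum_op_def)
    then obtain X Y X' Y' where XY: "X \<in> hcarrier ?S" "Y \<in> hcarrier ?S'" "Z = sum_join I I' X Y"
      "X' \<in> hcarrier ?S" "Y' \<in> hcarrier ?S'" "Z' = sum_join I I' X' Y'"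
      by (metis sum_join_split)
    then have "(X, X') \<in> map_prod V V ` T" "(Y, Y') \<in> map_prod V' V' ` T'"
      using z zz sum_join_op[OF XY(1,4,2,5), of Q Q'] by (simp_all add: Q)
    then obtain a a' b b' where "(a, a') \<in> T" "(b, b') \<in> T'" "X = V a" "X' = V a'" "Y = V' b" "Y' = V' b'"
      by auto
    then have "((a, b), (a', b')) \<in> pair_op T T'" "z = map_prod U U ((a, b), (a', b'))"
      by (simp_all add: pair_op_def zz XY U_def)
    then show "z \<in> map_prod U U ` pair_op T T'" by blast
  qed
  show ?thesis
    unfolding unitarily_equivalent_def
  proof (intro exI[of _ U] conjI)
    show "unitary_op (rspace (pair_rep P P')) (rspace (sum_rep (I <+> I') (case_sum R R'))) U"
      using uni by (simp add: pair_rep_def sum_rep_def cs)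
    show "map_prod U U ` rz1 (pair_rep P P') = rz1 (sum_rep (I <+> I') (case_sum R R'))"
      using op[OF sub(1,3) V1 V1'] by (simp add: pair_rep_def sum_rep_def cs)
    show "map_prod U U ` rz2 (pair_rep P P') = rz2 (sum_rep (I <+> I') (case_sum R R'))"
      using op[OF sub(2,4) V2 V2'] by (simp add: pair_rep_def sum_rep_def cs)
  qed
qed

section \<open>The model measures\<close>

abbreviation quadrant :: "(real \<times> real) measure" where
  "quadrant \<equiv> nonneg_borel \<Otimes>\<^sub>M nonneg_borel"

lemma space_nonneg_borel [simp]: "space nonneg_borel = {0..}"
  by (simp add: space_restrict_space)

lemma measurable_nonneg_borel_iff:
  "f \<in> measurable M nonneg_borel \<longleftrightarrow> f \<in> borel_measurable M \<and> (\<forall>x\<in>space M. 0 \<le> f x)"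
  by (auto simp: measurable_restrict_space2_iff Pi_iff)

lemma borel_measurable_nonneg_borel: "f \<in> borel_measurable borel \<Longrightarrow> f \<in> borel_measurable nonneg_borel"
  by (rule measurable_restrict_space1)

lemma measurable_quadrant_coordinates [measurable]:
  "fst \<in> borel_measurable quadrant" "snd \<in> borel_measurable quadrant"
  using measurable_compose[OF measurable_fst borel_measurable_nonneg_borel[OF measurable_ident], of nonneg_borel]
    measurable_compose[OF measurable_snd borel_measurable_nonneg_borel[OF measurable_ident], of nonneg_borel]
  by simp_all

lemma space_quadrant: "space quadrant = {0..} \<times> {0..}"
  by (simp add: space_pair_measure)

lemma measurable_to_quadrant:
  assumes "f \<in> borel_measurable M" "g \<in> borel_measurable M" "\<And>x. x \<in> space M \<Longrightarrow> 0 \<le> f x" "\<And>x. x \<in> space M \<Longrightarrow> 0 \<le> g x"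
  shows "(\<lambda>x. (f x, g x)) \<in> measurable M quadrant"
  by (rule measurable_Pair) (use assms in \<open>auto simp: measurable_nonneg_borel_iff\<close>)

lemma measurable_dilation:
  assumes h: "(h :: real \<times> real \<Rightarrow> complex) \<in> borel_measurable quadrant" and "0 \<le> a" "0 \<le> b"
  shows "(\<lambda>p. h (a * fst p, b * snd p)) \<in> borel_measurable quadrant"
proof (rule measurable_compose[OF _ h])
  show "(\<lambda>p. (a * fst p, b * snd p)) \<in> measurable quadrant quadrant"
    using assms by (intro measurable_to_quadrant) (auto simp: space_quadrant)
qed

lemma chi0_measurable [measurable]: "chi0 \<in> borel_measurable borel"
  unfolding chi0_def by measurable

lemma z_fun_measurable:
  assumes h: "h \<in> borel_measurable quadrant" and q: "0 < q"
  shows "z1_fun q h \<in> borel_measurable quadrant" "z2_fun q h \<in> borel_measurable quadrant"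
    "z1_adj_fun q h \<in> borel_measurable quadrant" "z2_adj_fun q h \<in> borel_measurable quadrant"
proof -
  have [measurable]: "(\<lambda>p. h (q * fst p, snd p)) \<in> borel_measurable quadrant"
    "(\<lambda>p. h (inverse q * fst p, snd p)) \<in> borel_measurable quadrant"
    "(\<lambda>p. h (fst p, q * snd p)) \<in> borel_measurable quadrant"
    "(\<lambda>p. h (fst p, inverse q * snd p)) \<in> borel_measurable quadrant"
    using measurable_dilation[OF h, of q 1] measurable_dilation[OF h, of "inverse q" 1]
      measurable_dilation[OF h, of 1 q] measurable_dilation[OF h, of 1 "inverse q"] q by simp_all
  show "z1_fun q h \<in> borel_measurable quadrant" "z2_fun q h \<in> borel_measurable quadrant"
    "z1_adj_fun q h \<in> borel_measurable quadrant" "z2_adj_fun q h \<in> borel_measurable quadrant"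
    unfolding z1_fun_def z2_fun_def z1_adj_fun_def z2_adj_fun_def case_prod_unfold by measurable
qed

text \<open>For \<open>x > 0\<close>, \<open>scale_index q x\<close> is the \<open>n\<close> with \<open>x \<in> q\<^sup>n (q, 1]\<close>.\<close>

definition scale_index :: "real \<Rightarrow> real \<Rightarrow> int" where
  "scale_index q x = \<lfloor>ln x / ln q\<rfloor>"

lemma scale_index_measurable [measurable]: "scale_index q \<in> measurable borel (count_space UNIV)"
  unfolding scale_index_def by measurable

text \<open>For \<open>t\<close> in \<open>(q, 1]\<close> the quotient \<open>ln t / ln q\<close>
  lies in \<open>[0, 1)\<close>: division by the negative \<open>ln q\<close> puts the closed end at
  \<open>t = 1\<close>, as the floor requires.\<close>

lemma scale_index_eq:
  assumes "0 < q" "q < 1" "q < t" "t \<le> 1"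
  shows "scale_index q (q powi n * t) = n"
proof -
  have "ln (q powi n * t) = real_of_int n * ln q + ln t"
    using assms by (simp add: ln_mult ln_powr powr_real_of_int'[symmetric])
  moreover have "ln q < 0" "ln q < ln t" "ln t \<le> 0"
    using assms by auto
  ultimately have "ln (q powi n * t) / ln q = real_of_int n + ln t / ln q" "0 \<le> ln t / ln q" "ln t / ln q < 1"
    by (auto simp: field_simps)
  then show ?thesis
    unfolding scale_index_def by (intro floor_unique) auto
qed

section \<open>The invariant extension of a measure on the fundamental domain\<close>

locale fundamental_measure = real_distribution \<nu> for \<nu> +
  fixes q :: real
  assumes q: "0 < q" "q < 1" and support: "AE t in \<nu>. q < t \<and> t \<le> 1"
begin

text \<open>The absolute value makes the map land in the half-line for every \<open>t\<close>;
  almost everywhere it changes nothing, because \<open>\<nu>\<close> is carried by positive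
  \<open>t\<close>.\<close>

definition periodic :: "real measure" where
  "periodic = distr (count_space (UNIV::int set) \<Otimes>\<^sub>M \<nu>) nonneg_borel (\<lambda>(n, t). q powi n * \<bar>t\<bar>)"

lemma periodic_map [measurable]: "(\<lambda>(n, t). q powi n * \<bar>t\<bar>) \<in> measurable (count_space (UNIV::int set) \<Otimes>\<^sub>M \<nu>) nonneg_borel"
  unfolding measurable_nonneg_borel_iff
proof
  show "(\<lambda>(n, t). q powi n * \<bar>t\<bar>) \<in> borel_measurable (count_space (UNIV::int set) \<Otimes>\<^sub>M \<nu>)"
    by (rule measurable_pair_measure_countable1) auto
qed (use q in auto)

lemma sets_periodic [simp, measurable_cong]: "sets periodic = sets nonneg_borel"
  by (simp add: periodic_def)

lemma nn_integral_periodic: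
  assumes g [measurable]: "g \<in> borel_measurable nonneg_borel"
  shows "(\<integral>\<^sup>+x. g x \<partial>periodic) = (\<integral>\<^sup>+n. (\<integral>\<^sup>+t. g (q powi n * \<bar>t\<bar>) \<partial>\<nu>) \<partial>count_space (UNIV::int set))"
proof -
  have "(\<integral>\<^sup>+x. g x \<partial>periodic) = (\<integral>\<^sup>+z. g (case z of (n, t) \<Rightarrow> q powi n * \<bar>t\<bar>) \<partial>(count_space (UNIV::int set) \<Otimes>\<^sub>M \<nu>))"
    unfolding periodic_def by (rule nn_integral_distr) measurable
  also have "\<dots> = (\<integral>\<^sup>+n. (\<integral>\<^sup>+t. g (q powi n * \<bar>t\<bar>) \<partial>\<nu>) \<partial>count_space (UNIV::int set))"
    by (subst nn_integral_fst[symmetric]) (auto intro!: measurable_compose[OF periodic_map g])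
  finally show ?thesis .
qed

lemma emeasure_periodic:
  assumes S: "S \<in> sets nonneg_borel"
  shows "emeasure periodic S = (\<integral>\<^sup>+n. (\<integral>\<^sup>+t. indicator S (q powi n * \<bar>t\<bar>) \<partial>\<nu>) \<partial>count_space (UNIV::int set))"
  using S by (subst nn_integral_periodic[symmetric]) auto

lemma emeasure_periodic_zero: "emeasure periodic {0} = 0"
proof -
  have S: "{0} \<in> sets nonneg_borel" by (simp add: sets_restrict_space_iff)
  have "(\<integral>\<^sup>+t. indicator {0} (q powi n * \<bar>t\<bar>) \<partial>\<nu>) = 0" for n
  proof -
    have "(\<integral>\<^sup>+t. indicator {0} (q powi n * \<bar>t\<bar>) \<partial>\<nu>) = (\<integral>\<^sup>+t. 0 \<partial>\<nu>)"
      using support by (intro nn_integral_cong_AE, eventually_elim) (use q in auto)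
    then show ?thesis by simp
  qed
  then show ?thesis by (simp add: emeasure_periodic[OF S])
qed

text \<open>Multiplication by \<open>q\<close> carries the copy of \<open>\<nu>\<close> with index
  \<open>n\<close> to the next one, which merely shifts the summation index.\<close>

lemma q_invariant_periodic: "q_invariant q periodic"
  unfolding q_invariant_def
proof (intro conjI ballI sets_periodic)
  fix S assume S: "S \<in> sets nonneg_borel"
  have Spos: "S \<subseteq> {0..}" using sets.sets_into_space[OF S] by simp
  have eq: "(\<lambda>x. q * x) ` S = (\<lambda>y. y / q) -` S \<inter> space nonneg_borel"
    using q Spos by (force simp: image_iff)
  have "(\<lambda>y. y / q) \<in> measurable nonneg_borel nonneg_borel"
    using q by (auto simp: measurable_nonneg_borel_iff intro!: borel_measurable_nonneg_borel)
  then have qS: "(\<lambda>x. q * x) ` S \<in> sets nonneg_borel"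
    unfolding eq using S by (rule measurable_sets)
  let ?F = "\<lambda>n. \<integral>\<^sup>+t. indicator S (q powi n * \<bar>t\<bar>) \<partial>\<nu>"
  have "indicator ((\<lambda>x. q * x) ` S) (q powi n * \<bar>t\<bar>) = (indicator S (q powi (n - 1) * \<bar>t\<bar>) :: ennreal)" for n t
  proof -
    have "q powi n * \<bar>t\<bar> / q = q powi (n - 1) * \<bar>t\<bar>" using q by (simp add: power_int_diff)
    moreover have "0 \<le> q powi n * \<bar>t\<bar>" using q by simp
    ultimately show ?thesis unfolding eq by (simp add: indicator_def)
  qed
  then have "emeasure periodic ((\<lambda>x. q * x) ` S) = (\<integral>\<^sup>+n. ?F (n - 1) \<partial>count_space UNIV)"
    by (simp add: emeasure_periodic[OF qS])
  also have "\<dots> = (\<integral>\<^sup>+n. ?F n \<partial>count_space UNIV)"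
    by (rule nn_integral_bij_count_space[of "\<lambda>n::int. n - 1"]) (auto intro!: bij_betwI[of _ _ _ "\<lambda>n. n + 1"])
  finally show "emeasure periodic ((\<lambda>x. q * x) ` S) = emeasure periodic S"
    by (simp add: emeasure_periodic[OF S])
qed

text \<open>The level sets of \<open>scale_index q\<close> cover the half-line, and each has mass at
  most \<open>1\<close>, since up to null sets only the copy \<open>n = k\<close> of
  \<open>\<nu>\<close> meets \<open>?A k\<close>.\<close>

lemma sigma_finite_periodic: "sigma_finite_measure periodic"
proof
  let ?A = "\<lambda>k. scale_index q -` {k} \<inter> space nonneg_borel"
  have meas: "?A k \<in> sets nonneg_borel" for k
    by (rule measurable_sets[OF measurable_restrict_space1[OF scale_index_measurable]]) simp
  have fin: "emeasure periodic (?A k) \<le> 1" for k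
  proof -
    have "(\<integral>\<^sup>+t. indicator (?A k) (q powi n * \<bar>t\<bar>) \<partial>\<nu>) \<le> (\<integral>\<^sup>+t. indicator {k} n \<partial>\<nu>)" for n
      using support
    proof (intro nn_integral_mono_AE, eventually_elim)
      case (elim t)
      then show ?case using scale_index_eq[OF q, of t n] q by (auto simp: indicator_def)
    qed
    then have "emeasure periodic (?A k) \<le> (\<integral>\<^sup>+n. indicator {k} n \<partial>count_space UNIV)"
      unfolding emeasure_periodic[OF meas] using emeasure_space_1
      by (intro nn_integral_mono) simp
    also have "\<dots> = 1" by simp
    finally show ?thesis .
  qed
  show "\<exists>A. countable A \<and> A \<subseteq> sets periodic \<and> \<Union>A = space periodic \<and> (\<forall>a\<in>A. emeasure periodic a \<noteq> \<infinity>)"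
  proof (intro exI[of _ "range ?A"] conjI ballI)
    show "\<Union>(range ?A) = space periodic"
      by (auto simp: periodic_def)
    fix a assume "a \<in> range ?A"
    then obtain k where a: "a = ?A k" by blast
    have "emeasure periodic a < \<infinity>"
      unfolding a by (rule le_less_trans[OF fin]) simp
    then show "emeasure periodic a \<noteq> \<infinity>" by simp
  qed (use meas in auto)
qed

lemma nn_integral_periodic_axis:
  assumes g: "g \<in> borel_measurable quadrant"
  shows "(\<integral>\<^sup>+p. g p \<partial>(periodic \<Otimes>\<^sub>M return nonneg_borel 0))
    = (\<integral>\<^sup>+n. (\<integral>\<^sup>+t. g (q powi n * \<bar>t\<bar>, 0) \<partial>\<nu>) \<partial>count_space (UNIV::int set))"
proof -
  interpret R: prob_space "return nonneg_borel 0" by (rule prob_space_return) simp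
  have [measurable]: "g \<in> borel_measurable (periodic \<Otimes>\<^sub>M return nonneg_borel 0)"
    using g by (simp cong: measurable_cong_sets)
  have "(\<integral>\<^sup>+p. g p \<partial>(periodic \<Otimes>\<^sub>M return nonneg_borel 0)) = (\<integral>\<^sup>+s. (\<integral>\<^sup>+t. g (s, t) \<partial>return nonneg_borel 0) \<partial>periodic)"
    by (rule R.nn_integral_fst[symmetric]) measurable
  also have "\<dots> = (\<integral>\<^sup>+s. g (s, 0) \<partial>periodic)"
    using g by (intro nn_integral_cong nn_integral_return) (auto simp: periodic_def)
  also have "\<dots> = (\<integral>\<^sup>+n. (\<integral>\<^sup>+t. g (q powi n * \<bar>t\<bar>, 0) \<partial>\<nu>) \<partial>count_space (UNIV::int set))"
    using g by (intro nn_integral_periodic) auto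
  finally show ?thesis .
qed

text \<open>Tonelli separates the coordinates. In the index pair the first entry is the exponent for
  \<open>t\<close> and the second the one for \<open>s\<close>, the order of
  \<open>std_index\<close>.\<close>

lemma nn_integral_sigma_periodic:
  assumes g: "g \<in> borel_measurable quadrant"
  shows "(\<integral>\<^sup>+p. g p \<partial>(sigma_q q \<Otimes>\<^sub>M periodic))
    = (\<integral>\<^sup>+j. (\<integral>\<^sup>+t. g (q powi (- int (snd j)), q powi (fst j) * \<bar>t\<bar>) \<partial>\<nu>) \<partial>count_space std_index)"
proof -
  interpret P: sigma_finite_measure periodic by (rule sigma_finite_periodic)
  have sig: "sets (sigma_q q) = sets nonneg_borel" by (simp add: sigma_q_def)
  have sm: "(\<lambda>n. q powi (- int n)) \<in> measurable (count_space {1::nat..}) nonneg_borel"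
    using q by (simp add: measurable_nonneg_borel_iff)
  have gp: "g \<in> borel_measurable (sigma_q q \<Otimes>\<^sub>M periodic)"
    using g sig by (simp cong: measurable_cong_sets sets_pair_measure_cong)
  have gn: "g \<in> borel_measurable (nonneg_borel \<Otimes>\<^sub>M periodic)"
    using g by (simp cong: measurable_cong_sets sets_pair_measure_cong)
  have "(\<integral>\<^sup>+p. g p \<partial>(sigma_q q \<Otimes>\<^sub>M periodic)) = (\<integral>\<^sup>+s. (\<integral>\<^sup>+t. g (s, t) \<partial>periodic) \<partial>sigma_q q)"
    by (rule P.nn_integral_fst[OF gp, symmetric])
  also have "\<dots> = (\<integral>\<^sup>+m. (\<integral>\<^sup>+t. g (q powi (- int m), t) \<partial>periodic) \<partial>count_space {1..})"
    unfolding sigma_q_def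
    by (rule nn_integral_distr[OF sm]) (simp add: P.borel_measurable_nn_integral_fst[OF gn])
  also have "\<dots> = (\<integral>\<^sup>+m. (\<integral>\<^sup>+n. (\<integral>\<^sup>+t. g (q powi (- int m), q powi n * \<bar>t\<bar>) \<partial>\<nu>) \<partial>count_space UNIV) \<partial>count_space {1..})"
  proof (intro nn_integral_cong nn_integral_periodic)
    fix m
    show "(\<lambda>t. g (q powi (- int m), t)) \<in> borel_measurable nonneg_borel"
      using g q by (intro measurable_compose[OF measurable_Pair1' g]) simp
  qed
  also have "\<dots> = (\<integral>\<^sup>+j. (\<integral>\<^sup>+t. g (q powi (- int (snd j)), q powi (fst j) * \<bar>t\<bar>) \<partial>\<nu>) \<partial>(count_space UNIV \<Otimes>\<^sub>M count_space {1..}))"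
  proof -
    interpret C: sigma_finite_measure "count_space (UNIV :: int set)"
      by (rule sigma_finite_measure_count_space_countable) simp
    interpret C': sigma_finite_measure "count_space {1::nat..}"
      by (rule sigma_finite_measure_count_space_countable) simp
    interpret pair_sigma_finite "count_space (UNIV :: int set)" "count_space {1::nat..}" ..
    show ?thesis
      by (subst nn_integral_snd[symmetric]) (auto simp: pair_measure_countable)
  qed
  finally show ?thesis by (simp add: pair_measure_countable)
qed

end

section \<open>Isolating the three terms of the model measure\<close>

lemma sets_quadrant:
  assumes "sets M = sets nonneg_borel" "sets N = sets nonneg_borel"
  shows "sets (M \<Otimes>\<^sub>M N) = sets quadrant"
  by (rule sets_pair_measure_cong) (rule assms)+

lemma sets_sigma_q: "sets (sigma_q q) = sets nonneg_borel"
  by (simp add: sigma_q_def)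

lemma
  assumes "sets \<mu> = sets nonneg_borel" "sets \<nu> = sets nonneg_borel"
  shows sets_model_measure: "sets (model_measure q \<mu> \<nu> \<epsilon>) = sets quadrant"
    and emeasure_model_measure: "S \<in> sets quadrant \<Longrightarrow> emeasure (model_measure q \<mu> \<nu> \<epsilon>) S =
      emeasure (sigma_q q \<Otimes>\<^sub>M \<mu>) S + emeasure (\<nu> \<Otimes>\<^sub>M return nonneg_borel 0) S
      + of_nat \<epsilon> * emeasure (return nonneg_borel 0 \<Otimes>\<^sub>M return nonneg_borel 0) S"
proof -
  have sets: "sets (sigma_q q \<Otimes>\<^sub>M \<mu>) = sets quadrant" "sets (\<nu> \<Otimes>\<^sub>M return nonneg_borel 0) = sets quadrant"
    "sets (return nonneg_borel 0 \<Otimes>\<^sub>M return nonneg_borel 0) = sets quadrant"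
    by (auto intro!: sets_quadrant simp only: sets_sigma_q assms sets_return)
  have sadd: "sets (add_measure M N) = sets M" for M N :: "'x measure"
    by (simp add: add_measure_def)
  show "sets (model_measure q \<mu> \<nu> \<epsilon>) = sets quadrant"
    by (simp only: model_measure_def sadd sets)
  assume S: "S \<in> sets quadrant"
  show "emeasure (model_measure q \<mu> \<nu> \<epsilon>) S =
      emeasure (sigma_q q \<Otimes>\<^sub>M \<mu>) S + emeasure (\<nu> \<Otimes>\<^sub>M return nonneg_borel 0) S
      + of_nat \<epsilon> * emeasure (return nonneg_borel 0 \<Otimes>\<^sub>M return nonneg_borel 0) S"
    unfolding model_measure_def
    by (subst emeasure_add_measure, simp only: sadd sets sets_scale_measure, simp only: sadd sets S,
        subst emeasure_add_measure, simp only: sets, simp only: sets S, simp only: emeasure_scale_measure)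
qed

lemma emeasure_pair_null:
  assumes "S \<in> sets quadrant"
  shows "emeasure (sigma_q q \<Otimes>\<^sub>M null_measure nonneg_borel) S = 0"
    "emeasure (null_measure nonneg_borel \<Otimes>\<^sub>M return nonneg_borel 0) S = 0"
proof -
  interpret null: finite_measure "null_measure nonneg_borel" by (rule finite_measureI) simp
  interpret R: prob_space "return nonneg_borel 0" by (rule prob_space_return) simp
  have "S \<in> sets (sigma_q q \<Otimes>\<^sub>M null_measure nonneg_borel)"
    using assms sets_quadrant[OF sets_sigma_q[of q] sets_null_measure[of nonneg_borel]] by blast
  then show "emeasure (sigma_q q \<Otimes>\<^sub>M null_measure nonneg_borel) S = 0"
    by (subst null.emeasure_pair_measure) auto
  have "S \<in> sets (null_measure nonneg_borel \<Otimes>\<^sub>M return nonneg_borel 0)"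
    using assms sets_quadrant[OF sets_null_measure[of nonneg_borel] sets_return[of nonneg_borel 0]] by blast
  then show "emeasure (null_measure nonneg_borel \<Otimes>\<^sub>M return nonneg_borel 0) S = 0"
    by (subst R.emeasure_pair_measure) auto
qed

lemma model_measure_axis:
  assumes nu: "sets \<nu> = sets nonneg_borel"
  shows "model_measure q (null_measure nonneg_borel) \<nu> 0 = \<nu> \<Otimes>\<^sub>M return nonneg_borel 0"
proof (rule measure_eqI)
  show "sets (model_measure q (null_measure nonneg_borel) \<nu> 0) = sets (\<nu> \<Otimes>\<^sub>M return nonneg_borel 0)"
    unfolding sets_model_measure[OF sets_null_measure nu] using sets_quadrant[OF nu sets_return] by simp
  fix S assume "S \<in> sets (model_measure q (null_measure nonneg_borel) \<nu> 0)"
  then have S: "S \<in> sets quadrant" unfolding sets_model_measure[OF sets_null_measure nu] .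
  show "emeasure (model_measure q (null_measure nonneg_borel) \<nu> 0) S = emeasure (\<nu> \<Otimes>\<^sub>M return nonneg_borel 0) S"
    unfolding emeasure_model_measure[OF sets_null_measure nu S] emeasure_pair_null[OF S] by simp
qed

lemma model_measure_plane:
  assumes mu: "sets \<mu> = sets nonneg_borel"
  shows "model_measure q \<mu> (null_measure nonneg_borel) 0 = sigma_q q \<Otimes>\<^sub>M \<mu>"
proof (rule measure_eqI)
  show "sets (model_measure q \<mu> (null_measure nonneg_borel) 0) = sets (sigma_q q \<Otimes>\<^sub>M \<mu>)"
    unfolding sets_model_measure[OF mu sets_null_measure] using sets_quadrant[OF sets_sigma_q mu] by simp
  fix S assume "S \<in> sets (model_measure q \<mu> (null_measure nonneg_borel) 0)"
  then have S: "S \<in> sets quadrant" unfolding sets_model_measure[OF mu sets_null_measure] .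
  show "emeasure (model_measure q \<mu> (null_measure nonneg_borel) 0) S = emeasure (sigma_q q \<Otimes>\<^sub>M \<mu>) S"
    unfolding emeasure_model_measure[OF mu sets_null_measure S] emeasure_pair_null[OF S] by simp
qed

lemma model_measure_origin:
  "model_measure q (null_measure nonneg_borel) (null_measure nonneg_borel) 1 = return quadrant (0, 0)"
    (is "?M = _")
proof (rule measure_eqI)
  note sets = sets_model_measure[OF sets_null_measure sets_null_measure]
  show "sets ?M = sets (return quadrant (0, 0))"
    unfolding sets by simp
  fix S assume "S \<in> sets ?M"
  then have S: "S \<in> sets quadrant" unfolding sets .
  interpret R: prob_space "return nonneg_borel 0" by (rule prob_space_return) simp
  have ind: "(indicator S :: _ \<Rightarrow> ennreal) \<in> borel_measurable quadrant" using S by simp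
  have "S \<in> sets (return nonneg_borel 0 \<Otimes>\<^sub>M return nonneg_borel 0)"
    using S sets_quadrant[OF sets_return sets_return] by blast
  then have "emeasure (return nonneg_borel 0 \<Otimes>\<^sub>M return nonneg_borel 0) S
      = (\<integral>\<^sup>+x. \<integral>\<^sup>+y. indicator S (x, y) \<partial>return nonneg_borel 0 \<partial>return nonneg_borel 0)"
    by (rule R.emeasure_pair_measure)
  also have "\<dots> = (\<integral>\<^sup>+x. indicator S (x, 0) \<partial>return nonneg_borel 0)"
  proof (intro nn_integral_cong nn_integral_return)
    fix x assume "x \<in> space (return nonneg_borel 0)"
    then show "(\<lambda>y. indicator S (x, y) :: ennreal) \<in> borel_measurable nonneg_borel"
      by (intro measurable_compose[OF measurable_Pair1' ind]) simp
  qed simp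
  also have "\<dots> = indicator S (0, 0)"
    by (intro nn_integral_return measurable_compose[OF measurable_Pair2' ind]) simp_all
  finally show "emeasure ?M S = emeasure (return quadrant (0, 0)) S"
    unfolding emeasure_model_measure[OF sets_null_measure sets_null_measure S] emeasure_pair_null[OF S]
    using S by simp
qed

section \<open>The three kinds of model representations\<close>

text \<open>\<open>U\<close> depends on the decomposition only and not on the generator, so the same
  unitary intertwines \<open>z1\<close> and \<open>z2\<close>, each with its own weights over the
  common \<open>J\<close> and \<open>\<Phi>\<close>.\<close>

lemma model_part:
  fixes T :: "'a::complex_hilbert \<Rightarrow> 'a"
  assumes ss: "spectral_sum q T I \<nu> K J \<Phi> (\<lambda>x. model_measure q (\<mu> x) (\<rho> x) \<epsilon>)"
    and z1: "\<And>x. x \<in> I \<Longrightarrow> shift_operator (model_measure q (\<mu> x) (\<rho> x) \<epsilon>) J (\<nu> x) \<Phi> w1 d1 p1 s1 C1 q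
        (dom_z1 (model_measure q (\<mu> x) (\<rho> x) \<epsilon>)) (z1_fun q) (z1_adj_fun q)"
    and z2: "\<And>x. x \<in> I \<Longrightarrow> shift_operator (model_measure q (\<mu> x) (\<rho> x) \<epsilon>) J (\<nu> x) \<Phi> w2 d2 p2 s2 C2 q
        (dom_z2 (model_measure q (\<mu> x) (\<rho> x) \<epsilon>)) (z2_fun q) (z2_adj_fun q)"
    and p1: "\<And>j. j \<in> J \<Longrightarrow> w1 j \<noteq> 0 \<Longrightarrow> p1 j \<in> J" and p2: "\<And>j. j \<in> J \<Longrightarrow> w2 j \<noteq> 0 \<Longrightarrow> p2 j \<in> J"
  shows "unitarily_equivalent \<lparr>rspace = type_sum J, rz1 = shift_op J T w1 p1, rz2 = shift_op J T w2 p2\<rparr>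
      (sum_rep I (\<lambda>x. model_rep q (\<mu> x) (\<rho> x) \<epsilon>))"
    and "x \<in> I \<Longrightarrow> model_adjoints q (\<mu> x) (\<rho> x) \<epsilon>"
proof -
  interpret spectral_sum q T I \<nu> K J \<Phi> "\<lambda>x. model_measure q (\<mu> x) (\<rho> x) \<epsilon>" by (rule ss)
  show "unitarily_equivalent \<lparr>rspace = type_sum J, rz1 = shift_op J T w1 p1, rz2 = shift_op J T w2 p2\<rparr>
      (sum_rep I (\<lambda>x. model_rep q (\<mu> x) (\<rho> x) \<epsilon>))"
    unfolding unitarily_equivalent_def
    using U_unitary U_shift_op[OF p1 shift_operator.fun_graph_eq[OF z1]] U_shift_op[OF p2 shift_operator.fun_graph_eq[OF z2]]
    by (intro exI[of _ U]) (simp add: sum_rep_def model_rep_def Let_def)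
  show "model_adjoints q (\<mu> x) (\<rho> x) \<epsilon>" if "x \<in> I"
    unfolding model_adjoints_def
    using shift_operator.fun_graph_adjoint[OF z1[OF that]] shift_operator.fun_graph_adjoint[OF z2[OF that]]
    by (simp add: model_rep_def Let_def)
qed

lemma shift_weights_zero: "shift_weights J (\<lambda>_. 0) (\<lambda>_. 0) (\<lambda>j. j) (\<lambda>j. j) 1"
  by unfold_locales auto

text \<open>Multiplication by \<open>c\<close> is the degenerate shift with \<open>p\<close> and
  \<open>s\<close> the identity, weight and domain multiplier both \<open>d\<close>, and
  \<open>C = 1\<close>; the claim is then \<open>F_l2_iff\<close>.\<close>

lemma multiplication_l2_iff:
  fixes c :: "'p \<Rightarrow> real"
  assumes dm: "direct_measure M J \<nu> \<Phi>" and q: "0 < q" "AE t in \<nu>. q < t \<and> t \<le> 1"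
    and c [measurable]: "c \<in> borel_measurable M"
    and sec: "\<And>j t. j \<in> J \<Longrightarrow> q < t \<Longrightarrow> t \<le> 1 \<Longrightarrow> c (\<Phi> j t) = d j * t"
    and h: "h \<in> l2_fun M"
  shows "(\<lambda>p. complex_of_real (c p) * h p) \<in> l2_fun M \<longleftrightarrow> (\<lambda>j. (d j)\<^sup>2 * sqnorm \<nu> (\<lambda>t. h (\<Phi> j t))) summable_on J"
proof -
  interpret direct_measure M J \<nu> \<Phi> by (rule dm)
  let ?D = "{h. h \<in> l2_fun M \<and> (\<lambda>j. (d j)\<^sup>2 * sqnorm \<nu> (\<lambda>t. h (\<Phi> j t))) summable_on J}"
  let ?F = "\<lambda>(h :: 'p \<Rightarrow> complex) p. complex_of_real (c p) * h p"
  have "shift_operator M J \<nu> \<Phi> d d (\<lambda>j. j) (\<lambda>j. j) 1 q ?D ?F ?F"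
  proof unfold_locales
    fix j and h :: "'p \<Rightarrow> complex" assume j: "j \<in> J"
    show "AE t in \<nu>. complex_of_real (c (\<Phi> j t)) * h (\<Phi> j t) = complex_of_real (d j * t) * h (\<Phi> j t)"
      using q(2) by eventually_elim (simp add: sec[OF j])
  qed (use q in auto)
  from shift_operator.F_l2_iff[OF this h] show ?thesis using h by simp
qed

context fundamental_measure
begin

lemma AE_support:
  assumes "\<And>t. q < t \<Longrightarrow> t \<le> 1 \<Longrightarrow> P t"
  shows "AE t in \<nu>. P t"
  using support by eventually_elim (use assms in auto)

text \<open>\<open>dom_z1\<close> imposes two conditions, with multipliers \<open>s * t\<close> and
  \<open>s * chi0 t\<close>. As all terms are nonnegative, both summability conditions together
  amount to the one for \<open>d^2 = da^2 + db^2\<close>.\<close>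

lemma shift_operator_z1I:
  assumes dm: "direct_measure M J \<nu> \<Phi>" and sw: "shift_weights J w d p s C" and sets: "sets M = sets quadrant"
    and F: "\<And>h j t. j \<in> J \<Longrightarrow> q < t \<Longrightarrow> t \<le> 1 \<Longrightarrow> z1_fun q h (\<Phi> j t) = complex_of_real (w j * t) * h (\<Phi> (p j) t)"
    and Fs: "\<And>h j t. j \<in> J \<Longrightarrow> q < t \<Longrightarrow> t \<le> 1 \<Longrightarrow> z1_adj_fun q h (\<Phi> j t) = complex_of_real (w (s j) * t) * h (\<Phi> (s j) t)"
    and da: "\<And>j t. j \<in> J \<Longrightarrow> q < t \<Longrightarrow> t \<le> 1 \<Longrightarrow> fst (\<Phi> j t) * snd (\<Phi> j t) = da j * t"
    and db: "\<And>j t. j \<in> J \<Longrightarrow> q < t \<Longrightarrow> t \<le> 1 \<Longrightarrow> fst (\<Phi> j t) * chi0 (snd (\<Phi> j t)) = db j * t"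
    and dd: "\<And>j. j \<in> J \<Longrightarrow> (d j)\<^sup>2 = (da j)\<^sup>2 + (db j)\<^sup>2"
  shows "shift_operator M J \<nu> \<Phi> w d p s C q (dom_z1 M) (z1_fun q) (z1_adj_fun q)"
proof -
  interpret direct_measure M J \<nu> \<Phi> by (rule dm)
  interpret shift_weights J w d p s C by (rule sw)
  have mM: "f \<in> borel_measurable M \<longleftrightarrow> f \<in> borel_measurable quadrant" for f :: "real \<times> real \<Rightarrow> 'x::topological_space"
    using measurable_cong_sets[OF sets refl] by blast
  show ?thesis
  proof unfold_locales
    show "0 < q" "AE t in \<nu>. q < t \<and> t \<le> 1" using q support by auto
    show "z1_fun q h \<in> borel_measurable M" "z1_adj_fun q h \<in> borel_measurable M" if "h \<in> borel_measurable M" for h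
      using that z_fun_measurable q unfolding mM by auto
    show "AE t in \<nu>. z1_fun q h (\<Phi> j t) = complex_of_real (w j * t) * h (\<Phi> (p j) t)" if "j \<in> J" for j h
      using F[OF that] by (rule AE_support)
    show "AE t in \<nu>. z1_adj_fun q h (\<Phi> j t) = complex_of_real (w (s j) * t) * h (\<Phi> (s j) t)" if "j \<in> J" for j h
      using Fs[OF that] by (rule AE_support)
    fix h
    let ?a = "\<lambda>j. sqnorm \<nu> (\<lambda>t. h (\<Phi> j t))"
    have 1: "(\<lambda>(s, t). complex_of_real (s * t) * h (s, t)) \<in> l2_fun M \<longleftrightarrow> (\<lambda>j. (da j)\<^sup>2 * ?a j) summable_on J"
      if "h \<in> l2_fun M"
      unfolding case_prod_unfold prod.collapse
      by (rule multiplication_l2_iff[OF dm q(1) support _ da that]) (auto simp: mM)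
    have 2: "(\<lambda>(s, t). complex_of_real (s * chi0 t) * h (s, t)) \<in> l2_fun M \<longleftrightarrow> (\<lambda>j. (db j)\<^sup>2 * ?a j) summable_on J"
      if "h \<in> l2_fun M"
      unfolding case_prod_unfold prod.collapse
      by (rule multiplication_l2_iff[OF dm q(1) support _ db that]) (auto simp: mM)
    have "(\<lambda>j. (d j)\<^sup>2 * ?a j) summable_on J \<longleftrightarrow> (\<lambda>j. (da j)\<^sup>2 * ?a j) summable_on J \<and> (\<lambda>j. (db j)\<^sup>2 * ?a j) summable_on J"
    proof safe
      assume S: "(\<lambda>j. (d j)\<^sup>2 * ?a j) summable_on J"
      show "(\<lambda>j. (da j)\<^sup>2 * ?a j) summable_on J" "(\<lambda>j. (db j)\<^sup>2 * ?a j) summable_on J"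
        by (rule summable_on_comparison_test[OF S]; auto simp: dd intro!: mult_right_mono)+
    next
      assume "(\<lambda>j. (da j)\<^sup>2 * ?a j) summable_on J" "(\<lambda>j. (db j)\<^sup>2 * ?a j) summable_on J"
      from summable_on_add[OF this] show "(\<lambda>j. (d j)\<^sup>2 * ?a j) summable_on J"
        by (rule summable_on_cong[THEN iffD1, rotated]) (simp add: dd distrib_right)
    qed
    then show "h \<in> dom_z1 M \<longleftrightarrow> h \<in> l2_fun M \<and> (\<lambda>j. (d j)\<^sup>2 * ?a j) summable_on J"
      unfolding dom_z1_def using 1 2 by blast
  qed
qed

lemma shift_operator_z2I:
  assumes dm: "direct_measure M J \<nu> \<Phi>" and sw: "shift_weights J w d p s C" and sets: "sets M = sets quadrant"
    and F: "\<And>h j t. j \<in> J \<Longrightarrow> q < t \<Longrightarrow> t \<le> 1 \<Longrightarrow> z2_fun q h (\<Phi> j t) = complex_of_real (w j * t) * h (\<Phi> (p j) t)"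
    and Fs: "\<And>h j t. j \<in> J \<Longrightarrow> q < t \<Longrightarrow> t \<le> 1 \<Longrightarrow> z2_adj_fun q h (\<Phi> j t) = complex_of_real (w (s j) * t) * h (\<Phi> (s j) t)"
    and d: "\<And>j t. j \<in> J \<Longrightarrow> q < t \<Longrightarrow> t \<le> 1 \<Longrightarrow> snd (\<Phi> j t) = d j * t"
  shows "shift_operator M J \<nu> \<Phi> w d p s C q (dom_z2 M) (z2_fun q) (z2_adj_fun q)"
proof -
  interpret direct_measure M J \<nu> \<Phi> by (rule dm)
  interpret shift_weights J w d p s C by (rule sw)
  have mM: "f \<in> borel_measurable M \<longleftrightarrow> f \<in> borel_measurable quadrant" for f :: "real \<times> real \<Rightarrow> 'x::topological_space"
    using measurable_cong_sets[OF sets refl] by blast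
  show ?thesis
  proof unfold_locales
    show "0 < q" "AE t in \<nu>. q < t \<and> t \<le> 1" using q support by auto
    show "z2_fun q h \<in> borel_measurable M" "z2_adj_fun q h \<in> borel_measurable M" if "h \<in> borel_measurable M" for h
      using that z_fun_measurable q unfolding mM by auto
    show "AE t in \<nu>. z2_fun q h (\<Phi> j t) = complex_of_real (w j * t) * h (\<Phi> (p j) t)" if "j \<in> J" for j h
      using F[OF that] by (rule AE_support)
    show "AE t in \<nu>. z2_adj_fun q h (\<Phi> j t) = complex_of_real (w (s j) * t) * h (\<Phi> (s j) t)" if "j \<in> J" for j h
      using Fs[OF that] by (rule AE_support)
    fix h
    have "(\<lambda>(s, t). complex_of_real t * h (s, t)) \<in> l2_fun M \<longleftrightarrow> (\<lambda>j. (d j)\<^sup>2 * sqnorm \<nu> (\<lambda>t. h (\<Phi> j t))) summable_on J"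
      if "h \<in> l2_fun M"
      unfolding case_prod_unfold prod.collapse
      by (rule multiplication_l2_iff[OF dm q(1) support _ d that]) (auto simp: mM)
    then show "h \<in> dom_z2 M \<longleftrightarrow> h \<in> l2_fun M \<and> (\<lambda>j. (d j)\<^sup>2 * sqnorm \<nu> (\<lambda>t. h (\<Phi> j t))) summable_on J"
      unfolding dom_z2_def by blast
  qed
qed

text \<open>\<open>\<iota>\<close> reads the index and \<open>\<pi>\<close> the parameter off a
  point, so \<open>g (\<iota> p) (\<pi> p)\<close> has the prescribed sections; it is measurable
  because \<open>J\<close> is countable.\<close>

lemma glueI:
  assumes dm: "direct_measure M J \<nu> \<Phi>" and \<iota>: "\<iota> \<in> measurable M (count_space J)" and \<pi>: "\<pi> \<in> borel_measurable M"
    and sec: "\<And>j. j \<in> J \<Longrightarrow> AE t in \<nu>. \<iota> (\<Phi> j t) = j \<and> \<pi> (\<Phi> j t) = t"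
    and g: "\<And>j. j \<in> J \<Longrightarrow> g j \<in> borel_measurable \<nu>"
  shows "\<exists>G\<in>borel_measurable M. \<forall>j\<in>J. AE t in \<nu>. (G (\<Phi> j t) :: complex) = g j t"
proof (intro bexI[of _ "\<lambda>p. g (\<iota> p) (\<pi> p)"] ballI)
  show "AE t in \<nu>. g (\<iota> (\<Phi> j t)) (\<pi> (\<Phi> j t)) = g j t" if "j \<in> J" for j
    using sec[OF that] by eventually_elim simp
  show "(\<lambda>p. g (\<iota> p) (\<pi> p)) \<in> borel_measurable M"
  proof (rule measurable_compose_countable'[OF _ \<iota>])
    show "(\<lambda>p. g j (\<pi> p)) \<in> borel_measurable M" if "j \<in> J" for j
      using \<pi> g[OF that] by (intro measurable_compose[OF \<pi>]) simp
    show "countable J" using dm by (rule direct_measure.countable_J)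
  qed
qed

lemma scale_index_section:
  "AE t in \<nu>. scale_index q (q powi n * \<bar>t\<bar>) = n \<and> q powi n * \<bar>t\<bar> / q powi scale_index q (q powi n * \<bar>t\<bar>) = t"
  by (rule AE_support) (use q scale_index_eq[OF q, of _ n] in auto)

section \<open>Coordinates on the axis, the plane and the origin\<close>

definition "axis_map n t = (q powi n * \<bar>t\<bar>, 0 :: real)"
definition "plane_map j t = (q powi (- int (snd j)), q powi (fst j) * \<bar>t\<bar>)"

abbreviation "axis_measure \<equiv> model_measure q (null_measure nonneg_borel) periodic 0"
abbreviation "plane_measure \<equiv> model_measure q periodic (null_measure nonneg_borel) 0"
abbreviation "origin_measure \<equiv> model_measure q (null_measure nonneg_borel) (null_measure nonneg_borel) 1"

lemma sets_models:
  "sets axis_measure = sets quadrant" "sets plane_measure = sets quadrant" "sets origin_measure = sets quadrant"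
  by (simp_all only: sets_model_measure sets_null_measure sets_periodic)

lemma direct_axis: "direct_measure axis_measure UNIV \<nu> axis_map"
proof
  show "axis_map n \<in> measurable \<nu> axis_measure" for n
    unfolding axis_map_def measurable_cong_sets[OF refl sets_models(1)]
    using q by (intro measurable_to_quadrant) auto
  fix g :: "real \<times> real \<Rightarrow> ennreal" assume "g \<in> borel_measurable axis_measure"
  then have "g \<in> borel_measurable quadrant" unfolding measurable_cong_sets[OF sets_models(1) refl] .
  from nn_integral_periodic_axis[OF this]
  show "(\<integral>\<^sup>+p. g p \<partial>axis_measure) = (\<integral>\<^sup>+n. (\<integral>\<^sup>+t. g (axis_map n t) \<partial>\<nu>) \<partial>count_space UNIV)"
    unfolding model_measure_axis[OF sets_periodic] axis_map_def .
qed simp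

lemma direct_plane: "direct_measure plane_measure std_index \<nu> plane_map"
proof
  show "plane_map j \<in> measurable \<nu> plane_measure" for j
    unfolding plane_map_def measurable_cong_sets[OF refl sets_models(2)]
    using q by (intro measurable_to_quadrant) auto
  fix g :: "real \<times> real \<Rightarrow> ennreal" assume "g \<in> borel_measurable plane_measure"
  then have "g \<in> borel_measurable quadrant" unfolding measurable_cong_sets[OF sets_models(2) refl] .
  from nn_integral_sigma_periodic[OF this]
  show "(\<integral>\<^sup>+p. g p \<partial>plane_measure) = (\<integral>\<^sup>+j. (\<integral>\<^sup>+t. g (plane_map j t) \<partial>\<nu>) \<partial>count_space std_index)"
    unfolding model_measure_plane[OF sets_periodic] plane_map_def .
qed simp

text \<open>\<open>\<nu>\<close> has total mass \<open>1\<close>, so integrating the constant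
  section over it returns the value at the origin.\<close>

lemma direct_origin: "direct_measure origin_measure (UNIV :: unit set) \<nu> (\<lambda>_ _. (0, 0))"
proof
  show "(\<lambda>_. (0, 0)) \<in> measurable \<nu> origin_measure"
    unfolding measurable_cong_sets[OF refl sets_models(3)]
    by (intro measurable_to_quadrant) auto
  fix g :: "real \<times> real \<Rightarrow> ennreal" assume "g \<in> borel_measurable origin_measure"
  then have "g \<in> borel_measurable quadrant" unfolding measurable_cong_sets[OF sets_models(3) refl] .
  then have "(\<integral>\<^sup>+p. g p \<partial>origin_measure) = g (0, 0)"
    unfolding model_measure_origin by (intro nn_integral_return) (auto simp: space_quadrant)
  then show "(\<integral>\<^sup>+p. g p \<partial>origin_measure) = (\<integral>\<^sup>+j. (\<integral>\<^sup>+t. g (0, 0) \<partial>\<nu>) \<partial>count_space (UNIV :: unit set))"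
    using emeasure_space_1 by (simp add: nn_integral_count_space_finite)
qed simp

lemma glue_axis:
  assumes "\<And>j. j \<in> (UNIV :: int set) \<Longrightarrow> g j \<in> borel_measurable \<nu>"
  shows "\<exists>G\<in>borel_measurable axis_measure. \<forall>j\<in>UNIV. AE t in \<nu>. (G (axis_map j t) :: complex) = g j t"
proof (rule glueI[OF direct_axis _ _ _ assms])
  show "(\<lambda>p. scale_index q (fst p)) \<in> measurable axis_measure (count_space UNIV)"
    "(\<lambda>p. fst p / q powi scale_index q (fst p)) \<in> borel_measurable axis_measure"
    unfolding measurable_cong_sets[OF sets_models(1) refl] by measurable
  show "AE t in \<nu>. scale_index q (fst (axis_map j t)) = j \<and>
      fst (axis_map j t) / q powi scale_index q (fst (axis_map j t)) = t" for j
    unfolding axis_map_def fst_conv by (rule scale_index_section)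
qed

lemma glue_plane:
  assumes "\<And>j. j \<in> std_index \<Longrightarrow> g j \<in> borel_measurable \<nu>"
  shows "\<exists>G\<in>borel_measurable plane_measure. \<forall>j\<in>std_index. AE t in \<nu>. (G (plane_map j t) :: complex) = g j t"
proof (rule glueI[OF direct_plane _ _ _ assms])
  \<comment> \<open>The exponent of \<open>s = q^(-m)\<close> recovers \<open>m\<close>; the maximum
    with \<open>1\<close> keeps the index inside \<open>std_index\<close> at points off the support
    as well.\<close>
  let ?m = "\<lambda>p. max 1 (nat (- scale_index q (fst p)))"
  have "(\<lambda>p. (scale_index q (snd p), ?m p)) \<in> measurable quadrant (count_space UNIV)"
    by measurable
  then show "(\<lambda>p. (scale_index q (snd p), ?m p)) \<in> measurable plane_measure (count_space std_index)"
    unfolding measurable_cong_sets[OF sets_models(2) refl]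
    by (simp add: measurable_count_space_eq2_countable)
  show "(\<lambda>p. snd p / q powi scale_index q (snd p)) \<in> borel_measurable plane_measure"
    unfolding measurable_cong_sets[OF sets_models(2) refl] by measurable
  show "AE t in \<nu>. (scale_index q (snd (plane_map j t)), ?m (plane_map j t)) = j \<and>
      snd (plane_map j t) / q powi scale_index q (snd (plane_map j t)) = t" if "j \<in> std_index" for j
  proof -
    have "scale_index q (q powi (- int (snd j))) = - int (snd j)"
      using scale_index_eq[OF q, of 1 "- int (snd j)"] q by simp
    then show ?thesis
      using that scale_index_section[of "fst j"] unfolding plane_map_def snd_conv fst_conv
      by (auto elim!: eventually_mono)
  qed
qed

text \<open>A function at the origin has a single value, so a section can be prescribed because
  \<open>\<nu>\<close> is concentrated at the one parameter \<open>1\<close>.\<close>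

lemma glue_origin:
  assumes one: "AE t in \<nu>. t = 1" and g: "\<And>j. j \<in> (UNIV :: unit set) \<Longrightarrow> g j \<in> borel_measurable \<nu>"
  shows "\<exists>G\<in>borel_measurable origin_measure. \<forall>j\<in>UNIV. AE t in \<nu>. (G (0, 0) :: complex) = g j t"
proof (rule glueI[OF direct_origin _ _ _ g])
  show "(\<lambda>_. ()) \<in> measurable origin_measure (count_space UNIV)" "(\<lambda>_. 1 :: real) \<in> borel_measurable origin_measure" by simp_all
  show "AE t in \<nu>. () = j \<and> 1 = t" for j
    using one by eventually_elim simp
qed

section \<open>The generators of the models as weighted shifts\<close>

lemma chi0_simps: "chi0 0 = 1" "x \<noteq> 0 \<Longrightarrow> chi0 x = 0"
  by (simp_all add: chi0_def)

text \<open>Component \<open>k\<close> of the image comes from \<open>k + 1\<close> with weight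
  \<open>q^(k+1)\<close>: this is the factor \<open>q * s\<close> of \<open>z1_fun\<close> at
  \<open>s = q^k t\<close>. The domain multiplier \<open>s\<close> gives \<open>q^k\<close>, which
  is the weight at the target \<open>k - 1\<close>, so \<open>C = 1\<close> works.\<close>

lemma axis_z1: "shift_operator axis_measure UNIV \<nu> axis_map (\<lambda>k. q powi (k + 1)) (\<lambda>k. q powi k) (\<lambda>k. k + 1) (\<lambda>k. k - 1) 1 q
    (dom_z1 axis_measure) (z1_fun q) (z1_adj_fun q)"
proof (rule shift_operator_z1I[OF direct_axis _ sets_models(1), where da = "\<lambda>_. 0" and db = "\<lambda>k. q powi k"])
  show "shift_weights UNIV (\<lambda>k. q powi (k + 1)) (\<lambda>k. q powi k) (\<lambda>k. k + 1) (\<lambda>k. k - 1) 1"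
  proof
    show "j \<notin> range (\<lambda>k::int. k - 1) \<Longrightarrow> q powi (j + 1) = 0" for j
      using surjI[of "\<lambda>k::int. k - 1" "\<lambda>k. k + 1"] by auto
    show "\<bar>q powi (i + 1)\<bar> \<le> 1 * \<bar>q powi i\<bar>" for i
      using q by (simp add: power_int_add mult_left_le)
  qed (use q in auto)
  show "z1_fun q h (axis_map j t) = complex_of_real (q powi (j + 1) * t) * h (axis_map (j + 1) t)"
    "z1_adj_fun q h (axis_map j t) = complex_of_real (q powi (j - 1 + 1) * t) * h (axis_map (j - 1) t)"
    if "q < t" for h j t
    using that q by (simp_all add: z1_fun_def z1_adj_fun_def axis_map_def chi0_simps power_int_add power_int_diff field_simps)
  show "fst (axis_map j t) * chi0 (snd (axis_map j t)) = q powi j * t" if "q < t" for j t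
    using that q by (simp add: axis_map_def chi0_simps)
qed (auto simp: axis_map_def)

lemma axis_z2: "shift_operator axis_measure UNIV \<nu> axis_map (\<lambda>_. 0) (\<lambda>_. 0) (\<lambda>j. j) (\<lambda>j. j) 1 q
    (dom_z2 axis_measure) (z2_fun q) (z2_adj_fun q)"
  by (rule shift_operator_z2I[OF direct_axis shift_weights_zero sets_models(1)])
    (auto simp: axis_map_def z2_fun_def z2_adj_fun_def)

lemma origin_z1: "shift_operator origin_measure (UNIV :: unit set) \<nu> (\<lambda>_ _. (0, 0)) (\<lambda>_. 0) (\<lambda>_. 0) (\<lambda>j. j) (\<lambda>j. j) 1 q
    (dom_z1 origin_measure) (z1_fun q) (z1_adj_fun q)"
  by (rule shift_operator_z1I[OF direct_origin shift_weights_zero sets_models(3), where da = "\<lambda>_. 0" and db = "\<lambda>_. 0"])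
    (auto simp: z1_fun_def z1_adj_fun_def)

lemma origin_z2: "shift_operator origin_measure (UNIV :: unit set) \<nu> (\<lambda>_ _. (0, 0)) (\<lambda>_. 0) (\<lambda>_. 0) (\<lambda>j. j) (\<lambda>j. j) 1 q
    (dom_z2 origin_measure) (z2_fun q) (z2_adj_fun q)"
  by (rule shift_operator_z2I[OF direct_origin shift_weights_zero sets_models(3)])
    (auto simp: z2_fun_def z2_adj_fun_def)

lemma plane_z2: "shift_operator plane_measure std_index \<nu> plane_map (\<lambda>j. q powi (fst j + 1)) (\<lambda>j. q powi fst j)
    (\<lambda>j. (fst j + 1, snd j)) (\<lambda>j. (fst j - 1, snd j)) 1 q (dom_z2 plane_measure) (z2_fun q) (z2_adj_fun q)"
proof (rule shift_operator_z2I[OF direct_plane _ sets_models(2)])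
  show "shift_weights std_index (\<lambda>j. q powi (fst j + 1)) (\<lambda>j. q powi fst j) (\<lambda>j. (fst j + 1, snd j)) (\<lambda>j. (fst j - 1, snd j)) 1"
  proof
    show "q powi (fst j + 1) = 0" if "j \<in> std_index" "j \<notin> (\<lambda>j. (fst j - 1, snd j)) ` std_index" for j
    proof -
      have "j = (\<lambda>j. (fst j - 1, snd j)) (fst j + 1, snd j)" "(fst j + 1, snd j) \<in> std_index"
        using that by auto
      then show ?thesis using that(2) by blast
    qed
    show "\<bar>q powi (fst i + 1)\<bar> \<le> 1 * \<bar>q powi fst i\<bar>" for i :: "int \<times> nat"
      using q by (simp add: power_int_add mult_left_le)
  qed (use q in auto)
  show "z2_fun q h (plane_map j t) = complex_of_real (q powi (fst j + 1) * t) * h (plane_map (fst j + 1, snd j) t)"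
    "z2_adj_fun q h (plane_map j t) = complex_of_real (q powi (fst (fst j - 1, snd j) + 1) * t) * h (plane_map (fst j - 1, snd j) t)"
    if "q < t" for h j t
    using that q by (simp_all add: z2_fun_def z2_adj_fun_def plane_map_def power_int_add power_int_diff field_simps)
  show "snd (plane_map j t) = q powi fst j * t" if "q < t" for j t
    using that q by (simp add: plane_map_def)
qed

text \<open>From \<open>1 \<le> q * x\<close> follows \<open>(1 - q^2) * x^2 \<le> x^2 - 1\<close>,
  so the square root stays comparable with \<open>x\<close>. This is the origin of the constant
  \<open>1 / sqrt (1 - q^2)\<close>.\<close>

lemma plane_weights_bounds:
  fixes x :: real
  assumes x: "1 \<le> q * x"
  shows "sqrt (x\<^sup>2 - 1) \<le> 1 / sqrt (1 - q\<^sup>2) * x" "x \<le> 1 / sqrt (1 - q\<^sup>2) * sqrt (x\<^sup>2 - 1)"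
    "sqrt ((q * x)\<^sup>2 - 1) \<le> 1 / sqrt (1 - q\<^sup>2) * x"
proof -
  have q2: "q\<^sup>2 < 1" using q by (simp add: power_less_one_iff)
  have x0: "x > 0"
  proof (rule ccontr)
    assume "\<not> x > 0"
    then have "q * x \<le> 0" using q by (intro mult_nonneg_nonpos) auto
    then show False using x by simp
  qed
  have C: "1 \<le> 1 / sqrt (1 - q\<^sup>2)" using q2 q by (simp add: real_le_rsqrt)
  have "sqrt (x\<^sup>2 - 1) \<le> x" using x0 by (intro real_le_lsqrt) auto
  then show "sqrt (x\<^sup>2 - 1) \<le> 1 / sqrt (1 - q\<^sup>2) * x"
    using mult_right_mono[OF C, of x] x0 by simp
  have "sqrt ((q * x)\<^sup>2 - 1) \<le> q * x" using x by (intro real_le_lsqrt) auto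
  also have "\<dots> \<le> 1 * x" using q x0 by (intro mult_right_mono) auto
  finally show "sqrt ((q * x)\<^sup>2 - 1) \<le> 1 / sqrt (1 - q\<^sup>2) * x"
    using mult_right_mono[OF C, of x] x0 by simp
  have "1\<^sup>2 \<le> (q * x)\<^sup>2" using x by (intro power_mono) auto
  then have "x\<^sup>2 * (1 - q\<^sup>2) \<le> x\<^sup>2 - 1" by (simp add: algebra_simps power_mult_distrib)
  then have "sqrt (x\<^sup>2 * (1 - q\<^sup>2)) \<le> sqrt (x\<^sup>2 - 1)" by simp
  then have "x * sqrt (1 - q\<^sup>2) \<le> sqrt (x\<^sup>2 - 1)" using x0 by (simp add: real_sqrt_mult)
  then show "x \<le> 1 / sqrt (1 - q\<^sup>2) * sqrt (x\<^sup>2 - 1)" using q2 by (simp add: field_simps)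
qed

text \<open>Weights are attached to targets: component \<open>(n, m)\<close> comes from
  \<open>(n, m - 1)\<close>, whence \<open>int m - 1\<close>. At \<open>m = 1\<close> the radicand
  is \<open>0\<close>, in accordance with the missing source.\<close>

abbreviation "plane_weight \<equiv> \<lambda>j :: int \<times> nat. sqrt (q powi (- 2 * (int (snd j) - 1)) - 1) * q powi fst j"

lemma plane_weight_eq:
  "plane_weight (n, m) = sqrt ((q * q powi (- int m))\<^sup>2 - 1) * q powi n"
  "plane_weight (n, m + 1) = sqrt ((q powi (- int m))\<^sup>2 - 1) * q powi n"
proof -
  have sq: "q powi (- 2 * k) = (q powi (- k))\<^sup>2" for k
    using q by (simp add: power2_eq_square power_int_add[symmetric])
  have "q * q powi (- int m) = q powi (- (int m - 1))"
    using q by (simp add: power_int_diff power_int_minus divide_inverse)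
  then show "plane_weight (n, m) = sqrt ((q * q powi (- int m))\<^sup>2 - 1) * q powi n"
    by (simp only: sq fst_conv snd_conv)
  show "plane_weight (n, m + 1) = sqrt ((q powi (- int m))\<^sup>2 - 1) * q powi n"
    unfolding fst_conv snd_conv sq by simp
qed

text \<open>In row \<open>m\<close> one has \<open>x = q^(-m)\<close> with
  \<open>1 \<le> q * x\<close> since \<open>m \<ge> 1\<close>, so the comparison of
  \<open>sqrt (x^2 - 1)\<close> with \<open>x\<close> applies. The targets without a source are
  those with \<open>m = 1\<close>.\<close>

lemma plane_shift_weights:
  "shift_weights std_index plane_weight (\<lambda>j. q powi (- int (snd j)) * q powi fst j)
    (\<lambda>j. (fst j, snd j - 1)) (\<lambda>j. (fst j, snd j + 1)) (1 / sqrt (1 - q\<^sup>2))"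
proof
  fix j :: "int \<times> nat" assume j: "j \<in> std_index"
  obtain n m where [simp]: "j = (n, m)" by (cases j)
  have m: "m \<ge> 1" using j by auto
  define x where "x = q powi (- int m)"
  have x: "1 \<le> q * x"
  proof -
    have "q * x = q powi (1 - int m)" using q by (simp add: x_def power_int_diff power_int_minus field_simps)
    also have "\<dots> = inverse q ^ (m - 1)" using m by (simp add: power_int_def nat_diff_distrib')
    also have "\<dots> \<ge> 1" using q by (intro one_le_power) (simp add: one_le_inverse)
    finally show ?thesis .
  qed
  have x0: "x > 0" using q by (simp add: x_def)
  have x1: "1 \<le> x\<^sup>2"
  proof -
    have "q * x \<le> 1 * x" using q x0 by (intro mult_right_mono) auto
    then show ?thesis using x by (intro one_le_power) simp
  qed
  have x2: "1 \<le> (q * x)\<^sup>2" using x by (rule one_le_power)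
  note b = plane_weights_bounds[OF x]
  have Q: "q powi n > 0" using q by simp
  show "(fst j, snd j + 1) \<in> std_index" by simp
  show "(fst (fst j, snd j + 1), snd (fst j, snd j + 1) - 1) = j" by simp
  have ws: "\<bar>plane_weight (fst j, snd j + 1)\<bar> = sqrt (x\<^sup>2 - 1) * q powi n"
    unfolding \<open>j = _\<close> fst_conv snd_conv plane_weight_eq(2)[unfolded fst_conv snd_conv] x_def[symmetric]
    using x1 Q by (simp add: abs_mult)
  have wj: "\<bar>plane_weight j\<bar> = sqrt ((q * x)\<^sup>2 - 1) * q powi n"
    unfolding \<open>j = _\<close> plane_weight_eq(1) x_def[symmetric] using x2 Q by (simp add: abs_mult)
  have d: "\<bar>q powi (- int (snd j)) * q powi fst j\<bar> = x * q powi n"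
    using x0 Q by (simp add: x_def abs_mult)
  show "\<bar>plane_weight (fst j, snd j + 1)\<bar> \<le> 1 / sqrt (1 - q\<^sup>2) * \<bar>q powi (- int (snd j)) * q powi fst j\<bar>"
    unfolding ws d using mult_right_mono[OF b(1), of "q powi n"] Q by (simp add: mult.assoc)
  show "\<bar>q powi (- int (snd j)) * q powi fst j\<bar> \<le> 1 / sqrt (1 - q\<^sup>2) * \<bar>plane_weight (fst j, snd j + 1)\<bar>"
    unfolding ws d using mult_right_mono[OF b(2), of "q powi n"] Q by (simp add: mult.assoc)
  show "\<bar>plane_weight j\<bar> \<le> 1 / sqrt (1 - q\<^sup>2) * \<bar>q powi (- int (snd j)) * q powi fst j\<bar>"
    unfolding wj d using mult_right_mono[OF b(3), of "q powi n"] Q by (simp add: mult.assoc)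
  assume ns: "j \<notin> (\<lambda>j. (fst j, snd j + 1)) ` std_index"
  have "m = 1"
  proof (rule ccontr)
    assume "m \<noteq> 1"
    then have "(n, m - 1) \<in> std_index" "j = (\<lambda>j. (fst j, snd j + 1)) (n, m - 1)" using m by auto
    then show False using ns by blast
  qed
  then show "plane_weight j = 0" by simp
qed

text \<open>As \<open>t\<close> is positive here, the \<open>chi0\<close> terms vanish. The
  coefficient of \<open>z1_fun\<close> at \<open>s = q^(-m)\<close> matches the weight of the target
  \<open>m\<close>, that of \<open>z1_adj_fun\<close> the weight of the target
  \<open>m + 1\<close>.\<close>

lemma plane_z1: "shift_operator plane_measure std_index \<nu> plane_map plane_weight (\<lambda>j. q powi (- int (snd j)) * q powi fst j)
    (\<lambda>j. (fst j, snd j - 1)) (\<lambda>j. (fst j, snd j + 1)) (1 / sqrt (1 - q\<^sup>2)) q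
    (dom_z1 plane_measure) (z1_fun q) (z1_adj_fun q)"
proof (rule shift_operator_z1I[OF direct_plane plane_shift_weights sets_models(2),
      where da = "\<lambda>j. q powi (- int (snd j)) * q powi fst j" and db = "\<lambda>_. 0"])
  fix h and j :: "int \<times> nat" and t assume j: "j \<in> std_index" and t: "q < t"
  obtain n m where jnm: "j = (n, m)" by (cases j)
  have m: "m \<ge> 1" using j jnm by auto
  have t0: "q powi n * \<bar>t\<bar> \<noteq> 0" "\<bar>t\<bar> = t" using q t by auto
  have e1: "q * q powi (- int m) = q powi (- int (m - 1))"
    using q m by (simp add: of_nat_diff power_int_diff power_int_minus divide_inverse)
  have e2: "inverse q * q powi (- int m) = q powi (- int (m + 1))"
    using q by (simp add: power_int_diff power_int_minus field_simps)
  show "z1_fun q h (plane_map j t) = complex_of_real (plane_weight j * t) * h (plane_map (fst j, snd j - 1) t)"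
    unfolding jnm fst_conv snd_conv plane_weight_eq(1)[unfolded fst_conv snd_conv]
    unfolding plane_map_def z1_fun_def fst_conv snd_conv prod.case chi0_simps(2)[OF t0(1)]
      e1[symmetric] using t0(2) by simp
  show "z1_adj_fun q h (plane_map j t)
      = complex_of_real (plane_weight (fst j, snd j + 1) * t) * h (plane_map (fst j, snd j + 1) t)"
    unfolding jnm fst_conv snd_conv plane_weight_eq(2)[unfolded fst_conv snd_conv]
    unfolding plane_map_def z1_adj_fun_def fst_conv snd_conv prod.case chi0_simps(2)[OF t0(1)]
      e2[symmetric] using t0(2) by simp
  show "fst (plane_map j t) * snd (plane_map j t) = q powi (- int (snd j)) * q powi fst j * t"
    using t0(2) by (simp add: plane_map_def)
  show "fst (plane_map j t) * chi0 (snd (plane_map j t)) = 0 * t"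
    using chi0_simps(2)[OF t0(1)] by (simp add: plane_map_def jnm)
qed auto

end

section \<open>Unitary equivalences for the three summands\<close>

lemma spectral_model_fundamental:
  assumes "spectral_model q T I \<nu> K" "x \<in> I" "0 < q" "q < 1"
  shows "fundamental_measure (\<nu> x) q"
  unfolding fundamental_measure_def fundamental_measure_axioms_def
  using spectral_model.distribution[OF assms(1,2)] spectral_model.support[OF assms(1,2)] assms by blast

lemma axis_part:
  assumes sm: "spectral_model q T I \<nu> K" and q: "0 < q" "q < 1"
  shows "unitarily_equivalent
      \<lparr>rspace = type_sum UNIV, rz1 = shift_op UNIV T (\<lambda>k. q powi (k + 1)) (\<lambda>k. k + 1),
        rz2 = shift_op UNIV T (\<lambda>_. 0) (\<lambda>k. k)\<rparr>
      (sum_rep I (\<lambda>x. model_rep q (null_measure nonneg_borel) (fundamental_measure.periodic (\<nu> x) q) 0))"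
    and "x \<in> I \<Longrightarrow> model_adjoints q (null_measure nonneg_borel) (fundamental_measure.periodic (\<nu> x) q) 0"
proof -
  note fm = spectral_model_fundamental[OF sm _ q]
  have ss: "spectral_sum q T I \<nu> K UNIV (fundamental_measure.axis_map q)
      (\<lambda>x. model_measure q (null_measure nonneg_borel) (fundamental_measure.periodic (\<nu> x) q) 0)"
    using fundamental_measure.direct_axis[OF fm] fundamental_measure.glue_axis[OF fm]
    by (intro spectral_sum.intro[OF sm] spectral_sum_axioms.intro) simp_all
  note part = model_part[OF ss fundamental_measure.axis_z1[OF fm] fundamental_measure.axis_z2[OF fm]]
  show "unitarily_equivalent
      \<lparr>rspace = type_sum UNIV, rz1 = shift_op UNIV T (\<lambda>k. q powi (k + 1)) (\<lambda>k. k + 1),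
        rz2 = shift_op UNIV T (\<lambda>_. 0) (\<lambda>k. k)\<rparr>
      (sum_rep I (\<lambda>x. model_rep q (null_measure nonneg_borel) (fundamental_measure.periodic (\<nu> x) q) 0))"
    by (rule part(1)) simp_all
  show "x \<in> I \<Longrightarrow> model_adjoints q (null_measure nonneg_borel) (fundamental_measure.periodic (\<nu> x) q) 0"
    by (rule part(2)) simp_all
qed

lemma plane_part:
  assumes sm: "spectral_model q T I \<nu> K" and q: "0 < q" "q < 1"
  shows "unitarily_equivalent
      \<lparr>rspace = type_sum std_index,
        rz1 = shift_op std_index T (\<lambda>j. sqrt (q powi (- 2 * (int (snd j) - 1)) - 1) * q powi fst j) (\<lambda>j. (fst j, snd j - 1)),
        rz2 = shift_op std_index T (\<lambda>j. q powi (fst j + 1)) (\<lambda>j. (fst j + 1, snd j))\<rparr>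
      (sum_rep I (\<lambda>x. model_rep q (fundamental_measure.periodic (\<nu> x) q) (null_measure nonneg_borel) 0))"
    and "x \<in> I \<Longrightarrow> model_adjoints q (fundamental_measure.periodic (\<nu> x) q) (null_measure nonneg_borel) 0"
proof -
  note fm = spectral_model_fundamental[OF sm _ q]
  have ss: "spectral_sum q T I \<nu> K std_index (fundamental_measure.plane_map q)
      (\<lambda>x. model_measure q (fundamental_measure.periodic (\<nu> x) q) (null_measure nonneg_borel) 0)"
    by (intro spectral_sum.intro[OF sm] spectral_sum_axioms.intro)
      (rule fundamental_measure.direct_plane[OF fm], assumption, rule fundamental_measure.glue_plane[OF fm])
  have p1: "(fst j, snd j - 1) \<in> std_index"
    if "j \<in> std_index" "sqrt (q powi (- 2 * (int (snd j) - 1)) - 1) * q powi fst j \<noteq> 0" for j :: "int \<times> nat"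
  proof -
    have "snd j \<noteq> 1" using that(2) by auto
    then show ?thesis using that(1) by auto
  qed
  note part = model_part[OF ss fundamental_measure.plane_z1[OF fm] fundamental_measure.plane_z2[OF fm]]
  show "unitarily_equivalent
      \<lparr>rspace = type_sum std_index,
        rz1 = shift_op std_index T (\<lambda>j. sqrt (q powi (- 2 * (int (snd j) - 1)) - 1) * q powi fst j) (\<lambda>j. (fst j, snd j - 1)),
        rz2 = shift_op std_index T (\<lambda>j. q powi (fst j + 1)) (\<lambda>j. (fst j + 1, snd j))\<rparr>
      (sum_rep I (\<lambda>x. model_rep q (fundamental_measure.periodic (\<nu> x) q) (null_measure nonneg_borel) 0))"
    by (rule part(1)) (assumption, assumption, (rule p1; assumption), auto)
  show "x \<in> I \<Longrightarrow> model_adjoints q (fundamental_measure.periodic (\<nu> x) q) (null_measure nonneg_borel) 0"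
    by (rule part(2)) (assumption, assumption, (rule p1; assumption), auto)
qed

text \<open>
  The summand on which both generators vanish is the case \<open>T = 1\<close> of the spectral theorem, where
  every spectral measure is the point mass at \<open>1\<close>.
\<close>

lemma spectral_measure_identity:
  assumes sm: "spectral_model q (\<lambda>h. h) I \<nu> K" and x: "x \<in> I"
  shows "AE t in \<nu> x. t = 1"
proof -
  interpret spectral_model q "\<lambda>h. h" I \<nu> K by (rule sm)
  \<comment> \<open>Prescribing \<open>1\<close> over \<open>x\<close> and \<open>0\<close> over the
    other indices, the multiplication rule with \<open>T\<close> the identity reads
    \<open>1 = t * 1\<close> almost everywhere.\<close>
  define f :: "'a \<Rightarrow> real \<Rightarrow> complex" where "f y t = (if y = x then 1 else 0)" for y t
  have "\<exists>h. \<forall>y\<in>I. AE t in \<nu> y. K y h t = f y t"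
  proof (rule K_surj)
    show "f y \<in> l2_fun (\<nu> y)" if "y \<in> I" for y
    proof -
      interpret real_distribution "\<nu> y" using that by (rule distribution)
      show ?thesis by (simp add: l2_fun_def f_def[abs_def])
    qed
    have "(\<lambda>y. sqnorm (\<nu> y) (f y)) summable_on {x}" by (rule summable_on_finite) simp
    then show "(\<lambda>y. sqnorm (\<nu> y) (f y)) summable_on I"
      by (rule summable_on_cong_neutral[THEN iffD1, rotated 3]) (use x in \<open>auto simp: f_def\<close>)
  qed
  then obtain h where "AE t in \<nu> x. K x h t = f x t" using x by blast
  then show ?thesis
    using K_mult[OF x, of h] by eventually_elim (simp add: f_def)
qed

text \<open>A one-element index set and zero weights put the trivial summand into the format of
  \<open>model_part\<close>.\<close>

lemma unitarily_equivalent_unit_sum: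
  "unitarily_equivalent \<lparr>rspace = type_space, rz1 = {(a, b). b = 0}, rz2 = {(a, b). b = (0::'a::complex_hilbert)}\<rparr>
    \<lparr>rspace = type_sum (UNIV :: unit set), rz1 = shift_op UNIV (\<lambda>h :: 'a. h) (\<lambda>_. 0) (\<lambda>j. j),
      rz2 = shift_op UNIV (\<lambda>h. h) (\<lambda>_. 0) (\<lambda>j. j)\<rparr>"
proof -
  let ?U = "\<lambda>(a :: 'a) (_ :: unit). a"
  have car: "u \<in> hcarrier (type_sum (UNIV :: unit set))" for u :: "unit \<Rightarrow> 'a"
    by (simp add: type_sum_carrier)
  have surj: "u = ?U (u ())" for u :: "unit \<Rightarrow> 'a" by (rule ext) simp
  have op: "map_prod ?U ?U ` {(a, b). b = 0} = shift_op UNIV (\<lambda>h. h) (\<lambda>_. 0) (\<lambda>j. j)"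
  proof (intro set_eqI iffI)
    fix z assume "z \<in> map_prod ?U ?U ` {(a, b). b = 0}"
    then show "z \<in> shift_op UNIV (\<lambda>h. h) (\<lambda>_. 0) (\<lambda>j. j)" using car by (auto simp: shift_op_def)
  next
    fix z :: "(unit \<Rightarrow> 'a) \<times> (unit \<Rightarrow> 'a)"
    assume z: "z \<in> shift_op UNIV (\<lambda>h. h) (\<lambda>_. 0) (\<lambda>j. j)"
    then have "snd z () = 0" by (auto simp: shift_op_def)
    then have "z = map_prod ?U ?U (fst z (), 0)"
      using surj[of "fst z"] surj[of "snd z"] by (simp add: prod_eq_iff)
    then show "z \<in> map_prod ?U ?U ` {(a, b). b = 0}" by blast
  qed
  have uni: "unitary_op type_space (type_sum (UNIV :: unit set)) ?U"
    unfolding unitary_op_def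
  proof (intro conjI)
    show "bij_betw ?U (hcarrier type_space) (hcarrier (type_sum UNIV))"
      by (rule bij_betwI[of _ _ _ "\<lambda>u. u ()"]) (use car in \<open>auto simp: type_space_def\<close>)
  qed (auto simp: type_sum_simps type_space_def)
  show ?thesis
    unfolding unitarily_equivalent_def rep.simps by (intro exI[of _ ?U] conjI uni op)
qed

lemma origin_part:
  assumes q: "0 < q" "q < 1"
  obtains I :: "'n::complex_hilbert set" where
    "unitarily_equivalent \<lparr>rspace = type_space, rz1 = {(a, b). b = 0}, rz2 = {(a, b). b = (0::'n)}\<rparr>
      (sum_rep I (\<lambda>_. model_rep q (null_measure nonneg_borel) (null_measure nonneg_borel) 1))"
    "\<And>x. x \<in> I \<Longrightarrow> model_adjoints q (null_measure nonneg_borel) (null_measure nonneg_borel) 1"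
proof -
  interpret T: positive_contraction "\<lambda>h :: 'n. h"
    by (rule positive_contraction.intro) (auto simp: cinner_self bounded_linear_ident)
  have "q * (norm y)\<^sup>2 \<le> Re (cinner y y)" for y :: 'n
    using q by (simp add: cinner_self mult_left_le_one_le)
  moreover have "y = 0" if "y = q *\<^sub>R y" for y :: 'n
  proof -
    have "(1 - q) *\<^sub>R y = y - q *\<^sub>R y" by (simp add: scaleR_left_diff_distrib)
    also have "\<dots> = 0" by (simp only: that[symmetric] diff_self)
    finally have "1 - q = 0 \<or> y = 0" by (simp only: scaleR_eq_0_iff)
    moreover have "1 - q \<noteq> 0" using q by simp
    ultimately show ?thesis by blast
  qed
  ultimately obtain I :: "'n set" and \<nu> K where sm: "spectral_model q (\<lambda>h. h) I \<nu> K"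
    using T.spectral_theorem[of q] by blast
  note fm = spectral_model_fundamental[OF sm _ q]
  note one = spectral_measure_identity[OF sm]
  have ss: "spectral_sum q (\<lambda>h. h) I \<nu> K (UNIV :: unit set) (\<lambda>_ _. (0, 0))
      (\<lambda>x. model_measure q (null_measure nonneg_borel) (null_measure nonneg_borel) 1)"
    by (intro spectral_sum.intro[OF sm] spectral_sum_axioms.intro)
      (rule fundamental_measure.direct_origin[OF fm], assumption, rule fundamental_measure.glue_origin[OF fm one])
  note part = model_part[OF ss fundamental_measure.origin_z1[OF fm] fundamental_measure.origin_z2[OF fm]]
  have "unitarily_equivalent
      \<lparr>rspace = type_sum (UNIV :: unit set), rz1 = shift_op UNIV (\<lambda>h :: 'n. h) (\<lambda>_. 0) (\<lambda>j. j),
        rz2 = shift_op UNIV (\<lambda>h. h) (\<lambda>_. 0) (\<lambda>j. j)\<rparr>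
      (sum_rep I (\<lambda>_. model_rep q (null_measure nonneg_borel) (null_measure nonneg_borel) 1))"
    by (rule part(1)) simp_all
  moreover have "model_adjoints q (null_measure nonneg_borel) (null_measure nonneg_borel) 1" if "x \<in> I" for x
    by (rule part(2)[of x]) (use that in simp_all)
  ultimately show ?thesis
    using that unitarily_equivalent_trans[OF unitarily_equivalent_unit_sum] by blast
qed

section \<open>The standard representation\<close>

lemma std_space_eq: "std_space N = pair_space type_space (pair_space (type_sum UNIV) (type_sum std_index))"
  by (simp add: std_space_def type_sum_def)

lemma finite_vectors_iff:
  "(a, x, u) \<in> finite_vectors N \<longleftrightarrow> x \<in> hcarrier (type_sum UNIV) \<and> u \<in> hcarrier (type_sum std_index) \<and>
    finite {k. x k \<noteq> 0} \<and> finite {p \<in> std_index. u p \<noteq> 0}"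
  by (auto simp: finite_vectors_def std_space_eq pair_space_def type_space_def)

lemma graph_mem_iff: "(a, b) \<in> range (\<lambda>x. (x, T x)) \<longleftrightarrow> b = T a"
  by auto

text \<open>Rules stated by source index are rewritten by target index: component \<open>k\<close>
  comes from \<open>k + 1\<close>, component \<open>(n, m)\<close> from \<open>(n, m - 1)\<close>.
  Since the graphs are those of everywhere defined operators, the existential witnesses are
  forced.\<close>

lemma std_z1_fin_eq:
  "std_z1_fin q N (range (\<lambda>x. (x, TA x))) (range (\<lambda>x. (x, TB x))) =
    pair_op {(a, b). b = 0} (pair_op (finite_shift UNIV TA (\<lambda>k. q powi (k + 1)) (\<lambda>k. k + 1))
      (finite_shift std_index TB (\<lambda>j. sqrt (q powi (- 2 * (int (snd j) - 1)) - 1) * q powi fst j) (\<lambda>j. (fst j, snd j - 1))))"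
proof -
  have A: "(\<exists>w. \<forall>k. (x k, w k) \<in> range (\<lambda>x. (x, TA x)) \<and> y (k - 1) = complex_of_real (q powi k) *\<^sub>C w k) \<longleftrightarrow>
      (\<forall>k. y k = complex_of_real (q powi (k + 1)) *\<^sub>C TA (x (k + 1)))" for x y
  proof
    assume "\<exists>w. \<forall>k. (x k, w k) \<in> range (\<lambda>x. (x, TA x)) \<and> y (k - 1) = complex_of_real (q powi k) *\<^sub>C w k"
    then have y: "y (k - 1) = complex_of_real (q powi k) *\<^sub>C TA (x k)" for k
      unfolding graph_mem_iff by metis
    show "\<forall>k. y k = complex_of_real (q powi (k + 1)) *\<^sub>C TA (x (k + 1))"
      using y[of "k + 1" for k] by simp
  next
    assume y: "\<forall>k. y k = complex_of_real (q powi (k + 1)) *\<^sub>C TA (x (k + 1))"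
    show "\<exists>w. \<forall>k. (x k, w k) \<in> range (\<lambda>x. (x, TA x)) \<and> y (k - 1) = complex_of_real (q powi k) *\<^sub>C w k"
      by (rule exI[of _ "\<lambda>k. TA (x k)"]) (simp add: y)
  qed
  have B: "(\<exists>r. \<forall>n. v (n, 1) = 0 \<and> (\<forall>m\<ge>1. (u (n, m), r (n, m)) \<in> range (\<lambda>x. (x, TB x)) \<and>
        v (n, m + 1) = complex_of_real (sqrt (q powi (- 2 * int m) - 1) * q powi n) *\<^sub>C r (n, m))) \<longleftrightarrow>
      (\<forall>j\<in>std_index. v j = complex_of_real (sqrt (q powi (- 2 * (int (snd j) - 1)) - 1) * q powi fst j) *\<^sub>C TB (u (fst j, snd j - 1)))"
    (is "?L \<longleftrightarrow> ?R") for u v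
  proof
    assume ?L
    then have v1: "v (n, 1) = 0" and v: "m \<ge> 1 \<Longrightarrow>
        v (n, m + 1) = complex_of_real (sqrt (q powi (- 2 * int m) - 1) * q powi n) *\<^sub>C TB (u (n, m))" for n m
      unfolding graph_mem_iff by metis+
    show ?R
    proof
      fix j :: "int \<times> nat" assume j: "j \<in> std_index"
      obtain n m where jnm: "j = (n, m)" by (cases j)
      show "v j = complex_of_real (sqrt (q powi (- 2 * (int (snd j) - 1)) - 1) * q powi fst j) *\<^sub>C TB (u (fst j, snd j - 1))"
      \<comment> \<open>At \<open>m = 1\<close> the source index \<open>0\<close> is outside
        \<open>std_index\<close>, but the weight is \<open>sqrt (1 - 1) = 0\<close>, which matches
        \<open>v (n, 1) = 0\<close>.\<close>
      proof (cases "m = 1")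
        case True
        then show ?thesis using v1 by (simp add: jnm)
      next
        case False
        then have "m - 1 \<ge> 1" "m = (m - 1) + 1" "int m - 1 = int (m - 1)" using j jnm by auto
        then show ?thesis using v[of "m - 1" n] by (simp only: jnm fst_conv snd_conv)
      qed
    qed
  next
    assume R: ?R
    show ?L
    proof (intro exI[of _ "\<lambda>j. TB (u j)"] allI conjI impI)
      show "v (n, 1) = 0" for n using R[rule_format, of "(n, 1)"] by simp
      show "(u (n, m), TB (u (n, m))) \<in> range (\<lambda>x. (x, TB x))" for n m by blast
      show "v (n, m + 1) = complex_of_real (sqrt (q powi (- 2 * int m) - 1) * q powi n) *\<^sub>C TB (u (n, m))" for n m
        using R[rule_format, of "(n, m + 1)"] by simp
    qed
  qed
  show ?thesis
    unfolding std_z1_fin_def pair_op_def finite_shift_def shift_op_def A B finite_vectors_iff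
    by (auto simp: finite_vectors_iff)
qed

text \<open>The zero operator on the middle summand is written as a shift with zero weights, so both
  generators have the same format on every summand.\<close>

lemma std_z2_fin_eq:
  "std_z2_fin q N (range (\<lambda>x. (x, TB x))) =
    pair_op {(a, b). b = 0} (pair_op (finite_shift UNIV TA (\<lambda>_. 0) (\<lambda>k. k))
      (finite_shift std_index TB (\<lambda>j. q powi (fst j + 1)) (\<lambda>j. (fst j + 1, snd j))))"
proof -
  have B: "(\<exists>r. \<forall>n. \<forall>m\<ge>1. (u (n, m), r (n, m)) \<in> range (\<lambda>x. (x, TB x)) \<and>
        v (n - 1, m) = complex_of_real (q powi n) *\<^sub>C r (n, m)) \<longleftrightarrow>
      (\<forall>j\<in>std_index. v j = complex_of_real (q powi (fst j + 1)) *\<^sub>C TB (u (fst j + 1, snd j)))"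
    (is "?L \<longleftrightarrow> ?R") for u v
  proof
    assume ?L
    then have v: "m \<ge> 1 \<Longrightarrow> v (n - 1, m) = complex_of_real (q powi n) *\<^sub>C TB (u (n, m))" for n m
      unfolding graph_mem_iff by metis
    show ?R
    proof
      fix j :: "int \<times> nat" assume "j \<in> std_index"
      then show "v j = complex_of_real (q powi (fst j + 1)) *\<^sub>C TB (u (fst j + 1, snd j))"
        using v[of "snd j" "fst j + 1"] by (cases j) auto
    qed
  next
    assume R: ?R
    show ?L
    proof (intro exI[of _ "\<lambda>j. TB (u j)"] allI conjI impI)
      show "(u (n, m), TB (u (n, m))) \<in> range (\<lambda>x. (x, TB x))" for n m by blast
      show "v (n - 1, m) = complex_of_real (q powi n) *\<^sub>C TB (u (n, m))" if "m \<ge> 1" for n m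
        using R[rule_format, of "(n - 1, m)"] that by simp
    qed
  qed
  show ?thesis
    unfolding std_z2_fin_def pair_op_def finite_shift_def shift_op_def B finite_vectors_iff
    by (auto simp: finite_vectors_iff)
qed

text \<open>Closure passes to the three summands, and on each of them the closure from finite
  vectors is the maximal shift; for \<open>z1\<close> on the third summand the index
  \<open>m = 1\<close> carries weight zero.\<close>

lemma std_rep_eq:
  fixes N :: "'n::complex_hilbert itself"
  assumes TA: "bounded_linear TA" and TB: "bounded_linear TB"
  shows "std_rep q N (range (\<lambda>x. (x, TA x))) (range (\<lambda>x. (x, TB x))) =
    pair_rep \<lparr>rspace = type_space, rz1 = {(a, b). b = 0}, rz2 = {(a, b). b = 0}\<rparr>
      (pair_rep \<lparr>rspace = type_sum UNIV, rz1 = shift_op UNIV TA (\<lambda>k. q powi (k + 1)) (\<lambda>k. k + 1),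
          rz2 = shift_op UNIV TA (\<lambda>_. 0) (\<lambda>k. k)\<rparr>
        \<lparr>rspace = type_sum std_index,
          rz1 = shift_op std_index TB (\<lambda>j. sqrt (q powi (- 2 * (int (snd j) - 1)) - 1) * q powi fst j) (\<lambda>j. (fst j, snd j - 1)),
          rz2 = shift_op std_index TB (\<lambda>j. q powi (fst j + 1)) (\<lambda>j. (fst j + 1, snd j))\<rparr>)"
proof -
  have cl: "op_closure (std_space N) (pair_op {(a, b). b = 0} (pair_op X Y)) =
      pair_op {(a, b). b = 0} (pair_op (op_closure (type_sum UNIV) X) (op_closure (type_sum std_index) Y))" for X Y
    unfolding std_space_eq
    by (simp add: op_closure_pair nonneg_dist_type_space nonneg_dist_pair nonneg_dist_type_sum op_closure_zero)
  have 1: "op_closure (type_sum UNIV) (finite_shift UNIV TA (\<lambda>k. q powi (k + 1)) (\<lambda>k. k + 1))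
      = shift_op UNIV TA (\<lambda>k. q powi (k + 1)) (\<lambda>k. k + 1)"
    by (rule op_closure_finite_shift[OF TA]) (auto simp: inj_on_def)
  have 2: "op_closure (type_sum UNIV) (finite_shift UNIV TA (\<lambda>_. 0) (\<lambda>k. k)) = shift_op UNIV TA (\<lambda>_. 0) (\<lambda>k. k)"
    by (rule op_closure_finite_shift[OF TA]) (auto simp: inj_on_def)
  let ?w = "\<lambda>j :: int \<times> nat. sqrt (q powi (- 2 * (int (snd j) - 1)) - 1) * q powi fst j"
  have 3: "op_closure (type_sum std_index) (finite_shift std_index TB ?w (\<lambda>j. (fst j, snd j - 1)))
      = shift_op std_index TB ?w (\<lambda>j. (fst j, snd j - 1))"
  proof (rule op_closure_finite_shift[OF TB])
    show "inj_on (\<lambda>j. (fst j, snd j - 1)) {j \<in> std_index. ?w j \<noteq> 0}"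
      by (rule inj_on_inverseI[of _ "\<lambda>j. (fst j, snd j + 1)"]) auto
    show "(fst j, snd j - 1) \<in> std_index" if "j \<in> std_index" "?w j \<noteq> 0" for j
    proof -
      have "snd j \<noteq> 1" using that(2) by auto
      then show ?thesis using that(1) by auto
    qed
  qed
  have 4: "op_closure (type_sum std_index) (finite_shift std_index TB (\<lambda>j. q powi (fst j + 1)) (\<lambda>j. (fst j + 1, snd j)))
      = shift_op std_index TB (\<lambda>j. q powi (fst j + 1)) (\<lambda>j. (fst j + 1, snd j))"
    by (rule op_closure_finite_shift[OF TB]) (auto simp: inj_on_def)
  show ?thesis
    unfolding std_rep_def pair_rep_def std_z1_fin_eq std_z2_fin_eq[where TA = TA] cl 1 2 3 4
    by (simp add: std_space_eq)
qed

text \<open>The upper end \<open>1\<close> of the spectrum makes \<open>T\<close> a contraction, and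
  the missing eigenvalue \<open>q\<close> keeps the spectral measures off the left end of
  \<open>[q, 1]\<close>.\<close>

lemma ex_spectral_model:
  assumes q: "0 < q" "q < 1" and A: "self_adjoint_op A" "op_spectrum A \<subseteq> complex_of_real ` {q..1}"
    "\<not> op_eigenvalue A (complex_of_real q)"
  obtains T I \<nu> K where "A = range (\<lambda>x. (x, T x))" "bounded_linear T" "spectral_model q T I \<nu> K"
proof -
  obtain T where T: "A = range (\<lambda>x. (x, T x))" "bounded_linear T"
    "\<And>c x. T (c *\<^sub>C x) = c *\<^sub>C T x" "\<And>x y. cinner (T x) y = cinner x (T y)"
    "\<And>x. q * (norm x)\<^sup>2 \<le> Re (cinner (T x) x)" "\<And>x. Re (cinner (T x) x) \<le> 1 * (norm x)\<^sup>2"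
    using self_adjoint_bounded_spectrum[OF A(1,2)] q by auto
  interpret positive_contraction T
  proof (rule positive_contraction.intro)
    show "0 \<le> Re (cinner (T x) x)" for x
    proof -
      have "0 \<le> q * (norm x)\<^sup>2" using q by simp
      then show ?thesis using T(5)[of x] by linarith
    qed
  qed (use T in auto)
  have "y = 0" if "T y = q *\<^sub>R y" for y
    using A(3) that unfolding op_eigenvalue_def T(1) cscale_of_real graph_mem_iff by auto
  with spectral_theorem[of q] T(5) obtain I \<nu> K where "spectral_model q T I \<nu> K" by blast
  then show ?thesis using that T by blast
qed

lemma ex_l2_space_model_rep: "\<exists>M. rspace (model_rep q \<mu> \<nu> \<epsilon>) = l2_space M"
  by (auto simp: model_rep_def Let_def)

lemma sum_rep_inner_summable:
  assumes "\<And>i. \<exists>M. rspace (R i) = l2_space M"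
    and "X \<in> hcarrier (rspace (sum_rep I R))" "Y \<in> hcarrier (rspace (sum_rep I R))"
  shows "(\<lambda>i. hinner (rspace (R i)) (X i) (Y i)) summable_on I"
proof -
  obtain M where "\<And>i. rspace (R i) = l2_space (M i)" using assms(1) by metis
  then show ?thesis
    using assms(2,3) l2_sum_inner_summable[of X I M Y] by (simp add: sum_rep_def)
qed

theorem theorem2:
  fixes q :: real
    and A :: "('a::complex_hilbert \<times> 'a) set"
    and B :: "('b::complex_hilbert \<times> 'b) set"
  assumes "0 < q" "q < 1"
    and "self_adjoint_op A" "op_spectrum A \<subseteq> complex_of_real ` {q..1}"
    and "\<not> op_eigenvalue A (complex_of_real q)"
    and "self_adjoint_op B" "op_spectrum B \<subseteq> complex_of_real ` {q..1}"
    and "\<not> op_eigenvalue B (complex_of_real q)"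
  shows "\<exists>(I :: ('n::complex_hilbert + 'a + 'b) set) \<mu> \<nu> \<epsilon>.
    (\<forall>i\<in>I.
       q_invariant q (\<mu> i) \<and> sigma_finite_measure (\<mu> i) \<and> emeasure (\<mu> i) {0} = 0 \<and>
       q_invariant q (\<nu> i) \<and> sigma_finite_measure (\<nu> i) \<and> emeasure (\<nu> i) {0} = 0 \<and>
       \<epsilon> i \<in> {0, 1} \<and>
       model_adjoints q (\<mu> i) (\<nu> i) (\<epsilon> i)) \<and>
    unitarily_equivalent (std_rep q TYPE('n) A B)
      (sum_rep I (\<lambda>i. model_rep q (\<mu> i) (\<nu> i) (\<epsilon> i)))"
proof -
  note q = assms(1,2)
  obtain TA IA \<nu>A KA where A: "A = range (\<lambda>x. (x, TA x))" "bounded_linear TA" and smA: "spectral_model q TA IA \<nu>A KA"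
    using ex_spectral_model[OF assms(1-5)] by blast
  obtain TB IB \<nu>B KB where B: "B = range (\<lambda>x. (x, TB x))" "bounded_linear TB" and smB: "spectral_model q TB IB \<nu>B KB"
    using ex_spectral_model[OF assms(1,2,6-8)] by blast
  let ?null = "null_measure nonneg_borel"
  let ?pA = "\<lambda>x. fundamental_measure.periodic (\<nu>A x) q" and ?pB = "\<lambda>x. fundamental_measure.periodic (\<nu>B x) q"
  obtain IN :: "'n set" where N: "unitarily_equivalent \<lparr>rspace = type_space, rz1 = {(a, b). b = 0}, rz2 = {(a, b). b = (0::'n)}\<rparr>
      (sum_rep IN (\<lambda>_. model_rep q ?null ?null 1))"
    and adjN: "\<And>x. x \<in> IN \<Longrightarrow> model_adjoints q ?null ?null 1"
    using origin_part[OF q] by blast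
  \<comment> \<open>In every summand some of the measures are switched off, so the zero measure has
    to satisfy the required conditions as well.\<close>
  have null: "q_invariant q ?null" "sigma_finite_measure ?null" "emeasure ?null {0} = 0"
    by (auto simp: q_invariant_def intro!: finite_measure.axioms(1) finite_measureI)
  have per: "q_invariant q (fundamental_measure.periodic m q)" "sigma_finite_measure (fundamental_measure.periodic m q)"
    "emeasure (fundamental_measure.periodic m q) {0} = 0" if "fundamental_measure m q" for m
    using that by (rule fundamental_measure.q_invariant_periodic fundamental_measure.sigma_finite_periodic
        fundamental_measure.emeasure_periodic_zero)+
  note fmA = spectral_model_fundamental[OF smA _ q] and fmB = spectral_model_fundamental[OF smB _ q]
  \<comment> \<open>The index sets consist of vectors of the three component spaces, and the nesting
    of the sums follows the nested pairs of \<open>std_space\<close>.\<close>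
  let ?I = "IN <+> (IA <+> IB)"
  let ?\<mu> = "case_sum (\<lambda>_. ?null) (case_sum (\<lambda>_. ?null) ?pB)"
  let ?\<nu> = "case_sum (\<lambda>_. ?null) (case_sum ?pA (\<lambda>_. ?null))"
  let ?\<epsilon> = "case_sum (\<lambda>_. 1) (case_sum (\<lambda>_. 0) (\<lambda>_. 0))"
  have R: "(\<lambda>i. model_rep q (?\<mu> i) (?\<nu> i) (?\<epsilon> i)) =
      case_sum (\<lambda>_. model_rep q ?null ?null 1) (case_sum (\<lambda>x. model_rep q ?null (?pA x) 0) (\<lambda>x. model_rep q (?pB x) ?null 0))"
    by (auto split: sum.splits)
  have "unitarily_equivalent (std_rep q TYPE('n) A B) (sum_rep ?I (\<lambda>i. model_rep q (?\<mu> i) (?\<nu> i) (?\<epsilon> i)))"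
    unfolding A(1) B(1) std_rep_eq[OF A(2) B(2)] R
  proof (rule unitarily_equivalent_pair[OF N unitarily_equivalent_pair[OF axis_part(1)[OF smA q] plane_part(1)[OF smB q]]])
  qed (auto simp: shift_op_def pair_rep_def pair_op_def pair_space_def type_space_def
      intro!: sum_rep_inner_summable ex_l2_space_model_rep split: sum.split)
  moreover have "\<forall>i\<in>?I.
       q_invariant q (?\<mu> i) \<and> sigma_finite_measure (?\<mu> i) \<and> emeasure (?\<mu> i) {0} = 0 \<and>
       q_invariant q (?\<nu> i) \<and> sigma_finite_measure (?\<nu> i) \<and> emeasure (?\<nu> i) {0} = 0 \<and>
       ?\<epsilon> i \<in> {0, 1::nat} \<and>
       model_adjoints q (?\<mu> i) (?\<nu> i) (?\<epsilon> i)"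
    using null per[OF fmA] per[OF fmB] adjN axis_part(2)[OF smA q] plane_part(2)[OF smB q]
    by (auto simp: ball_Plus)
  ultimately show ?thesis by blast
qed

end
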